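(* Let $d\in\mathbb{N}$, $T<\infty$, and let $f,g\colon[0,T]\times\mathbb{D}([0,T];\mathbb{R}^d)\to\mathbb{R}_+$ be measurable functions with $f\le g$ satisfying the following condition: for any $t\in[0,T]$ and $x,y\in\mathbb{D}([0,T];\mathbb{R}^d)$, $f(t,x)=f(t,y)$ and $g(t,x)=g(t,y)$ whenever $x(s)=y(s)$ for all $s\le t$; the functions $f(\cdot,x)$, $g(\cdot,x)$ are right-continuous with left-hand limits; and whenever $x_n\to x$ in $\mathbb{D}([0,T];\mathbb{R}^d)$ (Skorohod topology), $t_n\to t$ in $[0,T]$ and $x_n(t_n)\to x(t)$, then $f(t_n,x_n)\to f(t,x)$ and $g(t_n,x_n)\to g(t,x)$. For a càdlàg process $S=\{S_t\}_{t=0}^T$ with values in $\mathbb{R}^d$ let $\mathcal{F}^S$ be its usual filtration (smallest right-continuous filtration to which $S$ is adapted, completed by null sets) and $\mathcal{T}^S_{[0,T]}$ the set of $\mathcal{F}^S$-stopping times with values in $[0,T]$. Put $X^S_t=g(t,S)$, $Y^S_t=f(t,S)$, $H^S(t,s)=X^S_t\mathbb{I}_{t<s}+Y^S_s\mathbb{I}_{s\le t}$, and define the Dynkin game value $\Gamma(S)=\inf_{\sigma\in\mathcal{T}^S_{[0,T]}}\sup_{\tau\in\mathcal{T}^S_{[0,T]}}E\,H^S(\sigma,\tau)$ (assuming $\sup_{\tau}EX^S_\tau<\infty$). Let $S^{(n)}\colon\Omega_n\to\mathbb{D}([0,T];\mathbb{R}^d)$, $n\ge1$, and $S\colon\Omega\to\mathbb{D}([0,T];\mathbb{R}^d)$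 be càdlàg processes such that: (i) the random variables $g(\tau,S^{(n)})$, $n\ge1$, $\tau\in\mathcal{T}^{S^{(n)}}_{[0,T]}$, are uniformly integrable; (ii) (Aldous tightness criterion) for every $\varepsilon>0$, $\lim_{\delta\downarrow0}\lim_{n\to\infty}\sup_{0<u<\delta}\sup_{\tau\in\mathcal{T}^{S^{(n)}}_{[0,T]}}P\big(|S^{(n)}_{(\tau+u)\wedge T}-S^{(n)}_\tau|>\varepsilon\big)=0$; (iii) $S^{(n)}$ extended weak converges to $S$, i.e. for any $k$ and bounded continuous $\psi_1,\dots,\psi_k$ on $\mathbb{D}([0,T];\mathbb{R}^d)$, $(S^{(n)},Z^{(n,1)},\dots,Z^{(n,k)})$ converges in law to $(S,Z^{(1)},\dots,Z^{(k)})$ in $\mathbb{D}([0,T];\mathbb{R}^{d+k})$, where $Z^{(n,i)}_t=E_n(\psi_i(S^{(n)})\mid\mathcal{F}^{S^{(n)}}_t)$ and $Z^{(i)}_t=E(\psi_i(S)\mid\mathcal{F}^S_t)$. Then $\Gamma(S)=\lim_{n\to\infty}\Gamma(S^{(n)})$.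
   Context: Setting: Dynkin game values with payoffs that are path functionals of an underlying càdlàg process; all conditions used are written out in the claim. *)

theory Defs
  imports "HOL-Probability.Probability"
begin

definition Rm :: "nat \<Rightarrow> (nat \<Rightarrow> real) set" where
  "Rm m = {v. \<forall>i\<ge>m. v i = 0}"

definition euclid :: "nat \<Rightarrow> (nat \<Rightarrow> real) \<Rightarrow> (nat \<Rightarrow> real) \<Rightarrow> real" where
  "euclid m v w = sqrt (\<Sum>i<m. (v i - w i)\<^sup>2)"

definition Dsp :: "nat \<Rightarrow> real \<Rightarrow> (real \<Rightarrow> nat \<Rightarrow> real) set" where
  "Dsp m T = {x. (\<forall>t. x t \<in> Rm m) \<and> (\<forall>t. x t = x (max 0 (min T t)))
     \<and> (\<forall>t\<in>{0..<T}. ((\<lambda>s. euclid m (x s) (x t)) \<longlongrightarrow> 0) (at_right t))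
     \<and> (\<forall>t\<in>{0<..T}. \<exists>l\<in>Rm m. ((\<lambda>s. euclid m (x s) l) \<longlongrightarrow> 0) (at_left t))}"

definition time_changes :: "real \<Rightarrow> (real \<Rightarrow> real) set" where
  "time_changes T = {lam. continuous_on {0..T} lam \<and> strict_mono_on {0..T} lam
     \<and> lam 0 = 0 \<and> lam T = T}"

definition skor_dist :: "nat \<Rightarrow> real \<Rightarrow> (real \<Rightarrow> nat \<Rightarrow> real) \<Rightarrow> (real \<Rightarrow> nat \<Rightarrow> real) \<Rightarrow> real" where
  "skor_dist m T x y = Inf ((\<lambda>lam. max (SUP t\<in>{0..T}. \<bar>lam t - t\<bar>)
        (SUP t\<in>{0..T}. euclid m (x t) (y (lam t)))) ` time_changes T)"

definition skor_conv :: "nat \<Rightarrow> real \<Rightarrow> (nat \<Rightarrow> real \<Rightarrow> nat \<Rightarrow> real) \<Rightarrow> (real \<Rightarrow> nat \<Rightarrow> real) \<Rightarrow> bool" where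
  "skor_conv m T xs x \<longleftrightarrow> (\<lambda>n. skor_dist m T (xs n) x) \<longlonglongrightarrow> 0"

definition skor_open :: "nat \<Rightarrow> real \<Rightarrow> (real \<Rightarrow> nat \<Rightarrow> real) set \<Rightarrow> bool" where
  "skor_open m T U \<longleftrightarrow> U \<subseteq> Dsp m T \<and>
     (\<forall>x\<in>U. \<exists>e>0. \<forall>y\<in>Dsp m T. skor_dist m T x y < e \<longrightarrow> y \<in> U)"

definition skor_borel :: "nat \<Rightarrow> real \<Rightarrow> (real \<Rightarrow> nat \<Rightarrow> real) measure" where
  "skor_borel m T = sigma (Dsp m T) {U. skor_open m T U}"

definition skor_continuous :: "nat \<Rightarrow> real \<Rightarrow> ((real \<Rightarrow> nat \<Rightarrow> real) \<Rightarrow> real) \<Rightarrow> bool" where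
  "skor_continuous m T \<psi> \<longleftrightarrow> (\<forall>xs x. (\<forall>n. xs n \<in> Dsp m T) \<longrightarrow> x \<in> Dsp m T \<longrightarrow>
      skor_conv m T xs x \<longrightarrow> (\<lambda>n. \<psi> (xs n)) \<longlonglongrightarrow> \<psi> x)"

definition skor_bounded_continuous :: "nat \<Rightarrow> real \<Rightarrow> ((real \<Rightarrow> nat \<Rightarrow> real) \<Rightarrow> real) \<Rightarrow> bool" where
  "skor_bounded_continuous m T \<psi> \<longleftrightarrow> (\<exists>B. \<forall>x\<in>Dsp m T. \<bar>\<psi> x\<bar> \<le> B) \<and> skor_continuous m T \<psi>"

definition cadlag_real :: "real \<Rightarrow> (real \<Rightarrow> real) \<Rightarrow> bool" where
  "cadlag_real T h \<longleftrightarrow> (\<forall>t\<in>{0..<T}. (h \<longlongrightarrow> h t) (at_right t))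
     \<and> (\<forall>t\<in>{0<..T}. \<exists>l. (h \<longlongrightarrow> l) (at_left t))"

definition cadlag_process ::
  "'a measure \<Rightarrow> nat \<Rightarrow> real \<Rightarrow> ('a \<Rightarrow> real \<Rightarrow> nat \<Rightarrow> real) \<Rightarrow> bool" where
  "cadlag_process M d T S \<longleftrightarrow> (\<forall>\<omega>\<in>space M. S \<omega> \<in> Dsp d T) \<and>
     (\<forall>t\<in>{0..T}. \<forall>i<d. (\<lambda>\<omega>. S \<omega> t i) \<in> borel_measurable M)"

definition nat_gen :: "'a measure \<Rightarrow> nat \<Rightarrow> real \<Rightarrow> ('a \<Rightarrow> real \<Rightarrow> nat \<Rightarrow> real) \<Rightarrow> real \<Rightarrow> 'a set set" where
  "nat_gen M d T S u = {{\<omega>\<in>space M. S \<omega> s i \<in> A} | s i A.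
      s \<in> {0..min u T} \<and> i < d \<and> A \<in> sets borel}"

definition usual_filt :: "'a measure \<Rightarrow> nat \<Rightarrow> real \<Rightarrow> ('a \<Rightarrow> real \<Rightarrow> nat \<Rightarrow> real) \<Rightarrow> real \<Rightarrow> 'a set set" where
  "usual_filt M d T S t =
     (\<Inter>u\<in>{t<..}. sigma_sets (space M) (nat_gen M d T S u \<union> null_sets (completion M)))"

definition stop_times :: "'a measure \<Rightarrow> nat \<Rightarrow> real \<Rightarrow> ('a \<Rightarrow> real \<Rightarrow> nat \<Rightarrow> real) \<Rightarrow> ('a \<Rightarrow> real) set" where
  "stop_times M d T S = {\<tau>. (\<forall>\<omega>\<in>space M. \<tau> \<omega> \<in> {0..T}) \<and>
      (\<forall>t\<in>{0..T}. {\<omega>\<in>space M. \<tau> \<omega> \<le> t} \<in> usual_filt M d T S t)}"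

definition cond_exp_t :: "'a measure \<Rightarrow> nat \<Rightarrow> real \<Rightarrow> ('a \<Rightarrow> real \<Rightarrow> nat \<Rightarrow> real) \<Rightarrow> real
    \<Rightarrow> ('a \<Rightarrow> real) \<Rightarrow> 'a \<Rightarrow> real" where
  "cond_exp_t M d T S t h = real_cond_exp (completion M) (sigma (space M) (usual_filt M d T S t)) h"

text \<open>Payoff H(sigma,tau) = g(sigma,S) 1_{sigma<tau} + f(tau,S) 1_{tau<=sigma}.
  Payoffs are nonnegative, so expectations are taken as nonnegative integrals.\<close>
definition game_value :: "'a measure \<Rightarrow> nat \<Rightarrow> real \<Rightarrow> ('a \<Rightarrow> real \<Rightarrow> nat \<Rightarrow> real)
    \<Rightarrow> (real \<Rightarrow> (real \<Rightarrow> nat \<Rightarrow> real) \<Rightarrow> real) \<Rightarrow> (real \<Rightarrow> (real \<Rightarrow> nat \<Rightarrow> real) \<Rightarrow> real) \<Rightarrow> ennreal" where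
  "game_value M d T S f g =
     (INF \<sigma>\<in>stop_times M d T S. SUP \<tau>\<in>stop_times M d T S.
        \<integral>\<^sup>+ \<omega>. ennreal (if \<sigma> \<omega> < \<tau> \<omega> then g (\<sigma> \<omega>) (S \<omega>) else f (\<tau> \<omega>) (S \<omega>)) \<partial>completion M)"

definition joint_path :: "nat \<Rightarrow> real \<Rightarrow> nat \<Rightarrow> ('a \<Rightarrow> real \<Rightarrow> nat \<Rightarrow> real)
    \<Rightarrow> (nat \<Rightarrow> real \<Rightarrow> 'a \<Rightarrow> real) \<Rightarrow> 'a \<Rightarrow> real \<Rightarrow> nat \<Rightarrow> real" where
  "joint_path d T k S Z \<omega> = (\<lambda>t i. if i < d then S \<omega> t i
      else if i < d + k then Z (i - d) (max 0 (min T t)) \<omega> else 0)"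

end

theory Submission
  imports Defs
begin

text \<open>The payoffs may be truncated, by uniform integrability. On a deterministic grid the game has a saddle
  point, given by backward induction from conditional expectations, minima and maxima. Extended weak convergence
  passes through each step of this recursion, as long as the grid avoids countably many fixed times of
  discontinuity, so the grid values converge. By the Aldous criterion, rounding a stopping time up to a fine grid
  changes the expected payoffs little, uniformly in the stopping time and in \<open>n\<close>. Every stopping time of the limit
  process is approximated by stopping times of the prelimit processes, obtained by rounding conditional
  probabilities of the events \<open>{\<sigma> \<le> t}\<close>; hence the same rounding estimate and the same uniform integrability
  bound hold for the limit process, and the grid values are close to the game values on both sides.\<close>

section \<open>Skorohod space\<close>

text \<open>Evaluation at a fixed time is not Skorohod continuous, and this shapes the proof. Test
  functionals are averages over short time intervals, and each return from an average to one time
  needs its own argument: for payoffs, right-continuity in the limit and the rounding estimate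
  before it; for martingales, monotonicity of \<open>E Z_t^2\<close>, whose jump times are the
  exceptional ones. The exceptional set depends on the variable being conditioned, so the grid is
  chosen backwards from \<open>T\<close>, each time after the value function that follows it. The
  hypothesis on martingales speaks of cadlag versions and would be vacuous without them, so they are
  constructed. \<open>cv\<close> compares variables on different spaces through common continuous
  functionals and survives Lipschitz operations and conditioning. A stopping time of the limit is no
  continuous functional of the path; only finitely many of its events are transferred. Payoffs jump
  only together with the path, so rounding combines the Aldous bound for the path with a modulus of
  the payoff over times at which the path is close.\<close>

lemma tendsto_0_le:
  fixes f g :: "nat \<Rightarrow> real"
  assumes "g \<longlonglongrightarrow> 0" "\<And>n. 0 \<le> f n" "\<And>n. f n \<le> g n"
  shows "f \<longlonglongrightarrow> 0"
  by (rule tendsto_sandwich[OF _ _ tendsto_const assms(1)]) (use assms in auto)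

section \<open>Euclidean distance of coordinate vectors\<close>

lemma euclid_L2: "euclid m v w = L2_set (\<lambda>i. v i - w i) {..<m}"
  by (simp add: euclid_def L2_set_def)

lemma euclid_nonneg [simp]: "0 \<le> euclid m v w"
  by (simp add: euclid_L2)

lemma euclid_self [simp]: "euclid m v v = 0"
  by (simp add: euclid_def)

lemma euclid_sym: "euclid m v w = euclid m w v"
  by (simp add: euclid_def power2_commute)

lemma euclid_triangle: "euclid m u w \<le> euclid m u v + euclid m v w"
  using L2_set_triangle_ineq[of "\<lambda>i. u i - v i" "\<lambda>i. v i - w i" "{..<m}"]
  by (simp add: euclid_L2)

lemma euclid_coord: "i < m \<Longrightarrow> \<bar>v i - w i\<bar> \<le> euclid m v w"
  using member_le_L2_set[of "{..<m}" i "\<lambda>i. \<bar>v i - w i\<bar>"]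
  by (simp add: euclid_def L2_set_def)

lemma euclid_le_sum: "euclid m v w \<le> (\<Sum>i<m. \<bar>v i - w i\<bar>)"
  unfolding euclid_L2 by (rule L2_set_le_sum_abs)

lemma euclid_zero_Rm: "v \<in> Rm m \<Longrightarrow> w \<in> Rm m \<Longrightarrow> euclid m v w = 0 \<Longrightarrow> v = w"
proof (rule ext)
  fix i assume a: "v \<in> Rm m" "w \<in> Rm m" "euclid m v w = 0"
  show "v i = w i"
  proof (cases "i < m")
    case True then show ?thesis using euclid_coord[OF True, of v w] a by simp
  next
    case False then show ?thesis using a by (simp add: Rm_def)
  qed
qed

lemma euclid_mono: "m \<le> k \<Longrightarrow> euclid m v w \<le> euclid k v w"
  unfolding euclid_def by (intro real_sqrt_le_mono sum_mono2) auto

lemma euclid_cong: "(\<And>i. i < m \<Longrightarrow> v i = v' i) \<Longrightarrow> (\<And>i. i < m \<Longrightarrow> w i = w' i) \<Longrightarrow> euclid m v w = euclid m v' w'"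
  unfolding euclid_def by simp

section \<open>Cadlag paths, constant outside [0,T]\<close>

lemma Dsp_Rm: "x \<in> Dsp m T \<Longrightarrow> x t \<in> Rm m"
  by (simp add: Dsp_def)

lemma Dsp_clamp: "x \<in> Dsp m T \<Longrightarrow> x (max 0 (min T t)) = x t"
  unfolding Dsp_def by auto

lemma Dsp_ge_T: "x \<in> Dsp m T \<Longrightarrow> 0 < T \<Longrightarrow> T \<le> t \<Longrightarrow> x t = x T"
  using Dsp_clamp[of x m T t] by (simp add: min_def max_def split: if_splits)

lemma Dsp_le_0: "x \<in> Dsp m T \<Longrightarrow> 0 < T \<Longrightarrow> t \<le> 0 \<Longrightarrow> x t = x 0"
  using Dsp_clamp[of x m T t] by (simp add: min_def max_def split: if_splits)

text \<open>Clamping makes a path constant before 0 and from \<open>T\<close> on, so one-sided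
  limits exist at every real time and later arguments need no case split at the end points.\<close>

lemma Dsp_right:
  assumes x: "x \<in> Dsp m T" and T: "0 < T"
  shows "((\<lambda>s. euclid m (x s) (x t)) \<longlongrightarrow> 0) (at_right t)"
proof -
  consider "t < 0" | "0 \<le> t" "t < T" | "T \<le> t" by linarith
  then show ?thesis
  proof cases
    case 1
    have "eventually (\<lambda>s. s < 0) (at_right t)" using 1 by (auto simp: eventually_at_right)
    then have "eventually (\<lambda>s. euclid m (x s) (x t) = 0) (at_right t)"
    proof eventually_elim
      case (elim s)
      then show ?case using 1 Dsp_le_0[OF x T, of s] Dsp_le_0[OF x T, of t] by simp
    qed
    then show ?thesis by (rule tendsto_eventually)
  next
    case 2 then show ?thesis using x by (auto simp: Dsp_def)
  next
    case 3
    have "eventually (\<lambda>s. t < s) (at_right t)" by (auto simp: eventually_at_filter)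
    then have "eventually (\<lambda>s. euclid m (x s) (x t) = 0) (at_right t)"
    proof eventually_elim
      case (elim s)
      then show ?case using 3 Dsp_ge_T[OF x T, of s] Dsp_ge_T[OF x T, of t] by simp
    qed
    then show ?thesis by (rule tendsto_eventually)
  qed
qed

lemma Dsp_left:
  assumes x: "x \<in> Dsp m T" and T: "0 < T"
  shows "\<exists>l\<in>Rm m. ((\<lambda>s. euclid m (x s) l) \<longlongrightarrow> 0) (at_left t)"
proof -
  consider "t \<le> 0" | "0 < t" "t \<le> T" | "T < t" by linarith
  then show ?thesis
  proof cases
    case 1
    have "eventually (\<lambda>s. s < t) (at_left t)" by (auto simp: eventually_at_filter)
    then have "eventually (\<lambda>s. euclid m (x s) (x 0) = 0) (at_left t)"
    proof eventually_elim
      case (elim s)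
      then show ?case using 1 Dsp_le_0[OF x T, of s] by simp
    qed
    then show ?thesis using Dsp_Rm[OF x] by (blast intro: tendsto_eventually)
  next
    case 2 then show ?thesis using x by (auto simp: Dsp_def)
  next
    case 3
    have "eventually (\<lambda>s. T < s) (at_left t)" using 3 by (auto simp: eventually_at_left)
    then have "eventually (\<lambda>s. euclid m (x s) (x T) = 0) (at_left t)"
    proof eventually_elim
      case (elim s)
      then show ?case using 3 Dsp_ge_T[OF x T, of s] by simp
    qed
    then show ?thesis using Dsp_Rm[OF x] by (blast intro: tendsto_eventually)
  qed
qed

lemma Dsp_right_eps:
  assumes x: "x \<in> Dsp m T" and T: "0 < T" and e: "0 < e"
  shows "\<exists>\<delta>>0. \<forall>s. t \<le> s \<and> s < t + \<delta> \<longrightarrow> euclid m (x s) (x t) < e"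
proof -
  have "eventually (\<lambda>s. euclid m (x s) (x t) < e) (at_right t)"
    using order_tendstoD(2)[OF Dsp_right[OF x T]] e by blast
  then obtain b where b: "b > t" "\<And>s. t < s \<Longrightarrow> s < b \<Longrightarrow> euclid m (x s) (x t) < e"
    by (auto simp: eventually_at_right[of t "t+1"])
  show ?thesis
  proof (intro exI[of _ "b - t"] conjI allI impI)
    fix s assume "t \<le> s \<and> s < t + (b - t)"
    then show "euclid m (x s) (x t) < e" using b e by (cases "s = t") auto
  qed (use b in auto)
qed

lemma Dsp_left_eps:
  assumes "((\<lambda>s. euclid m (x s) l) \<longlongrightarrow> 0) (at_left (t::real))" and e: "0 < e"
  shows "\<exists>\<delta>>0. \<forall>s. t - \<delta> < s \<and> s < t \<longrightarrow> euclid m (x s) l < e"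
proof -
  have "eventually (\<lambda>s. euclid m (x s) l < e) (at_left t)"
    using order_tendstoD(2)[OF assms(1)] e by blast
  then obtain b where b: "b < t" "\<And>s. b < s \<Longrightarrow> s < t \<Longrightarrow> euclid m (x s) l < e"
    by (auto simp: eventually_at_left[of "t-1"])
  show ?thesis by (intro exI[of _ "t - b"]) (use b in auto)
qed

text \<open>Bisection (\<open>Bolzano\<close>): the property \<open>P a b\<close> passes to adjacent
  intervals, and it holds around each time because the path is close to its left limit before and to
  its value after. The interval \<open>{s<..t}\<close> is half-open since a jump at \<open>t\<close>
  separates \<open>s\<close> from \<open>t\<close> while a jump at \<open>s\<close> does not;
  \<open>t < T\<close> leaves room for a jump at \<open>T\<close>.\<close>

lemma cadlag_partition:
  assumes x: "x \<in> Dsp m T" and T: "0 < T" and e: "0 < e"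
  shows "\<exists>F. finite F \<and> {0,T} \<subseteq> F \<and> F \<subseteq> {0..T} \<and>
     (\<forall>s t. 0 \<le> s \<and> s < t \<and> t < T \<and> F \<inter> {s<..t} = {} \<longrightarrow> euclid m (x s) (x t) < e)"
proof -
  define P where "P a b \<longleftrightarrow> (\<exists>F. finite F \<and> {a,b} \<subseteq> F \<and> F \<subseteq> {a..b} \<and>
     (\<forall>s t. a \<le> s \<and> s < t \<and> t < b \<and> F \<inter> {s<..t} = {} \<longrightarrow> euclid m (x s) (x t) < e))" for a b :: real
  have "P 0 T"
  proof (rule Bolzano)
    show "0 \<le> T" using T by simp
  next
    fix a b c assume "P a b" "P b c" "a \<le> b" "b \<le> c"
    then obtain F G where F: "finite F" "{a,b} \<subseteq> F" "F \<subseteq> {a..b}"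
       "\<And>s t. a \<le> s \<Longrightarrow> s < t \<Longrightarrow> t < b \<Longrightarrow> F \<inter> {s<..t} = {} \<Longrightarrow> euclid m (x s) (x t) < e"
      and G: "finite G" "{b,c} \<subseteq> G" "G \<subseteq> {b..c}"
       "\<And>s t. b \<le> s \<Longrightarrow> s < t \<Longrightarrow> t < c \<Longrightarrow> G \<inter> {s<..t} = {} \<Longrightarrow> euclid m (x s) (x t) < e"
      unfolding P_def by metis
    show "P a c" unfolding P_def
    proof (intro exI[of _ "F \<union> G"] conjI allI impI)
      fix s t assume st: "a \<le> s \<and> s < t \<and> t < c \<and> (F \<union> G) \<inter> {s<..t} = {}"
      then have "b \<notin> {s<..t}" "F \<inter> {s<..t} = {}" "G \<inter> {s<..t} = {}" using F by blast+
      then consider "t < b" | "b \<le> s" by force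
      then show "euclid m (x s) (x t) < e"
        by cases (use st F(4) G(4) \<open>F \<inter> {s<..t} = {}\<close> \<open>G \<inter> {s<..t} = {}\<close> in blast)+
    qed (use F G \<open>a \<le> b\<close> \<open>b \<le> c\<close> in force)+
  next
    fix t
    obtain d1 where d1: "d1 > 0" "\<And>s. t \<le> s \<Longrightarrow> s < t + d1 \<Longrightarrow> euclid m (x s) (x t) < e/2"
      using Dsp_right_eps[OF x T, of "e/2" t] e by auto
    obtain l where "((\<lambda>s. euclid m (x s) l) \<longlongrightarrow> 0) (at_left t)" using Dsp_left[OF x T] by blast
    then obtain d2 where d2: "d2 > 0" "\<And>s. t - d2 < s \<Longrightarrow> s < t \<Longrightarrow> euclid m (x s) l < e/2"
      using Dsp_left_eps[of m x l t "e/2"] e by auto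
    show "\<exists>d>0. \<forall>a b. a \<le> t \<and> t \<le> b \<and> b - a < d \<longrightarrow> P a b"
    proof (intro exI[of _ "min d1 d2"] conjI allI impI)
      fix a b assume ab: "a \<le> t \<and> t \<le> b \<and> b - a < min d1 d2"
      show "P a b" unfolding P_def
      proof (intro exI[of _ "{a,t,b}"] conjI allI impI)
        fix s r assume sr: "a \<le> s \<and> s < r \<and> r < b \<and> {a,t,b} \<inter> {s<..r} = {}"
        then consider "r < t" | "t \<le> s" by force
        then show "euclid m (x s) (x r) < e"
        proof cases
          case 1
          then have "euclid m (x s) l < e/2" "euclid m (x r) l < e/2"
            using sr ab d2 by auto
          then show ?thesis using euclid_triangle[of m "x s" "x r" l] euclid_sym[of m l "x r"] by linarith
        next
          case 2
          then have "euclid m (x s) (x t) < e/2" "euclid m (x r) (x t) < e/2"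
            using sr ab d1 by auto
          then show ?thesis using euclid_triangle[of m "x s" "x r" "x t"] euclid_sym[of m "x t" "x r"] by linarith
        qed
      qed (use ab in auto)
    qed (use d1 d2 in auto)
  qed
  then show ?thesis unfolding P_def by blast
qed

text \<open>Each value is within 1 of the value at the last partition point before it, and there are
  finitely many partition points.\<close>

lemma cadlag_bounded:
  assumes x: "x \<in> Dsp m T" and T: "0 < T"
  shows "\<exists>B. \<forall>t. euclid m (x t) (\<lambda>_. 0) \<le> B"
proof -
  obtain F where F: "finite F" "{0,T} \<subseteq> F" "F \<subseteq> {0..T}"
    "\<And>s t. 0 \<le> s \<Longrightarrow> s < t \<Longrightarrow> t < T \<Longrightarrow> F \<inter> {s<..t} = {} \<Longrightarrow> euclid m (x s) (x t) < 1"
    using cadlag_partition[OF x T zero_less_one] by metis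
  define B where "B = Max ((\<lambda>s. euclid m (x s) (\<lambda>_. 0)) ` F)"
  have B: "euclid m (x s) (\<lambda>_. 0) \<le> B" if "s \<in> F" for s
    unfolding B_def using F that by (intro Max_ge) auto
  have *: "euclid m (x t) (\<lambda>_. 0) \<le> B + 1" if "0 \<le> t" "t \<le> T" for t
  proof (cases "t \<in> F")
    case True then show ?thesis using B[of t] by simp
  next
    case False
    then have tT: "t < T" using F that by (cases "t = T") auto
    define s where "s = Max (F \<inter> {..t})"
    have ne: "F \<inter> {..t} \<noteq> {}" "finite (F \<inter> {..t})" using F that by auto
    have sF: "s \<in> F" "s \<le> t" using Max_in[OF ne(2,1)] by (auto simp: s_def)
    have mx: "u \<le> s" if "u \<in> F" "u \<le> t" for u unfolding s_def using ne that by (intro Max_ge) auto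
    have "euclid m (x s) (x t) < 1"
      using sF F(3) False tT mx by (intro F(4)) (auto simp: less_le, force+)
    then show ?thesis using euclid_triangle[of m "x t" "\<lambda>_. 0" "x s"] euclid_sym[of m "x s" "x t"] B[OF sF(1)] by linarith
  qed
  show ?thesis
  proof (intro exI[of _ "B+1"] allI)
    fix t
    have "euclid m (x (max 0 (min T t))) (\<lambda>_. 0) \<le> B + 1" using T by (intro *) auto
    then show "euclid m (x t) (\<lambda>_. 0) \<le> B + 1" using Dsp_clamp[OF x] by simp
  qed
qed

text \<open>A time that lies in none of the partitions for oscillation 1/(n+1) has, for each
  \<open>n\<close>, a left neighbourhood free of partition points; continuity from the right is
  built into the paths.\<close>

lemma Dsp_countable_disc:
  assumes x: "x \<in> Dsp m T" and T: "0 < T"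
  shows "\<exists>C. countable C \<and> (\<forall>t. t \<notin> C \<longrightarrow> ((\<lambda>s. euclid m (x s) (x t)) \<longlongrightarrow> 0) (at t))"
proof -
  have "\<exists>F. finite F \<and> {0,T} \<subseteq> F \<and> F \<subseteq> {0..T} \<and>
     (\<forall>s t. 0 \<le> s \<and> s < t \<and> t < T \<and> F \<inter> {s<..t} = {} \<longrightarrow> euclid m (x s) (x t) < inverse (Suc n))" for n
    by (rule cadlag_partition[OF x T]) simp
  then obtain F where F: "\<And>n. finite (F n)" "\<And>n. {0,T} \<subseteq> F n" "\<And>n. F n \<subseteq> {0..T}"
    "\<And>n s t. 0 \<le> s \<Longrightarrow> s < t \<Longrightarrow> t < T \<Longrightarrow> F n \<inter> {s<..t} = {} \<Longrightarrow> euclid m (x s) (x t) < inverse (Suc n)"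
    by metis
  show ?thesis
  proof (intro exI[of _ "\<Union>n. F n"] conjI allI impI)
    show "countable (\<Union>n. F n)" using F(1) by (intro countable_UN) (auto intro: countable_finite)
    fix t assume t: "t \<notin> (\<Union>n. F n)"
    have "((\<lambda>s. euclid m (x s) (x t)) \<longlongrightarrow> 0) (at_left t)"
    proof (cases "0 < t \<and> t < T")
      case True
      show ?thesis
      proof (rule tendstoI)
        fix e :: real assume "0 < e"
        then obtain n where n: "inverse (Suc n) < e" using reals_Archimedean by blast
        define r where "r = Max (F n \<inter> {..t})"
        have ne: "F n \<inter> {..t} \<noteq> {}" "finite (F n \<inter> {..t})" using F(1,2)[of n] True by auto
        have r: "r \<in> F n" "r \<le> t" using Max_in[OF ne(2,1)] by (auto simp: r_def)
        have mx: "u \<le> r" if "u \<in> F n" "u \<le> t" for u unfolding r_def using ne that by (intro Max_ge) auto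
        have rt: "r < t" using r t by (cases "r = t") auto
        have "eventually (\<lambda>s. r < s \<and> s < t) (at_left t)" using rt
          by (auto simp: eventually_at_left)
        then show "eventually (\<lambda>s. dist (euclid m (x s) (x t)) 0 < e) (at_left t)"
        proof eventually_elim
          case (elim s)
          have "0 \<le> r" using r(1) F(3)[of n] by auto
          then have "euclid m (x s) (x t) < inverse (Suc n)"
            using elim True mx by (intro F(4)) force+
          then show ?case using n by simp
        qed
      qed
    next
      case False
      have "t \<noteq> 0" "t \<noteq> T" using t F(2)[of 0] by auto
      with False have c: "t < 0 \<or> T < t" by auto
      have "eventually (\<lambda>s. euclid m (x s) (x t) = 0) (at_left t)"
      proof (cases "t < 0")
        case True
        have "eventually (\<lambda>s. s < t) (at_left t)" by (auto simp: eventually_at_filter)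
        then show ?thesis
        proof eventually_elim
          case (elim s)
          then show ?case using True Dsp_le_0[OF x T, of s] Dsp_le_0[OF x T, of t] by simp
        qed
      next
        case False
        then have "T < t" using c by simp
        then have "eventually (\<lambda>s. T < s) (at_left t)" by (auto simp: eventually_at_left)
        then show ?thesis
        proof eventually_elim
          case (elim s)
          then show ?case using \<open>T < t\<close> Dsp_ge_T[OF x T, of s] Dsp_ge_T[OF x T, of t] by simp
        qed
      qed
      then show ?thesis by (rule tendsto_eventually)
    qed
    then show "((\<lambda>s. euclid m (x s) (x t)) \<longlongrightarrow> 0) (at t)"
      using Dsp_right[OF x T, of t] by (simp add: filterlim_at_split)
  qed
qed

section \<open>Time changes and the Skorohod distance\<close>

lemma time_change_range: "lam \<in> time_changes T \<Longrightarrow> t \<in> {0..T} \<Longrightarrow> lam t \<in> {0..T}"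
  unfolding time_changes_def using strict_mono_on_leD[of "{0..T}" lam 0 t] strict_mono_on_leD[of "{0..T}" lam t T] by force

lemma time_change_diff: "lam \<in> time_changes T \<Longrightarrow> t \<in> {0..T} \<Longrightarrow> \<bar>lam t - t\<bar> \<le> T"
  using time_change_range[of lam T t] by auto

lemma time_change_surj:
  assumes "lam \<in> time_changes T" "0 < T" shows "lam ` {0..T} = {0..T}"
proof
  show "lam ` {0..T} \<subseteq> {0..T}" using time_change_range[OF assms(1)] by auto
  show "{0..T} \<subseteq> lam ` {0..T}"
  proof
    fix y assume "y \<in> {0..T}"
    then have "\<exists>x\<ge>0. x \<le> T \<and> lam x = y"
      using assms by (intro IVT') (auto simp: time_changes_def)
    then show "y \<in> lam ` {0..T}" by auto
  qed
qed

lemma time_change_inv: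
  assumes l: "lam \<in> time_changes T" and T: "0 < T"
  shows "inv_into {0..T} lam \<in> time_changes T"
proof -
  have sm: "strict_mono_on {0..T} lam" and ct: "continuous_on {0..T} lam" and e: "lam 0 = 0" "lam T = T"
    using l by (auto simp: time_changes_def)
  have inj: "inj_on lam {0..T}" using sm by (rule strict_mono_on_imp_inj_on)
  have im: "lam ` {0..T} = {0..T}" by (rule time_change_surj[OF l T])
  have "continuous_on {0..T} (inv_into {0..T} lam)"
    using continuous_on_inv[OF ct compact_Icc, of "inv_into {0..T} lam"] inj im by (simp add: inv_into_f_f)
  moreover have "strict_mono_on {0..T} (inv_into {0..T} lam)"
  proof (rule strict_mono_onI)
    fix r s assume rs: "r \<in> {0..T}" "s \<in> {0..T}" "r < s"
    define a b where "a = inv_into {0..T} lam r" and "b = inv_into {0..T} lam s"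
    have ab: "a \<in> {0..T}" "b \<in> {0..T}" "lam a = r" "lam b = s" unfolding a_def b_def using rs im
      by (auto simp: inv_into_into f_inv_into_f simp del: atLeastAtMost_iff)
    have "a < b"
    proof (rule ccontr)
      assume "\<not> a < b" then have "lam b \<le> lam a" using sm ab by (auto intro: strict_mono_on_leD)
      then show False using ab rs by simp
    qed
    then show "inv_into {0..T} lam r < inv_into {0..T} lam s" by (simp add: a_def b_def)
  qed
  moreover have "inv_into {0..T} lam 0 = 0" "inv_into {0..T} lam T = T"
    using inv_into_f_f[OF inj, of 0] inv_into_f_f[OF inj, of T] e T by auto
  ultimately show ?thesis by (simp add: time_changes_def)
qed

lemma time_change_comp:
  assumes l: "lam \<in> time_changes T" and k: "kap \<in> time_changes T"
  shows "kap \<circ> lam \<in> time_changes T"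
proof -
  have r: "lam ` {0..T} \<subseteq> {0..T}" using time_change_range[OF l] by auto
  have "continuous_on {0..T} (kap \<circ> lam)"
    using l k r by (intro continuous_on_compose) (auto simp: time_changes_def intro: continuous_on_subset)
  moreover have "strict_mono_on {0..T} (kap \<circ> lam)"
    using l k r by (auto simp: time_changes_def strict_mono_on_def image_subset_iff)
  ultimately show ?thesis using l k by (simp add: time_changes_def)
qed

lemma time_change_id: "(\<lambda>t. t) \<in> time_changes T"
  by (auto simp: time_changes_def strict_mono_on_def)

text \<open>A witness form of the Skorohod distance that avoids suprema and infima. A time change
  bounds \<open>skor_dist\<close> by \<open>e\<close>; conversely only a strict bound on
  \<open>skor_dist\<close> yields a time change, as the infimum need not be attained.\<close>

definition skor_close :: "nat \<Rightarrow> real \<Rightarrow> real \<Rightarrow> (real \<Rightarrow> real) \<Rightarrow> (real \<Rightarrow> nat \<Rightarrow> real) \<Rightarrow> (real \<Rightarrow> nat \<Rightarrow> real) \<Rightarrow> bool" where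
  "skor_close m T e lam x y \<longleftrightarrow> lam \<in> time_changes T \<and>
     (\<forall>t\<in>{0..T}. \<bar>lam t - t\<bar> \<le> e \<and> euclid m (x t) (y (lam t)) \<le> e)"

lemma skor_dist_le:
  assumes c: "skor_close m T e lam x y" and T: "0 < T"
  shows "skor_dist m T x y \<le> e"
proof -
  have lam: "lam \<in> time_changes T" using c by (simp add: skor_close_def)
  have bdd: "bdd_below ((\<lambda>lam. max (SUP t\<in>{0..T}. \<bar>lam t - t\<bar>) (SUP t\<in>{0..T}. euclid m (x t) (y (lam t)))) ` time_changes T)"
  proof (rule bdd_belowI2)
    fix k assume k: "k \<in> time_changes T"
    have "\<bar>k 0 - 0\<bar> \<le> (SUP t\<in>{0..T}. \<bar>k t - t\<bar>)"
    proof (rule cSUP_upper)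
      show "bdd_above ((\<lambda>t. \<bar>k t - t\<bar>) ` {0..T})"
        using time_change_diff[OF k] by (intro bdd_aboveI2[of _ _ T])
    qed (use T in auto)
    then show "0 \<le> max (SUP t\<in>{0..T}. \<bar>k t - t\<bar>) (SUP t\<in>{0..T}. euclid m (x t) (y (k t)))" by auto
  qed
  have "skor_dist m T x y \<le> max (SUP t\<in>{0..T}. \<bar>lam t - t\<bar>) (SUP t\<in>{0..T}. euclid m (x t) (y (lam t)))"
    unfolding skor_dist_def by (rule cINF_lower[OF bdd lam])
  also have "\<dots> \<le> e" using c T by (auto simp: skor_close_def intro!: cSUP_least)
  finally show ?thesis .
qed

text \<open>Boundedness of cadlag paths enters here: a real supremum bounds the members of a set
  only if the set is bounded above.\<close>

lemma skor_dist_less: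
  assumes d: "skor_dist m T x y < e" and T: "0 < T" and x: "x \<in> Dsp m T" and y: "y \<in> Dsp m T"
  shows "\<exists>lam. skor_close m T e lam x y"
proof -
  obtain lam where lam: "lam \<in> time_changes T"
    and l: "max (SUP t\<in>{0..T}. \<bar>lam t - t\<bar>) (SUP t\<in>{0..T}. euclid m (x t) (y (lam t))) < e"
    using d cInf_lessD[of "(\<lambda>lam. max (SUP t\<in>{0..T}. \<bar>lam t - t\<bar>) (SUP t\<in>{0..T}. euclid m (x t) (y (lam t)))) ` time_changes T" e]
      time_change_id unfolding skor_dist_def by blast
  obtain B1 B2 where B: "\<And>t. euclid m (x t) (\<lambda>_. 0) \<le> B1" "\<And>t. euclid m (y t) (\<lambda>_. 0) \<le> B2"
    using cadlag_bounded[OF x T] cadlag_bounded[OF y T] by blast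
  have "skor_close m T e lam x y" unfolding skor_close_def
  proof (intro conjI ballI lam)
    fix t assume t: "t \<in> {0..T}"
    have "\<bar>lam t - t\<bar> \<le> (SUP t\<in>{0..T}. \<bar>lam t - t\<bar>)"
      using time_change_diff[OF lam] t
      by (intro cSUP_upper bdd_aboveI2[of _ _ T])
    then show "\<bar>lam t - t\<bar> \<le> e" using l by simp
    have "euclid m (x t) (y (lam t)) \<le> (SUP t\<in>{0..T}. euclid m (x t) (y (lam t)))"
    proof (intro cSUP_upper t bdd_aboveI2[of _ _ "B1+B2"])
      fix t show "euclid m (x t) (y (lam t)) \<le> B1 + B2"
        using euclid_triangle[of m "x t" "y (lam t)" "\<lambda>_. 0"] B(1)[of t] B(2)[of "lam t"] euclid_sym[of m "\<lambda>_. 0" "y (lam t)"]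
        by linarith
    qed
    then show "euclid m (x t) (y (lam t)) \<le> e" using l by simp
  qed
  then show ?thesis by blast
qed

lemma skor_close_ge0: "skor_close m T e lam x y \<Longrightarrow> 0 < T \<Longrightarrow> 0 \<le> e"
  unfolding skor_close_def by (metis abs_ge_zero atLeastAtMost_iff less_imp_le order_refl order_trans)

lemma skor_dist_nonneg:
  assumes T: "0 < T" and x: "x \<in> Dsp m T" and y: "y \<in> Dsp m T"
  shows "0 \<le> skor_dist m T x y"
proof (rule ccontr)
  assume "\<not> 0 \<le> skor_dist m T x y"
  then have "skor_dist m T x y < skor_dist m T x y / 2" by simp
  then show False using skor_dist_less[OF _ T x y] skor_close_ge0[OF _ T] \<open>\<not> 0 \<le> skor_dist m T x y\<close> by fastforce
qed

lemma skor_dist_self: "0 < T \<Longrightarrow> x \<in> Dsp m T \<Longrightarrow> skor_dist m T x x = 0"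
  using skor_dist_le[of m T 0 "\<lambda>t. t" x x] skor_dist_nonneg[of T x m x] time_change_id
  by (auto simp: skor_close_def)

lemma skor_close_sym:
  assumes c: "skor_close m T e lam x y" and T: "0 < T"
  shows "skor_close m T e (inv_into {0..T} lam) y x"
proof -
  have lam: "lam \<in> time_changes T" using c by (simp add: skor_close_def)
  show ?thesis unfolding skor_close_def
  proof (intro conjI ballI time_change_inv[OF lam T])
    fix t assume t: "t \<in> {0..T}"
    define s where "s = inv_into {0..T} lam t"
    have s: "s \<in> {0..T}" "lam s = t" using time_change_surj[OF lam T] t
      by (auto simp: s_def inv_into_into f_inv_into_f simp del: atLeastAtMost_iff)
    then have "\<bar>lam s - s\<bar> \<le> e" "euclid m (x s) (y (lam s)) \<le> e" using c by (auto simp: skor_close_def)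
    then show "\<bar>inv_into {0..T} lam t - t\<bar> \<le> e" "euclid m (y t) (x (inv_into {0..T} lam t)) \<le> e"
      unfolding s_def[symmetric] using s by (auto simp: euclid_sym)
  qed
qed

lemma skor_dist_sym:
  assumes T: "0 < T" and x: "x \<in> Dsp m T" and y: "y \<in> Dsp m T"
  shows "skor_dist m T x y = skor_dist m T y x"
proof (rule antisym)
  show "skor_dist m T x y \<le> skor_dist m T y x"
    by (rule field_le_epsilon) (metis skor_dist_less[OF _ T y x] skor_close_sym[OF _ T] skor_dist_le[OF _ T] less_add_same_cancel1)
  show "skor_dist m T y x \<le> skor_dist m T x y"
    by (rule field_le_epsilon) (metis skor_dist_less[OF _ T x y] skor_close_sym[OF _ T] skor_dist_le[OF _ T] less_add_same_cancel1)
qed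

lemma skor_close_trans:
  assumes a: "skor_close m T e lam x y" and b: "skor_close m T h kap y z"
  shows "skor_close m T (e + h) (kap \<circ> lam) x z"
  unfolding skor_close_def
proof (intro conjI ballI)
  show "kap \<circ> lam \<in> time_changes T" using a b by (intro time_change_comp) (auto simp: skor_close_def)
  fix t assume t: "t \<in> {0..T}"
  then have l: "lam t \<in> {0..T}" using a time_change_range by (auto simp: skor_close_def simp del: atLeastAtMost_iff)
  have 1: "\<bar>lam t - t\<bar> \<le> e" "euclid m (x t) (y (lam t)) \<le> e" using a t by (auto simp: skor_close_def)
  have 2: "\<bar>kap (lam t) - lam t\<bar> \<le> h" "euclid m (y (lam t)) (z (kap (lam t))) \<le> h" using b l by (auto simp: skor_close_def)
  show "\<bar>(kap \<circ> lam) t - t\<bar> \<le> e + h" using 1 2 by simp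
  show "euclid m (x t) (z ((kap \<circ> lam) t)) \<le> e + h"
    using 1 2 euclid_triangle[of m "x t" "z (kap (lam t))" "y (lam t)"] by simp
qed

lemma skor_dist_triangle:
  assumes T: "0 < T" and x: "x \<in> Dsp m T" and y: "y \<in> Dsp m T" and z: "z \<in> Dsp m T"
  shows "skor_dist m T x z \<le> skor_dist m T x y + skor_dist m T y z"
proof (rule field_le_epsilon)
  fix e :: real assume e: "0 < e"
  obtain lam kap where "skor_close m T (skor_dist m T x y + e/2) lam x y"
    "skor_close m T (skor_dist m T y z + e/2) kap y z"
    using skor_dist_less[OF _ T x y, of "skor_dist m T x y + e/2"] skor_dist_less[OF _ T y z, of "skor_dist m T y z + e/2"] e by auto
  from skor_dist_le[OF skor_close_trans[OF this] T]
  show "skor_dist m T x z \<le> skor_dist m T x y + skor_dist m T y z + e" by (simp add: algebra_simps)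
qed

lemma skor_conv_iff:
  assumes T: "0 < T" and xs: "\<And>n. xs n \<in> Dsp m T" and x: "x \<in> Dsp m T"
  shows "skor_conv m T xs x \<longleftrightarrow> (\<exists>lam e. e \<longlonglongrightarrow> 0 \<and> (\<forall>n. skor_close m T (e n) (lam n) (xs n) x))"
proof
  assume c: "skor_conv m T xs x"
  have "\<forall>n. \<exists>lam. skor_close m T (skor_dist m T (xs n) x + inverse (Suc n)) lam (xs n) x"
    by (intro allI skor_dist_less[OF _ T xs x]) simp
  then obtain lam where "\<forall>n. skor_close m T (skor_dist m T (xs n) x + inverse (Suc n)) (lam n) (xs n) x" by metis
  moreover have "(\<lambda>n. skor_dist m T (xs n) x + inverse (Suc n)) \<longlonglongrightarrow> 0 + 0"
    using c LIMSEQ_inverse_real_of_nat by (intro tendsto_add) (auto simp: skor_conv_def)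
  ultimately show "\<exists>lam e. e \<longlonglongrightarrow> 0 \<and> (\<forall>n. skor_close m T (e n) (lam n) (xs n) x)"
    by (intro exI[of _ lam] exI[of _ "\<lambda>n. skor_dist m T (xs n) x + inverse (Suc n)"]) simp
next
  assume "\<exists>lam e. e \<longlonglongrightarrow> 0 \<and> (\<forall>n. skor_close m T (e n) (lam n) (xs n) x)"
  then obtain lam e where e: "e \<longlonglongrightarrow> 0" "\<And>n. skor_close m T (e n) (lam n) (xs n) x" by blast
  show "skor_conv m T xs x" unfolding skor_conv_def
    by (rule tendsto_0_le[OF e(1) skor_dist_nonneg[OF T xs x] skor_dist_le[OF e(2) T]])
qed

lemma skor_convE:
  assumes c: "skor_conv m T xs x" and T: "0 < T" and xs: "\<And>n. xs n \<in> Dsp m T" and x: "x \<in> Dsp m T"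
  obtains lam e where "e \<longlonglongrightarrow> 0" "\<And>n. lam n \<in> time_changes T"
    "\<And>n t. t \<in> {0..T} \<Longrightarrow> \<bar>lam n t - t\<bar> \<le> e n"
    "\<And>n t. t \<in> {0..T} \<Longrightarrow> euclid m (xs n t) (x (lam n t)) \<le> e n"
proof -
  obtain lam e where "e \<longlonglongrightarrow> 0" "\<And>n. skor_close m T (e n) (lam n) (xs n) x"
    using c unfolding skor_conv_iff[OF T xs x] by blast
  then show thesis by (intro that[of e lam]) (simp_all add: skor_close_def)
qed

text \<open>Time changes fix 0 and \<open>T\<close>, so at the end points values converge without
  any continuity of the limit. At an interior time the changed time tends to \<open>t\<close>, and
  continuity of the limit path at \<open>t\<close> finishes.\<close>

lemma skor_conv_at:
  assumes c: "skor_conv m T xs x" and T: "0 < T" and xs: "\<And>n. xs n \<in> Dsp m T" and x: "x \<in> Dsp m T"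
    and t: "((\<lambda>s. euclid m (x s) (x t)) \<longlongrightarrow> 0) (at t) \<or> T \<le> t \<or> t \<le> 0"
  shows "(\<lambda>n. euclid m (xs n t) (x t)) \<longlonglongrightarrow> 0"
proof -
  obtain lam e where L: "e \<longlonglongrightarrow> 0" "\<And>n. lam n \<in> time_changes T"
    "\<And>n t. t \<in> {0..T} \<Longrightarrow> \<bar>lam n t - t\<bar> \<le> e n"
    "\<And>n t. t \<in> {0..T} \<Longrightarrow> euclid m (xs n t) (x (lam n t)) \<le> e n"
    using skor_convE[OF c T xs x] by metis
  have le: "lam n 0 = 0" "lam n T = T" for n using L(2)[of n] by (auto simp: time_changes_def)
  consider "T \<le> t" | "t \<le> 0" | "0 < t" "t < T" by linarith
  then show ?thesis
  proof cases
    case 1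
    have "euclid m (xs n t) (x t) \<le> e n" for n
      using L(4)[of T n] le 1 T Dsp_ge_T[OF xs T 1] Dsp_ge_T[OF x T 1] by simp
    then show ?thesis by (rule tendsto_0_le[OF L(1) euclid_nonneg])
  next
    case 2
    have "euclid m (xs n t) (x t) \<le> e n" for n
      using L(4)[of 0 n] le 2 T Dsp_le_0[OF xs T 2] Dsp_le_0[OF x T 2] by simp
    then show ?thesis by (rule tendsto_0_le[OF L(1) euclid_nonneg])
  next
    case 3
    then have ct: "((\<lambda>s. euclid m (x s) (x t)) \<longlongrightarrow> 0) (at t)" using t by auto
    have lt: "(\<lambda>n. lam n t) \<longlonglongrightarrow> t"
      by (rule Lim_null_comparison[THEN LIM_zero_cancel, OF _ L(1)]) (use 3 L(3) in auto)
    have "isCont (\<lambda>s. euclid m (x s) (x t)) t" using ct by (simp add: isCont_def)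
    from isCont_tendsto_compose[OF this lt]
    have a: "(\<lambda>n. euclid m (x (lam n t)) (x t)) \<longlonglongrightarrow> 0" by simp
    have "euclid m (xs n t) (x t) \<le> e n + euclid m (x (lam n t)) (x t)" for n
      using euclid_triangle[of m "xs n t" "x t" "x (lam n t)"] L(4)[of t n] 3 by simp
    then show ?thesis using tendsto_add[OF L(1) a] by (intro tendsto_0_le[OF _ euclid_nonneg]) auto
  qed
qed

lemma euclid_tendsto_coord:
  assumes "((\<lambda>n. euclid m (v n) w) \<longlongrightarrow> 0) F" "i < m"
  shows "((\<lambda>n. v n i) \<longlongrightarrow> w i) F"
  by (rule Lim_null_comparison[THEN LIM_zero_cancel, OF _ assms(1)]) (use assms euclid_coord in auto)

text \<open>Convergence can fail only at the countably many discontinuities of the limit; this is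
  what makes time averages Skorohod continuous.\<close>

lemma skor_conv_ae:
  assumes c: "skor_conv m T xs x" and T: "0 < T" and xs: "\<And>n. xs n \<in> Dsp m T" and x: "x \<in> Dsp m T"
  shows "AE t in lborel. (\<lambda>n. euclid m (xs n t) (x t)) \<longlonglongrightarrow> 0"
proof -
  obtain C where C: "countable C" "\<And>t. t \<notin> C \<Longrightarrow> ((\<lambda>s. euclid m (x s) (x t)) \<longlongrightarrow> 0) (at t)"
    using Dsp_countable_disc[OF x T] by blast
  have "AE t in lborel. t \<notin> C" using countable_imp_null_set_lborel[OF C(1)] by (rule AE_not_in)
  then show ?thesis by eventually_elim (use C(2) skor_conv_at[OF c T xs x] in blast)
qed

lemma skor_conv_subseq: "skor_conv m T xs x \<Longrightarrow> strict_mono r \<Longrightarrow> skor_conv m T (\<lambda>n. xs (r n)) x"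
  unfolding skor_conv_def using LIMSEQ_subseq_LIMSEQ[of "\<lambda>n. skor_dist m T (xs n) x" 0 r] by (simp add: o_def)

section \<open>Approximation of paths by step functions on a regular grid\<close>

lemma strict_chain:
  fixes q :: "nat \<Rightarrow> real"
  assumes "\<And>j. j < r \<Longrightarrow> q j < q (Suc j)" "i < j" "j \<le> r"
  shows "q i < q j"
  using assms(2,3)
proof (induction j)
  case (Suc j)
  then show ?case using assms(1)[of j] by (cases "i = j") (auto simp: less_Suc_eq)
qed simp

lemma chain_le:
  fixes q :: "nat \<Rightarrow> real"
  assumes "\<And>j. j < r \<Longrightarrow> q j < q (Suc j)" "i \<le> j" "j \<le> r"
  shows "q i \<le> q j"
  using strict_chain[of r q i j] assms by (cases "i = j") auto

lemma chain_locate: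
  fixes q :: "nat \<Rightarrow> real"
  assumes "q 0 \<le> t" "t < q r"
  shows "\<exists>j<r. q j \<le> t \<and> t < q (Suc j)"
  using assms(2)
proof (induction r)
  case 0 then show ?case using assms(1) by simp
next
  case (Suc r)
  show ?case
  proof (cases "t < q r")
    case True then show ?thesis using Suc.IH by (meson less_SucI)
  next
    case False then show ?thesis using Suc.prems by (intro exI[of _ r]) simp
  qed
qed

text \<open>The interpolation is a sum of ramps: \<open>c t j\<close> rises from 0 to 1 over
  \<open>[q j, q (Suc j)]\<close> and is weighted by an increment of \<open>p\<close>. At
  \<open>q i\<close> the sum telescopes to \<open>p i\<close>. With increments of \<open>q\<close>
  as weights it would be the identity, and each of the \<open>r\<close> summands differs from that
  by at most \<open>2 * h\<close>. The crude bound suffices because \<open>r\<close> stays fixed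
  while \<open>h\<close> tends to 0.\<close>

lemma piecewise_linear_time_change:
  fixes p q :: "nat \<Rightarrow> real"
  assumes p: "p 0 = 0" "p r = T" "\<And>j. j < r \<Longrightarrow> p j < p (Suc j)"
    and q: "q 0 = 0" "q r = T" "\<And>j. j < r \<Longrightarrow> q j < q (Suc j)"
    and h: "\<And>j. j \<le> r \<Longrightarrow> \<bar>p j - q j\<bar> \<le> h"
  shows "\<exists>lam\<in>time_changes T. (\<forall>j\<le>r. lam (q j) = p j) \<and> (\<forall>t\<in>{0..T}. \<bar>lam t - t\<bar> \<le> 2 * real r * h)"
proof -
  define c where "c t j = (min t (q (Suc j)) - min t (q j)) / (q (Suc j) - q j)" for t j
  define lam where "lam t = (\<Sum>j<r. c t j * (p (Suc j) - p j))" for t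
  have c01: "0 \<le> c t j" "c t j \<le> 1" if "j < r" for t j
    using q(3)[OF that] by (auto simp: c_def field_simps min_def)
  have cmono: "c s j \<le> c t j" if "j < r" "s \<le> t" for s t j
    using q(3)[OF that(1)] that(2) unfolding c_def by (intro divide_right_mono) (auto simp: min_def)
  have lq: "lam (q i) = p i" if i: "i \<le> r" for i
  proof -
    have c1: "c (q i) j = (if j < i then 1 else 0)" if j: "j < r" for j
    proof (cases "j < i")
      case True
      then have "q (Suc j) \<le> q i" using chain_le[of r q "Suc j" i] q(3) i by auto
      then show ?thesis using True q(3)[OF j] by (simp add: c_def)
    next
      case False
      then have "q i \<le> q j" using chain_le[of r q i j] q(3) j by auto
      then show ?thesis using False q(3)[OF j] by (simp add: c_def)
    qed
    have "lam (q i) = (\<Sum>j<r. if j < i then p (Suc j) - p j else 0)"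
      unfolding lam_def using c1 by (intro sum.cong) auto
    also have "\<dots> = (\<Sum>j<i. p (Suc j) - p j)"
    proof -
      have "{..<r} \<inter> {j. j < i} = {..<i}" using i by auto
      then show ?thesis by (simp add: sum.If_cases)
    qed
    also have "\<dots> = p i" using sum_lessThan_telescope[of p i] p(1) by simp
    finally show ?thesis .
  qed
  have "lam \<in> time_changes T" unfolding time_changes_def
  proof (intro CollectI conjI)
    have ct: "continuous_on {0..T} (\<lambda>t. c t j)" if "j < r" for j
      unfolding c_def using q(3)[OF that] by (intro continuous_intros) auto
    show "continuous_on {0..T} lam" unfolding lam_def
      by (intro continuous_on_sum continuous_on_mult continuous_on_const) (auto intro: ct)
    show "strict_mono_on {0..T} lam"
    proof (rule strict_mono_onI)
      fix s t assume st: "s \<in> {0..T}" "t \<in> {0..T}" "s < t"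
      then obtain j where j: "j < r" "q j \<le> s" "s < q (Suc j)"
        using chain_locate[of q s r] q by auto
      have "c s j < c t j"
        using j st q(3)[OF j(1)] unfolding c_def by (intro divide_strict_right_mono) (auto simp: min_def)
      then show "lam s < lam t" unfolding lam_def
        using cmono[of _ s t] st p(3) j(1)
        by (intro sum_strict_mono2[of "{..<r}" "{..<r}", simplified] sum_strict_mono_ex1)
          (auto intro!: mult_right_mono bexI[of _ j] simp: less_imp_le)
    qed
    show "lam 0 = 0" using lq[of 0] p q by simp
    show "lam T = T" using lq[of r] p q by simp
  qed
  moreover have "\<bar>lam t - t\<bar> \<le> 2 * real r * h" if t: "t \<in> {0..T}" for t
  proof -
    have "(\<Sum>j<r. c t j * (q (Suc j) - q j)) = (\<Sum>j<r. min t (q (Suc j)) - min t (q j))"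
      using q(3) by (intro sum.cong refl) (simp add: c_def less_imp_neq[THEN not_sym])
    also have "\<dots> = t" using sum_lessThan_telescope[of "\<lambda>j. min t (q j)" r] q t by simp
    finally have "lam t - t = (\<Sum>j<r. c t j * (p (Suc j) - p j)) - (\<Sum>j<r. c t j * (q (Suc j) - q j))"
      by (simp add: lam_def)
    also have "\<dots> = (\<Sum>j<r. c t j * ((p (Suc j) - q (Suc j)) - (p j - q j)))"
      unfolding sum_subtractf[symmetric] by (intro sum.cong refl) (simp add: algebra_simps)
    also have "\<bar>\<dots>\<bar> \<le> (\<Sum>j<r. 2 * h)"
    proof (rule order_trans[OF sum_abs], rule sum_mono)
      fix j assume j: "j \<in> {..<r}"
      have "\<bar>c t j\<bar> \<le> 1" using c01[of j t] j by auto
      then have "\<bar>c t j * ((p (Suc j) - q (Suc j)) - (p j - q j))\<bar> \<le> 1 * \<bar>(p (Suc j) - q (Suc j)) - (p j - q j)\<bar>"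
        unfolding abs_mult by (rule mult_right_mono) simp
      also have "\<dots> \<le> 2 * h" using h[of j] h[of "Suc j"] j by auto
      finally show "\<bar>c t j * ((p (Suc j) - q (Suc j)) - (p j - q j))\<bar> \<le> 2 * h" .
    qed
    finally show ?thesis by simp
  qed
  ultimately show ?thesis using lq by blast
qed

lemma cadlag_partition_seq:
  assumes x: "x \<in> Dsp m T" and T: "0 < T" and e: "0 < e"
  shows "\<exists>r p. p 0 = 0 \<and> p r = T \<and> (\<forall>j<r. p j < p (Suc j)) \<and>
     (\<forall>j<r. \<forall>s\<in>{p j..<p (Suc j)}. \<forall>t\<in>{p j..<p (Suc j)}. euclid m (x s) (x t) < e)"
proof -
  obtain F where F: "finite F" "{0,T} \<subseteq> F" "F \<subseteq> {0..T}"
    "\<And>s t. 0 \<le> s \<Longrightarrow> s < t \<Longrightarrow> t < T \<Longrightarrow> F \<inter> {s<..t} = {} \<Longrightarrow> euclid m (x s) (x t) < e"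
    using cadlag_partition[OF x T e] by metis
  define l where "l = sorted_list_of_set F"
  have l: "set l = F" "sorted l" "distinct l" using F(1) by (auto simp: l_def)
  have len: "length l > 0" using l(1) F(2) by auto
  define r where "r = length l - 1"
  define p where "p j = l ! j" for j
  have pF: "p j \<in> F" if "j \<le> r" for j proof -
    have "j < length l" using that len unfolding r_def by linarith
    then show ?thesis using l(1) nth_mem by (auto simp: p_def)
  qed
  have mono: "p i \<le> p j" if "i \<le> j" "j \<le> r" for i j
    proof -
    have "j < length l" using that len unfolding r_def by linarith
    then show ?thesis using that l(2) by (auto simp: p_def intro: sorted_nth_mono)
  qed
  have st: "p j < p (Suc j)" if "j < r" for j
proof -
    have "j < length l" "Suc j < length l" using that unfolding r_def by linarith+
    then have "p j \<noteq> p (Suc j)" using l(3) nth_eq_iff_index_eq[of l j "Suc j"] by (simp add: p_def)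
    then show ?thesis using mono[of j "Suc j"] that by simp
  qed
  have idx: "\<exists>i\<le>r. p i = y" if "y \<in> F" for y
  proof -
    have "y \<in> set l" using that l(1) by simp
    then obtain i where "i < length l" "l ! i = y" unfolding in_set_conv_nth by blast
    moreover from this(1) have "i \<le> r" unfolding r_def by linarith
    ultimately show ?thesis unfolding p_def by blast
  qed
  have p0: "p 0 = 0"
  proof -
    obtain i where "i \<le> r" "p i = 0" using idx F(2) by auto
    then have "p 0 \<le> 0" using mono[of 0 i] by auto
    moreover have "0 \<le> p 0" using pF[of 0] F(3) by auto
    ultimately show ?thesis by simp
  qed
  have pr: "p r = T"
  proof -
    obtain i where "i \<le> r" "p i = T" using idx F(2) by auto
    then have "T \<le> p r" using mono[of i r] by auto
    moreover have "p r \<le> T" using pF[of r] F(3) by auto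
    ultimately show ?thesis by simp
  qed
  have emp: "F \<inter> {p j<..<p (Suc j)} = {}" if "j < r" for j
  proof (rule ccontr)
    assume "F \<inter> {p j<..<p (Suc j)} \<noteq> {}"
    then obtain i where i: "i \<le> r" "p j < p i" "p i < p (Suc j)" using idx by fastforce
    then have "i > j" "i < Suc j" using mono[of i j] mono[of "Suc j" i] that by (auto simp: not_le[symmetric])
    then show False by simp
  qed
  have lt: "euclid m (x s) (x t) < e" if "j < r" "p j \<le> s" "s < t" "t < p (Suc j)" for j s t
  proof (rule F(4))
    show "0 \<le> s" using mono[of 0 j] p0 that by auto
    show "t < T" using mono[of "Suc j" r] pr that by auto
    show "F \<inter> {s<..t} = {}" using emp[OF that(1)] that by fastforce
  qed (use that in simp)
  have "euclid m (x s) (x t) < e" if "j < r" "s \<in> {p j..<p (Suc j)}" "t \<in> {p j..<p (Suc j)}" for j s t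
  proof -
    consider "s < t" | "s = t" | "t < s" by linarith
    then show ?thesis by cases (use that e lt[of j s t] lt[of j t s] in \<open>auto simp: euclid_sym\<close>)
  qed
  then show ?thesis using p0 pr st by blast
qed

text \<open>A path coded by finitely many reals, so that Skorohod continuity of a functional turns
  into Borel measurability in the code \<open>v\<close>. The last index \<open>k\<close> is reached
  only from time \<open>T\<close> on, where it records the final value.\<close>

definition step_path :: "nat \<Rightarrow> real \<Rightarrow> nat \<Rightarrow> (nat \<times> nat \<Rightarrow> real) \<Rightarrow> real \<Rightarrow> nat \<Rightarrow> real" where
  "step_path d T k v = (\<lambda>t j. if j < d then v (nat \<lfloor>real k * max 0 (min T t) / T\<rfloor>, j) else 0)"

lemma step_path_index: "0 < T \<Longrightarrow> nat \<lfloor>real k * max 0 (min T t) / T\<rfloor> \<le> k"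
proof -
  assume T: "0 < T"
  have "max 0 (min T t) / T \<le> 1" using T by simp
  then have "real k * max 0 (min T t) / T \<le> real k"
    using mult_left_mono[of "max 0 (min T t) / T" 1 "real k"] by simp
  then show ?thesis by (simp add: nat_le_iff floor_le_iff)
qed

lemma step_path_Dsp:
  assumes T: "0 < T" and k: "0 < k"
  shows "step_path d T k v \<in> Dsp d T"
proof -
  let ?x = "step_path d T k v"
  have Rm: "?x t \<in> Rm d" for t by (auto simp: step_path_def Rm_def)
  have cl: "?x t = ?x (max 0 (min T t))" for t
  proof -
    have "max 0 (min T (max 0 (min T t))) = max 0 (min T t)" using T by auto
    then show ?thesis unfolding step_path_def by (simp only:)
  qed
  have R: "((\<lambda>s. euclid d (?x s) (?x t)) \<longlongrightarrow> 0) (at_right t)" if t: "t \<in> {0..<T}" for t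
  proof -
    define n where "n = \<lfloor>real k * t / T\<rfloor>"
    define b where "b = min T ((n + 1) * T / k)"
    have "real k * t / T < n + 1" unfolding n_def by linarith
    then have "t < (n + 1) * T / k" using T k by (simp add: field_simps)
    then have "t < b" using t by (simp add: b_def)
    then have "eventually (\<lambda>s. t < s \<and> s < b) (at_right t)" by (auto simp: eventually_at_right)
    then have "eventually (\<lambda>s. euclid d (?x s) (?x t) = 0) (at_right t)"
    proof eventually_elim
      case (elim s)
      have "n \<le> real k * t / T" unfolding n_def by linarith
      also have "\<dots> \<le> real k * s / T" using elim T by (intro divide_right_mono mult_left_mono) auto
      finally have 1: "n \<le> real k * s / T" .
      have "s < (n + 1) * T / k" using elim by (simp add: b_def)
      then have "real k * s / T < n + 1" using T k by (simp add: field_simps)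
      then have "\<lfloor>real k * s / T\<rfloor> = n" using 1 by (intro floor_unique) auto
      moreover have "max 0 (min T s) = s" "max 0 (min T t) = t" using elim t by (auto simp: b_def)
      ultimately have "?x s = ?x t" unfolding step_path_def n_def by (simp only:)
      then show ?case by simp
    qed
    then show ?thesis by (rule tendsto_eventually)
  qed
  have L: "\<exists>l\<in>Rm d. ((\<lambda>s. euclid d (?x s) l) \<longlongrightarrow> 0) (at_left t)" if t: "t \<in> {0<..T}" for t
  proof -
    define n where "n = \<lceil>real k * t / T\<rceil> - 1"
    define b where "b = max 0 (n * T / k)"
    have "n < real k * t / T" unfolding n_def by linarith
    then have "n * T / k < t" using T k by (simp add: field_simps)
    then have "b < t" using t by (simp add: b_def)
    then have "eventually (\<lambda>s. b < s \<and> s < t) (at_left t)" by (auto simp: eventually_at_left)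
    then have "eventually (\<lambda>s. euclid d (?x s) (\<lambda>j. if j < d then v (nat n, j) else 0) = 0) (at_left t)"
    proof eventually_elim
      case (elim s)
      have "real k * s / T < real k * t / T" using elim T k by (intro divide_strict_right_mono mult_strict_left_mono) auto
      also have "\<dots> \<le> n + 1" unfolding n_def by linarith
      finally have 1: "real k * s / T < n + 1" .
      have "n * T / k < s" using elim by (simp add: b_def)
      then have "n \<le> real k * s / T" using T k by (simp add: field_simps)
      then have "\<lfloor>real k * s / T\<rfloor> = n" using 1 by (intro floor_unique) auto
      moreover have "max 0 (min T s) = s" using elim t by (auto simp: b_def)
      ultimately have "?x s = (\<lambda>j. if j < d then v (nat n, j) else 0)" unfolding step_path_def by (simp only:)
      then show ?case by simp
    qed
    then have "((\<lambda>s. euclid d (?x s) (\<lambda>j. if j < d then v (nat n, j) else 0)) \<longlongrightarrow> 0) (at_left t)"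
      by (rule tendsto_eventually)
    moreover have "(\<lambda>j. if j < d then v (nat n, j) else 0) \<in> Rm d" by (simp add: Rm_def)
    ultimately show ?thesis by blast
  qed
  show ?thesis unfolding Dsp_def using Rm cl R L by auto
qed

lemma skor_conv_uniform:
  assumes T: "0 < T" and xs: "\<And>n. xs n \<in> Dsp m T" and x: "x \<in> Dsp m T"
    and e: "e \<longlonglongrightarrow> 0" "\<And>n t. euclid m (xs n t) (x t) \<le> e n"
  shows "skor_conv m T xs x"
proof -
  have "0 \<le> e n" for n by (rule order_trans[OF euclid_nonneg e(2)[of n 0]])
  then have "\<And>n. skor_close m T (e n) (\<lambda>t. t) (xs n) x"
    using e(2) by (auto simp: skor_close_def time_change_id)
  then show ?thesis using e(1) unfolding skor_conv_iff[OF T xs x] by (intro exI[of _ "\<lambda>n t. t"] exI[of _ e]) auto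
qed

lemma step_path_conv:
  assumes T: "0 < T" and k: "0 < k" and v: "\<And>p. (\<lambda>n. v n p) \<longlonglongrightarrow> v0 p"
  shows "skor_conv d T (\<lambda>n. step_path d T k (v n)) (step_path d T k v0)"
    and "(\<lambda>n. euclid d (step_path d T k (v n) t) (step_path d T k v0 t)) \<longlonglongrightarrow> 0"
proof -
  define e where "e n = (\<Sum>i\<le>k. \<Sum>j<d. \<bar>v n (i,j) - v0 (i,j)\<bar>)" for n
  have e0: "e \<longlonglongrightarrow> 0" unfolding e_def
  proof (rule tendsto_null_sum, rule tendsto_null_sum)
    fix i j show "(\<lambda>n. \<bar>v n (i,j) - v0 (i,j)\<bar>) \<longlonglongrightarrow> 0"
      using v[of "(i,j)"] by (simp add: tendsto_rabs_zero_iff LIM_zero)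
  qed
  have le: "euclid d (step_path d T k (v n) t) (step_path d T k v0 t) \<le> e n" for n t
  proof -
    define i where "i = nat \<lfloor>real k * max 0 (min T t) / T\<rfloor>"
    have "i \<le> k" unfolding i_def by (rule step_path_index[OF T])
    have "euclid d (step_path d T k (v n) t) (step_path d T k v0 t) \<le> (\<Sum>j<d. \<bar>v n (i,j) - v0 (i,j)\<bar>)"
      by (rule order_trans[OF euclid_le_sum]) (simp add: step_path_def i_def)
    also have "\<dots> \<le> e n" unfolding e_def
      using \<open>i \<le> k\<close> by (intro member_le_sum[of i "{..k}" "\<lambda>i. \<Sum>j<d. \<bar>v n (i,j) - v0 (i,j)\<bar>"]) (auto intro: sum_nonneg)
    finally show ?thesis .
  qed
  show "skor_conv d T (\<lambda>n. step_path d T k (v n)) (step_path d T k v0)"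
    by (rule skor_conv_uniform[OF T step_path_Dsp[OF T k] step_path_Dsp[OF T k] e0 le])
  show "(\<lambda>n. euclid d (step_path d T k (v n) t) (step_path d T k v0 t)) \<longlonglongrightarrow> 0"
    by (rule tendsto_0_le[OF e0 euclid_nonneg le])
qed

definition sample :: "real \<Rightarrow> nat \<Rightarrow> (real \<Rightarrow> nat \<Rightarrow> real) \<Rightarrow> nat \<times> nat \<Rightarrow> real" where
  "sample T k x = (\<lambda>(i, j). x (real i * T / real k) j)"

lemma step_sample:
  assumes x: "x \<in> Dsp d T" and T: "0 < T" and t: "t \<in> {0..T}"
  shows "step_path d T k (sample T k x) t = x (real_of_int \<lfloor>real k * t / T\<rfloor> * T / real k)"
proof
  fix j
  have "max 0 (min T t) = t" "0 \<le> \<lfloor>real k * t / T\<rfloor>" using t T by auto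
  then show "step_path d T k (sample T k x) t j = x (real_of_int \<lfloor>real k * t / T\<rfloor> * T / real k) j"
    using Dsp_Rm[OF x] by (auto simp: step_path_def sample_def Rm_def)
qed

text \<open>A sampled step path notices the partition time \<open>p j\<close> only at the next
  sampling time \<open>q j\<close>. The time change sending \<open>q j\<close> to \<open>p j\<close>
  repairs this: for \<open>t\<close> in \<open>[q j, q (Suc j))\<close> both the last sampling time
  up to \<open>t\<close> and the changed time lie in \<open>[p j, p (Suc j))\<close>, where the path
  varies by less than \<open>e\<close>.\<close>

lemma step_sample_close:
  assumes x: "x \<in> Dsp d T" and T: "0 < T" and e: "0 < e"
  shows "\<exists>K. \<forall>k\<ge>K. \<exists>lam. skor_close d T e lam (step_path d T k (sample T k x)) x"
proof -
  obtain r p where p: "p 0 = 0" "p r = T" "\<And>j. j < r \<Longrightarrow> p j < p (Suc j)"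
     "\<And>j s t. j < r \<Longrightarrow> s \<in> {p j..<p (Suc j)} \<Longrightarrow> t \<in> {p j..<p (Suc j)} \<Longrightarrow> euclid d (x s) (x t) < e"
    using cadlag_partition_seq[OF x T e] by metis
  \<comment> \<open>A mesh \<open>h\<close> below every gap keeps the rounded times
    \<open>q j\<close> strictly increasing; below the last entry of the minimum it makes the
    deviation \<open>2 * real r * h\<close> of the time change at most \<open>e\<close>.\<close>
  define g where "g = Min ((\<lambda>j. p (Suc j) - p j) ` {..<r} \<union> {e / (2 * (real r + 1))})"
  have g0: "0 < g" unfolding g_def using p(3) e by (subst Min_gr_iff) auto
  have ge: "g \<le> e / (2 * (real r + 1))" unfolding g_def by (intro Min_le) auto
  have gj: "g \<le> p (Suc j) - p j" if "j < r" for j unfolding g_def using that by (intro Min_le) auto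
  obtain K0 :: nat where K0: "T / g < K0" using reals_Archimedean2 by blast
  show ?thesis
  proof (intro exI[of _ "Suc K0"] allI impI)
    fix k assume k: "Suc K0 \<le> k"
    then have k0: "0 < real k" by simp
    define h where "h = T / k"
    have "T / g < real k" using K0 k by linarith
    then have hg: "h < g" using g0 k0 by (simp add: h_def field_simps)
    have h0: "0 < h" using T k0 by (simp add: h_def)
    define q where "q j = \<lceil>p j / h\<rceil> * h" for j
    have q1: "p j \<le> q j" "q j < p j + h" for j
    proof -
      have "p j / h * h \<le> \<lceil>p j / h\<rceil> * h" using h0 by (intro mult_right_mono le_of_int_ceiling) auto
      moreover have "\<lceil>p j / h\<rceil> * h < (p j / h + 1) * h" using h0 by (intro mult_strict_right_mono) linarith+
      ultimately show "p j \<le> q j" "q j < p j + h" using h0 unfolding q_def by (simp_all add: distrib_right)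
    qed
    have q0: "q 0 = 0" by (simp add: q_def p)
    have Th: "T / h = k" using T k0 by (simp add: h_def)
    have qr: "q r = T" using T k0 by (simp add: q_def p Th) (simp add: h_def)
    have qs: "q j < q (Suc j)" if "j < r" for j using q1(2)[of j] q1(1)[of "Suc j"] gj[OF that] hg by linarith
    obtain lam where lam: "lam \<in> time_changes T" "\<And>j. j \<le> r \<Longrightarrow> lam (q j) = p j"
       "\<And>t. t \<in> {0..T} \<Longrightarrow> \<bar>lam t - t\<bar> \<le> 2 * real r * h"
    proof -
      have "\<bar>p j - q j\<bar> \<le> h" for j using q1[of j] by simp
      then show thesis using piecewise_linear_time_change[OF p(1,2,3) q0 qr qs, of h] that by blast
    qed
    have "2 * real r * h \<le> 2 * (real r + 1) * g" using hg h0 g0 by (intro mult_mono) auto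
    also have "\<dots> \<le> e" using ge by (simp add: field_simps)
    finally have rhe: "2 * real r * h \<le> e" .
    have sm: "strict_mono_on {0..T} lam" using lam(1) by (simp add: time_changes_def)
    have "euclid d (step_path d T k (sample T k x) t) (x (lam t)) \<le> e" if t: "t \<in> {0..T}" for t
    proof -
      have st: "step_path d T k (sample T k x) t = x (\<lfloor>t / h\<rfloor> * h)"
        using step_sample[OF x T t] T k0 by (simp add: h_def mult.commute)
      show ?thesis
      proof (cases "t = T")
        case True
        then have "lam t = T" using lam(1) by (simp add: time_changes_def)
        then show ?thesis using st True e T k0 by (simp add: Th) (simp add: h_def)
      next
        case False
        then obtain j where j: "j < r" "q j \<le> t" "t < q (Suc j)"
          using chain_locate[of q t r] q0 qr t by auto
        have qin: "q j \<in> {0..T}" "q (Suc j) \<in> {0..T}"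
          using chain_le[of r q 0 j] chain_le[of r q j r] chain_le[of r q 0 "Suc j"] chain_le[of r q "Suc j" r] qs q0 qr j(1) by auto
        have "lam (q j) \<le> lam t" "lam t < lam (q (Suc j))"
          using strict_mono_on_leD[OF sm qin(1) t j(2)] strict_mono_onD[OF sm t qin(2) j(3)] by auto
        then have 1: "lam t \<in> {p j..<p (Suc j)}" using lam(2)[of j] lam(2)[of "Suc j"] j by auto
        have "\<lceil>p j / h\<rceil> \<le> t / h" using j(2) h0 by (simp add: q_def field_simps)
        then have "\<lceil>p j / h\<rceil> \<le> \<lfloor>t / h\<rfloor>" by (simp add: le_floor_iff)
        then have "q j \<le> \<lfloor>t / h\<rfloor> * h" using h0 by (simp add: q_def)
        then have a: "p j \<le> \<lfloor>t / h\<rfloor> * h" using q1(1)[of j] by simp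
        have "t / h < \<lceil>p (Suc j) / h\<rceil>" using j(3) h0 by (simp add: q_def field_simps)
        then have "\<lfloor>t / h\<rfloor> < \<lceil>p (Suc j) / h\<rceil>" by (simp add: floor_less_iff)
        then have "\<lfloor>t / h\<rfloor> < p (Suc j) / h" by (simp add: less_ceiling_iff)
        then have "\<lfloor>t / h\<rfloor> * h < p (Suc j)" using h0 by (simp add: field_simps)
        then have "\<lfloor>t / h\<rfloor> * h \<in> {p j..<p (Suc j)}" using a by simp
        then show ?thesis using p(4)[OF j(1) _ 1] st by (simp add: less_imp_le)
      qed
    qed
    then have "skor_close d T e lam (step_path d T k (sample T k x)) x"
      using lam(1) order_trans[OF lam(3) rhe] unfolding skor_close_def by blast
    then show "\<exists>lam. skor_close d T e lam (step_path d T k (sample T k x)) x" by blast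
  qed
qed

lemma step_sample_conv:
  assumes x: "x \<in> Dsp d T" and T: "0 < T"
  shows "skor_conv d T (\<lambda>k. step_path d T (Suc k) (sample T (Suc k) x)) x"
  unfolding skor_conv_def
proof (rule LIMSEQ_I)
  fix e :: real assume e: "0 < e"
  then obtain K where K: "\<And>k. k \<ge> K \<Longrightarrow> \<exists>lam. skor_close d T (e/2) lam (step_path d T k (sample T k x)) x"
    using step_sample_close[OF x T, of "e/2"] by auto
  show "\<exists>no. \<forall>n\<ge>no. norm (skor_dist d T (step_path d T (Suc n) (sample T (Suc n) x)) x - 0) < e"
  proof (intro exI[of _ K] allI impI)
    fix n assume "K \<le> n"
    then have "skor_dist d T (step_path d T (Suc n) (sample T (Suc n) x)) x \<le> e/2"
    proof -
      obtain lam where "skor_close d T (e/2) lam (step_path d T (Suc n) (sample T (Suc n) x)) x"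
        using K[of "Suc n"] \<open>K \<le> n\<close> by auto
      then show ?thesis by (rule skor_dist_le[OF _ T])
    qed
    moreover have "0 \<le> skor_dist d T (step_path d T (Suc n) (sample T (Suc n) x)) x"
      by (intro skor_dist_nonneg T x step_path_Dsp) simp
    ultimately show "norm (skor_dist d T (step_path d T (Suc n) (sample T (Suc n) x)) x - 0) < e" using e by simp
  qed
qed

definition stop_path :: "(real \<Rightarrow> nat \<Rightarrow> real) \<Rightarrow> real \<Rightarrow> real \<Rightarrow> nat \<Rightarrow> real" where
  "stop_path x t = (\<lambda>s. x (min s t))"

lemma stop_path_Dsp:
  assumes x: "x \<in> Dsp d T" and T: "0 < T" and t: "t \<in> {0..T}"
  shows "stop_path x t \<in> Dsp d T"
proof -
  have Rm: "stop_path x t s \<in> Rm d" for s using Dsp_Rm[OF x] by (simp add: stop_path_def)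
  have cl: "stop_path x t s = stop_path x t (max 0 (min T s))" for s
  proof (cases "s < 0")
    case True
    then show ?thesis using t T Dsp_le_0[OF x T, of s] by (simp add: stop_path_def min_def max_def)
  next
    case False
    then have "min s t = min (max 0 (min T s)) t" using t by (auto simp: min_def max_def)
    then show ?thesis by (simp add: stop_path_def)
  qed
  have R: "((\<lambda>s. euclid d (stop_path x t s) (stop_path x t r)) \<longlongrightarrow> 0) (at_right r)" if r: "r \<in> {0..<T}" for r
  proof (cases "r < t")
    case True
    then have "eventually (\<lambda>s. s < t) (at_right r)" by (auto simp: eventually_at_right)
    then have "eventually (\<lambda>s. euclid d (x s) (x r) = euclid d (stop_path x t s) (stop_path x t r)) (at_right r)"
      by eventually_elim (use True in \<open>simp add: stop_path_def\<close>)
    then show ?thesis using Dsp_right[OF x T, of r] by (rule Lim_transform_eventually[rotated])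
  next
    case False
    have "eventually (\<lambda>s. r < s) (at_right r)" by (auto simp: eventually_at_filter)
    then have "eventually (\<lambda>s. euclid d (stop_path x t s) (stop_path x t r) = 0) (at_right r)"
      by eventually_elim (use False in \<open>simp add: stop_path_def\<close>)
    then show ?thesis by (rule tendsto_eventually)
  qed
  have L: "\<exists>l\<in>Rm d. ((\<lambda>s. euclid d (stop_path x t s) l) \<longlongrightarrow> 0) (at_left r)" if r: "r \<in> {0<..T}" for r
  proof (cases "r \<le> t")
    case True
    obtain l where l: "l \<in> Rm d" "((\<lambda>s. euclid d (x s) l) \<longlongrightarrow> 0) (at_left r)" using Dsp_left[OF x T] by blast
    have "eventually (\<lambda>s. s < r) (at_left r)" by (auto simp: eventually_at_filter)
    then have "eventually (\<lambda>s. euclid d (x s) l = euclid d (stop_path x t s) l) (at_left r)"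
      by eventually_elim (use True in \<open>simp add: stop_path_def\<close>)
    then show ?thesis using l by (blast intro: Lim_transform_eventually)
  next
    case False
    then have "eventually (\<lambda>s. t < s) (at_left r)" by (intro order_tendstoD(1)[OF tendsto_ident_at]) simp
    then have "eventually (\<lambda>s. euclid d (stop_path x t s) (x t) = 0) (at_left r)"
      by eventually_elim (simp add: stop_path_def)
    then show ?thesis using Dsp_Rm[OF x] by (blast intro: tendsto_eventually)
  qed
  show ?thesis unfolding Dsp_def using Rm cl R L by auto
qed

section \<open>Payoffs and time averages\<close>

abbreviation unif :: "real \<Rightarrow> real \<Rightarrow> real measure" where
  "unif p q \<equiv> uniform_measure lborel {p..q}"

lemma prob_space_unif: "p < q \<Longrightarrow> prob_space (unif p q)"
  by (intro prob_space_uniform_measure) auto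

lemma AE_unif_in: "p < q \<Longrightarrow> AE s in unif p q. s \<in> {p..q}"
  by (intro AE_uniform_measureI) auto

lemma AE_unif_lborel: "AE s in lborel. P s \<Longrightarrow> AE s in unif p q. P s"
  by (intro AE_uniform_measureI) auto

lemma measurable_unif [measurable_cong]: "sets (unif p q) = sets borel"
  by simp

text \<open>Evaluation at \<open>a n s\<close> in place of \<open>s\<close> involves only countably
  many times and is therefore jointly measurable; right-continuity supplies the limit.\<close>

lemma right_cont_measurable:
  fixes h :: "real \<Rightarrow> 'a \<Rightarrow> real"
  assumes m: "\<And>u. h u \<in> borel_measurable M"
    and r: "\<And>w s. w \<in> space M \<Longrightarrow> ((\<lambda>u. h u w) \<longlongrightarrow> h s w) (at_right s)"
  shows "(\<lambda>(s, w). h s w) \<in> borel_measurable (borel \<Otimes>\<^sub>M M)"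
proof -
  \<comment> \<open>The \<open>+ 1\<close> puts \<open>a n s\<close> strictly to the right of
    \<open>s\<close> even when \<open>s\<close> is a grid point, so that \<open>s\<close> is
    approached from the right.\<close>
  define a where "a n s = (real_of_int \<lfloor>real (Suc n) * s\<rfloor> + 1) / real (Suc n)" for n s
  have a: "s < a n s" "a n s \<le> s + inverse (Suc n)" for n s
  proof -
    have "real (Suc n) * s < real_of_int \<lfloor>real (Suc n) * s\<rfloor> + 1" by linarith
    then show "s < a n s" by (simp add: a_def pos_less_divide_eq mult.commute)
    have "real_of_int \<lfloor>real (Suc n) * s\<rfloor> + 1 \<le> real (Suc n) * s + 1" by linarith
    then have "a n s \<le> (real (Suc n) * s + 1) / real (Suc n)" unfolding a_def by (rule divide_right_mono) simp
    also have "\<dots> = s + inverse (Suc n)" by (simp add: add_divide_distrib inverse_eq_divide)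
    finally show "a n s \<le> s + inverse (Suc n)" .
  qed
  have at: "filterlim (\<lambda>n. a n s) (at_right s) sequentially" for s
  proof -
    have "(\<lambda>n. a n s) \<longlonglongrightarrow> s"
    proof (rule tendsto_sandwich[OF _ _ tendsto_const])
      show "(\<lambda>n. s + inverse (Suc n)) \<longlonglongrightarrow> s"
        using tendsto_add[OF tendsto_const LIMSEQ_inverse_real_of_nat, of s] by simp
    qed (use a in \<open>auto simp: less_imp_le\<close>)
    then show ?thesis using a(1) by (auto simp: filterlim_at less_imp_neq[THEN not_sym])
  qed
  show ?thesis
  proof (rule borel_measurable_LIMSEQ_real[where u="\<lambda>n (s, w). h (a n s) w"])
    fix p assume "p \<in> space (borel \<Otimes>\<^sub>M M :: (real \<times> 'a) measure)"
    then have "snd p \<in> space M" by (auto simp: space_pair_measure)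
    from filterlim_compose[OF r[OF this] at]
    show "(\<lambda>n. (case p of (s, w) \<Rightarrow> h (a n s) w)) \<longlonglongrightarrow> (case p of (s, w) \<Rightarrow> h s w)"
      by (simp add: case_prod_beta)
  next
    fix n
    have [measurable]: "(\<lambda>p. h ((real_of_int i + 1) / real (Suc n)) (snd p)) \<in> borel_measurable (borel \<Otimes>\<^sub>M M)" for i
      using m by (intro measurable_compose[OF measurable_snd]) auto
    have fl: "(\<lambda>p::real \<times> 'a. \<lfloor>real (Suc n) * fst p\<rfloor>) \<in> measurable (borel \<Otimes>\<^sub>M M) (count_space UNIV)"
      by measurable
    have "(\<lambda>p. h ((real_of_int \<lfloor>real (Suc n) * fst p\<rfloor> + 1) / real (Suc n)) (snd p)) \<in> borel_measurable (borel \<Otimes>\<^sub>M M)"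
      by (rule measurable_compose_countable[OF _ fl]) measurable
    then show "(\<lambda>(s, w). h (a n s) w) \<in> borel_measurable (borel \<Otimes>\<^sub>M M)"
      by (simp add: a_def case_prod_beta)
  qed
qed

lemma right_cont_measurable1:
  fixes h :: "real \<Rightarrow> real"
  assumes "\<And>s. (h \<longlongrightarrow> h s) (at_right s)"
  shows "h \<in> borel_measurable borel"
proof -
  have "(\<lambda>(s, w::unit). h s) \<in> borel_measurable (borel \<Otimes>\<^sub>M count_space UNIV)"
    using assms by (intro right_cont_measurable) auto
  from measurable_compose[OF _ this, of "\<lambda>s. (s, ())" borel] show ?thesis by simp
qed

lemma Dsp_coord_right:
  assumes x: "x \<in> Dsp m T" and T: "0 < T"
  shows "((\<lambda>s. x s i) \<longlongrightarrow> x t i) (at_right t)"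
proof (cases "i < m")
  case True
  then show ?thesis using euclid_tendsto_coord[OF Dsp_right[OF x T]] by blast
next
  case False
  then have "x s i = 0" for s using Dsp_Rm[OF x, of s] by (simp add: Rm_def)
  then show ?thesis by simp
qed

lemma Dsp_coord_measurable:
  assumes x: "x \<in> Dsp m T" and T: "0 < T"
  shows "(\<lambda>s. x s i) \<in> borel_measurable borel"
  by (rule right_cont_measurable1[OF Dsp_coord_right[OF x T]])

lemma unif_integral_bound:
  assumes pq: "p < q" and m: "h \<in> borel_measurable borel" and b: "\<And>s. s \<in> {p..q} \<Longrightarrow> \<bar>h s\<bar> \<le> (B::real)"
  shows "integrable (unif p q) h" "\<bar>\<integral>s. h s \<partial>unif p q\<bar> \<le> B"
proof -
  interpret prob_space "unif p q" by (rule prob_space_unif[OF pq])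
  have ae: "AE s in unif p q. \<bar>h s\<bar> \<le> B" using AE_unif_in[OF pq] by eventually_elim (use b in auto)
  show i: "integrable (unif p q) h" using m ae by (intro integrable_const_bound[of _ B]) auto
  have "\<bar>\<integral>s. h s \<partial>unif p q\<bar> \<le> (\<integral>s. \<bar>h s\<bar> \<partial>unif p q)" by (rule integral_abs_bound)
  also have "\<dots> \<le> (\<integral>s. B \<partial>unif p q)" using ae i by (intro integral_mono_AE) auto
  also have "\<dots> = B" using prob_space by simp
  finally show "\<bar>\<integral>s. h s \<partial>unif p q\<bar> \<le> B" .
qed

lemma unif_integral_tendsto:
  assumes pq: "p < q" and m: "\<And>n. h n \<in> borel_measurable borel" "h0 \<in> borel_measurable borel"
    and b: "\<And>n s. s \<in> {p..q} \<Longrightarrow> \<bar>h n s\<bar> \<le> (B::real)"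
    and c: "AE s in lborel. s \<in> {p..q} \<longrightarrow> (\<lambda>n. h n s) \<longlonglongrightarrow> h0 s"
  shows "(\<lambda>n. \<integral>s. h n s \<partial>unif p q) \<longlonglongrightarrow> (\<integral>s. h0 s \<partial>unif p q)"
proof -
  interpret prob_space "unif p q" by (rule prob_space_unif[OF pq])
  show ?thesis
  proof (rule integral_dominated_convergence[where w="\<lambda>_. B"])
    show "AE s in unif p q. (\<lambda>n. h n s) \<longlonglongrightarrow> h0 s"
      using AE_unif_lborel[OF c] AE_unif_in[OF pq] by eventually_elim blast
    show "AE s in unif p q. norm (h n s) \<le> B" for n
      using AE_unif_in[OF pq] by eventually_elim (use b in auto)
  qed (use m in auto)
qed

text \<open>Values of converging paths converge at almost every time, so bounded convergence makes
  the average continuous although evaluation at one time is not. The argument \<open>c x\<close>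
  allows a coordinate to be compared with a functional of the whole path.\<close>

lemma skor_continuous_avg:
  assumes T: "0 < T" and pq: "p < q" and i: "i < m"
    and K: "continuous_on UNIV (\<lambda>(a, b). K a b)" "\<And>a b. \<bar>K a b\<bar> \<le> (B::real)"
    and c: "skor_continuous m T c"
  shows "skor_bounded_continuous m T (\<lambda>x. \<integral>s. K (x s i) (c x) \<partial>unif p q)"
proof -
  have Km: "(\<lambda>(a, b). K a b) \<in> borel_measurable borel"
    by (rule borel_measurable_continuous_onI[OF K(1)])
  have Kx: "(\<lambda>s. K (x s i) z) \<in> borel_measurable borel" if x: "x \<in> Dsp m T" for x z
  proof -
    have "(\<lambda>s. (x s i, z)) \<in> borel_measurable borel"
      using Dsp_coord_measurable[OF x T] by (intro borel_measurable_Pair) auto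
    from measurable_compose[OF this Km] show ?thesis by simp
  qed
  have bd: "\<bar>\<integral>s. K (x s i) (c x) \<partial>unif p q\<bar> \<le> B" if x: "x \<in> Dsp m T" for x
    by (rule unif_integral_bound(2)[OF pq Kx[OF x] K(2)])
  have ct: "skor_continuous m T (\<lambda>x. \<integral>s. K (x s i) (c x) \<partial>unif p q)"
    unfolding skor_continuous_def
  proof (intro allI impI)
    fix xs x assume xs: "\<forall>n. xs n \<in> Dsp m T" and x: "x \<in> Dsp m T" and cv: "skor_conv m T xs x"
    then have cc: "(\<lambda>n. c (xs n)) \<longlonglongrightarrow> c x" using c by (auto simp: skor_continuous_def)
    show "(\<lambda>n. \<integral>s. K (xs n s i) (c (xs n)) \<partial>unif p q) \<longlonglongrightarrow> (\<integral>s. K (x s i) (c x) \<partial>unif p q)"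
    proof (rule unif_integral_tendsto[OF pq _ _ K(2)])
      show "AE s in lborel. s \<in> {p..q} \<longrightarrow> (\<lambda>n. K (xs n s i) (c (xs n))) \<longlonglongrightarrow> K (x s i) (c x)"
        using skor_conv_ae[OF cv T spec[OF xs] x]
      proof eventually_elim
        case (elim s)
        have "(\<lambda>n. (xs n s i, c (xs n))) \<longlonglongrightarrow> (x s i, c x)"
          using euclid_tendsto_coord[OF elim i] cc by (rule tendsto_Pair)
        with K(1) have "(\<lambda>n. (\<lambda>(a, b). K a b) (xs n s i, c (xs n))) \<longlonglongrightarrow> (\<lambda>(a, b). K a b) (x s i, c x)"
          by (rule continuous_on_tendsto_compose) auto
        then show ?case by simp
      qed
    qed (use Kx xs x in auto)
  qed
  show ?thesis unfolding skor_bounded_continuous_def using bd ct by blast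
qed

text \<open>The conditions on a single payoff, so that each result serves \<open>f\<close>,
  \<open>g\<close> and their truncations alike.\<close>

definition payoff :: "nat \<Rightarrow> real \<Rightarrow> (real \<Rightarrow> (real \<Rightarrow> nat \<Rightarrow> real) \<Rightarrow> real) \<Rightarrow> bool" where
  "payoff d T \<phi> \<longleftrightarrow>
     (\<forall>t\<in>{0..T}. \<forall>x\<in>Dsp d T. \<forall>y\<in>Dsp d T. (\<forall>s\<in>{0..t}. x s = y s) \<longrightarrow> \<phi> t x = \<phi> t y) \<and>
     (\<forall>x\<in>Dsp d T. \<forall>t\<in>{0..<T}. ((\<lambda>s. \<phi> s x) \<longlongrightarrow> \<phi> t x) (at_right t)) \<and>
     (\<forall>xs x ts t. (\<forall>n. xs n \<in> Dsp d T) \<longrightarrow> x \<in> Dsp d T \<longrightarrow> skor_conv d T xs x \<longrightarrow>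
        (\<forall>n. ts n \<in> {0..T}) \<longrightarrow> t \<in> {0..T} \<longrightarrow> ts \<longlonglongrightarrow> t \<longrightarrow>
        (\<lambda>n. euclid d (xs n (ts n)) (x t)) \<longlonglongrightarrow> 0 \<longrightarrow> (\<lambda>n. \<phi> (ts n) (xs n)) \<longlonglongrightarrow> \<phi> t x)"

lemma payoff_nonanticip:
  "payoff d T \<phi> \<Longrightarrow> t \<in> {0..T} \<Longrightarrow> x \<in> Dsp d T \<Longrightarrow> y \<in> Dsp d T \<Longrightarrow> (\<And>s. s \<in> {0..t} \<Longrightarrow> x s = y s) \<Longrightarrow> \<phi> t x = \<phi> t y"
  unfolding payoff_def by blast

lemma payoff_right:
  "payoff d T \<phi> \<Longrightarrow> x \<in> Dsp d T \<Longrightarrow> t \<in> {0..<T} \<Longrightarrow> ((\<lambda>s. \<phi> s x) \<longlongrightarrow> \<phi> t x) (at_right t)"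
  unfolding payoff_def by blast

lemma payoff_cont:
  "payoff d T \<phi> \<Longrightarrow> (\<And>n. xs n \<in> Dsp d T) \<Longrightarrow> x \<in> Dsp d T \<Longrightarrow> skor_conv d T xs x \<Longrightarrow>
   (\<And>n. ts n \<in> {0..T}) \<Longrightarrow> t \<in> {0..T} \<Longrightarrow> ts \<longlonglongrightarrow> t \<Longrightarrow>
   (\<lambda>n. euclid d (xs n (ts n)) (x t)) \<longlonglongrightarrow> 0 \<Longrightarrow> (\<lambda>n. \<phi> (ts n) (xs n)) \<longlonglongrightarrow> \<phi> t x"
  unfolding payoff_def by blast

lemma payoff_min: "payoff d T \<phi> \<Longrightarrow> payoff d T (\<lambda>t x. min (\<phi> t x) K)"
  unfolding payoff_def
  apply (elim conjE, intro conjI)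
    apply (metis (no_types, lifting))
   apply (intro ballI tendsto_min tendsto_const, blast)
  apply (intro allI impI tendsto_min tendsto_const, blast)
  done

abbreviation clampT :: "real \<Rightarrow> real \<Rightarrow> real" where
  "clampT T s \<equiv> max 0 (min T s)"

lemma clampT_tendsto_right:
  assumes T: "0 < T" and h: "\<And>t. t \<in> {0..<T} \<Longrightarrow> (h \<longlongrightarrow> h t) (at_right t)"
  shows "((\<lambda>s. h (clampT T s)) \<longlongrightarrow> h (clampT T t)) (at_right t)"
proof -
  consider "t < 0" | "0 \<le> t" "t < T" | "T \<le> t" by linarith
  then show ?thesis
  proof cases
    case 1
    then have "eventually (\<lambda>s. s < 0) (at_right t)" by (intro order_tendstoD(2)[OF tendsto_ident_at])
    then have "eventually (\<lambda>s. h (clampT T s) = h (clampT T t)) (at_right t)"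
      by eventually_elim (use 1 in simp)
    then show ?thesis by (rule tendsto_eventually)
  next
    case 2
    have "eventually (\<lambda>s. s < T) (at_right t)" using 2 by (intro order_tendstoD(2)[OF tendsto_ident_at])
    moreover have "eventually (\<lambda>s. t < s) (at_right t)" by (auto simp: eventually_at_filter)
    ultimately have "eventually (\<lambda>s. h s = h (clampT T s)) (at_right t)"
      by eventually_elim (use 2 in simp)
    moreover have "(h \<longlongrightarrow> h (clampT T t)) (at_right t)" using h[of t] 2 by simp
    ultimately show ?thesis by (rule Lim_transform_eventually[rotated])
  next
    case 3
    have "eventually (\<lambda>s. t < s) (at_right t)" by (auto simp: eventually_at_filter)
    then have "eventually (\<lambda>s. h (clampT T s) = h (clampT T t)) (at_right t)"
      by eventually_elim (use 3 in simp)
    then show ?thesis by (rule tendsto_eventually)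
  qed
qed

lemma payoff_clamp_right:
  assumes "payoff d T \<phi>" and "x \<in> Dsp d T" and "0 < T"
  shows "((\<lambda>s. \<phi> (clampT T s) x) \<longlongrightarrow> \<phi> (clampT T t) x) (at_right t)"
  by (rule clampT_tendsto_right[OF assms(3) payoff_right[OF assms(1,2)]])

lemma clampT_in: "0 < T \<Longrightarrow> clampT T s \<in> {0..T}"
  by auto

lemma payoff_clamp_measurable:
  assumes p: "payoff d T \<phi>" and x: "x \<in> Dsp d T" and T: "0 < T"
  shows "(\<lambda>s. \<phi> (clampT T s) x) \<in> borel_measurable borel"
  by (rule right_cont_measurable1[OF payoff_clamp_right[OF p x T]])

text \<open>At almost every time the path values converge, and there joint continuity with a
  constant time sequence gives convergence of the payoff.\<close>

lemma payoff_avg_continuous: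
  assumes p: "payoff d T \<phi>" and T: "0 < T" and ab: "a < b"
    and K: "\<And>t x. t \<in> {0..T} \<Longrightarrow> x \<in> Dsp d T \<Longrightarrow> \<bar>\<phi> t x\<bar> \<le> K"
  shows "skor_bounded_continuous d T (\<lambda>x. \<integral>s. \<phi> (clampT T s) x \<partial>unif a b)"
proof -
  have bd: "\<bar>\<integral>s. \<phi> (clampT T s) x \<partial>unif a b\<bar> \<le> K" if x: "x \<in> Dsp d T" for x
    by (rule unif_integral_bound(2)[OF ab payoff_clamp_measurable[OF p x T]]) (use K x T in auto)
  have ct: "skor_continuous d T (\<lambda>x. \<integral>s. \<phi> (clampT T s) x \<partial>unif a b)"
    unfolding skor_continuous_def
  proof (intro allI impI)
    fix xs x assume xs: "\<forall>n. xs n \<in> Dsp d T" and x: "x \<in> Dsp d T" and cv: "skor_conv d T xs x"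
    show "(\<lambda>n. \<integral>s. \<phi> (clampT T s) (xs n) \<partial>unif a b) \<longlonglongrightarrow> (\<integral>s. \<phi> (clampT T s) x \<partial>unif a b)"
    proof (rule unif_integral_tendsto[OF ab])
      show "AE s in lborel. s \<in> {a..b} \<longrightarrow> (\<lambda>n. \<phi> (clampT T s) (xs n)) \<longlonglongrightarrow> \<phi> (clampT T s) x"
        using skor_conv_ae[OF cv T spec[OF xs] x]
      proof eventually_elim
        case (elim s)
        then have e: "(\<lambda>n. euclid d (xs n (clampT T s)) (x (clampT T s))) \<longlonglongrightarrow> 0"
          using Dsp_clamp[OF x] Dsp_clamp[OF spec[OF xs]] by simp
        have "(\<lambda>n. \<phi> (clampT T s) (xs n)) \<longlonglongrightarrow> \<phi> (clampT T s) x"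
          using payoff_cont[OF p spec[OF xs] x cv, of "\<lambda>n. clampT T s" "clampT T s"] e T by simp
        then show ?case by simp
      qed
      show "\<bar>\<phi> (clampT T s) (xs n)\<bar> \<le> K" for n s using K xs T by auto
    qed (use payoff_clamp_measurable[OF p _ T] xs x in auto)
  qed
  show ?thesis unfolding skor_bounded_continuous_def using bd ct by blast
qed

lemma payoff_T_continuous:
  assumes p: "payoff d T \<phi>" and T: "0 < T"
    and K: "\<And>t x. t \<in> {0..T} \<Longrightarrow> x \<in> Dsp d T \<Longrightarrow> \<bar>\<phi> t x\<bar> \<le> K"
  shows "skor_bounded_continuous d T (\<phi> T)"
  unfolding skor_bounded_continuous_def skor_continuous_def
proof (intro conjI allI impI)
  show "\<exists>B. \<forall>x\<in>Dsp d T. \<bar>\<phi> T x\<bar> \<le> B" using K T by (intro exI[of _ K]) auto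
  fix xs x assume xs: "\<forall>n. xs n \<in> Dsp d T" and x: "x \<in> Dsp d T" and cv: "skor_conv d T xs x"
  show "(\<lambda>n. \<phi> T (xs n)) \<longlonglongrightarrow> \<phi> T x"
    using payoff_cont[OF p spec[OF xs] x cv, of "\<lambda>n. T" T] T skor_conv_at[OF cv T spec[OF xs] x, of T] by simp
qed

text \<open>The path frozen at its left limit \<open>l\<close> just before \<open>t\<close>. It is
  the Skorohod limit of approximating paths that are stopped shortly before their own copy of the
  jump at \<open>t\<close>.\<close>

definition stop_left :: "(real \<Rightarrow> nat \<Rightarrow> real) \<Rightarrow> real \<Rightarrow> (nat \<Rightarrow> real) \<Rightarrow> real \<Rightarrow> nat \<Rightarrow> real" where
  "stop_left x t l = (\<lambda>u. if u < t then x u else l)"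

lemma stop_left_Dsp:
  assumes x: "x \<in> Dsp d T" and T: "0 < T" and t: "0 < t" "t \<le> T"
    and l: "l \<in> Rm d" "((\<lambda>s. euclid d (x s) l) \<longlongrightarrow> 0) (at_left t)"
  shows "stop_left x t l \<in> Dsp d T"
proof -
  let ?z = "stop_left x t l"
  have Rm: "?z s \<in> Rm d" for s using Dsp_Rm[OF x] l by (simp add: stop_left_def)
  have cl: "?z s = ?z (clampT T s)" for s
  proof -
    have "s < t \<longleftrightarrow> clampT T s < t \<or> (T \<le> s \<and> s < t)" using t T by (auto simp: min_def max_def)
    then show ?thesis using Dsp_clamp[OF x, of s] t T by (auto simp: stop_left_def)
  qed
  have R: "((\<lambda>s. euclid d (?z s) (?z r)) \<longlongrightarrow> 0) (at_right r)" for r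
  proof (cases "r < t")
    case True
    then have "eventually (\<lambda>s. s < t) (at_right r)" by (intro order_tendstoD(2)[OF tendsto_ident_at])
    then have "eventually (\<lambda>s. euclid d (x s) (x r) = euclid d (?z s) (?z r)) (at_right r)"
      by eventually_elim (use True in \<open>simp add: stop_left_def\<close>)
    then show ?thesis using Dsp_right[OF x T, of r] by (rule Lim_transform_eventually[rotated])
  next
    case False
    have "eventually (\<lambda>s. r < s) (at_right r)" by (auto simp: eventually_at_filter)
    then have "eventually (\<lambda>s. euclid d (?z s) (?z r) = 0) (at_right r)"
      by eventually_elim (use False in \<open>simp add: stop_left_def\<close>)
    then show ?thesis by (rule tendsto_eventually)
  qed
  have L: "\<exists>k\<in>Rm d. ((\<lambda>s. euclid d (?z s) k) \<longlongrightarrow> 0) (at_left r)" for r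
  proof (cases "r \<le> t")
    case True
    obtain k where k: "k \<in> Rm d" "((\<lambda>s. euclid d (x s) k) \<longlongrightarrow> 0) (at_left r)" using Dsp_left[OF x T] by blast
    have "eventually (\<lambda>s. s < r) (at_left r)" by (auto simp: eventually_at_filter)
    then have "eventually (\<lambda>s. euclid d (x s) k = euclid d (?z s) k) (at_left r)"
      by eventually_elim (use True in \<open>simp add: stop_left_def\<close>)
    then show ?thesis using k by (blast intro: Lim_transform_eventually)
  next
    case False
    then have "eventually (\<lambda>s. t < s) (at_left r)" by (intro order_tendstoD(1)[OF tendsto_ident_at]) simp
    then have "eventually (\<lambda>s. euclid d (?z s) l = 0) (at_left r)"
      by eventually_elim (simp add: stop_left_def)
    then show ?thesis using l(1) by (blast intro: tendsto_eventually)
  qed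
  show ?thesis unfolding Dsp_def using Rm cl R L by blast
qed

text \<open>Joint continuity need not apply to \<open>xs n\<close> itself, whose value at
  \<open>s n\<close> tends to \<open>l\<close> rather than to \<open>x t\<close>. The payoff does
  not see what follows \<open>s n\<close>, so \<open>xs n\<close> may be stopped there; the stopped
  paths converge to \<open>stop_left x t l\<close> under the same time changes, and their values at
  \<open>s n\<close> tend to its value at \<open>t\<close>.\<close>

lemma payoff_before_jump:
  assumes p: "payoff d T \<phi>" and T: "0 < T"
    and xs: "\<And>n. xs n \<in> Dsp d T" and x: "x \<in> Dsp d T"
    and e: "e \<longlonglongrightarrow> 0" and lam: "\<And>n. skor_close d T (e n) (lam n) (xs n) x"
    and s: "\<And>n. s n \<in> {0..T}" "s \<longlonglongrightarrow> t" and t: "0 < t" "t \<le> T"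
    and before: "\<And>n. lam n (s n) < t"
    and l: "l \<in> Rm d" "((\<lambda>s. euclid d (x s) l) \<longlongrightarrow> 0) (at_left t)"
  shows "(\<lambda>n. \<phi> (s n) (xs n)) \<longlonglongrightarrow> \<phi> t (stop_left x t l)"
    and "(\<lambda>n. euclid d (xs n (s n)) l) \<longlonglongrightarrow> 0"
proof -
  have tc: "lam n \<in> time_changes T" for n using lam by (simp add: skor_close_def)
  have l1: "\<bar>lam n u - u\<bar> \<le> e n" "euclid d (xs n u) (x (lam n u)) \<le> e n" if "u \<in> {0..T}" for n u
    using lam[of n] that by (auto simp: skor_close_def)
  have sm: "strict_mono_on {0..T} (lam n)" for n using tc by (simp add: time_changes_def)
  define c where "c n = lam n (s n)" for n
  have c: "c \<longlonglongrightarrow> t"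
  proof -
    have "(\<lambda>n. c n - s n) \<longlonglongrightarrow> 0"
      by (rule Lim_null_comparison[OF _ e]) (use l1 s in \<open>auto simp: c_def\<close>)
    from tendsto_add[OF this s(2)] show ?thesis by simp
  qed
  \<comment> \<open>The worst distance of the path to its left limit between the changed time
    \<open>c n\<close> and \<open>t\<close>; it bounds the error made by freezing.\<close>
  define b where "b n = (SUP v\<in>{c n..<t}. euclid d (x v) l)" for n
  obtain B where B: "\<And>v. euclid d (x v) (\<lambda>_. 0) \<le> B" using cadlag_bounded[OF x T] by blast
  have bdd: "bdd_above ((\<lambda>v. euclid d (x v) l) ` {c n..<t})" for n
    by (intro bdd_aboveI2[of _ _ "B + euclid d (\<lambda>_. 0) l"]) (use euclid_triangle[of d] B in \<open>metis add_right_mono order_trans\<close>)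
  have b: "euclid d (x v) l \<le> b n" if "c n \<le> v" "v < t" for v n
    unfolding b_def using that by (intro cSUP_upper bdd) auto
  have b0: "0 \<le> b n" for n
    by (rule order_trans[OF euclid_nonneg b[of n "c n"]]) (use before in \<open>auto simp: c_def\<close>)
  have bt: "b \<longlonglongrightarrow> 0"
  proof (rule LIMSEQ_I)
    fix \<epsilon> :: real assume "0 < \<epsilon>"
    then obtain \<delta> where \<delta>: "\<delta> > 0" "\<And>v. t - \<delta> < v \<Longrightarrow> v < t \<Longrightarrow> euclid d (x v) l < \<epsilon>/2"
      using Dsp_left_eps[OF l(2), of "\<epsilon>/2"] by auto
    have "eventually (\<lambda>n. t - \<delta> < c n) sequentially" using order_tendstoD(1)[OF c] \<delta>(1) by auto
    then obtain N where N: "\<And>n. n \<ge> N \<Longrightarrow> t - \<delta> < c n" by (auto simp: eventually_sequentially)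
    show "\<exists>no. \<forall>n\<ge>no. norm (b n - 0) < \<epsilon>"
    proof (intro exI[of _ N] allI impI)
      fix n assume "N \<le> n"
      then have "b n \<le> \<epsilon>/2" unfolding b_def using N[of n] before[of n] \<delta>(2)
        by (intro cSUP_least) (auto simp: c_def intro!: less_imp_le)
      then show "norm (b n - 0) < \<epsilon>" using b0[of n] \<open>0 < \<epsilon>\<close> by simp
    qed
  qed
  have eb: "(\<lambda>n. e n + b n) \<longlonglongrightarrow> 0" using tendsto_add[OF e bt] by simp
  have xl: "euclid d (xs n (s n)) l \<le> e n + b n" for n
    using euclid_triangle[of d "xs n (s n)" l "x (lam n (s n))"] l1(2)[where u="s n" and n=n] s(1)[of n] b[of n "c n"] before[of n]
    by (simp add: c_def)
  show xl0: "(\<lambda>n. euclid d (xs n (s n)) l) \<longlonglongrightarrow> 0" by (rule tendsto_0_le[OF eb euclid_nonneg xl])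
  define y where "y n = stop_path (xs n) (s n)" for n
  have y: "y n \<in> Dsp d T" for n unfolding y_def by (intro stop_path_Dsp xs T s)
  have z: "stop_left x t l \<in> Dsp d T" by (rule stop_left_Dsp[OF x T t l])
  have close: "skor_close d T (e n + 2 * b n) (lam n) (y n) (stop_left x t l)" for n
    unfolding skor_close_def
  proof (intro conjI ballI tc)
    fix u assume u: "u \<in> {0..T}"
    show "\<bar>lam n u - u\<bar> \<le> e n + 2 * b n" using l1(1)[where n=n, OF u] b0[of n] by linarith
    show "euclid d (y n u) (stop_left x t l (lam n u)) \<le> e n + 2 * b n"
    proof (cases "u \<le> s n")
      case True
      then have "lam n u \<le> lam n (s n)" using strict_mono_on_leD[OF sm u s(1)[of n]] by simp
      then have "lam n u < t" using before[of n] by simp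
      then have "euclid d (y n u) (stop_left x t l (lam n u)) = euclid d (xs n u) (x (lam n u))"
        using True by (simp add: y_def stop_path_def stop_left_def)
      then show ?thesis using l1(2)[where n=n, OF u] b0[of n] by linarith
    next
      case False
      then have cu: "c n \<le> lam n u" unfolding c_def using strict_mono_on_leD[OF sm s(1)[of n] u] by simp
      have yu: "y n u = xs n (s n)" using False by (simp add: y_def stop_path_def min_def)
      have "euclid d (stop_left x t l (lam n u)) l \<le> b n"
        using b[OF cu] b0[of n] by (auto simp: stop_left_def)
      then show ?thesis
        using xl[of n] euclid_triangle[of d "y n u" "stop_left x t l (lam n u)" l]
          euclid_sym[of d l "stop_left x t l (lam n u)"] yu by simp
    qed
  qed
  have "(\<lambda>n. e n + 2 * b n) \<longlonglongrightarrow> 0" using tendsto_add[OF e tendsto_mult_right_zero[OF bt, of 2]] by simp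
  then have "skor_conv d T y (stop_left x t l)"
    unfolding skor_conv_iff[OF T y z] using close by (intro exI[of _ lam] exI[of _ "\<lambda>n. e n + 2 * b n"]) auto
  moreover have "(\<lambda>n. euclid d (y n (s n)) (stop_left x t l t)) \<longlonglongrightarrow> 0"
    using xl0 by (simp add: y_def stop_path_def stop_left_def)
  ultimately have "(\<lambda>n. \<phi> (s n) (y n)) \<longlonglongrightarrow> \<phi> t (stop_left x t l)"
    using payoff_cont[where xs=y and ts=s and t=t, OF p y z] s t by simp
  moreover have "\<phi> (s n) (y n) = \<phi> (s n) (xs n)" for n
    by (rule payoff_nonanticip[OF p s(1) y xs]) (simp add: y_def stop_path_def)
  ultimately show "(\<lambda>n. \<phi> (s n) (xs n)) \<longlonglongrightarrow> \<phi> t (stop_left x t l)" by simp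
qed

text \<open>The changed times approach \<open>t\<close> from above, so right-continuity of
  \<open>x\<close> supplies the convergence of values that joint continuity asks for.\<close>

lemma payoff_after_jump:
  assumes p: "payoff d T \<phi>" and T: "0 < T"
    and xs: "\<And>n. xs n \<in> Dsp d T" and x: "x \<in> Dsp d T"
    and e: "e \<longlonglongrightarrow> 0" and lam: "\<And>n. skor_close d T (e n) (lam n) (xs n) x"
    and s: "\<And>n. s n \<in> {0..T}" "s \<longlonglongrightarrow> t" and t: "t \<in> {0..T}"
    and after: "\<And>n. t \<le> lam n (s n)"
  shows "(\<lambda>n. \<phi> (s n) (xs n)) \<longlonglongrightarrow> \<phi> t x"
    and "(\<lambda>n. euclid d (xs n (s n)) (x t)) \<longlonglongrightarrow> 0"
proof -
  have l1: "\<bar>lam n u - u\<bar> \<le> e n" "euclid d (xs n u) (x (lam n u)) \<le> e n" if "u \<in> {0..T}" for n u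
    using lam[of n] that by (auto simp: skor_close_def)
  have c: "(\<lambda>n. lam n (s n)) \<longlonglongrightarrow> t"
  proof -
    have "(\<lambda>n. lam n (s n) - s n) \<longlonglongrightarrow> 0"
      by (rule Lim_null_comparison[OF _ e]) (use l1 s in auto)
    from tendsto_add[OF this s(2)] show ?thesis by simp
  qed
  have a: "(\<lambda>n. euclid d (x (lam n (s n))) (x t)) \<longlonglongrightarrow> 0"
  proof (rule LIMSEQ_I)
    fix \<epsilon> :: real assume "0 < \<epsilon>"
    then obtain \<delta> where \<delta>: "\<delta> > 0" "\<And>v. t \<le> v \<Longrightarrow> v < t + \<delta> \<Longrightarrow> euclid d (x v) (x t) < \<epsilon>"
      using Dsp_right_eps[OF x T \<open>0 < \<epsilon>\<close>, of t] by auto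
    have "eventually (\<lambda>n. lam n (s n) < t + \<delta>) sequentially" using order_tendstoD(2)[OF c] \<delta>(1) by auto
    then obtain N where "\<And>n. n \<ge> N \<Longrightarrow> lam n (s n) < t + \<delta>" by (auto simp: eventually_sequentially)
    then show "\<exists>no. \<forall>n\<ge>no. norm (euclid d (x (lam n (s n))) (x t) - 0) < \<epsilon>"
      using \<delta>(2) after by (intro exI[of _ N]) simp
  qed
  have "(\<lambda>n. e n + euclid d (x (lam n (s n))) (x t)) \<longlonglongrightarrow> 0" using tendsto_add[OF e a] by simp
  moreover have "euclid d (xs n (s n)) (x t) \<le> e n + euclid d (x (lam n (s n))) (x t)" for n
    using euclid_triangle[of d "xs n (s n)" "x t" "x (lam n (s n))"] l1(2)[where u="s n" and n=n] s(1)[of n] by linarith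
  ultimately show r: "(\<lambda>n. euclid d (xs n (s n)) (x t)) \<longlonglongrightarrow> 0" by (rule tendsto_0_le[OF _ euclid_nonneg])
  have "skor_conv d T xs x" unfolding skor_conv_iff[OF T xs x] using e lam by blast
  then show "(\<lambda>n. \<phi> (s n) (xs n)) \<longlonglongrightarrow> \<phi> t x"
    by (intro payoff_cont[OF p xs x _ s(1) t s(2) r])
qed

text \<open>Along a subsequence each of the two time sequences stays on one side of
  \<open>t\<close>, measured in changed time, and the side determines the limits of payoff and path.
  If the sides differ, closeness of the path values forces \<open>l = x t\<close>; then there is no
  jump at \<open>t\<close> and both payoff limits agree.\<close>

lemma payoff_det:
  assumes p: "payoff d T \<phi>" and T: "0 < T"
    and xs: "\<And>n. xs n \<in> Dsp d T" and x: "x \<in> Dsp d T" and cv: "skor_conv d T xs x"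
    and s: "\<And>n. s n \<in> {0..T}" "s \<longlonglongrightarrow> t" and r: "\<And>n. r n \<in> {0..T}" "r \<longlonglongrightarrow> t"
    and close: "(\<lambda>n. euclid d (xs n (s n)) (xs n (r n))) \<longlonglongrightarrow> 0"
  shows "(\<lambda>n. \<phi> (s n) (xs n) - \<phi> (r n) (xs n)) \<longlonglongrightarrow> 0"
proof (rule ccontr)
  assume "\<not> (\<lambda>n. \<phi> (s n) (xs n) - \<phi> (r n) (xs n)) \<longlonglongrightarrow> 0"
  then obtain \<epsilon> where \<epsilon>: "\<epsilon> > 0" "\<And>N. \<exists>n\<ge>N. \<epsilon> \<le> \<bar>\<phi> (s n) (xs n) - \<phi> (r n) (xs n)\<bar>"
    unfolding LIMSEQ_iff by (auto simp: not_less)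
  define I where "I = {n. \<epsilon> \<le> \<bar>\<phi> (s n) (xs n) - \<phi> (r n) (xs n)\<bar>}"
  have "infinite I" unfolding infinite_nat_iff_unbounded_le I_def using \<epsilon>(2) by auto
  obtain lam e where e: "e \<longlonglongrightarrow> 0" and lam: "\<And>n. skor_close d T (e n) (lam n) (xs n) x"
    using cv unfolding skor_conv_iff[OF T xs x] by blast
  have t: "t \<in> {0..T}"
    using LIMSEQ_le_const[OF s(2), of 0] LIMSEQ_le_const2[OF s(2), of T] s(1) by auto
  obtain l where l: "l \<in> Rm d" "((\<lambda>s. euclid d (x s) l) \<longlongrightarrow> 0) (at_left t)" using Dsp_left[OF x T] by blast
  define V where "V a = (if a then \<phi> t (stop_left x t l) else \<phi> t x)" for a
  define W where "W a = (if a then l else x t)" for a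
  \<comment> \<open>The flag \<open>a\<close> records whether the changed times lie before
    \<open>t\<close>. This is possible only for \<open>0 < t\<close>, because changed times are
    nonnegative, and then a left limit at \<open>t\<close> is meaningful.\<close>
  have lim: "(\<lambda>n. \<phi> (w (q n)) (xs (q n))) \<longlonglongrightarrow> V a" "(\<lambda>n. euclid d (xs (q n) (w (q n))) (W a)) \<longlonglongrightarrow> 0"
    "a \<Longrightarrow> 0 < t"
    if q: "strict_mono q" and w: "\<And>n. w n \<in> {0..T}" "w \<longlonglongrightarrow> t" and a: "\<And>n. (lam (q n) (w (q n)) < t) = a"
    for q w a
  proof -
    have eq: "(\<lambda>n. e (q n)) \<longlonglongrightarrow> 0" and wq: "(\<lambda>n. w (q n)) \<longlonglongrightarrow> t"
      using LIMSEQ_subseq_LIMSEQ[OF e q] LIMSEQ_subseq_LIMSEQ[OF w(2) q] by (auto simp: o_def)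
    have "lam (q n) (w (q n)) \<ge> 0" for n
      using time_change_range[OF _ w(1)[of "q n"], of "lam (q n)"] lam[of "q n"] by (auto simp: skor_close_def)
    then show t0: "0 < t" if a using a[of 0] that by (meson le_less_trans)
    show "(\<lambda>n. \<phi> (w (q n)) (xs (q n))) \<longlonglongrightarrow> V a"
      using payoff_before_jump(1)[OF p T xs x eq lam w(1) wq _ _ _ l] payoff_after_jump(1)[OF p T xs x eq lam w(1) wq t] a t t0
      by (cases a) (auto simp: V_def not_less)
    show "(\<lambda>n. euclid d (xs (q n) (w (q n))) (W a)) \<longlonglongrightarrow> 0"
      using payoff_before_jump(2)[OF p T xs x eq lam w(1) wq _ _ _ l] payoff_after_jump(2)[OF p T xs x eq lam w(1) wq t] a t t0
      by (cases a) (auto simp: W_def not_less)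
  qed
  \<comment> \<open>Pigeonhole over the four combinations of sides.\<close>
  have "I = (\<Union>(a,b)\<in>UNIV. {n\<in>I. (lam n (s n) < t) = a \<and> (lam n (r n) < t) = b})" by auto
  then obtain a b where inf: "infinite {n\<in>I. (lam n (s n) < t) = a \<and> (lam n (r n) < t) = b}"
    using \<open>infinite I\<close> finite_UN_I[of "UNIV :: (bool \<times> bool) set" "\<lambda>(a,b). {n\<in>I. (lam n (s n) < t) = a \<and> (lam n (r n) < t) = b}"]
    by fastforce
  define J where "J = {n\<in>I. (lam n (s n) < t) = a \<and> (lam n (r n) < t) = b}"
  from inf have "infinite J" unfolding J_def .
  from infinite_enumerate[OF this] obtain q :: "nat \<Rightarrow> nat" where q: "strict_mono q" and qJ: "\<forall>n. q n \<in> J"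
    by (elim exE conjE)
  have q3: "(lam (q n) (s (q n)) < t) = a" and q4: "(lam (q n) (r (q n)) < t) = b" and q2: "q n \<in> I" for n
    using qJ[rule_format, of n] by (simp_all add: J_def)
  note ls = lim[OF q s q3]
  note lr = lim[OF q r q4]
  have "(\<lambda>n. euclid d (xs (q n) (s (q n))) (W a) + euclid d (xs (q n) (s (q n))) (xs (q n) (r (q n)))
     + euclid d (xs (q n) (r (q n))) (W b)) \<longlonglongrightarrow> 0 + 0 + 0"
    using LIMSEQ_subseq_LIMSEQ[OF close q] by (intro tendsto_add ls(2) lr(2)) (simp add: o_def)
  moreover have "euclid d (W a) (W b) \<le> euclid d (xs (q n) (s (q n))) (W a) + euclid d (xs (q n) (s (q n))) (xs (q n) (r (q n)))
     + euclid d (xs (q n) (r (q n))) (W b)" for n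
    using euclid_triangle[of d "W a" "W b" "xs (q n) (s (q n))"]
      euclid_triangle[of d "xs (q n) (s (q n))" "W b" "xs (q n) (r (q n))"] euclid_sym[of d "W a"] by (smt (verit))
  ultimately have "euclid d (W a) (W b) \<le> 0 + 0 + 0" by (intro LIMSEQ_le_const) auto
  then have "euclid d (W a) (W b) = 0" using euclid_nonneg[of d "W a" "W b"] by linarith
  moreover have "W c \<in> Rm d" for c using l(1) Dsp_Rm[OF x] by (simp add: W_def)
  ultimately have W: "W a = W b" by (intro euclid_zero_Rm)
  have "V a = V b"
  proof (cases "a = b")
    case False
    then have lx: "l = x t" "0 < t" using W ls(3) lr(3) by (auto simp: W_def split: if_splits)
    have "\<phi> t (stop_left x t l) = \<phi> t x"
      by (rule payoff_nonanticip[OF p t _ x]) (use stop_left_Dsp[OF x T lx(2) _ l] t lx in \<open>auto simp: stop_left_def\<close>)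
    then show ?thesis by (simp add: V_def)
  qed simp
  have "(\<lambda>n. \<phi> (s (q n)) (xs (q n)) - \<phi> (r (q n)) (xs (q n))) \<longlonglongrightarrow> V a - V b"
    by (intro tendsto_diff ls(1) lr(1))
  then have "(\<lambda>n. \<bar>\<phi> (s (q n)) (xs (q n)) - \<phi> (r (q n)) (xs (q n))\<bar>) \<longlonglongrightarrow> 0"
    using \<open>V a = V b\<close> by (simp add: tendsto_rabs_zero_iff)
  moreover have "\<epsilon> \<le> \<bar>\<phi> (s (q n)) (xs (q n)) - \<phi> (r (q n)) (xs (q n))\<bar>" for n
    using q2[of n] by (simp add: I_def)
  ultimately have "\<epsilon> \<le> 0" by (intro LIMSEQ_le_const) auto
  then show False using \<epsilon>(1) by simp
qed

text \<open>The oscillation of a payoff at scale \<open>1/k\<close>, over time pairs at which the path itself is close,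
  is dominated by its Lipschitz regularization, which is Skorohod continuous.\<close>

definition osc_vals :: "nat \<Rightarrow> real \<Rightarrow> (real \<Rightarrow> (real \<Rightarrow> nat \<Rightarrow> real) \<Rightarrow> real) \<Rightarrow> nat \<Rightarrow> (real \<Rightarrow> nat \<Rightarrow> real) \<Rightarrow> real set" where
  "osc_vals d T \<phi> k x = {\<bar>\<phi> s y - \<phi> r y\<bar> - real (Suc k) * skor_dist d T y x | y s r.
     y \<in> Dsp d T \<and> s \<in> {0..T} \<and> r \<in> {0..T} \<and> \<bar>s - r\<bar> \<le> 1 / real (Suc k) \<and> euclid d (y s) (y r) \<le> 1 / real (Suc k)}"

definition osc_reg :: "nat \<Rightarrow> real \<Rightarrow> (real \<Rightarrow> (real \<Rightarrow> nat \<Rightarrow> real) \<Rightarrow> real) \<Rightarrow> nat \<Rightarrow> (real \<Rightarrow> nat \<Rightarrow> real) \<Rightarrow> real" where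
  "osc_reg d T \<phi> k x = Sup (insert 0 (osc_vals d T \<phi> k x))"

context
  fixes d T \<phi> K
  assumes p: "payoff d T \<phi>" and T: "0 < T"
    and K: "\<And>t x. t \<in> {0..T} \<Longrightarrow> x \<in> Dsp d T \<Longrightarrow> 0 \<le> \<phi> t x \<and> \<phi> t x \<le> K"
begin

lemma osc_diff: "y \<in> Dsp d T \<Longrightarrow> s \<in> {0..T} \<Longrightarrow> r \<in> {0..T} \<Longrightarrow> \<bar>\<phi> s y - \<phi> r y\<bar> \<le> K"
  using K[of s y] K[of r y] by auto

lemma osc_bdd:
  assumes "x \<in> Dsp d T"
  shows "v \<in> insert 0 (osc_vals d T \<phi> k x) \<Longrightarrow> v \<le> K"
proof -
  assume v: "v \<in> insert 0 (osc_vals d T \<phi> k x)"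
  show "v \<le> K"
  proof (cases "v = 0")
    case True then show ?thesis using K[of 0 x] assms T by auto
  next
    case False
    then obtain y s r where y: "v = \<bar>\<phi> s y - \<phi> r y\<bar> - real (Suc k) * skor_dist d T y x" "y \<in> Dsp d T" "s \<in> {0..T}" "r \<in> {0..T}"
      using v unfolding osc_vals_def by blast
    have "0 \<le> real (Suc k) * skor_dist d T y x" using skor_dist_nonneg[OF T y(2) assms] by simp
    then show ?thesis using y(1) osc_diff[OF y(2-4)] by linarith
  qed
qed

lemma osc_reg_ge:
  assumes x: "x \<in> Dsp d T" and y: "y \<in> Dsp d T" "s \<in> {0..T}" "r \<in> {0..T}" "\<bar>s - r\<bar> \<le> 1 / real (Suc k)" "euclid d (y s) (y r) \<le> 1 / real (Suc k)"
  shows "\<bar>\<phi> s y - \<phi> r y\<bar> - real (Suc k) * skor_dist d T y x \<le> osc_reg d T \<phi> k x"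
  unfolding osc_reg_def
proof (rule cSup_upper)
  show "\<bar>\<phi> s y - \<phi> r y\<bar> - real (Suc k) * skor_dist d T y x \<in> insert 0 (osc_vals d T \<phi> k x)"
    unfolding osc_vals_def using y by blast
  show "bdd_above (insert 0 (osc_vals d T \<phi> k x))" by (rule bdd_aboveI[OF osc_bdd[OF x]])
qed

lemma osc_reg_nonneg: "x \<in> Dsp d T \<Longrightarrow> 0 \<le> osc_reg d T \<phi> k x"
  unfolding osc_reg_def
  by (rule cSup_upper) (simp, rule bdd_aboveI[OF osc_bdd])

lemma osc_reg_le: "x \<in> Dsp d T \<Longrightarrow> osc_reg d T \<phi> k x \<le> K"
  unfolding osc_reg_def by (rule cSup_least) (simp, rule osc_bdd)

lemma osc_reg_dominates:
  assumes x: "x \<in> Dsp d T" "s \<in> {0..T}" "r \<in> {0..T}" "\<bar>s - r\<bar> \<le> 1 / real (Suc k)" "euclid d (x s) (x r) \<le> 1 / real (Suc k)"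
  shows "\<bar>\<phi> s x - \<phi> r x\<bar> \<le> osc_reg d T \<phi> k x"
  using osc_reg_ge[OF x(1) x] skor_dist_self[OF T x(1)] by simp

text \<open>The centre \<open>x\<close> enters each value only through the penalty, which is
  Lipschitz with constant k+1 by the triangle inequality; a supremum of such functions has the same
  constant.\<close>

lemma osc_reg_Lipschitz:
  assumes x: "x \<in> Dsp d T" and x': "x' \<in> Dsp d T"
  shows "osc_reg d T \<phi> k x \<le> osc_reg d T \<phi> k x' + real (Suc k) * skor_dist d T x x'"
proof -
  have nn: "0 \<le> real (Suc k) * skor_dist d T x x'" using skor_dist_nonneg[OF T x x'] by simp
  show ?thesis
    unfolding osc_reg_def[of d T \<phi> k x]
  proof (rule cSup_least, blast)
    fix v assume v: "v \<in> insert 0 (osc_vals d T \<phi> k x)"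
    show "v \<le> osc_reg d T \<phi> k x' + real (Suc k) * skor_dist d T x x'"
    proof (cases "v = 0")
      case True then show ?thesis using nn osc_reg_nonneg[OF x', of k] by linarith
    next
      case False
      then obtain y s r where y: "v = \<bar>\<phi> s y - \<phi> r y\<bar> - real (Suc k) * skor_dist d T y x" "y \<in> Dsp d T" "s \<in> {0..T}" "r \<in> {0..T}"
        "\<bar>s - r\<bar> \<le> 1 / real (Suc k)" "euclid d (y s) (y r) \<le> 1 / real (Suc k)"
        using v unfolding osc_vals_def by blast
      have "real (Suc k) * skor_dist d T y x' \<le> real (Suc k) * (skor_dist d T y x + skor_dist d T x x')"
        by (intro mult_left_mono skor_dist_triangle T y x x') simp
      then show ?thesis using osc_reg_ge[OF x' y(2-6)] y(1) by (simp add: distrib_left)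
    qed
  qed
qed

lemma osc_reg_continuous: "skor_bounded_continuous d T (osc_reg d T \<phi> k)"
  unfolding skor_bounded_continuous_def skor_continuous_def
proof (intro conjI allI impI)
  show "\<exists>B. \<forall>x\<in>Dsp d T. \<bar>osc_reg d T \<phi> k x\<bar> \<le> B"
    using osc_reg_le osc_reg_nonneg by (intro exI[of _ K]) auto
  fix xs x assume xs: "\<forall>n. xs n \<in> Dsp d T" and x: "x \<in> Dsp d T" and cv: "skor_conv d T xs x"
  have "(\<lambda>n. real (Suc k) * skor_dist d T (xs n) x) \<longlonglongrightarrow> 0"
    using cv unfolding skor_conv_def by (rule tendsto_mult_right_zero)
  moreover have "norm (osc_reg d T \<phi> k (xs n) - osc_reg d T \<phi> k x) \<le> real (Suc k) * skor_dist d T (xs n) x" for n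
    using osc_reg_Lipschitz[OF spec[OF xs] x] osc_reg_Lipschitz[OF x spec[OF xs]] skor_dist_sym[OF T x spec[OF xs]]
    by (smt (verit) real_norm_def)
  ultimately have "(\<lambda>n. osc_reg d T \<phi> k (xs n) - osc_reg d T \<phi> k x) \<longlonglongrightarrow> 0"
    by (rule Lim_null_comparison[OF always_eventually[OF allI], rotated])
  then show "(\<lambda>n. osc_reg d T \<phi> k (xs n)) \<longlonglongrightarrow> osc_reg d T \<phi> k x" by (rule LIM_zero_cancel)
qed

text \<open>Near-maximizers \<open>y n\<close> have a penalty bounded by \<open>K\<close>, so their
  distance to \<open>x\<close> is of order 1/(k+1) and they converge to \<open>x\<close>. Their
  times converge along a subsequence, and \<open>payoff_det\<close> then excludes a payoff gap
  bounded away from 0.\<close>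

lemma osc_reg_tendsto:
  assumes x: "x \<in> Dsp d T"
  shows "(\<lambda>k. osc_reg d T \<phi> k x) \<longlonglongrightarrow> 0"
proof (rule ccontr)
  assume "\<not> (\<lambda>k. osc_reg d T \<phi> k x) \<longlonglongrightarrow> 0"
  then obtain \<epsilon> where \<epsilon>: "\<epsilon> > 0" "\<And>N. \<exists>n\<ge>N. \<epsilon> \<le> \<bar>osc_reg d T \<phi> n x\<bar>"
    unfolding LIMSEQ_iff by (auto simp: not_less)
  have "\<exists>k y s r. n \<le> k \<and> y \<in> Dsp d T \<and> s \<in> {0..T} \<and> r \<in> {0..T} \<and> \<bar>s - r\<bar> \<le> 1 / real (Suc k) \<and>
      euclid d (y s) (y r) \<le> 1 / real (Suc k) \<and> \<epsilon>/2 < \<bar>\<phi> s y - \<phi> r y\<bar> - real (Suc k) * skor_dist d T y x" for n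
  proof -
    obtain k where k: "k \<ge> n" "\<epsilon> \<le> \<bar>osc_reg d T \<phi> k x\<bar>" using \<epsilon>(2) by blast
    then have "\<epsilon>/2 < osc_reg d T \<phi> k x" using osc_reg_nonneg[OF x, of k] \<epsilon>(1) by linarith
    then obtain v where v: "v \<in> insert 0 (osc_vals d T \<phi> k x)" "\<epsilon>/2 < v"
      unfolding osc_reg_def by (elim less_cSupE) auto
    then have "v \<noteq> 0" using \<epsilon>(1) by simp
    then show ?thesis using v k(1) unfolding osc_vals_def by blast
  qed
  then obtain k y s r where c: "\<And>n::nat. n \<le> k n" "\<And>n. y n \<in> Dsp d T" "\<And>n. s n \<in> {0..T}" "\<And>n. r n \<in> {0..T}"
     "\<And>n. \<bar>s n - r n\<bar> \<le> 1 / real (Suc (k n))" "\<And>n. euclid d (y n (s n)) (y n (r n)) \<le> 1 / real (Suc (k n))"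
     "\<And>n. \<epsilon>/2 < \<bar>\<phi> (s n) (y n) - \<phi> (r n) (y n)\<bar> - real (Suc (k n)) * skor_dist d T (y n) x" by metis
  have kn: "1 / real (Suc (k n)) \<le> inverse (real (Suc n))" for n
    using c(1)[of n] by (simp add: inverse_eq_divide frac_le)
  have i0: "(\<lambda>n. inverse (real (Suc n))) \<longlonglongrightarrow> 0" by (rule LIMSEQ_inverse_real_of_nat)
  have "skor_dist d T (y n) x \<le> K * inverse (real (Suc n))" for n
  proof -
    have "real (Suc (k n)) * skor_dist d T (y n) x \<le> K" using c(7)[of n] osc_diff[OF c(2,3,4), of n n n] \<epsilon>(1) by linarith
    then have "skor_dist d T (y n) x \<le> K * (1 / real (Suc (k n)))" by (simp add: field_simps)
    also have "\<dots> \<le> K * inverse (real (Suc n))" using K[of 0 x] x T by (intro mult_left_mono kn) auto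
    finally show ?thesis .
  qed
  then have cv: "skor_conv d T y x" unfolding skor_conv_def
    by (intro tendsto_0_le[OF tendsto_mult_right_zero[OF i0, of K]] skor_dist_nonneg T c x)
  obtain t q where q: "strict_mono q" "(s \<circ> q) \<longlonglongrightarrow> t"
    using compact_Icc[of 0 T] c(3) unfolding compact_def by blast
  have i0q: "(\<lambda>n. inverse (real (Suc (q n)))) \<longlonglongrightarrow> 0" using LIMSEQ_subseq_LIMSEQ[OF i0 q(1)] by (simp add: o_def)
  have "(\<lambda>n. r (q n) - s (q n)) \<longlonglongrightarrow> 0"
    by (rule Lim_null_comparison[OF _ i0q]) (use c(5) kn in \<open>auto intro!: always_eventually simp: abs_minus_commute intro: order_trans\<close>)
  from tendsto_add[OF this q(2)] have rq: "(\<lambda>n. r (q n)) \<longlonglongrightarrow> t" by (simp add: o_def)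
  have "(\<lambda>n. euclid d (y (q n) (s (q n))) (y (q n) (r (q n)))) \<longlonglongrightarrow> 0"
    by (rule tendsto_0_le[OF i0q euclid_nonneg order_trans[OF c(6) kn]])
  then have "(\<lambda>n. \<phi> (s (q n)) (y (q n)) - \<phi> (r (q n)) (y (q n))) \<longlonglongrightarrow> 0"
    using payoff_det[OF p T c(2) x skor_conv_subseq[OF cv q(1)] c(3) _ c(4) rq] q(2) by (simp add: o_def)
  then have "(\<lambda>n. \<bar>\<phi> (s (q n)) (y (q n)) - \<phi> (r (q n)) (y (q n))\<bar>) \<longlonglongrightarrow> 0" by (simp add: tendsto_rabs_zero_iff)
  moreover have "\<epsilon>/2 \<le> \<bar>\<phi> (s (q n)) (y (q n)) - \<phi> (r (q n)) (y (q n))\<bar>" for n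
  proof -
    have "0 \<le> real (Suc (k (q n))) * skor_dist d T (y (q n)) x" using skor_dist_nonneg[OF T c(2) x] by simp
    then show ?thesis using c(7)[of "q n"] by linarith
  qed
  ultimately have "\<epsilon>/2 \<le> 0" by (intro LIMSEQ_le_const) auto
  then show False using \<epsilon>(1) by simp
qed

end

text \<open>The source of measurability for payoffs: the code \<open>v\<close> ranges over a product
  of real lines, where sequential continuity already gives Borel measurability.\<close>

lemma payoff_step_continuous:
  assumes p: "payoff d T \<phi>" and T: "0 < T" and k: "0 < k" and c: "c \<in> {0..T}"
  shows "(\<lambda>v. \<phi> c (step_path d T k v)) \<in> borel_measurable borel"
proof (intro borel_measurable_continuous_onI continuous_on_sequentiallyI)
  fix v and v0 :: "nat \<times> nat \<Rightarrow> real" assume v: "v \<longlonglongrightarrow> v0"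
  have "(\<lambda>n. v n q) \<longlonglongrightarrow> v0 q" for q
    by (rule continuous_on_tendsto_compose[OF continuous_on_product_coordinates v]) auto
  note cv = step_path_conv[OF T k this]
  show "(\<lambda>n. \<phi> c (step_path d T k (v n))) \<longlonglongrightarrow> \<phi> c (step_path d T k v0)"
    by (rule payoff_cont[where xs="\<lambda>n. step_path d T k (v n)" and ts="\<lambda>_. c" and t=c,
        OF p step_path_Dsp[OF T k] step_path_Dsp[OF T k] cv(1) c c tendsto_const cv(2)])
qed

lemma skor_step_continuous:
  assumes p: "skor_continuous d T \<psi>" and T: "0 < T" and k: "0 < k"
  shows "(\<lambda>v. \<psi> (step_path d T k v)) \<in> borel_measurable borel"
proof (intro borel_measurable_continuous_onI continuous_on_sequentiallyI)
  fix v and v0 :: "nat \<times> nat \<Rightarrow> real" assume v: "v \<longlonglongrightarrow> v0"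
  have "(\<lambda>n. v n q) \<longlonglongrightarrow> v0 q" for q
    by (rule continuous_on_tendsto_compose[OF continuous_on_product_coordinates v]) auto
  note cv = step_path_conv[OF T k this]
  show "(\<lambda>n. \<psi> (step_path d T k (v n))) \<longlonglongrightarrow> \<psi> (step_path d T k v0)"
    by (rule p[unfolded skor_continuous_def, rule_format, OF step_path_Dsp[OF T k] step_path_Dsp[OF T k] cv(1)])
qed

text \<open>Time is rounded up to the sampling grid so that the sampled step path attains at that
  time exactly the final value of a path stopped at \<open>t\<close>.\<close>

definition grid_ceil :: "real \<Rightarrow> nat \<Rightarrow> real \<Rightarrow> real" where
  "grid_ceil T k t = real_of_int \<lceil>real k * t / T\<rceil> * T / real k"

lemma grid_ceil:
  assumes T: "0 < T" and k: "0 < k" and t: "t \<in> {0..T}"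
  shows "t \<le> grid_ceil T k t" "grid_ceil T k t \<le> t + T / k" "grid_ceil T k t \<in> {0..T}"
proof -
  have "real k * t / T \<le> real_of_int \<lceil>real k * t / T\<rceil>" "real_of_int \<lceil>real k * t / T\<rceil> \<le> real k * t / T + 1" by linarith+
  then have "real k * t / T * (T / k) \<le> real_of_int \<lceil>real k * t / T\<rceil> * (T / k)"
    "real_of_int \<lceil>real k * t / T\<rceil> * (T / k) \<le> (real k * t / T + 1) * (T / k)"
    using T k by (intro mult_right_mono; simp)+
  then show a: "t \<le> grid_ceil T k t" and "grid_ceil T k t \<le> t + T / k"
    using T k by (simp_all add: grid_ceil_def distrib_right add_divide_distrib)
  have "t / T \<le> 1" using t T by simp
  then have "real k * (t / T) \<le> real k" by (intro mult_left_le) auto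
  then have "\<lceil>real k * t / T\<rceil> \<le> int k" by (simp add: ceiling_le_iff)
  then have "real_of_int \<lceil>real k * t / T\<rceil> * (T / k) \<le> real k * (T / k)"
    using T of_int_le_iff[of "\<lceil>real k * t / T\<rceil>" "int k", where 'a=real] by (intro mult_right_mono) (simp_all del: of_int_le_iff)
  then show "grid_ceil T k t \<in> {0..T}" using a t T k by (simp add: grid_ceil_def)
qed

text \<open>The path is stopped at \<open>t\<close> before sampling, so every approximant depends on
  the path up to \<open>t\<close> only; this is what yields adaptedness. Since the approximating
  path equals \<open>x t\<close> at the rounded time, the convergence of values demanded by joint
  continuity is immediate.\<close>

lemma payoff_sample_limit:
  assumes p: "payoff d T \<phi>" and T: "0 < T" and x: "x \<in> Dsp d T" and t: "t \<in> {0..T}"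
  shows "(\<lambda>k. \<phi> (grid_ceil T (Suc k) t) (step_path d T (Suc k) (sample T (Suc k) (stop_path x t)))) \<longlonglongrightarrow> \<phi> t x"
proof -
  let ?y = "stop_path x t"
  let ?c = "\<lambda>k. grid_ceil T (Suc k) t"
  have y: "?y \<in> Dsp d T" by (rule stop_path_Dsp[OF x T t])
  have c: "?c k \<in> {0..T}" "t \<le> ?c k" "?c k \<le> t + T * inverse (real (Suc k))" for k
    using grid_ceil[OF T _ t, of "Suc k"] by (auto simp: divide_inverse)
  have ct: "?c \<longlonglongrightarrow> t"
  proof (rule tendsto_sandwich[OF _ _ tendsto_const])
    show "(\<lambda>k. t + T * inverse (real (Suc k))) \<longlonglongrightarrow> t"
      using tendsto_add[OF tendsto_const tendsto_mult_right_zero[OF LIMSEQ_inverse_real_of_nat], of t T] by simp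
  qed (use c in \<open>auto intro!: always_eventually\<close>)
  have ev: "step_path d T (Suc k) (sample T (Suc k) ?y) (?c k) = ?y t" for k
  proof -
    have "real (Suc k) * ?c k / T = real_of_int \<lceil>real (Suc k) * t / T\<rceil>"
      using T by (simp add: grid_ceil_def del: of_nat_Suc)
    then have "real_of_int \<lfloor>real (Suc k) * ?c k / T\<rfloor> * T / real (Suc k) = ?c k"
      unfolding grid_ceil_def[of T "Suc k" t] by (simp del: of_nat_Suc)
    then have "step_path d T (Suc k) (sample T (Suc k) ?y) (?c k) = ?y (?c k)"
      using step_sample[OF y T c(1), of "Suc k"] by (simp only:)
    also have "\<dots> = ?y t" using c(2)[of k] by (simp add: stop_path_def)
    finally show ?thesis .
  qed
  have "(\<lambda>k. \<phi> (?c k) (step_path d T (Suc k) (sample T (Suc k) ?y))) \<longlonglongrightarrow> \<phi> t ?y"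
  proof (rule payoff_cont[where xs="\<lambda>k. step_path d T (Suc k) (sample T (Suc k) ?y)" and ts="?c",
        OF p _ y step_sample_conv[OF y T] c(1) t ct])
    show "step_path d T (Suc n) (sample T (Suc n) ?y) \<in> Dsp d T" for n by (rule step_path_Dsp[OF T]) simp
    show "(\<lambda>n. euclid d (step_path d T (Suc n) (sample T (Suc n) ?y) (?c n)) (?y t)) \<longlonglongrightarrow> 0"
      unfolding ev by simp
  qed
  moreover have "\<phi> t ?y = \<phi> t x" by (rule payoff_nonanticip[OF p t y x]) (simp add: stop_path_def)
  ultimately show ?thesis by simp
qed

section \<open>Filtrations and stopping times\<close>

text \<open>The usual conditions. Each sigma-algebra is packaged as a measure so that
  \<open>real_cond_exp\<close> applies. \<open>F_null\<close> with \<open>complete\<close> lets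
  versions be changed on null sets without losing adaptedness, and \<open>F_right\<close> keeps
  limits from the right adapted.\<close>

locale filtered_space = prob_space P for P :: "'a measure" +
  fixes F :: "real \<Rightarrow> 'a measure"
  assumes space_F: "space (F t) = space P"
    and sets_F: "sets (F t) \<subseteq> sets P"
    and F_mono: "s \<le> t \<Longrightarrow> sets (F s) \<subseteq> sets (F t)"
    and F_right: "(\<And>u. t < u \<Longrightarrow> A \<in> sets (F u)) \<Longrightarrow> A \<in> sets (F t)"
    and F_null: "A \<in> null_sets P \<Longrightarrow> A \<in> sets (F t)"
    and complete: "A \<in> null_sets P \<Longrightarrow> B \<subseteq> A \<Longrightarrow> B \<in> sets P"
begin

lemma subalg: "subalgebra P (F t)"
  by (simp add: subalgebra_def space_F sets_F)

lemma subalgFF: "s \<le> t \<Longrightarrow> subalgebra (F t) (F s)"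
  by (simp add: subalgebra_def space_F F_mono)

lemma sigma_finite_F: "sigma_finite_subalgebra P (F t)"
proof (rule finite_measure_subalgebra_is_sigma_finite)
  show "finite_measure_subalgebra P (F t)" by unfold_locales (rule subalg)
qed

sublocale FS: sigma_finite_subalgebra P "F t" for t
  by (rule sigma_finite_F)

lemma measurable_F_P: "f \<in> borel_measurable (F t) \<Longrightarrow> f \<in> borel_measurable P"
  by (rule measurable_from_subalg[OF subalg])

lemma measurable_F_mono: "s \<le> t \<Longrightarrow> f \<in> borel_measurable (F s) \<Longrightarrow> f \<in> borel_measurable (F t)"
  by (rule measurable_from_subalg[OF subalgFF])

lemma measurable_F_right:
  fixes f :: "'a \<Rightarrow> real"
  assumes "\<And>u. t < u \<Longrightarrow> f \<in> borel_measurable (F u)"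
  shows "f \<in> borel_measurable (F t)"
proof (rule measurableI)
  fix A :: "real set" assume A: "A \<in> sets borel"
  show "f -` A \<inter> space (F t) \<in> sets (F t)"
  proof (rule F_right)
    fix u assume "t < u"
    from measurable_sets[OF assms[OF this] A] show "f -` A \<inter> space (F t) \<in> sets (F u)" by (simp add: space_F)
  qed
qed simp

definition stopT :: "real \<Rightarrow> ('a \<Rightarrow> real) \<Rightarrow> bool" where
  "stopT T \<tau> \<longleftrightarrow> (\<forall>w\<in>space P. \<tau> w \<in> {0..T}) \<and> (\<forall>t\<in>{0..T}. {w\<in>space P. \<tau> w \<le> t} \<in> sets (F t))"

lemma space_P_in_F: "space P \<in> sets (F t)"
  using sets.top[of "F t"] by (simp add: space_F)

lemma stopT_range: "stopT T \<tau> \<Longrightarrow> w \<in> space P \<Longrightarrow> \<tau> w \<in> {0..T}"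
  by (simp add: stopT_def)

lemma stopT_le:
  assumes "stopT T \<tau>"
  shows "{w\<in>space P. \<tau> w \<le> t} \<in> sets (F t)"
proof -
  consider "t < 0" | "t \<in> {0..T}" | "T < t" by force
  then show ?thesis
  proof cases
    case 1
    then have "{w\<in>space P. \<tau> w \<le> t} = {}" using assms by (force simp: stopT_def)
    then show ?thesis by (simp only: sets.empty_sets)
  next
    case 2 then show ?thesis using assms by (simp add: stopT_def)
  next
    case 3
    then have "{w\<in>space P. \<tau> w \<le> t} = space P" using assms by (force simp: stopT_def)
    then show ?thesis by (simp only: space_P_in_F)
  qed
qed

lemma stopT_measurable: "stopT T \<tau> \<Longrightarrow> \<tau> \<in> borel_measurable P"
  using stopT_le sets_F by (intro borel_measurableI_le) blast

lemma stopT_const: "c \<in> {0..T} \<Longrightarrow> stopT T (\<lambda>_. c)"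
proof -
  assume c: "c \<in> {0..T}"
  have "{w\<in>space P. c \<le> t} \<in> sets (F t)" for t
    by (cases "c \<le> t") (auto simp: space_P_in_F)
  then show ?thesis unfolding stopT_def using c by blast
qed

lemma stopT_min:
  assumes "stopT T \<sigma>" "stopT T \<tau>"
  shows "stopT T (\<lambda>w. min (\<sigma> w) (\<tau> w))"
proof -
  have "{w\<in>space P. min (\<sigma> w) (\<tau> w) \<le> t} = {w\<in>space P. \<sigma> w \<le> t} \<union> {w\<in>space P. \<tau> w \<le> t}" for t
    by (auto simp: min_le_iff_disj)
  then have 1: "{w\<in>space P. min (\<sigma> w) (\<tau> w) \<le> t} \<in> sets (F t)" for t
    using sets.Un[OF stopT_le[OF assms(1), of t] stopT_le[OF assms(2), of t]] by simp
  have "min (\<sigma> w) (\<tau> w) \<in> {0..T}" if "w \<in> space P" for w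
    using stopT_range[OF assms(1) that] stopT_range[OF assms(2) that] by auto
  then show ?thesis unfolding stopT_def using 1 by blast
qed

text \<open>Stopping times on a finite grid \<open>t 0 < \<dots> < t m\<close> are handled through their index.\<close>

definition stopI :: "(nat \<Rightarrow> real) \<Rightarrow> nat \<Rightarrow> ('a \<Rightarrow> nat) \<Rightarrow> bool" where
  "stopI t m \<kappa> \<longleftrightarrow> (\<forall>w\<in>space P. \<kappa> w \<le> m) \<and> (\<forall>j\<le>m. {w\<in>space P. \<kappa> w \<le> j} \<in> sets (F (t j)))"

lemma stopI_eq_sets:
  assumes k: "stopI t m \<kappa>" and mono: "\<And>i j. i \<le> j \<Longrightarrow> j \<le> m \<Longrightarrow> t i \<le> t j" and j: "j \<le> m"
  shows "{w\<in>space P. \<kappa> w = j} \<in> sets (F (t j))"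
proof (cases j)
  case 0
  then have "{w\<in>space P. \<kappa> w = j} = {w\<in>space P. \<kappa> w \<le> j}" by auto
  then show ?thesis using k j by (simp add: stopI_def)
next
  case (Suc i)
  then have "{w\<in>space P. \<kappa> w = j} = {w\<in>space P. \<kappa> w \<le> j} - {w\<in>space P. \<kappa> w \<le> i}" by auto
  moreover have "{w\<in>space P. \<kappa> w \<le> i} \<in> sets (F (t j))"
    using k Suc j F_mono[OF mono[of i j]] by (auto simp: stopI_def)
  ultimately show ?thesis using k j by (auto simp: stopI_def)
qed

lemma stopI_measurable:
  assumes k: "stopI t m \<kappa>" 
  shows "\<kappa> \<in> measurable P (count_space UNIV)"
proof (rule measurable_count_space_eq2_countable[THEN iffD2])
  have le: "{w\<in>space P. \<kappa> w \<le> j} \<in> sets P" for j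
  proof (cases "j \<le> m")
    case True then show ?thesis using k sets_F by (auto simp: stopI_def)
  next
    case False
    then have "{w\<in>space P. \<kappa> w \<le> j} = space P" using k by (force simp: stopI_def)
    then show ?thesis by simp
  qed
  have "\<kappa> -` {j} \<inter> space P \<in> sets P" for j
  proof (cases j)
    case 0
    then have "\<kappa> -` {j} \<inter> space P = {w\<in>space P. \<kappa> w \<le> j}" by auto
    then show ?thesis using le by simp
  next
    case (Suc i)
    then have "\<kappa> -` {j} \<inter> space P = {w\<in>space P. \<kappa> w \<le> j} - {w\<in>space P. \<kappa> w \<le> i}" by auto
    then show ?thesis by (simp only: sets.Diff[OF le le])
  qed
  then show "\<kappa> \<in> space P \<rightarrow> UNIV \<and> (\<forall>a\<in>UNIV. \<kappa> -` {a} \<inter> space P \<in> sets P)" by simp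
qed

lemma stopI_stopT:
  assumes k: "stopI t m \<kappa>" and mono: "\<And>i j. i \<le> j \<Longrightarrow> j \<le> m \<Longrightarrow> t i \<le> t j"
    and r: "\<And>i. i \<le> m \<Longrightarrow> t i \<in> {0..T}"
  shows "stopT T (\<lambda>w. t (\<kappa> w))"
proof -
  have km: "\<kappa> w \<le> m" if "w \<in> space P" for w using k that by (simp add: stopI_def)
  have "{w\<in>space P. t (\<kappa> w) \<le> u} \<in> sets (F u)" for u
  proof -
    have "{w\<in>space P. t (\<kappa> w) \<le> u} = (\<Union>j\<in>{j. j \<le> m \<and> t j \<le> u}. {w\<in>space P. \<kappa> w = j})"
      using km by auto
    moreover have "{w\<in>space P. \<kappa> w = j} \<in> sets (F u)" if "j \<in> {j. j \<le> m \<and> t j \<le> u}" for j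
      using stopI_eq_sets[OF k mono, of j] that F_mono[of "t j" u] by auto
    moreover have "finite {j. j \<le> m \<and> t j \<le> u}" by simp
    ultimately show ?thesis by (metis (no_types, lifting) sets.finite_UN)
  qed
  then show ?thesis unfolding stopT_def using km r by blast
qed

lemma cond_exp_L1:
  assumes "integrable P f" "integrable P g"
  shows "(\<integral>w. \<bar>real_cond_exp P (F t) f w - real_cond_exp P (F t) g w\<bar> \<partial>P) \<le> (\<integral>w. \<bar>f w - g w\<bar> \<partial>P)"
proof -
  have i: "integrable P (\<lambda>w. f w - g w)" using assms by simp
  have 1: "AE w in P. real_cond_exp P (F t) (\<lambda>w. f w - g w) w = real_cond_exp P (F t) f w - real_cond_exp P (F t) g w"
    by (rule FS.real_cond_exp_diff[OF assms])
  have 2: "AE w in P. \<bar>real_cond_exp P (F t) (\<lambda>w. f w - g w) w\<bar> \<le> real_cond_exp P (F t) (\<lambda>w. \<bar>f w - g w\<bar>) w"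
  proof -
    have ia: "integrable P (\<lambda>w. \<bar>f w - g w\<bar>)" using i by simp
    have a: "AE w in P. real_cond_exp P (F t) (\<lambda>w. f w - g w) w \<le> real_cond_exp P (F t) (\<lambda>w. \<bar>f w - g w\<bar>) w"
      by (rule FS.real_cond_exp_mono[OF _ i ia]) auto
    have b: "AE w in P. real_cond_exp P (F t) (\<lambda>w. - 1 * (f w - g w)) w \<le> real_cond_exp P (F t) (\<lambda>w. \<bar>f w - g w\<bar>) w"
      by (rule FS.real_cond_exp_mono[OF _ integrable_mult_right[OF i] ia]) auto
    have c: "AE w in P. real_cond_exp P (F t) (\<lambda>w. - 1 * (f w - g w)) w = - 1 * real_cond_exp P (F t) (\<lambda>w. f w - g w) w"
      by (rule FS.real_cond_exp_cmult[OF i])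
    show ?thesis using a b c by eventually_elim auto
  qed
  have "(\<integral>w. \<bar>real_cond_exp P (F t) f w - real_cond_exp P (F t) g w\<bar> \<partial>P)
      \<le> (\<integral>w. real_cond_exp P (F t) (\<lambda>w. \<bar>f w - g w\<bar>) w \<partial>P)"
  proof (rule integral_mono_AE)
    show "AE w in P. \<bar>real_cond_exp P (F t) f w - real_cond_exp P (F t) g w\<bar> \<le> real_cond_exp P (F t) (\<lambda>w. \<bar>f w - g w\<bar>) w"
      using 1 2 by eventually_elim simp
  qed (use assms FS.real_cond_exp_int(1) in auto)
  also have "\<dots> = (\<integral>w. \<bar>f w - g w\<bar> \<partial>P)" using i by (intro FS.real_cond_exp_int(2)) simp
  finally show ?thesis .
qed

lemma cond_exp_bound:
  assumes "h \<in> borel_measurable P" "AE w in P. \<bar>h w\<bar> \<le> B"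
  shows "AE w in P. \<bar>real_cond_exp P (F t) h w\<bar> \<le> B"
proof -
  have i: "integrable P h" by (rule integrable_const_bound[of _ B]) (use assms in auto)
  have "AE w in P. real_cond_exp P (F t) h w \<le> B"
    by (rule FS.real_cond_exp_le_c[OF i]) (use assms(2) in \<open>auto elim: eventually_mono\<close>)
  moreover have "AE w in P. real_cond_exp P (F t) h w \<ge> - B"
    by (rule FS.real_cond_exp_ge_c[OF i]) (use assms(2) in \<open>auto elim: eventually_mono\<close>)
  ultimately show ?thesis by eventually_elim auto
qed

lemma cond_exp_mult_bounded:
  assumes h: "integrable P h" and g: "g \<in> borel_measurable (F t)" "AE w in P. \<bar>g w\<bar> \<le> B"
  shows "(\<integral>w. g w * real_cond_exp P (F t) h w \<partial>P) = (\<integral>w. g w * h w \<partial>P)"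
proof (rule FS.real_cond_exp_intg(2)[OF _ g(1)])
  show "integrable P (\<lambda>x. g x * h x)"
    by (rule Bochner_Integration.integrable_bound[OF integrable_mult_right[OF integrable_abs[OF h], of B]])
      (use g h measurable_F_P[OF g(1)] in \<open>auto elim!: eventually_mono simp: abs_mult intro!: mult_mono\<close>)
  show "h \<in> borel_measurable P" using h by auto
qed

text \<open>Preimages under \<open>g\<close> and \<open>f\<close> differ inside a null set, all of
  whose subsets belong to \<open>F t\<close>. It serves for arbitrary versions of a conditional
  expectation.\<close>

lemma AE_eq_measurable:
  assumes f: "f \<in> borel_measurable (F t)" and e: "AE w in P. g w = (f w :: real)"
  shows "g \<in> borel_measurable (F t)"
proof -
  obtain Nn where Nn: "Nn \<in> null_sets P" "{w\<in>space P. g w \<noteq> f w} \<subseteq> Nn"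
    using AE_E[OF e] by (metis (mono_tags, lifting) null_setsI)
  show ?thesis
  proof (rule measurableI)
    fix A :: "real set" assume A: "A \<in> sets borel"
    have fm: "f -` A \<inter> space P \<in> sets (F t)" using measurable_sets[OF f A] by (simp add: space_F)
    have "B \<in> sets (F t)" if "B \<subseteq> Nn" for B
      using that Nn(1) complete by (meson F_null null_sets_subset)
    then have "(g -` A \<inter> space P) \<inter> Nn \<in> sets (F t)" "(f -` A \<inter> space P) - Nn \<in> sets (F t)"
      using fm F_null[OF Nn(1)] by (auto intro: sets.Diff)
    moreover have "g -` A \<inter> space P = ((g -` A \<inter> space P) \<inter> Nn) \<union> ((f -` A \<inter> space P) - Nn)"
      using Nn(2) by auto
    ultimately show "g -` A \<inter> space (F t) \<in> sets (F t)" by (metis sets.Un space_F)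
  qed simp
qed

end

section \<open>The completed right-continuous filtration of a cadlag process\<close>

locale cadlag_proc = prob_space M for M :: "'a measure" +
  fixes d :: nat and T :: real and S :: "'a \<Rightarrow> real \<Rightarrow> nat \<Rightarrow> real"
  assumes T: "0 < T" and proc: "cadlag_process M d T S"
begin

definition Ft :: "real \<Rightarrow> 'a measure" where
  "Ft t = sigma (space M) (usual_filt M d T S t)"

lemma S_Dsp: "w \<in> space M \<Longrightarrow> S w \<in> Dsp d T"
  using proc by (simp add: cadlag_process_def)

lemma S_meas: "(\<lambda>w. S w t i) \<in> borel_measurable M"
proof (cases "i < d")
  case True
  have "(\<lambda>w. S w (clampT T t) i) \<in> borel_measurable M" using proc True T by (simp add: cadlag_process_def)
  moreover have "w \<in> space M \<Longrightarrow> S w (clampT T t) i = S w t i" for w using Dsp_clamp[OF S_Dsp] by simp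
  ultimately show ?thesis by (subst measurable_cong[of _ _ "\<lambda>w. S w (clampT T t) i"]) simp_all
next
  case False
  have "w \<in> space M \<Longrightarrow> S w t i = 0" for w using Dsp_Rm[OF S_Dsp, of w t] False by (simp add: Rm_def)
  then show ?thesis by (subst measurable_cong[of _ _ "\<lambda>w. 0"]) simp_all
qed

lemma nat_gen_sub: "nat_gen M d T S u \<subseteq> sets (completion M)"
  unfolding nat_gen_def using S_meas by (auto intro!: sets_completionI_sets)

lemma gen_Pow: "nat_gen M d T S u \<union> null_sets (completion M) \<subseteq> Pow (space M)"
  using nat_gen_sub[of u] sets.space_closed[of "completion M"] by auto

lemma sigma_gen: "sigma_algebra (space M) (sigma_sets (space M) (nat_gen M d T S u \<union> null_sets (completion M)))"
  by (rule sigma_algebra_sigma_sets[OF gen_Pow])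

lemma usual_filt_sigma_algebra: "sigma_algebra (space M) (usual_filt M d T S t)"
proof -
  have "t + 1 \<in> {t<..}" by simp
  then show ?thesis
    unfolding usual_filt_def sigma_algebra_iff2
    using sigma_gen[unfolded sigma_algebra_iff2] by (intro conjI ballI allI impI) blast+
qed

lemma sets_Ft: "sets (Ft t) = usual_filt M d T S t"
proof -
  interpret sigma_algebra "space M" "usual_filt M d T S t" by (rule usual_filt_sigma_algebra)
  show ?thesis unfolding Ft_def by (simp add: sigma_sets_eq space_closed)
qed

lemma space_Ft: "space (Ft t) = space M"
  by (simp add: Ft_def space_measure_of_conv)

lemma usual_filt_sub: "usual_filt M d T S t \<subseteq> sets (completion M)"
proof -
  have "sigma_sets (space M) (nat_gen M d T S u \<union> null_sets (completion M)) \<subseteq> sets (completion M)" for u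
    using nat_gen_sub[of u] sets.sigma_sets_subset[of "nat_gen M d T S u \<union> null_sets (completion M)" "completion M"] by auto
  then show ?thesis unfolding usual_filt_def using gt_ex[of t] by fastforce
qed

sublocale FS: filtered_space "completion M" Ft
proof -
  interpret C: prob_space "completion M" by (rule prob_space_completion)
  show "filtered_space (completion M) Ft"
  proof
    show "space (Ft t) = space (completion M)" for t by (simp add: space_Ft)
    show "sets (Ft t) \<subseteq> sets (completion M)" for t using usual_filt_sub by (simp add: sets_Ft)
    show "sets (Ft s) \<subseteq> sets (Ft t)" if "s \<le> t" for s t
      unfolding sets_Ft usual_filt_def using that by (intro INT_anti_mono) auto
    show "A \<in> sets (Ft t)" if "\<And>u. t < u \<Longrightarrow> A \<in> sets (Ft u)" for A t
      unfolding sets_Ft usual_filt_def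
    proof
      fix u assume "u \<in> {t<..}"
      \<comment> \<open>Membership in \<open>Ft v\<close> means membership in every generated
        sigma-algebra after \<open>v\<close>, in particular in the one at \<open>u\<close>.\<close>
      then obtain v where v: "t < v" "v < u" using dense by auto
      then show "A \<in> sigma_sets (space M) (nat_gen M d T S u \<union> null_sets (completion M))"
        using that[OF v(1)] by (auto simp: sets_Ft usual_filt_def)
    qed
    show "A \<in> sets (Ft t)" if "A \<in> null_sets (completion M)" for A t
      unfolding sets_Ft usual_filt_def using that by auto
    show "B \<in> sets (completion M)" if "A \<in> null_sets (completion M)" "B \<subseteq> A" for A B
      using that by (meson null_sets_completion_subset null_setsD2)
  qed
qed

lemma stop_times_iff: "\<tau> \<in> stop_times M d T S \<longleftrightarrow> FS.stopT T \<tau>"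
  by (simp add: stop_times_def FS.stopT_def sets_Ft)

lemma S_adapted: 
  assumes u: "0 \<le> u" "s \<le> u"
  shows "(\<lambda>w. S w s i) \<in> borel_measurable (Ft u)"
proof (cases "i < d")
  case True
  show ?thesis
  proof (rule measurableI)
    fix A :: "real set" assume A: "A \<in> sets borel"
    have eq: "(\<lambda>w. S w s i) -` A \<inter> space (Ft u) = {w\<in>space M. S w (clampT T s) i \<in> A}"
      using Dsp_clamp[OF S_Dsp] by (auto simp: space_Ft)
    have "{w\<in>space M. S w (clampT T s) i \<in> A} \<in> nat_gen M d T S v" if "u < v" for v
      unfolding nat_gen_def using True A u that T by (intro CollectI exI[of _ "clampT T s"] exI[of _ i] exI[of _ A]) auto
    then show "(\<lambda>w. S w s i) -` A \<inter> space (Ft u) \<in> sets (Ft u)"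
      unfolding eq sets_Ft usual_filt_def by auto
  qed simp
next
  case False
  have "w \<in> space M \<Longrightarrow> S w s i = 0" for w using Dsp_Rm[OF S_Dsp, of w s] False by (simp add: Rm_def)
  then show ?thesis by (subst measurable_cong[of _ _ "\<lambda>w. 0"]) (simp_all add: space_Ft)
qed

lemma sample_measurable:
  assumes "t \<in> {0..T}"
  shows "(\<lambda>w. sample T k (stop_path (S w) t)) \<in> borel_measurable (Ft t)"
proof (rule measurable_coordinatewise_then_product)
  fix p :: "nat \<times> nat"
  show "(\<lambda>w. sample T k (stop_path (S w) t) p) \<in> borel_measurable (Ft t)"
    using assms by (cases p) (auto simp: sample_def stop_path_def intro!: S_adapted)
qed

lemma payoff_adapted:
  assumes p: "payoff d T \<phi>" and t: "t \<in> {0..T}"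
  shows "(\<lambda>w. \<phi> t (S w)) \<in> borel_measurable (Ft t)"
proof (rule borel_measurable_LIMSEQ_real)
  fix w assume "w \<in> space (Ft t)"
  then show "(\<lambda>k. \<phi> (grid_ceil T (Suc k) t) (step_path d T (Suc k) (sample T (Suc k) (stop_path (S w) t)))) \<longlonglongrightarrow> \<phi> t (S w)"
    by (intro payoff_sample_limit p T S_Dsp t) (simp add: space_Ft)
next
  fix k
  show "(\<lambda>w. \<phi> (grid_ceil T (Suc k) t) (step_path d T (Suc k) (sample T (Suc k) (stop_path (S w) t)))) \<in> borel_measurable (Ft t)"
    by (rule measurable_compose[OF sample_measurable[OF t] payoff_step_continuous[OF p T]])
      (use grid_ceil(3)[OF T _ t] in auto)
qed

text \<open>Stopping at \<open>T\<close> changes nothing, so the sampled step paths converge to the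
  path itself.\<close>

lemma skor_continuous_measurable:
  assumes p: "skor_continuous d T \<psi>"
  shows "(\<lambda>w. \<psi> (S w)) \<in> borel_measurable (Ft T)"
proof (rule borel_measurable_LIMSEQ_real)
  fix w assume "w \<in> space (Ft T)"
  then have w: "S w \<in> Dsp d T" by (simp add: space_Ft S_Dsp)
  have "stop_path (S w) T = S w"
  proof
    fix s show "stop_path (S w) T s = S w s" using Dsp_ge_T[OF w T, of s] by (simp add: stop_path_def min_def)
  qed
  moreover have "(\<lambda>k. \<psi> (step_path d T (Suc k) (sample T (Suc k) (S w)))) \<longlonglongrightarrow> \<psi> (S w)"
    by (rule p[unfolded skor_continuous_def, rule_format, OF step_path_Dsp[OF T] w step_sample_conv[OF w T]]) simp
  ultimately show "(\<lambda>k. \<psi> (step_path d T (Suc k) (sample T (Suc k) (stop_path (S w) T)))) \<longlonglongrightarrow> \<psi> (S w)" by simp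
next
  fix k
  show "(\<lambda>w. \<psi> (step_path d T (Suc k) (sample T (Suc k) (stop_path (S w) T)))) \<in> borel_measurable (Ft T)"
    by (rule measurable_compose[OF sample_measurable skor_step_continuous[OF p T]]) (use T in auto)
qed

lemma S_joint_measurable: "(\<lambda>(s, w). S w s i) \<in> borel_measurable (borel \<Otimes>\<^sub>M completion M)"
  by (rule right_cont_measurable) (use S_meas Dsp_coord_right[OF S_Dsp T] in \<open>auto intro: measurable_completion\<close>)

lemma payoff_joint_measurable:
  assumes p: "payoff d T \<phi>"
  shows "(\<lambda>(s, w). \<phi> (clampT T s) (S w)) \<in> borel_measurable (borel \<Otimes>\<^sub>M completion M)"
  by (rule right_cont_measurable)
    (use payoff_clamp_right[OF p S_Dsp T] FS.measurable_F_P[OF payoff_adapted[OF p clampT_in[OF T]]] in auto)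

lemma S_random_time_measurable:
  assumes "\<tau> \<in> borel_measurable (completion M)"
  shows "(\<lambda>w. S w (\<tau> w) i) \<in> borel_measurable (completion M)"
proof -
  have "(\<lambda>w. (\<tau> w, w)) \<in> measurable (completion M) (borel \<Otimes>\<^sub>M completion M)" using assms by simp
  from measurable_compose[OF this S_joint_measurable] show ?thesis by simp
qed

lemma payoff_random_time_measurable:
  assumes p: "payoff d T \<phi>" and \<tau>: "\<tau> \<in> borel_measurable (completion M)" "\<And>w. w \<in> space M \<Longrightarrow> \<tau> w \<in> {0..T}"
  shows "(\<lambda>w. \<phi> (\<tau> w) (S w)) \<in> borel_measurable (completion M)"
proof -
  have "(\<lambda>w. (\<tau> w, w)) \<in> measurable (completion M) (borel \<Otimes>\<^sub>M completion M)" using \<tau> by simp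
  from measurable_compose[OF this payoff_joint_measurable[OF p]]
  have "(\<lambda>w. \<phi> (clampT T (\<tau> w)) (S w)) \<in> borel_measurable (completion M)" by simp
  then show ?thesis using \<tau>(2) by (subst measurable_cong[of _ _ "\<lambda>w. \<phi> (clampT T (\<tau> w)) (S w)"]) auto
qed

end

text \<open>At least \<open>n\<close> successive disjoint moves larger than \<open>e\<close> between
  times of \<open>A\<close>, the recursion splitting off the rightmost one. If for every
  \<open>e\<close> the number of moves is bounded, one-sided limits along \<open>A\<close>
  exist.\<close>

primrec osc :: "real set \<Rightarrow> real \<Rightarrow> (real \<Rightarrow> real) \<Rightarrow> nat \<Rightarrow> real \<Rightarrow> real \<Rightarrow> bool" where
  "osc A e y 0 a b = True"
| "osc A e y (Suc n) a b = (\<exists>s\<in>A. \<exists>t\<in>A. a < s \<and> s < t \<and> t < b \<and> e < \<bar>y s - y t\<bar> \<and> osc A e y n a s)"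

lemma osc_mono: "osc A e y n a b \<Longrightarrow> a' \<le> a \<Longrightarrow> b \<le> b' \<Longrightarrow> A \<subseteq> A' \<Longrightarrow> osc A' e y n a' b'"
proof (induction n arbitrary: b b')
  case (Suc n)
  then obtain s t where "s \<in> A" "t \<in> A" "a < s" "s < t" "t < b" "e < \<bar>y s - y t\<bar>" "osc A e y n a s" by auto
  moreover from this(7) have "osc A' e y n a' s" using Suc by blast
  moreover have "s \<in> A'" "t \<in> A'" "a' < s" "t < b'" using Suc.prems calculation by auto
  ultimately show ?case unfolding osc.simps by blast
qed simp

text \<open>The recursion appends on the right; moves that accumulate at \<open>t\<close> from the
  left have to be prepended, which takes an induction.\<close>

lemma osc_add_left:
  assumes "osc A e y n t b" "s \<in> A" "t \<in> A" "a < s" "s < t" "t < b" "e < \<bar>y s - y t\<bar>"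
  shows "osc A e y (Suc n) a b"
  using assms
proof (induction n arbitrary: b)
  case 0
  then show ?case by auto
next
  case (Suc n)
  then obtain s' t' where "s' \<in> A" "t' \<in> A" "t < s'" "s' < t'" "t' < b" "e < \<bar>y s' - y t'\<bar>" "osc A e y n t s'" by auto
  moreover from this(7) have "osc A e y (Suc n) a s'" using Suc \<open>t < s'\<close> by blast
  moreover have "a < s'" using \<open>t < s'\<close> Suc.prems by simp
  ultimately show ?case unfolding osc.simps(2)[of A e y "Suc n"] by blast
qed

text \<open>If the values were not Cauchy to the right of \<open>t\<close>, there would be moves
  larger than \<open>e\<close> arbitrarily close to \<open>t\<close>. Each leaves room between
  \<open>t\<close> and itself for further ones, so their number would be unbounded.\<close>

lemma osc_right_cauchy:
  assumes "\<not> osc A e y n t b" "t < b" and e: "0 \<le> e"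
  shows "\<exists>\<delta>>0. \<forall>s\<in>A \<inter> {t<..<t+\<delta>}. \<forall>r\<in>A \<inter> {t<..<t+\<delta>}. \<bar>y s - y r\<bar> \<le> e"
proof (rule ccontr)
  assume neg: "\<not> ?thesis"
  have "osc A e y n t b'" if "t < b'" for n b' using that
  proof (induction n arbitrary: b')
    case (Suc n)
    have "\<exists>s\<in>A \<inter> {t<..<t+(b'-t)}. \<exists>r\<in>A \<inter> {t<..<t+(b'-t)}. \<not> \<bar>y s - y r\<bar> \<le> e"
      using neg Suc.prems by (metis diff_gt_0_iff_gt)
    then obtain s r where sr: "s \<in> A" "r \<in> A" "t < s" "t < r" "s < b'" "r < b'" "e < \<bar>y s - y r\<bar>" by auto
    then have "s \<noteq> r" using e by auto
    then consider "s < r" | "r < s" by linarith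
    then show ?case
    proof cases
      case 1
      then show ?thesis unfolding osc.simps using sr Suc.IH[of s] by blast
    next
      case 2
      moreover have "e < \<bar>y r - y s\<bar>" using sr(7) by (simp add: abs_minus_commute)
      ultimately show ?thesis unfolding osc.simps using sr Suc.IH[of r] by blast
    qed
  qed simp
  then show False using assms by blast
qed

lemma osc_left_cauchy:
  assumes "\<not> osc A e y n a t" "a < t" and e: "0 \<le> e"
  shows "\<exists>\<delta>>0. \<forall>s\<in>A \<inter> {t-\<delta><..<t}. \<forall>r\<in>A \<inter> {t-\<delta><..<t}. \<bar>y s - y r\<bar> \<le> e"
proof (rule ccontr)
  assume neg: "\<not> ?thesis"
  have "osc A e y n a' t" if "a' < t" for n a' using that
  proof (induction n arbitrary: a')
    case (Suc n)
    have "\<exists>s\<in>A \<inter> {t-(t-a')<..<t}. \<exists>r\<in>A \<inter> {t-(t-a')<..<t}. \<not> \<bar>y s - y r\<bar> \<le> e"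
      using neg Suc.prems by (metis diff_gt_0_iff_gt)
    then obtain s r where sr: "s \<in> A" "r \<in> A" "a' < s" "a' < r" "s < t" "r < t" "e < \<bar>y s - y r\<bar>" by auto
    then have "s \<noteq> r" using e by auto
    then consider "s < r" | "r < s" by linarith
    then show ?case
    proof cases
      case 1
      show ?thesis by (rule osc_add_left[OF Suc.IH[OF sr(6)] sr(1,2,3) 1 sr(6,7)])
    next
      case 2
      show ?thesis
        by (rule osc_add_left[OF Suc.IH[OF sr(5)] sr(2,1,4) 2 sr(5)]) (use sr in \<open>simp add: abs_minus_commute\<close>)
    qed
  qed simp
  then show False using assms by blast
qed

text \<open>Serves both one-sided limits: \<open>D \<delta>\<close> will be the part of
  \<open>A\<close> within \<delta> to the right, or to the left, of a given time.\<close>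

lemma cauchy_family_limit:
  fixes y :: "'c \<Rightarrow> real"
  assumes ne: "\<And>\<delta>::real. 0 < \<delta> \<Longrightarrow> D \<delta> \<noteq> {}" and mono: "\<And>\<delta> \<delta>'. 0 < \<delta> \<Longrightarrow> \<delta> \<le> \<delta>' \<Longrightarrow> D \<delta> \<subseteq> D \<delta>'"
    and c: "\<And>k. \<exists>\<delta>>0. \<forall>s\<in>D \<delta>. \<forall>r\<in>D \<delta>. \<bar>y s - y r\<bar> \<le> inverse (real (Suc k))"
  shows "\<exists>l. \<forall>e>0. \<exists>\<delta>>0. \<forall>s\<in>D \<delta>. \<bar>y s - l\<bar> \<le> e"
proof -
  have c': "\<exists>\<delta>>0. \<forall>s\<in>D \<delta>. \<forall>r\<in>D \<delta>. \<bar>y s - y r\<bar> < e" if e: "0 < e" for e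
  proof -
    obtain k where k: "inverse (real (Suc k)) < e" using reals_Archimedean[OF e] by blast
    obtain \<delta> where "\<delta> > 0" "\<forall>s\<in>D \<delta>. \<forall>r\<in>D \<delta>. \<bar>y s - y r\<bar> \<le> inverse (real (Suc k))" using c by blast
    then show ?thesis using k by (intro exI[of _ \<delta>]) force
  qed
  have "\<forall>n. \<exists>s. s \<in> D (inverse (real (Suc n)))" using ne by (simp add: ex_in_conv)
  then obtain s where s: "\<And>n. s n \<in> D (inverse (real (Suc n)))" by metis
  have sD: "\<exists>N. \<forall>n\<ge>N. s n \<in> D \<delta>" if "\<delta> > 0" for \<delta>
  proof -
    from reals_Archimedean[OF that] obtain N where N: "inverse (real (Suc N)) < \<delta>" by blast
    show ?thesis
    proof (intro exI[of _ N] allI impI)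
      fix n assume "N \<le> n"
      then have "inverse (real (Suc n)) \<le> inverse (real (Suc N))" by (intro le_imp_inverse_le) auto
      then have "inverse (real (Suc n)) \<le> \<delta>" using N by linarith
      then show "s n \<in> D \<delta>" using s[of n] mono[of "inverse (real (Suc n))" \<delta>] by auto
    qed
  qed
  have "Cauchy (\<lambda>n. y (s n))"
  proof (rule metric_CauchyI)
    fix e :: real assume "0 < e"
    then obtain \<delta> where \<delta>: "\<delta> > 0" "\<forall>s\<in>D \<delta>. \<forall>r\<in>D \<delta>. \<bar>y s - y r\<bar> < e" using c' by blast
    obtain N where "\<forall>n\<ge>N. s n \<in> D \<delta>" using sD[OF \<delta>(1)] by blast
    then show "\<exists>M. \<forall>m\<ge>M. \<forall>n\<ge>M. dist (y (s m)) (y (s n)) < e"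
      using \<delta>(2) by (intro exI[of _ N]) (auto simp: dist_real_def)
  qed
  then obtain l where l: "(\<lambda>n. y (s n)) \<longlonglongrightarrow> l" using Cauchy_convergent convergent_def by blast
  show ?thesis
  proof (rule exI[of _ l], intro allI impI)
    fix e :: real assume "0 < e"
    then obtain \<delta> where \<delta>: "\<delta> > 0" "\<forall>s\<in>D \<delta>. \<forall>r\<in>D \<delta>. \<bar>y s - y r\<bar> < e" using c' by blast
    obtain N where N: "\<forall>n\<ge>N. s n \<in> D \<delta>" using sD[OF \<delta>(1)] by blast
    show "\<exists>\<delta>>0. \<forall>s\<in>D \<delta>. \<bar>y s - l\<bar> \<le> e"
    proof (intro exI[of _ \<delta>] conjI ballI \<delta>(1))
      fix r assume r: "r \<in> D \<delta>"
      have "(\<lambda>n. \<bar>y r - y (s n)\<bar>) \<longlonglongrightarrow> \<bar>y r - l\<bar>" by (intro tendsto_intros l)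
      then show "\<bar>y r - l\<bar> \<le> e"
        by (rule LIMSEQ_le_const2) (use N r \<delta>(2) in \<open>auto intro!: exI[of _ N] less_imp_le\<close>)
    qed
  qed
qed

section \<open>Cadlag versions of bounded martingales\<close>

text \<open>Martingale increments between moves are orthogonal, so the expected number of moves of size
  \<open>e\<close> is at most \<open>E y\<^sup>2 / e\<^sup>2\<close>. This takes the place of the upcrossing inequality.\<close>

primrec greedy :: "real \<Rightarrow> (nat \<Rightarrow> real) \<Rightarrow> nat \<Rightarrow> real" where
  "greedy e y 0 = y 0"
| "greedy e y (Suc i) = (if e < \<bar>y (Suc i) - greedy e y i\<bar> then y (Suc i) else greedy e y i)"

primrec moves :: "real \<Rightarrow> (nat \<Rightarrow> real) \<Rightarrow> nat \<Rightarrow> nat" where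
  "moves e y 0 = 0"
| "moves e y (Suc i) = (if e < \<bar>y (Suc i) - greedy e y i\<bar> then Suc (moves e y i) else moves e y i)"

lemma greedy_close: "0 \<le> e \<Longrightarrow> \<bar>y i - greedy e y i\<bar> \<le> e"
  by (cases i) auto

lemma moves_mono: "i \<le> j \<Longrightarrow> moves e y i \<le> moves e y j"
  by (induction j) (auto simp: le_Suc_eq)

lemma moves_eq_greedy: "i \<le> j \<Longrightarrow> moves e y i = moves e y j \<Longrightarrow> greedy e y i = greedy e y j"
proof (induction j)
  case (Suc j)
  show ?case
  proof (cases "i = Suc j")
    case False
    then have ij: "i \<le> j" using Suc.prems by simp
    have "moves e y i \<le> moves e y j" by (rule moves_mono[OF ij])
    then have "\<not> e < \<bar>y (Suc j) - greedy e y j\<bar>" "moves e y i = moves e y j"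
      using Suc.prems(2) by (auto split: if_splits)
    then show ?thesis using Suc.IH[OF ij] by simp
  qed simp
qed simp

text \<open>Two values more than \<open>2 * e\<close> apart cannot both be within \<open>e\<close>
  of the same reference value, so the greedy reference moves at least once in between. The factor 2
  is the price for working with a reference value.\<close>

lemma osc_le_moves:
  assumes e: "0 \<le> e" and r: "\<And>i j. i < j \<Longrightarrow> j \<le> m \<Longrightarrow> r i < r j"
    and o: "osc (r ` {..m}) (2 * e) y n a b" and j: "j \<le> m" "\<And>i. i \<le> m \<Longrightarrow> r i < b \<Longrightarrow> i \<le> j"
  shows "n \<le> moves e (\<lambda>i. y (r i)) j"
  using o j
proof (induction n arbitrary: b j)
  case (Suc n)
  then obtain i k where ik: "i \<le> m" "k \<le> m" "r i < r k" "r k < b" "2 * e < \<bar>y (r i) - y (r k)\<bar>"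
    "osc (r ` {..m}) (2 * e) y n a (r i)" by auto
  have "i < k" using ik r[of k i] by (metis linorder_neqE_nat not_less_iff_gr_or_eq)
  have "n \<le> moves e (\<lambda>i. y (r i)) i"
  proof (rule Suc.IH[OF ik(6,1)])
    fix i' assume "i' \<le> m" "r i' < r i"
    then show "i' \<le> i" using r[of i i'] ik(1) by (metis not_le not_less_iff_gr_or_eq)
  qed
  moreover have "moves e (\<lambda>i. y (r i)) i \<noteq> moves e (\<lambda>i. y (r i)) k"
  proof
    assume "moves e (\<lambda>i. y (r i)) i = moves e (\<lambda>i. y (r i)) k"
    then have "greedy e (\<lambda>i. y (r i)) i = greedy e (\<lambda>i. y (r i)) k" using moves_eq_greedy \<open>i < k\<close> by (metis less_imp_le)
    then show False using greedy_close[OF e, of "\<lambda>i. y (r i)" i] greedy_close[OF e, of "\<lambda>i. y (r i)" k] ik(5) by linarith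
  qed
  moreover have "moves e (\<lambda>i. y (r i)) i \<le> moves e (\<lambda>i. y (r i)) k" using \<open>i < k\<close> by (intro moves_mono) simp
  moreover have "moves e (\<lambda>i. y (r i)) k \<le> moves e (\<lambda>i. y (r i)) j" using Suc.prems(3)[OF ik(2,4)] by (rule moves_mono)
  ultimately show ?case by linarith
qed simp

context filtered_space
begin

context
  fixes h :: "'a \<Rightarrow> real" and B :: real and Y :: "real \<Rightarrow> 'a \<Rightarrow> real"
  assumes h: "h \<in> borel_measurable P" and hB: "\<And>w. w \<in> space P \<Longrightarrow> \<bar>h w\<bar> \<le> B"
  defines "Y \<equiv> (\<lambda>t w. max (- B) (min B (real_cond_exp P (F t) h w)))"
begin

lemma B_nonneg: "0 \<le> B"
  using hB not_empty by (metis abs_ge_zero all_not_in_conv order_trans)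

lemma h_int: "integrable P h"
  by (rule integrable_const_bound[of _ B]) (use h hB in auto)

lemma Y_F: "Y t \<in> borel_measurable (F t)"
  unfolding Y_def by measurable

lemma Y_P: "Y t \<in> borel_measurable P"
  by (rule measurable_F_P[OF Y_F])

lemma Y_bound: "\<bar>Y t w\<bar> \<le> B"
  using B_nonneg by (auto simp: Y_def)

text \<open>Clipping to \<open>[-B, B]\<close> costs only a null set and makes the bounds on
  \<open>Y\<close> and on the greedy reference hold everywhere.\<close>

lemma Y_AE: "AE w in P. Y t w = real_cond_exp P (F t) h w"
proof -
  have "AE w in P. \<bar>real_cond_exp P (F t) h w\<bar> \<le> B" by (rule cond_exp_bound[OF h]) (use hB in auto)
  then show ?thesis by eventually_elim (auto simp: Y_def)
qed

lemma bounded_int: "f \<in> borel_measurable P \<Longrightarrow> (\<And>w. \<bar>f w\<bar> \<le> (C::real)) \<Longrightarrow> integrable P f"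
  by (rule integrable_const_bound[of _ C]) auto

lemma Y_mult:
  assumes "g \<in> borel_measurable (F t)" "\<And>w. \<bar>g w\<bar> \<le> C"
  shows "(\<integral>w. g w * Y t w \<partial>P) = (\<integral>w. g w * h w \<partial>P)"
proof -
  have "(\<integral>w. g w * Y t w \<partial>P) = (\<integral>w. g w * real_cond_exp P (F t) h w \<partial>P)"
  proof (rule integral_cong_AE)
    show "AE w in P. g w * Y t w = g w * real_cond_exp P (F t) h w" using Y_AE[of t] by eventually_elim simp
  qed (use measurable_F_P[OF assms(1)] Y_P in auto)
  also have "\<dots> = (\<integral>w. g w * h w \<partial>P)" by (rule cond_exp_mult_bounded[OF h_int assms(1)]) (use assms(2) in auto)
  finally show ?thesis .
qed

text \<open>Against a bounded multiplier known at time \<open>s\<close>, both \<open>Y s\<close> and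
  \<open>Y t\<close> integrate like \<open>h\<close> (\<open>Y_mult\<close>); when the squares are
  expanded, the cross terms therefore cancel.\<close>

lemma Y_increment:
  assumes g: "g \<in> borel_measurable (F s)" "\<And>w. \<bar>g w\<bar> \<le> C" and st: "s \<le> t"
  shows "(\<integral>w. (Y t w - g w)\<^sup>2 \<partial>P) = (\<integral>w. (Y s w - g w)\<^sup>2 \<partial>P) + (\<integral>w. (Y t w)\<^sup>2 \<partial>P) - (\<integral>w. (Y s w)\<^sup>2 \<partial>P)"
proof -
  note [measurable] = Y_P measurable_F_P[OF g(1)]
  have i1: "integrable P (\<lambda>w. (Y u w)\<^sup>2)" for u
    by (rule bounded_int[of _ "B\<^sup>2"]) (use Y_bound[of u] B_nonneg in \<open>auto simp: abs_le_square_iff[symmetric]\<close>)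
  have i2: "integrable P (\<lambda>w. g w * Y u w)" for u
    by (rule bounded_int[of _ "C * B"]) (use Y_bound[of u] g(2) in \<open>auto simp: abs_mult intro!: mult_mono intro: order_trans[OF abs_ge_zero]\<close>)
  have i3: "integrable P (\<lambda>w. (g w)\<^sup>2)"
    by (rule bounded_int[of _ "C\<^sup>2"]) (use g(2) in \<open>auto simp: abs_le_square_iff[symmetric] intro: order_trans[OF _ abs_ge_self]\<close>)
  have e: "(\<integral>w. (Y u w - g w)\<^sup>2 \<partial>P) = (\<integral>w. (Y u w)\<^sup>2 \<partial>P) - 2 * (\<integral>w. g w * Y u w \<partial>P) + (\<integral>w. (g w)\<^sup>2 \<partial>P)" for u
  proof -
    have "(\<integral>w. (Y u w - g w)\<^sup>2 \<partial>P) = (\<integral>w. (Y u w)\<^sup>2 - 2 * (g w * Y u w) + (g w)\<^sup>2 \<partial>P)"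
      by (intro Bochner_Integration.integral_cong refl) (simp add: power2_diff algebra_simps)
    then show ?thesis using i1 i2 i3 by simp
  qed
  have "(\<integral>w. g w * Y t w \<partial>P) = (\<integral>w. g w * Y s w \<partial>P)"
    using Y_mult[OF g] Y_mult[OF measurable_F_mono[OF st g(1)] g(2)] by simp
  then show ?thesis using e[of t] e[of s] by simp
qed

lemma greedy_measurable:
  assumes r: "\<And>i j. i \<le> j \<Longrightarrow> j \<le> m \<Longrightarrow> r i \<le> (r j :: real)" and i: "i \<le> m"
  shows "(\<lambda>w. greedy e (\<lambda>i. Y (r i) w) i) \<in> borel_measurable (F (r i))
    \<and> (\<lambda>w. real (moves e (\<lambda>i. Y (r i) w) i)) \<in> borel_measurable P"
  using i
proof (induction i)
  case 0 then show ?case using Y_F by simp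
next
  case (Suc i)
  then have g: "(\<lambda>w. greedy e (\<lambda>i. Y (r i) w) i) \<in> borel_measurable (F (r (Suc i)))"
     and m: "(\<lambda>w. real (moves e (\<lambda>i. Y (r i) w) i)) \<in> borel_measurable P"
    using measurable_F_mono[OF r[of i "Suc i"]] by auto
  note [measurable] = g Y_F[of "r (Suc i)"] m Y_P measurable_F_P[OF g]
  have "(\<lambda>w. greedy e (\<lambda>i. Y (r i) w) (Suc i)) \<in> borel_measurable (F (r (Suc i)))" by simp
  moreover have "(\<lambda>w. if e < \<bar>Y (r (Suc i)) w - greedy e (\<lambda>i. Y (r i) w) i\<bar> then real (moves e (\<lambda>i. Y (r i) w) i) + 1
        else real (moves e (\<lambda>i. Y (r i) w) i)) \<in> borel_measurable P" by measurable
  moreover have "(\<lambda>w. real (moves e (\<lambda>i. Y (r i) w) (Suc i))) = (\<lambda>w. if e < \<bar>Y (r (Suc i)) w - greedy e (\<lambda>i. Y (r i) w) i\<bar> then real (moves e (\<lambda>i. Y (r i) w) i) + 1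
        else real (moves e (\<lambda>i. Y (r i) w) i))" by auto
  ultimately show ?case by simp
qed

lemma greedy_bound: "\<bar>greedy e (\<lambda>i. Y (r i) w) i\<bar> \<le> B"
  by (induction i) (auto intro: Y_bound)

lemma moves_le: "moves e y i \<le> i"
  by (induction i) auto

text \<open>The squared gap to the reference is carried along in the induction. A move resets the
  gap to 0 and so releases at least \<open>e ^ 2\<close>, which pays for the increased count. From
  one time to the next, \<open>Y_increment\<close> with the reference as multiplier converts growth
  of the squared gap into growth of \<open>E Y^2\<close>.\<close>

lemma moves_expectation:
  assumes e: "0 < e" and r: "\<And>i j. i \<le> j \<Longrightarrow> j \<le> m \<Longrightarrow> r i \<le> (r j :: real)" and i: "i \<le> m"
  shows "e\<^sup>2 * (\<integral>w. real (moves e (\<lambda>i. Y (r i) w) i) \<partial>P) + (\<integral>w. (Y (r i) w - greedy e (\<lambda>i. Y (r i) w) i)\<^sup>2 \<partial>P)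
    \<le> (\<integral>w. (Y (r i) w)\<^sup>2 \<partial>P)"
  using i
proof (induction i)
  case 0 then show ?case by simp
next
  case (Suc i)
  let ?C = "\<lambda>i w. real (moves e (\<lambda>i. Y (r i) w) i)" and ?R = "\<lambda>i w. greedy e (\<lambda>i. Y (r i) w) i"
  have i: "i \<le> m" "r i \<le> r (Suc i)" using Suc.prems r by auto
  have Rm: "?R j \<in> borel_measurable (F (r j))" "?C j \<in> borel_measurable P" if "j \<le> m" for j
    using greedy_measurable[where r=r and m=m and e=e, OF r that] by auto
  have intC: "integrable P (?C j)" if "j \<le> m" for j
    by (rule bounded_int[of _ "real j"]) (use Rm(2)[OF that] moves_le in auto)
  have int2: "integrable P (\<lambda>w. (Y u w - ?R j w)\<^sup>2)" if "j \<le> m" for u j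
  proof (rule bounded_int[of _ "(2 * B)\<^sup>2"])
    show "(\<lambda>w. (Y u w - ?R j w)\<^sup>2) \<in> borel_measurable P" using Y_P measurable_F_P[OF Rm(1)[OF that]] by measurable
    fix w
    have "\<bar>Y u w - ?R j w\<bar> \<le> 2 * B" using Y_bound[of u w] greedy_bound[of e r w j] by linarith
    then have "\<bar>Y u w - ?R j w\<bar>\<^sup>2 \<le> (2 * B)\<^sup>2" by (rule power_mono) simp
    then show "\<bar>(Y u w - ?R j w)\<^sup>2\<bar> \<le> (2 * B)\<^sup>2" by simp
  qed
  have "e\<^sup>2 * (\<integral>w. ?C (Suc i) w \<partial>P) + (\<integral>w. (Y (r (Suc i)) w - ?R (Suc i) w)\<^sup>2 \<partial>P)
      = (\<integral>w. e\<^sup>2 * ?C (Suc i) w + (Y (r (Suc i)) w - ?R (Suc i) w)\<^sup>2 \<partial>P)"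
    using intC[OF Suc.prems] int2[OF Suc.prems] by simp
  also have "\<dots> \<le> (\<integral>w. e\<^sup>2 * ?C i w + (Y (r (Suc i)) w - ?R i w)\<^sup>2 \<partial>P)"
  proof (rule integral_mono)
    fix w
    show "e\<^sup>2 * ?C (Suc i) w + (Y (r (Suc i)) w - ?R (Suc i) w)\<^sup>2 \<le> e\<^sup>2 * ?C i w + (Y (r (Suc i)) w - ?R i w)\<^sup>2"
    proof (cases "e < \<bar>Y (r (Suc i)) w - ?R i w\<bar>")
      case True
      then have "e\<^sup>2 \<le> \<bar>Y (r (Suc i)) w - ?R i w\<bar>\<^sup>2" using e by (intro power_mono) auto
      then show ?thesis using True by (simp add: algebra_simps)
    next
      case False then show ?thesis by simp
    qed
  qed (use intC[OF Suc.prems] int2[OF Suc.prems] intC[OF i(1)] int2[OF i(1)] in auto)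
  also have "\<dots> = e\<^sup>2 * (\<integral>w. ?C i w \<partial>P) + (\<integral>w. (Y (r (Suc i)) w - ?R i w)\<^sup>2 \<partial>P)"
    using intC[OF i(1)] int2[OF i(1)] by simp
  also have "(\<integral>w. (Y (r (Suc i)) w - ?R i w)\<^sup>2 \<partial>P)
     = (\<integral>w. (Y (r i) w - ?R i w)\<^sup>2 \<partial>P) + (\<integral>w. (Y (r (Suc i)) w)\<^sup>2 \<partial>P) - (\<integral>w. (Y (r i) w)\<^sup>2 \<partial>P)"
    by (rule Y_increment[OF Rm(1)[OF i(1)] greedy_bound i(2)])
  finally show ?case using Suc.IH[OF i(1)] by linarith
qed

lemma osc_measurable:
  assumes A: "countable A"
  shows "{w\<in>space P. osc A e (\<lambda>q. Y q w) n a b} \<in> sets P"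
proof (induction n arbitrary: b)
  case (Suc n)
  have "{w\<in>space P. osc A e (\<lambda>q. Y q w) (Suc n) a b} =
    (\<Union>s\<in>A. \<Union>t\<in>{t\<in>A. a < s \<and> s < t \<and> t < b}. {w\<in>space P. e < \<bar>Y s w - Y t w\<bar>} \<inter> {w\<in>space P. osc A e (\<lambda>q. Y q w) n a s})"
    by auto
  also have "\<dots> \<in> sets P"
  proof -
    note [measurable] = Y_P
    have "{w\<in>space P. e < \<bar>Y s w - Y t w\<bar>} \<in> sets P" for s t by measurable
    moreover have "countable {t\<in>A. a < s \<and> s < t \<and> t < b}" for s by (rule countable_subset[OF _ A]) auto
    ultimately show ?thesis by (intro sets.countable_UN'' A sets.Int Suc.IH)
  qed
  finally show ?case .
qed simp

text \<open>Markov's inequality for the number of greedy moves along the sorted points of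
  \<open>A\<close>. The bound does not depend on the size of \<open>A\<close>, which permits the
  passage to countable sets.\<close>

lemma osc_prob_finite:
  assumes A: "finite A" and e: "0 < e" and n: "0 < n"
  shows "prob {w\<in>space P. osc A (2 * e) (\<lambda>q. Y q w) n a b} \<le> B\<^sup>2 / (e\<^sup>2 * n)"
proof (cases "A = {}")
  case True
  then obtain n' where "n = Suc n'" using n by (cases n) auto
  then have "{w\<in>space P. osc A (2 * e) (\<lambda>q. Y q w) n a b} = {}" using True by simp
  then show ?thesis by (simp only: measure_empty) simp
next
  case False
  define l where "l = sorted_list_of_set A"
  have l: "set l = A" "sorted l" "distinct l" using A by (auto simp: l_def)
  define m where "m = length l - 1"
  define r where "r i = l ! i" for i
  have len: "length l = Suc m" using l False by (cases l) (auto simp: m_def)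
  have img: "r ` {..m} = A"
    using l(1) len by (auto simp: r_def set_conv_nth less_Suc_eq_le)
  have rs: "r i < r j" if "i < j" "j \<le> m" for i j
    unfolding r_def using l(2,3) that len sorted_wrt_nth_less[of "(<)" l i j] by (simp add: strict_sorted_iff)
  have rm: "r i \<le> r j" if "i \<le> j" "j \<le> m" for i j
    using rs[of i j] that by (cases "i = j") auto
  let ?C = "\<lambda>w. real (moves e (\<lambda>i. Y (r i) w) m)"
  let ?E = "{w\<in>space P. osc A (2 * e) (\<lambda>q. Y q w) n a b}"
  have Cm: "?C \<in> borel_measurable P" using greedy_measurable[where r=r and m=m and e=e, OF rm order_refl] by auto
  have iC: "integrable P ?C" by (rule bounded_int[OF Cm, of "real m"]) (use moves_le in auto)
  have Em: "?E \<in> sets P" by (rule osc_measurable[OF countable_finite[OF A]])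
  have "real n * prob ?E = (\<integral>w. real n * indicator ?E w \<partial>P)" using Em by simp
  also have "\<dots> \<le> (\<integral>w. ?C w \<partial>P)"
  proof (rule integral_mono)
    show "integrable P (\<lambda>w. real n * indicator ?E w)"
      by (intro integrable_mult_right integrable_real_indicator Em) (simp add: emeasure_eq_measure)
    fix w assume "w \<in> space P"
    show "real n * indicator ?E w \<le> ?C w"
    proof (cases "w \<in> ?E")
      case True
      then have "osc (r ` {..m}) (2 * e) (\<lambda>q. Y q w) n a b" by (simp add: img)
      then have "n \<le> moves e (\<lambda>i. Y (r i) w) m"
        using osc_le_moves[of e m r "\<lambda>q. Y q w" n a b m] e rs by simp
      then show ?thesis using True by simp
    qed simp
  qed (rule iC)
  finally have 1: "n * prob ?E \<le> (\<integral>w. ?C w \<partial>P)" .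
  have "0 \<le> (\<integral>w. (Y (r m) w - greedy e (\<lambda>i. Y (r i) w) m)\<^sup>2 \<partial>P)"
    by (intro integral_nonneg_AE) auto
  then have "e\<^sup>2 * (\<integral>w. ?C w \<partial>P) \<le> (\<integral>w. (Y (r m) w)\<^sup>2 \<partial>P)"
    using moves_expectation[where r=r and m=m, OF e rm order_refl] by linarith
  also have "\<dots> \<le> (\<integral>w. B\<^sup>2 \<partial>P)"
  proof (rule integral_mono)
    show Y2: "(Y (r m) w)\<^sup>2 \<le> B\<^sup>2" for w using Y_bound[of "r m" w] B_nonneg by (simp add: abs_le_square_iff[symmetric])
    show "integrable P (\<lambda>w. (Y (r m) w)\<^sup>2)" by (rule bounded_int[of _ "B\<^sup>2"]) (use Y_P Y2 in auto)
  qed simp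
  also have "\<dots> = B\<^sup>2" by (simp add: prob_space)
  finally have "e\<^sup>2 * (\<integral>w. ?C w \<partial>P) \<le> B\<^sup>2" .
  then have "e\<^sup>2 * (n * prob ?E) \<le> B\<^sup>2" using 1 mult_left_mono[OF 1, of "e\<^sup>2"] by simp
  then show ?thesis using e n by (simp add: field_simps)
qed

lemma osc_finite_approx:
  assumes "osc A e y n a b" "A = (\<Union>k. G k)" "incseq G"
  shows "\<exists>k. osc (G k) e y n a b"
  using assms(1)
proof (induction n arbitrary: b)
  case (Suc n)
  then obtain s t where st: "s \<in> A" "t \<in> A" "a < s" "s < t" "t < b" "e < \<bar>y s - y t\<bar>" "osc A e y n a s" by auto
  obtain k1 where "osc (G k1) e y n a s" using Suc.IH[OF st(7)] by blast
  moreover obtain k2 k3 where "s \<in> G k2" "t \<in> G k3" using st assms(2) by blast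
  moreover define k where "k = max k1 (max k2 k3)"
  ultimately have "osc (G k) e y n a s \<and> s \<in> G k \<and> t \<in> G k"
  proof -
    assume o: "osc (G k1) e y n a s" and s: "s \<in> G k2" and t: "t \<in> G k3" and k: "k = max k1 (max k2 k3)"
    have "G k1 \<subseteq> G k" "G k2 \<subseteq> G k" "G k3 \<subseteq> G k" by (auto intro!: incseqD[OF assms(3)] simp: k)
    then show ?thesis using o s t by (auto intro: osc_mono)
  qed
  then show ?case using st by (intro exI[of _ k]) auto
qed simp

text \<open>\<open>A\<close> is exhausted by finite sets. Finitely many moves involve finitely many
  times, so the events increase to the event for \<open>A\<close>.\<close>

lemma osc_prob:
  assumes A: "countable A" and e: "0 < e" and n: "0 < n"
  shows "prob {w\<in>space P. osc A (2 * e) (\<lambda>q. Y q w) n a b} \<le> B\<^sup>2 / (e\<^sup>2 * n)"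
proof (cases "A = {}")
  case True then show ?thesis using osc_prob_finite[OF _ e n, of A] by simp
next
  case False
  define G where "G k = from_nat_into A ` {..k}" for k
  have "(\<Union>k. G k) = range (from_nat_into A)" unfolding G_def by blast
  then have G: "A = (\<Union>k. G k)" using range_from_nat_into[OF False A] by simp
  have inc: "incseq G" by (auto simp: incseq_def G_def)
  let ?E = "\<lambda>A. {w\<in>space P. osc A (2 * e) (\<lambda>q. Y q w) n a b}"
  have "?E A = (\<Union>k. ?E (G k))"
    using osc_finite_approx[OF _ G inc] G by (auto intro: osc_mono)
  moreover have "(\<lambda>k. prob (?E (G k))) \<longlonglongrightarrow> prob (\<Union>k. ?E (G k))"
  proof (rule finite_Lim_measure_incseq)
    show "range (\<lambda>k. ?E (G k)) \<subseteq> sets P"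
      using osc_measurable[of "G _"] by (auto simp: G_def intro: countable_finite)
    show "incseq (\<lambda>k. ?E (G k))" using incseqD[OF inc] by (auto simp: incseq_def intro: osc_mono)
  qed
  ultimately have "(\<lambda>k. prob (?E (G k))) \<longlonglongrightarrow> prob (?E A)" by simp
  then show ?thesis by (rule LIMSEQ_le_const2) (use osc_prob_finite[OF _ e n] in \<open>auto simp: G_def\<close>)
qed

lemma osc_AE:
  assumes A: "countable A" and e: "0 < e"
  shows "AE w in P. \<exists>n. \<not> osc A e (\<lambda>q. Y q w) n a b"
proof -
  let ?E = "\<lambda>n. {w\<in>space P. osc A e (\<lambda>q. Y q w) n a b}"
  define N0 where "N0 = (\<Inter>n. ?E n)"
  have Em: "?E n \<in> sets P" for n by (rule osc_measurable[OF A])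
  have N0m: "N0 \<in> sets P" unfolding N0_def by (intro sets.countable_INT) (use Em in auto)
  have "prob N0 \<le> B\<^sup>2 / ((e/2)\<^sup>2) * inverse (real (Suc n))" for n
  proof -
    have "prob N0 \<le> prob (?E (Suc n))" using Em[of "Suc n"] by (intro finite_measure_mono) (auto simp: N0_def simp del: osc.simps)
    also have "\<dots> \<le> B\<^sup>2 / ((e/2)\<^sup>2 * Suc n)" using osc_prob[OF A, of "e/2" "Suc n" a b] e by simp
    finally show ?thesis by (simp add: field_simps)
  qed
  moreover have "(\<lambda>n. B\<^sup>2 / ((e/2)\<^sup>2) * inverse (real (Suc n))) \<longlonglongrightarrow> 0"
    by (intro tendsto_mult_right_zero LIMSEQ_inverse_real_of_nat)
  ultimately have "prob N0 \<le> 0" by (intro LIMSEQ_le_const) auto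
  then have "prob N0 = 0" using measure_nonneg[of P N0] by linarith
  then have "N0 \<in> null_sets P" using N0m by (simp add: null_sets_def emeasure_eq_measure)
  then show ?thesis by (rule AE_I') (auto simp: N0_def)
qed

text \<open>Outside a null set the clipped conditional expectations make finitely many moves of each
  size along the rationals, hence have one-sided limits there; the version is the right limit.
  Right-continuity of the filtration makes it adapted, and bounded convergence in
  \<open>E[1_E Y_q]\<close> as \<open>q\<close> tends to \<open>t\<close> from the right identifies
  it.\<close>

lemma cadlag_version_exists:
  assumes T: "0 < T"
  shows "\<exists>Z. (\<forall>w\<in>space P. cadlag_real T (\<lambda>t. Z t w)) \<and> (\<forall>t w. \<bar>Z t w\<bar> \<le> B) \<and>
     (\<forall>t\<in>{0..T}. AE w in P. Z t w = real_cond_exp P (F t) h w)"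
proof -
  define A where "A = \<rat> \<inter> {0..T}"
  have Ac: "countable A" unfolding A_def using countable_rat by (intro countable_Int1)
  have Ad: "\<exists>q\<in>A. a < q \<and> q < b" if "0 \<le> a" "a < b" "b \<le> T" for a b
  proof -
    from Rats_dense_in_real[OF that(2)] obtain q where "q \<in> \<rat>" "a < q" "q < b" by blast
    then show ?thesis using that by (intro bexI[of _ q]) (auto simp: A_def)
  qed
  \<comment> \<open>The bounds in \<open>osc\<close> are strict, so the window is widened beyond
    \<open>[0, T]\<close> to keep 0 and \<open>T\<close> usable.\<close>
  define G where "G = {w\<in>space P. \<forall>k. \<exists>n. \<not> osc A (inverse (real (Suc k))) (\<lambda>q. Y q w) n (-1) (T+1)}"
  have GAE: "AE w in P. w \<in> G"
  proof -
    have "AE w in P. \<forall>k. \<exists>n. \<not> osc A (inverse (real (Suc k))) (\<lambda>q. Y q w) n (-1) (T+1)"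
      unfolding AE_all_countable by (intro allI osc_AE[OF Ac]) simp
    then show ?thesis using AE_space by eventually_elim (simp add: G_def)
  qed
  \<comment> \<open>The event refers to all times and yet lies in every \<open>F t\<close>, because
    its complement is null.\<close>
  have Gm: "G \<in> sets (F t)" for t
  proof -
    obtain Nn where Nn: "Nn \<in> null_sets P" "{w\<in>space P. w \<notin> G} \<subseteq> Nn"
      using AE_E[OF GAE] by (metis (mono_tags, lifting) null_setsI)
    have "{w\<in>space P. w \<notin> G} \<in> sets (F t)"
      using Nn complete by (meson F_null null_sets_subset)
    then have "space P - {w\<in>space P. w \<notin> G} \<in> sets (F t)" using space_P_in_F[of t] by (rule sets.Diff[rotated])
    moreover have "space P - {w\<in>space P. w \<notin> G} = G" by (auto simp: G_def)
    ultimately show ?thesis by simp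
  qed
  have no: "\<exists>n. \<not> osc A (inverse (real (Suc k))) (\<lambda>q. Y q w) n a b" if "w \<in> G" "-1 \<le> a" "b \<le> T+1" for k w a b
    using that osc_mono[of A _ "\<lambda>q. Y q w" _ a b "-1" "T+1" A] unfolding G_def by blast
  have R: "\<exists>l. \<forall>e>0. \<exists>\<delta>>0. \<forall>s\<in>A \<inter> {t<..<t+\<delta>}. \<bar>Y s w - l\<bar> \<le> e" if "w \<in> G" "0 \<le> t" "t < T" for w t
  proof (rule cauchy_family_limit)
    show "A \<inter> {t<..<t+\<delta>} \<noteq> {}" if "0 < \<delta>" for \<delta>
      using Ad[of t "min T (t+\<delta>)"] that \<open>0 \<le> t\<close> \<open>t < T\<close> by fastforce
    show "\<exists>\<delta>>0. \<forall>s\<in>A \<inter> {t<..<t+\<delta>}. \<forall>r\<in>A \<inter> {t<..<t+\<delta>}. \<bar>Y s w - Y r w\<bar> \<le> inverse (real (Suc k))" for k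
    proof -
      obtain n where "\<not> osc A (inverse (real (Suc k))) (\<lambda>q. Y q w) n t (T+1)" using no[OF \<open>w \<in> G\<close>, of t "T+1" k] \<open>0 \<le> t\<close> by auto
      from osc_right_cauchy[OF this] show ?thesis using \<open>t < T\<close> by simp
    qed
  qed auto
  have L: "\<exists>l. \<forall>e>0. \<exists>\<delta>>0. \<forall>s\<in>A \<inter> {t-\<delta><..<t}. \<bar>Y s w - l\<bar> \<le> e" if "w \<in> G" "0 < t" "t \<le> T" for w t
  proof (rule cauchy_family_limit)
    show "A \<inter> {t-\<delta><..<t} \<noteq> {}" if "0 < \<delta>" for \<delta>
      using Ad[of "max 0 (t-\<delta>)" t] that \<open>0 < t\<close> \<open>t \<le> T\<close> by fastforce
    show "\<exists>\<delta>>0. \<forall>s\<in>A \<inter> {t-\<delta><..<t}. \<forall>r\<in>A \<inter> {t-\<delta><..<t}. \<bar>Y s w - Y r w\<bar> \<le> inverse (real (Suc k))" for k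
    proof -
      obtain n where "\<not> osc A (inverse (real (Suc k))) (\<lambda>q. Y q w) n (-1) t" using no[OF \<open>w \<in> G\<close>, of "-1" t k] \<open>t \<le> T\<close> by auto
      from osc_left_cauchy[OF this] show ?thesis using \<open>0 < t\<close> by simp
    qed
  qed auto
  define rl where "rl t w = (SOME l. \<forall>e>0. \<exists>\<delta>>0. \<forall>s\<in>A \<inter> {t<..<t+\<delta>}. \<bar>Y s w - l\<bar> \<le> e)" for t w
  have rl: "\<forall>e>0. \<exists>\<delta>>0. \<forall>s\<in>A \<inter> {t<..<t+\<delta>}. \<bar>Y s w - rl t w\<bar> \<le> e" if "w \<in> G" "0 \<le> t" "t < T" for w t
    unfolding rl_def by (rule someI_ex[OF R[OF that]])
  \<comment> \<open>\<open>A\<close> has no times to the right of \<open>T\<close>, so the clipped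
    conditional expectation itself is taken there.\<close>
  define Z where "Z t w = (if w \<in> G \<and> 0 \<le> t then if t < T then rl t w else Y T w else 0)" for t w
  \<comment> \<open>Right limits inherit closeness to \<open>l\<close> from the later times of
    \<open>A\<close>. This one estimate yields right-continuity, left limits and the bound by
    \<open>B\<close>.\<close>
  have near: "\<bar>rl s w - l\<bar> \<le> e" if "w \<in> G" "0 \<le> s" "s < b" "b \<le> T" "\<And>q. q \<in> A \<Longrightarrow> s < q \<Longrightarrow> q < b \<Longrightarrow> \<bar>Y q w - l\<bar> \<le> e" for w s b l e
  proof (rule field_le_epsilon)
    fix \<eta> :: real assume "0 < \<eta>"
    have "s < T" using that(3,4) by simp
    from rl[OF that(1,2) this] \<open>0 < \<eta>\<close>
    obtain \<delta> where \<delta>: "\<delta> > 0" "\<forall>q\<in>A \<inter> {s<..<s+\<delta>}. \<bar>Y q w - rl s w\<bar> \<le> \<eta>" by blast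
    have "\<exists>q\<in>A. s < q \<and> q < min b (s+\<delta>)" using that \<delta>(1) by (intro Ad) auto
    then obtain q where q: "q \<in> A" "s < q" "q < min b (s+\<delta>)" by blast
    then have "\<bar>Y q w - rl s w\<bar> \<le> \<eta>" "\<bar>Y q w - l\<bar> \<le> e" using \<delta>(2) that(5) by auto
    then show "\<bar>rl s w - l\<bar> \<le> e + \<eta>" by linarith
  qed
  have cad: "cadlag_real T (\<lambda>t. Z t w)" for w
  proof (cases "w \<in> G")
    case False
    then have "(\<lambda>t. Z t w) = (\<lambda>t. 0)" by (auto simp: Z_def)
    then show ?thesis by (auto simp: cadlag_real_def)
  next
    case True
    show ?thesis unfolding cadlag_real_def
    proof (intro conjI ballI)
      fix t assume t: "t \<in> {0..<T}"
      show "((\<lambda>t. Z t w) \<longlongrightarrow> Z t w) (at_right t)"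
      proof (rule tendstoI)
        fix e :: real assume "0 < e"
        then have "0 < e/2" by simp
        moreover have "0 \<le> t" "t < T" using t by auto
        ultimately obtain \<delta> where \<delta>: "\<delta> > 0" "\<forall>s\<in>A \<inter> {t<..<t+\<delta>}. \<bar>Y s w - rl t w\<bar> \<le> e/2" using rl[OF True] by blast
        have "eventually (\<lambda>s. s < min T (t+\<delta>)) (at_right t)" using \<delta>(1) t by (intro order_tendstoD(2)[OF tendsto_ident_at]) auto
        moreover have "eventually (\<lambda>s. t < s) (at_right t)" by (auto simp: eventually_at_filter)
        ultimately show "\<forall>\<^sub>F s in at_right t. dist (Z s w) (Z t w) < e"
        proof eventually_elim
          case (elim s)
          have "\<bar>rl s w - rl t w\<bar> \<le> e/2"
            by (rule near[OF True, of s "min T (t+\<delta>)"]) (use elim t \<delta>(2) in auto)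
          then show ?case using elim t True \<open>0 < e\<close> by (simp add: Z_def dist_real_def)
        qed
      qed
    next
      fix t assume t: "t \<in> {0<..T}"
      obtain l where l: "\<forall>e>0. \<exists>\<delta>>0. \<forall>s\<in>A \<inter> {t-\<delta><..<t}. \<bar>Y s w - l\<bar> \<le> e" using L[OF True, of t] t by auto
      have "((\<lambda>t. Z t w) \<longlongrightarrow> l) (at_left t)"
      proof (rule tendstoI)
        fix e :: real assume "0 < e"
        then obtain \<delta> where \<delta>: "\<delta> > 0" "\<forall>s\<in>A \<inter> {t-\<delta><..<t}. \<bar>Y s w - l\<bar> \<le> e/2" using l by (meson half_gt_zero)
        have "eventually (\<lambda>s. max 0 (t-\<delta>) < s) (at_left t)" using \<delta>(1) t by (intro order_tendstoD(1)[OF tendsto_ident_at]) auto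
        moreover have "eventually (\<lambda>s. s < t) (at_left t)" by (auto simp: eventually_at_filter)
        ultimately show "\<forall>\<^sub>F s in at_left t. dist (Z s w) l < e"
        proof eventually_elim
          case (elim s)
          have "\<bar>rl s w - l\<bar> \<le> e/2"
            by (rule near[OF True, of s t]) (use elim t \<delta>(2) in auto)
          then show ?case using elim t True \<open>0 < e\<close> by (simp add: Z_def dist_real_def)
        qed
      qed
      then show "\<exists>l. ((\<lambda>t. Z t w) \<longlongrightarrow> l) (at_left t)" by blast
    qed
  qed
  have rlB: "\<bar>rl t w\<bar> \<le> B" if "w \<in> G" "0 \<le> t" "t < T" for t w
    using near[OF that(1,2,3), of 0 B] Y_bound by simp
  have ZB: "\<bar>Z t w\<bar> \<le> B" for t w using rlB Y_bound B_nonneg by (auto simp: Z_def)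
  \<comment> \<open>One sequence of rational times serves all \<open>w\<close>, which measurability
    of the limit requires; keeping it before \<open>u\<close> makes the limit measurable at time
    \<open>u\<close>.\<close>
  have seq: "\<exists>q. (\<forall>n. q n \<in> A \<and> t < q n \<and> q n < u) \<and> (\<forall>w\<in>G. (\<lambda>n. Y (q n) w) \<longlonglongrightarrow> rl t w)"
    if t: "0 \<le> t" "t < T" "t < u" for t u
  proof -
    have "\<exists>q\<in>A. t < q \<and> q < min (min T u) (t + inverse (real (Suc n)))" for n using t by (intro Ad) auto
    then obtain q where q: "\<And>n. q n \<in> A" "\<And>n. t < q n" "\<And>n. q n < min (min T u) (t + inverse (real (Suc n)))" by metis
    have "(\<lambda>n. Y (q n) w) \<longlonglongrightarrow> rl t w" if "w \<in> G" for w
    proof (rule LIMSEQ_I)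
      fix e :: real assume "0 < e"
      then have "0 < e/2" by simp
      with rl[OF that t(1,2)] obtain \<delta> where \<delta>: "\<delta> > 0" "\<forall>s\<in>A \<inter> {t<..<t+\<delta>}. \<bar>Y s w - rl t w\<bar> \<le> e/2" by blast
      obtain N where N: "inverse (real (Suc N)) < \<delta>" using reals_Archimedean[OF \<delta>(1)] by blast
      show "\<exists>no. \<forall>n\<ge>no. norm (Y (q n) w - rl t w) < e"
      proof (intro exI[of _ N] allI impI)
        fix n assume "N \<le> n"
        then have "inverse (real (Suc n)) \<le> inverse (real (Suc N))" by (intro le_imp_inverse_le) auto
        moreover have "q n < t + inverse (real (Suc n))" using q(3)[of n] by (simp only: min_less_iff_conj)
        ultimately have "q n < t + \<delta>" using N by linarith
        then have "\<bar>Y (q n) w - rl t w\<bar> \<le> e/2" using \<delta>(2) q(1,2)[of n] by simp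
        then show "norm (Y (q n) w - rl t w) < e" using \<open>0 < e\<close> by simp
      qed
    qed
    then show ?thesis using q by (intro exI[of _ q]) auto
  qed
  have ver: "AE w in P. Z t w = real_cond_exp P (F t) h w" if t: "t \<in> {0..T}" for t
  proof (cases "t = T")
    case True
    show ?thesis using GAE Y_AE[of T] by eventually_elim (use True T in \<open>simp add: Z_def\<close>)
  next
    case False
    then have tT: "0 \<le> t" "t < T" using t by auto
    have Zm: "Z t \<in> borel_measurable (F t)"
    proof (rule measurable_F_right)
      fix u assume "t < u"
      then obtain q where q: "\<And>n. q n < u" "\<And>w. w \<in> G \<Longrightarrow> (\<lambda>n. Y (q n) w) \<longlonglongrightarrow> rl t w" using seq[OF tT] by blast
      show "Z t \<in> borel_measurable (F u)"
      proof (rule borel_measurable_LIMSEQ_real[where u="\<lambda>n w. Y (q n) w * indicator G w"])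
        show "(\<lambda>n. Y (q n) w * indicator G w) \<longlonglongrightarrow> Z t w" for w
          using q(2)[of w] tT by (cases "w \<in> G") (auto simp: Z_def)
        show "(\<lambda>w. Y (q n) w * indicator G w) \<in> borel_measurable (F u)" for n
          using measurable_F_mono[OF less_imp_le[OF q(1)] Y_F, of n] Gm by measurable
      qed
    qed
    obtain q where q: "\<And>n. t < q n" "\<And>w. w \<in> G \<Longrightarrow> (\<lambda>n. Y (q n) w) \<longlonglongrightarrow> rl t w" using seq[OF tT tT(2)] by blast
    have "AE w in P. real_cond_exp P (F t) h w = Z t w"
    proof (rule FS.real_cond_exp_charact[OF _ h_int _ Zm])
      show "integrable P (Z t)" by (rule bounded_int[OF measurable_F_P[OF Zm] ZB])
      fix E assume E: "E \<in> sets (F t)"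
      have EP: "E \<in> sets P" using E sets_F by auto
      have c: "(\<integral>w. indicator E w * Y (q n) w \<partial>P) = (\<integral>w. indicator E w * h w \<partial>P)" for n
      proof (rule Y_mult[of _ _ 1])
        have "E \<in> sets (F (q n))" using E F_mono[OF less_imp_le[OF q(1)]] by auto
        then show "(indicator E :: 'a \<Rightarrow> real) \<in> borel_measurable (F (q n))" by simp
      qed (simp add: indicator_def)
      have "(\<lambda>n. \<integral>w. indicator E w * Y (q n) w \<partial>P) \<longlonglongrightarrow> (\<integral>w. indicator E w * Z t w \<partial>P)"
      proof (rule integral_dominated_convergence[where w="\<lambda>_. B"])
        show "AE w in P. (\<lambda>n. indicator E w * Y (q n) w) \<longlonglongrightarrow> indicator E w * Z t w"
          using GAE by eventually_elim (use q(2) tT in \<open>auto simp: Z_def intro!: tendsto_mult\<close>)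
        show "AE w in P. norm (indicator E w * Y (q n) w) \<le> B" for n
          using Y_bound B_nonneg by (auto simp: indicator_def)
      qed (use Y_P measurable_F_P[OF Zm] EP in auto)
      then have "(\<integral>w. indicator E w * h w \<partial>P) = (\<integral>w. indicator E w * Z t w \<partial>P)"
        unfolding c by (simp add: LIMSEQ_const_iff)
      then show "(LINT w:E|P. h w) = (LINT w:E|P. Z t w)" by (simp add: set_lebesgue_integral_def)
    qed
    then show ?thesis by eventually_elim simp
  qed
  show ?thesis using cad ZB ver by blast
qed

end

text \<open>\<open>Y_increment\<close> with the earlier value as multiplier, carried over from the
  clipped version.\<close>

lemma cond_exp_L2_increment:
  assumes h: "h \<in> borel_measurable P" and hB: "\<And>w. w \<in> space P \<Longrightarrow> \<bar>h w\<bar> \<le> B" and st: "s \<le> t"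
  shows "(\<integral>w. (real_cond_exp P (F t) h w - real_cond_exp P (F s) h w)\<^sup>2 \<partial>P)
    = (\<integral>w. (real_cond_exp P (F t) h w)\<^sup>2 \<partial>P) - (\<integral>w. (real_cond_exp P (F s) h w)\<^sup>2 \<partial>P)"
proof -
  let ?Y = "\<lambda>t w. max (- B) (min B (real_cond_exp P (F t) h w))"
  note ae = Y_AE[OF h hB] and [measurable] = borel_measurable_cond_exp2
  have "(\<integral>w. (real_cond_exp P (F t) h w - real_cond_exp P (F s) h w)\<^sup>2 \<partial>P) = (\<integral>w. (?Y t w - ?Y s w)\<^sup>2 \<partial>P)"
    using ae[of t] ae[of s] by (intro integral_cong_AE) (auto elim: eventually_elim2)
  also have "\<dots> = (\<integral>w. (?Y t w)\<^sup>2 \<partial>P) - (\<integral>w. (?Y s w)\<^sup>2 \<partial>P)"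
    using Y_increment[OF h hB Y_F[OF h hB, of s] Y_bound[OF h hB] st] by simp
  also have "\<dots> = (\<integral>w. (real_cond_exp P (F t) h w)\<^sup>2 \<partial>P) - (\<integral>w. (real_cond_exp P (F s) h w)\<^sup>2 \<partial>P)"
  proof -
    have "(\<integral>w. (?Y u w)\<^sup>2 \<partial>P) = (\<integral>w. (real_cond_exp P (F u) h w)\<^sup>2 \<partial>P)" for u
      using ae[of u] by (intro integral_cong_AE) (auto elim: eventually_mono)
    then show ?thesis by simp
  qed
  finally show ?thesis .
qed

lemma cond_exp_L2_mono:
  assumes h: "h \<in> borel_measurable P" and hB: "\<And>w. w \<in> space P \<Longrightarrow> \<bar>h w\<bar> \<le> B" and st: "s \<le> t"
  shows "(\<integral>w. (real_cond_exp P (F s) h w)\<^sup>2 \<partial>P) \<le> (\<integral>w. (real_cond_exp P (F t) h w)\<^sup>2 \<partial>P)"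
proof -
  have "0 \<le> (\<integral>w. (real_cond_exp P (F t) h w - real_cond_exp P (F s) h w)\<^sup>2 \<partial>P)" by (intro integral_nonneg_AE) auto
  then show ?thesis using cond_exp_L2_increment[OF h hB st] by simp
qed

text \<open>Nonnegativity of the variance bounds the L1 norm by the L2 norm. Increments are thereby
  controlled by a nondecreasing function of time, which is what carries estimates for averages over
  to fixed times.\<close>

lemma cond_exp_L1_increment:
  assumes h: "h \<in> borel_measurable P" and hB: "\<And>w. w \<in> space P \<Longrightarrow> \<bar>h w\<bar> \<le> B" and st: "s \<le> t"
  shows "(\<integral>w. \<bar>real_cond_exp P (F t) h w - real_cond_exp P (F s) h w\<bar> \<partial>P)
    \<le> sqrt ((\<integral>w. (real_cond_exp P (F t) h w)\<^sup>2 \<partial>P) - (\<integral>w. (real_cond_exp P (F s) h w)\<^sup>2 \<partial>P))"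
proof -
  let ?D = "\<lambda>w. \<bar>real_cond_exp P (F t) h w - real_cond_exp P (F s) h w\<bar>"
  have Dm: "?D \<in> borel_measurable P" using borel_measurable_cond_exp2 by measurable
  have DB: "AE w in P. ?D w \<le> 2 * B"
    using cond_exp_bound[OF h, of B t] cond_exp_bound[OF h, of B s] hB
    by (auto elim!: eventually_elim2)
  have i1: "integrable P ?D" by (rule integrable_const_bound[of _ "2 * B"]) (use Dm DB in auto)
  have i2: "integrable P (\<lambda>w. (?D w)\<^sup>2)"
  proof (rule integrable_const_bound[of _ "(2 * B)\<^sup>2"])
    show "AE w in P. norm ((?D w)\<^sup>2) \<le> (2 * B)\<^sup>2" using DB
    proof eventually_elim
      case (elim w)
      then have "(?D w)\<^sup>2 \<le> (2 * B)\<^sup>2" by (rule power_mono) simp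
      then show ?case by simp
    qed
  qed (use Dm in measurable)
  have "0 \<le> variance ?D" by (intro integral_nonneg_AE) auto
  then have "(expectation ?D)\<^sup>2 \<le> expectation (\<lambda>w. (?D w)\<^sup>2)" using variance_eq[OF i1 i2] by simp
  then have "expectation ?D \<le> sqrt (expectation (\<lambda>w. (?D w)\<^sup>2))" by (rule real_le_rsqrt)
  then show ?thesis using cond_exp_L2_increment[OF h hB st] by simp
qed

end

section \<open>L1-approximation by continuous functionals of the path\<close>

definition clip :: "real \<Rightarrow> real \<Rightarrow> real" where
  "clip B x = max (- B) (min B x)"

lemma clip_bound: "0 \<le> B \<Longrightarrow> \<bar>clip B x\<bar> \<le> B"
  by (auto simp: clip_def)

lemma clip_eq: "\<bar>x\<bar> \<le> B \<Longrightarrow> clip B x = x"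
  by (auto simp: clip_def)

lemma clip_Lipschitz: "\<bar>clip B x - clip B y\<bar> \<le> \<bar>x - y\<bar>"
  by (auto simp: clip_def)

lemma clip_continuous: "continuous_on A f \<Longrightarrow> continuous_on A (\<lambda>x. clip B (f x))"
  unfolding clip_def by (intro continuous_intros)

lemma sbc_bound: "skor_bounded_continuous d T \<psi> \<Longrightarrow> \<exists>B\<ge>0. \<forall>x\<in>Dsp d T. \<bar>\<psi> x\<bar> \<le> B"
  unfolding skor_bounded_continuous_def by (meson abs_ge_zero linear order_trans)

lemma sbc_cont: "skor_bounded_continuous d T \<psi> \<Longrightarrow> skor_continuous d T \<psi>"
  unfolding skor_bounded_continuous_def by blast

lemma skor_continuous_compose2:
  assumes "skor_continuous d T \<psi>1" "skor_continuous d T \<psi>2" "continuous_on UNIV (\<lambda>(a, b). k a b)"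
  shows "skor_continuous d T (\<lambda>x. k (\<psi>1 x) (\<psi>2 x) :: real)"
  unfolding skor_continuous_def
proof (intro allI impI)
  fix xs x assume a: "\<forall>n. xs n \<in> Dsp d T" "x \<in> Dsp d T" "skor_conv d T xs x"
  have "(\<lambda>n. (\<psi>1 (xs n), \<psi>2 (xs n))) \<longlonglongrightarrow> (\<psi>1 x, \<psi>2 x)"
    using assms(1,2) a unfolding skor_continuous_def by (intro tendsto_Pair) blast+
  from continuous_on_tendsto_compose[OF assms(3) this]
  show "(\<lambda>n. k (\<psi>1 (xs n)) (\<psi>2 (xs n))) \<longlonglongrightarrow> k (\<psi>1 x) (\<psi>2 x)" by simp
qed

lemma skor_continuous_const: "skor_continuous d T (\<lambda>_. c)"
  by (simp add: skor_continuous_def)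

lemma sbc_const: "skor_bounded_continuous d T (\<lambda>_. c)"
  unfolding skor_bounded_continuous_def using skor_continuous_const by blast

lemma sbc_Lipschitz2:
  assumes 1: "skor_bounded_continuous d T \<psi>1" and 2: "skor_bounded_continuous d T \<psi>2"
    and c: "continuous_on UNIV (\<lambda>(a, b). k a b)"
    and L: "\<And>a b a' b'. \<bar>k a b - k a' b'\<bar> \<le> L * (\<bar>a - a'\<bar> + \<bar>b - b'\<bar>)"
  shows "skor_bounded_continuous d T (\<lambda>x. k (\<psi>1 x) (\<psi>2 x) :: real)"
proof -
  obtain B1 B2 where B: "\<forall>x\<in>Dsp d T. \<bar>\<psi>1 x\<bar> \<le> B1" "\<forall>x\<in>Dsp d T. \<bar>\<psi>2 x\<bar> \<le> B2"
    using sbc_bound[OF 1] sbc_bound[OF 2] by blast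
  have "\<bar>k (\<psi>1 x) (\<psi>2 x)\<bar> \<le> \<bar>k 0 0\<bar> + \<bar>L\<bar> * (B1 + B2)" if x: "x \<in> Dsp d T" for x
  proof -
    have "\<bar>k (\<psi>1 x) (\<psi>2 x) - k 0 0\<bar> \<le> L * (\<bar>\<psi>1 x\<bar> + \<bar>\<psi>2 x\<bar>)" using L[of "\<psi>1 x" "\<psi>2 x" 0 0] by simp
    also have "\<dots> \<le> \<bar>L\<bar> * (\<bar>\<psi>1 x\<bar> + \<bar>\<psi>2 x\<bar>)" by (intro mult_right_mono) auto
    also have "\<dots> \<le> \<bar>L\<bar> * (B1 + B2)" using B x by (intro mult_left_mono add_mono) auto
    finally show ?thesis by linarith
  qed
  then show ?thesis unfolding skor_bounded_continuous_def
    using skor_continuous_compose2[OF sbc_cont[OF 1] sbc_cont[OF 2] c] by blast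
qed

lemma unif_avg_le:
  assumes pq: "p < q" and m: "(\<lambda>s. h (c s)) \<in> borel_measurable borel" and b: "\<And>s. \<bar>h s\<bar> \<le> (B::real)"
    and le: "\<And>s. s \<in> {p..q} \<Longrightarrow> h (c s) \<le> v"
  shows "(\<integral>s. h (c s) \<partial>unif p q) \<le> v"
proof -
  interpret prob_space "unif p q" by (rule prob_space_unif[OF pq])
  have "(\<integral>s. h (c s) \<partial>unif p q) \<le> (\<integral>s. v \<partial>unif p q)"
    using AE_unif_in[OF pq] unif_integral_bound(1)[OF pq m b] le
    by (intro integral_mono_AE) (auto elim: eventually_mono)
  then show ?thesis using prob_space by simp
qed

lemma unif_avg_ge:
  assumes pq: "p < q" and m: "(\<lambda>s. h (c s)) \<in> borel_measurable borel" and b: "\<And>s. \<bar>h s\<bar> \<le> (B::real)"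
    and le: "\<And>s. s \<in> {p..q} \<Longrightarrow> v \<le> h (c s)"
  shows "v \<le> (\<integral>s. h (c s) \<partial>unif p q)"
proof -
  interpret prob_space "unif p q" by (rule prob_space_unif[OF pq])
  have "(\<integral>s. v \<partial>unif p q) \<le> (\<integral>s. h (c s) \<partial>unif p q)"
    using AE_unif_in[OF pq] unif_integral_bound(1)[OF pq m b] le
    by (intro integral_mono_AE) (auto elim: eventually_mono)
  then show ?thesis using prob_space by simp
qed

lemma unif_avg_right_limit:
  fixes h :: "real \<Rightarrow> real"
  assumes m: "h \<in> borel_measurable borel" and b: "\<And>u. \<bar>h u\<bar> \<le> B" and r: "(h \<longlongrightarrow> h s) (at_right s)"
  shows "(\<lambda>j. \<integral>u. h u \<partial>unif s (s + inverse (real (Suc j)))) \<longlonglongrightarrow> h s"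
proof (rule LIMSEQ_I)
  fix e :: real assume e: "0 < e"
  have "eventually (\<lambda>u. dist (h u) (h s) < e/2) (at_right s)" using e by (intro tendstoD[OF r]) auto
  then obtain c where c: "c > s" "\<And>u. s < u \<Longrightarrow> u < c \<Longrightarrow> dist (h u) (h s) < e/2"
    by (auto simp: eventually_at_right[of s "s+1"])
  obtain N where N: "inverse (real (Suc N)) < c - s" using reals_Archimedean[of "c - s"] c(1) by auto
  show "\<exists>no. \<forall>j\<ge>no. norm ((\<integral>u. h u \<partial>unif s (s + inverse (real (Suc j)))) - h s) < e"
  proof (intro exI[of _ N] allI impI)
    fix j assume "N \<le> j"
    then have "inverse (real (Suc j)) \<le> inverse (real (Suc N))" by (intro le_imp_inverse_le) auto
    then have jc: "s + inverse (real (Suc j)) < c" using N by linarith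
    have ss: "s < s + inverse (real (Suc j))" by simp
    have cl: "h s - e/2 \<le> h u" "h u \<le> h s + e/2" if "u \<in> {s..s + inverse (real (Suc j))}" for u
    proof -
      have "\<bar>h u - h s\<bar> \<le> e/2"
      proof (cases "u = s")
        case False then show ?thesis using c(2)[of u] jc that by (auto simp: dist_real_def)
      qed (use e in simp)
      then show "h s - e/2 \<le> h u" "h u \<le> h s + e/2" by linarith+
    qed
    have "(\<integral>u. h u \<partial>unif s (s + inverse (real (Suc j)))) \<le> h s + e/2"
      by (rule unif_avg_le[where c="\<lambda>u. u", OF ss _ b]) (use m cl in auto)
    moreover have "h s - e/2 \<le> (\<integral>u. h u \<partial>unif s (s + inverse (real (Suc j))))"
      by (rule unif_avg_ge[where c="\<lambda>u. u", OF ss _ b]) (use m cl in auto)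
    ultimately show "norm ((\<integral>u. h u \<partial>unif s (s + inverse (real (Suc j)))) - h s) < e" using e by (simp add: abs_le_iff abs_less_iff) 
  qed
qed

context cadlag_proc
begin

lemma sbc_integrable:
  assumes "skor_bounded_continuous d T \<psi>"
  shows "(\<lambda>w. \<psi> (S w)) \<in> borel_measurable (completion M)" "integrable (completion M) (\<lambda>w. \<psi> (S w))"
proof -
  show m: "(\<lambda>w. \<psi> (S w)) \<in> borel_measurable (completion M)"
    by (rule FS.measurable_F_P[OF skor_continuous_measurable[OF sbc_cont[OF assms]]])
  obtain B where "\<forall>x\<in>Dsp d T. \<bar>\<psi> x\<bar> \<le> B" using sbc_bound[OF assms] by blast
  then show "integrable (completion M) (\<lambda>w. \<psi> (S w))"
    using S_Dsp by (intro FS.integrable_const_bound[of _ B] m) auto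
qed

text \<open>The L1-closure of the bounded Skorohod continuous functionals of the path. That it
  contains every integrable variable of the filtration is what allows events of the limit process to
  be carried back to the approximating ones.\<close>

definition approximable :: "('a \<Rightarrow> real) \<Rightarrow> bool" where
  "approximable X \<longleftrightarrow> integrable (completion M) X \<and>
    (\<forall>\<epsilon>>0. \<exists>\<psi>. skor_bounded_continuous d T \<psi> \<and> (\<integral>w. \<bar>X w - \<psi> (S w)\<bar> \<partial>completion M) < \<epsilon>)"

lemma approximable_psi: "skor_bounded_continuous d T \<psi> \<Longrightarrow> approximable (\<lambda>w. \<psi> (S w))"
  unfolding approximable_def using sbc_integrable(2) by (intro conjI allI impI exI[of _ \<psi>]) auto

lemma approximable_closed:
  assumes i: "integrable (completion M) X"
    and a: "\<And>\<epsilon>. 0 < \<epsilon> \<Longrightarrow> \<exists>X'. approximable X' \<and> (\<integral>w. \<bar>X w - X' w\<bar> \<partial>completion M) < \<epsilon>"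
  shows "approximable X"
  unfolding approximable_def
proof (intro conjI i allI impI)
  fix \<epsilon> :: real assume "0 < \<epsilon>"
  then have e2: "0 < \<epsilon>/2" by simp
  obtain X' where X': "approximable X'" "(\<integral>w. \<bar>X w - X' w\<bar> \<partial>completion M) < \<epsilon>/2" using a[OF e2] by blast
  then obtain \<psi> where \<psi>: "skor_bounded_continuous d T \<psi>" "(\<integral>w. \<bar>X' w - \<psi> (S w)\<bar> \<partial>completion M) < \<epsilon>/2"
    using e2 unfolding approximable_def by blast
  have i': "integrable (completion M) X'" using X' by (simp add: approximable_def)
  note ip = sbc_integrable(2)[OF \<psi>(1)]
  have "(\<integral>w. \<bar>X w - \<psi> (S w)\<bar> \<partial>completion M) \<le> (\<integral>w. \<bar>X w - X' w\<bar> + \<bar>X' w - \<psi> (S w)\<bar> \<partial>completion M)"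
    using i i' ip by (intro integral_mono) auto
  also have "\<dots> < \<epsilon>" using X'(2) \<psi>(2) i i' ip by simp
  finally show "\<exists>\<psi>. skor_bounded_continuous d T \<psi> \<and> (\<integral>w. \<bar>X w - \<psi> (S w)\<bar> \<partial>completion M) < \<epsilon>" using \<psi>(1) by blast
qed

lemma approximable_Lipschitz2:
  assumes X: "approximable X" and Y: "approximable Y"
    and c: "continuous_on UNIV (\<lambda>(a, b). k a b)"
    and L: "\<And>a b a' b'. \<bar>k a b - k a' b'\<bar> \<le> L * (\<bar>a - a'\<bar> + \<bar>b - b'\<bar>)" "0 < L"
  shows "approximable (\<lambda>w. k (X w) (Y w))"
  unfolding approximable_def
proof (intro conjI allI impI)
  have iX: "integrable (completion M) X" and iY: "integrable (completion M) Y" using X Y by (auto simp: approximable_def)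
  have "(\<lambda>w. (X w, Y w)) \<in> borel_measurable (completion M)" using iX iY by (intro borel_measurable_Pair) auto
  from measurable_compose[OF this borel_measurable_continuous_onI[OF c]]
  have m: "(\<lambda>w. k (X w) (Y w)) \<in> borel_measurable (completion M)" by simp
  have "integrable (completion M) (\<lambda>w. \<bar>k 0 0\<bar> + L * (\<bar>X w\<bar> + \<bar>Y w\<bar>))" using iX iY by simp
  then show i: "integrable (completion M) (\<lambda>w. k (X w) (Y w))"
  proof (rule Bochner_Integration.integrable_bound[OF _ m], intro AE_I2)
    fix w
    show "norm (k (X w) (Y w)) \<le> norm (\<bar>k 0 0\<bar> + L * (\<bar>X w\<bar> + \<bar>Y w\<bar>))"
      using L(1)[of "X w" "Y w" 0 0] L(2) by simp
  qed
  fix \<epsilon> :: real assume "0 < \<epsilon>"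
  then have e: "0 < \<epsilon> / (2 * L)" using L(2) by simp
  obtain \<psi>1 \<psi>2 where p: "skor_bounded_continuous d T \<psi>1" "(\<integral>w. \<bar>X w - \<psi>1 (S w)\<bar> \<partial>completion M) < \<epsilon> / (2 * L)"
    "skor_bounded_continuous d T \<psi>2" "(\<integral>w. \<bar>Y w - \<psi>2 (S w)\<bar> \<partial>completion M) < \<epsilon> / (2 * L)"
    using X Y e unfolding approximable_def by blast
  have s: "skor_bounded_continuous d T (\<lambda>x. k (\<psi>1 x) (\<psi>2 x))" by (rule sbc_Lipschitz2[OF p(1,3) c L(1)])
  note ii = sbc_integrable(2)[OF s] sbc_integrable(2)[OF p(1)] sbc_integrable(2)[OF p(3)]
  have "(\<integral>w. \<bar>k (X w) (Y w) - k (\<psi>1 (S w)) (\<psi>2 (S w))\<bar> \<partial>completion M)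
     \<le> (\<integral>w. L * (\<bar>X w - \<psi>1 (S w)\<bar> + \<bar>Y w - \<psi>2 (S w)\<bar>) \<partial>completion M)"
    using i iX iY ii by (intro integral_mono L(1)) auto
  also have "\<dots> = L * ((\<integral>w. \<bar>X w - \<psi>1 (S w)\<bar> \<partial>completion M) + (\<integral>w. \<bar>Y w - \<psi>2 (S w)\<bar> \<partial>completion M))"
    using iX iY ii by simp
  also have "\<dots> < L * (\<epsilon> / (2 * L) + \<epsilon> / (2 * L))" using p L(2) by (intro mult_strict_left_mono add_strict_mono)
  also have "\<dots> = \<epsilon>" using L(2) by (simp add: field_simps)
  finally show "\<exists>\<psi>. skor_bounded_continuous d T \<psi> \<and> (\<integral>w. \<bar>k (X w) (Y w) - \<psi> (S w)\<bar> \<partial>completion M) < \<epsilon>"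
    using s by blast
qed

lemma approximable_AE:
  assumes X: "approximable X" and e: "AE w in completion M. X w = Y w" and m: "Y \<in> borel_measurable (completion M)"
  shows "approximable Y"
proof -
  have iX: "integrable (completion M) X" using X by (auto simp: approximable_def)
  have "integrable (completion M) Y" using iX e m by (subst integrable_cong_AE[of _ _ X]) (auto elim: eventually_mono)
  moreover have "(\<integral>w. \<bar>Y w - \<psi> (S w)\<bar> \<partial>completion M) = (\<integral>w. \<bar>X w - \<psi> (S w)\<bar> \<partial>completion M)"
    if "skor_bounded_continuous d T \<psi>" for \<psi>
    using e m iX sbc_integrable(1)[OF that] by (intro integral_cong_AE) (auto elim: eventually_mono)
  ultimately show ?thesis using X unfolding approximable_def by metis
qed

text \<open>Two limits: the indicator is the limit of the ramps \<open>K n\<close>, and each ramp at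
  time \<open>s\<close> is, by right-continuity, the limit of its averages just after
  \<open>s\<close>, which are continuous functionals.\<close>

lemma approximable_coord_gt: "approximable (indicator {w\<in>space M. c < S w s i})"
proof (cases "i < d")
  case False
  have "S w s i = 0" if "w \<in> space M" for w using Dsp_Rm[OF S_Dsp[OF that], of s] False by (simp add: Rm_def)
  then have "{w\<in>space M. c < S w s i} = {} \<or> {w\<in>space M. c < S w s i} = space M" by force
  then show ?thesis
  proof
    assume *: "{w\<in>space M. c < S w s i} = {}"
    show ?thesis unfolding * using approximable_psi[OF sbc_const[of d T 0]] by (simp add: indicator_def[abs_def])
  next
    assume *: "{w\<in>space M. c < S w s i} = space M"
    show ?thesis unfolding * by (rule approximable_AE[OF approximable_psi[OF sbc_const[of d T 1]]])
      (use sets.top[of "completion M"] in \<open>auto intro!: borel_measurable_indicator\<close>)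
  qed
next
  case True
  have pm: "{w\<in>space M. c < S w s i} \<in> sets (completion M)"
    using S_meas[of s i] by (intro sets_completionI_sets) measurable
  define K where "K n v = min 1 (max 0 (real n * (v - c)))" for n :: nat and v :: real
  have Kc: "continuous_on UNIV (\<lambda>(v, w::real). K n v)" for n
    unfolding K_def case_prod_beta by (intro continuous_intros)
  have Kb: "\<bar>K n v\<bar> \<le> 1" for n v by (auto simp: K_def)
  have K1: "approximable (\<lambda>w. K n (S w s i))" for n
  proof (rule approximable_closed)
    have m: "(\<lambda>w. K n (S w s i)) \<in> borel_measurable (completion M)"
      unfolding K_def using measurable_completion[OF S_meas[of s i]] by measurable
    show i1: "integrable (completion M) (\<lambda>w. K n (S w s i))"
      using Kb by (intro FS.integrable_const_bound[of _ 1] m) auto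
    fix \<epsilon> :: real assume "0 < \<epsilon>"
    define X where "X j w = (\<integral>u. K n (S w u i) \<partial>unif s (s + inverse (real (Suc j))))" for j w
    have sb: "skor_bounded_continuous d T (\<lambda>x. \<integral>u. K n (x u i) \<partial>unif s (s + inverse (real (Suc j))))" for j
      using skor_continuous_avg[OF T _ True Kc Kb skor_continuous_const, of s "s + inverse (real (Suc j))"] by simp
    have aX: "approximable (X j)" for j unfolding X_def by (rule approximable_psi[OF sb])
    have Km: "(\<lambda>u. K n (S w u i)) \<in> borel_measurable borel" if "w \<in> space M" for w
      unfolding K_def using Dsp_coord_measurable[OF S_Dsp[OF that] T, of i] by measurable
    have lim: "(\<lambda>j. X j w) \<longlonglongrightarrow> K n (S w s i)" if w: "w \<in> space M" for w
      unfolding X_def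
    proof (rule unif_avg_right_limit[OF Km[OF w] Kb])
      have "isCont (K n) (S w s i)" unfolding K_def by (intro continuous_intros)
      then show "((\<lambda>u. K n (S w u i)) \<longlongrightarrow> K n (S w s i)) (at_right s)"
        by (rule isCont_tendsto_compose[OF _ Dsp_coord_right[OF S_Dsp[OF w] T]])
    qed
    have "(\<lambda>j. \<integral>w. \<bar>K n (S w s i) - X j w\<bar> \<partial>completion M) \<longlonglongrightarrow> (\<integral>w. \<bar>K n (S w s i) - K n (S w s i)\<bar> \<partial>completion M)"
    proof (rule integral_dominated_convergence[where w="\<lambda>_. 2"])
      show "AE w in completion M. (\<lambda>j. \<bar>K n (S w s i) - X j w\<bar>) \<longlonglongrightarrow> \<bar>K n (S w s i) - K n (S w s i)\<bar>"
        using lim by (intro AE_I2 tendsto_intros) auto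
      show "AE w in completion M. norm \<bar>K n (S w s i) - X j w\<bar> \<le> 2" for j
      proof (rule AE_I2)
        fix w assume "w \<in> space (completion M)"
        then have "\<bar>X j w\<bar> \<le> 1" unfolding X_def by (intro unif_integral_bound(2)[OF _ Km Kb]) simp_all
        then show "norm \<bar>K n (S w s i) - X j w\<bar> \<le> 2" using Kb[of n "S w s i"] by simp
      qed
      show "(\<lambda>w. \<bar>K n (S w s i) - X j w\<bar>) \<in> borel_measurable (completion M)" for j
        using m sbc_integrable(1)[OF sb] by (simp add: X_def)
    qed auto
    then have "(\<lambda>j. \<integral>w. \<bar>K n (S w s i) - X j w\<bar> \<partial>completion M) \<longlonglongrightarrow> 0" by simp
    then have "\<forall>\<^sub>F j in sequentially. (\<integral>w. \<bar>K n (S w s i) - X j w\<bar> \<partial>completion M) < \<epsilon>"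
      using \<open>0 < \<epsilon>\<close> by (rule order_tendstoD(2))
    then show "\<exists>X'. approximable X' \<and> (\<integral>w. \<bar>K n (S w s i) - X' w\<bar> \<partial>completion M) < \<epsilon>"
      using aX by (auto simp: eventually_sequentially)
  qed
  let ?I = "indicator {w\<in>space M. c < S w s i} :: 'a \<Rightarrow> real"
  show ?thesis
  proof (rule approximable_closed)
    show iI: "integrable (completion M) ?I" using pm by (intro FS.integrable_const_bound[of _ 1]) auto
    fix \<epsilon> :: real assume "0 < \<epsilon>"
    have "(\<lambda>n. \<integral>w. \<bar>?I w - K n (S w s i)\<bar> \<partial>completion M) \<longlonglongrightarrow> (\<integral>w. 0 \<partial>completion M)"
    proof (rule integral_dominated_convergence[where w="\<lambda>_. 2"])
      show "AE w in completion M. (\<lambda>n. \<bar>?I w - K n (S w s i)\<bar>) \<longlonglongrightarrow> 0"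
      proof (rule AE_I2)
        fix w assume w: "w \<in> space (completion M)"
        obtain N :: nat where N: "c < S w s i \<Longrightarrow> 1 / (S w s i - c) < N" using reals_Archimedean2 by blast
        have "\<bar>?I w - K n (S w s i)\<bar> = 0" if "N \<le> n" for n
        proof (cases "c < S w s i")
          case True
          then have "1 / (S w s i - c) < n" using N that by linarith
          then have "1 < n * (S w s i - c)" using True by (simp add: field_simps)
          then show ?thesis using True w by (simp add: K_def)
        next
          case False
          then have "real n * (S w s i - c) \<le> 0" by (intro mult_nonneg_nonpos) auto
          then show ?thesis using False by (simp add: K_def)
        qed
        then have "\<forall>\<^sub>F n in sequentially. \<bar>?I w - K n (S w s i)\<bar> = 0" by (auto simp: eventually_sequentially)
        then show "(\<lambda>n. \<bar>?I w - K n (S w s i)\<bar>) \<longlonglongrightarrow> 0" by (rule tendsto_eventually)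
      qed
      show "AE w in completion M. norm \<bar>?I w - K n (S w s i)\<bar> \<le> 2" for n
      proof (rule AE_I2)
        fix w
        show "norm \<bar>?I w - K n (S w s i)\<bar> \<le> 2" using Kb[of n "S w s i"] by (simp add: indicator_def abs_le_iff)
      qed
      show "(\<lambda>w. \<bar>?I w - K n (S w s i)\<bar>) \<in> borel_measurable (completion M)" for n
        using iI K1[of n] by (auto simp: approximable_def)
    qed auto
    then have "(\<lambda>n. \<integral>w. \<bar>?I w - K n (S w s i)\<bar> \<partial>completion M) \<longlonglongrightarrow> 0" by simp
    then have "\<forall>\<^sub>F n in sequentially. (\<integral>w. \<bar>?I w - K n (S w s i)\<bar> \<partial>completion M) < \<epsilon>"
      using \<open>0 < \<epsilon>\<close> by (rule order_tendstoD(2))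
    then show "\<exists>X'. approximable X' \<and> (\<integral>w. \<bar>?I w - X' w\<bar> \<partial>completion M) < \<epsilon>"
      using K1 by (auto simp: eventually_sequentially)
  qed
qed

lemma approximable_Compl:
  assumes "approximable (indicator A)" "A \<in> sets (completion M)"
  shows "approximable (indicator (space M - A))"
proof (rule approximable_AE)
  show "approximable (\<lambda>w. 1 - indicator A w)"
    by (rule approximable_Lipschitz2[OF assms(1,1), where k="\<lambda>a b. 1 - a" and L=1])
      (auto simp: case_prod_beta intro!: continuous_intros)
  show "AE w in completion M. 1 - indicator A w = (indicator (space M - A) w :: real)" by (rule AE_I2) (auto simp: indicator_def)
  have "space M - A \<in> sets (completion M)" using sets.compl_sets[OF assms(2)] by simp
  then show "(indicator (space M - A) :: 'a \<Rightarrow> real) \<in> borel_measurable (completion M)" by simp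
qed

text \<open>Indicators of finite unions are maxima, a Lipschitz operation; the countable union is
  their L1-limit.\<close>

lemma approximable_Union:
  fixes A :: "nat \<Rightarrow> 'a set"
  assumes "\<And>i. approximable (indicator (A i))" and m: "\<And>i. A i \<in> sets (completion M)"
  shows "approximable (indicator (\<Union>i. A i))"
proof (rule approximable_closed)
  have fin: "approximable (indicator (\<Union>i<n. A i))" for n
  proof (induction n)
    case 0
    show ?case using approximable_psi[OF sbc_const[of d T 0]] by (simp add: indicator_def[abs_def])
  next
    case (Suc n)
    have "approximable (\<lambda>w. max (indicator (\<Union>i<n. A i) w) (indicator (A n) w))"
      by (rule approximable_Lipschitz2[OF Suc assms(1), of max 1]) (auto simp: case_prod_beta intro!: continuous_intros)
    moreover have "(\<lambda>w. max (indicator (\<Union>i<n. A i) w) (indicator (A n) w)) = (indicator (\<Union>i<Suc n. A i) :: 'a \<Rightarrow> real)"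
      by (auto simp: indicator_def fun_eq_iff less_Suc_eq)
    ultimately show ?case by simp
  qed
  have mU: "(\<Union>i. A i) \<in> sets (completion M)" using m by auto
  then show iU: "integrable (completion M) (indicator (\<Union>i. A i) :: 'a \<Rightarrow> real)" by (intro FS.integrable_const_bound[of _ 1]) auto
  fix \<epsilon> :: real assume "0 < \<epsilon>"
  have "(\<lambda>n. \<integral>w. \<bar>indicator (\<Union>i. A i) w - indicator (\<Union>i<n. A i) w :: real\<bar> \<partial>completion M) \<longlonglongrightarrow> (\<integral>w. 0 \<partial>completion M)"
  proof (rule integral_dominated_convergence[where w="\<lambda>_. 1"])
    show "AE w in completion M. (\<lambda>n. \<bar>indicator (\<Union>i. A i) w - indicator (\<Union>i<n. A i) w :: real\<bar>) \<longlonglongrightarrow> 0"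
    proof (rule AE_I2)
      fix w
      have "\<exists>N. \<forall>n\<ge>N. \<bar>indicator (\<Union>i. A i) w - indicator (\<Union>i<n. A i) w :: real\<bar> = 0"
      proof (cases "w \<in> (\<Union>i. A i)")
        case True
        then obtain i where "w \<in> A i" by blast
        then show ?thesis by (intro exI[of _ "Suc i"]) (auto simp: indicator_def)
      qed (auto simp: indicator_def)
      then show "(\<lambda>n. \<bar>indicator (\<Union>i. A i) w - indicator (\<Union>i<n. A i) w :: real\<bar>) \<longlonglongrightarrow> 0"
        by (intro tendsto_eventually) (simp add: eventually_sequentially)
    qed
    show "(\<lambda>w. \<bar>indicator (\<Union>i. A i) w - indicator (\<Union>i<n. A i) w :: real\<bar>) \<in> borel_measurable (completion M)" for n
      using iU fin[of n] by (auto simp: approximable_def)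
  qed (auto simp: indicator_def)
  then have "(\<lambda>n. \<integral>w. \<bar>indicator (\<Union>i. A i) w - indicator (\<Union>i<n. A i) w :: real\<bar> \<partial>completion M) \<longlonglongrightarrow> 0" by simp
  then have "\<forall>\<^sub>F n in sequentially. (\<integral>w. \<bar>indicator (\<Union>i. A i) w - indicator (\<Union>i<n. A i) w :: real\<bar> \<partial>completion M) < \<epsilon>"
    using \<open>0 < \<epsilon>\<close> by (rule order_tendstoD(2))
  then show "\<exists>X'. approximable X' \<and> (\<integral>w. \<bar>indicator (\<Union>i. A i) w - X' w\<bar> \<partial>completion M) < \<epsilon>"
    using fin by (auto simp: eventually_sequentially)
qed

lemma approximable_coord:
  assumes "A \<in> sets borel"
  shows "approximable (indicator {w\<in>space M. S w s i \<in> A}) \<and> {w\<in>space M. S w s i \<in> A} \<in> sets (completion M)"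
proof -
  have m: "{w\<in>space M. S w s i \<in> A} \<in> sets (completion M)" if "A \<in> sets borel" for A
    using measurable_sets[OF S_meas[of s i] that] by (intro sets_completionI_sets) (simp add: vimage_def Int_def conj_commute)
  have "A \<in> sigma_sets UNIV (range greaterThan)"
    using assms unfolding borel_Ioi by simp
  then have "A \<in> sets borel \<and> approximable (indicator {w\<in>space M. S w s i \<in> A})"
  proof (induction rule: sigma_sets.induct)
    case (Basic a)
    then show ?case using approximable_coord_gt[of _ s i] by auto
  next
    case Empty
    show ?case using approximable_psi[OF sbc_const[of d T 0]] by (simp add: indicator_def[abs_def])
  next
    case (Compl a)
    have "{w\<in>space M. S w s i \<in> UNIV - a} = space M - {w\<in>space M. S w s i \<in> a}" by auto
    then show ?case using approximable_Compl[OF _ m] Compl.IH by auto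
  next
    case (Union a)
    have "{w\<in>space M. S w s i \<in> (\<Union>j. a j)} = (\<Union>j. {w\<in>space M. S w s i \<in> a j})" by auto
    then show ?case using approximable_Union[of "\<lambda>j. {w\<in>space M. S w s i \<in> a j}"] m Union.IH by auto
  qed
  then show ?thesis using m[OF assms] by simp
qed

text \<open>A set of \<open>Ft t\<close> belongs to the sigma-algebra generated by the coordinates
  up to \<open>t+1\<close> and the null sets, so the closure properties propagate approximability
  from the generators.\<close>

lemma approximable_F_set:
  assumes "A \<in> sets (Ft t)"
  shows "approximable (indicator A)"
proof -
  have sub: "nat_gen M d T S (t+1) \<union> null_sets (completion M) \<subseteq> sets (completion M)" using nat_gen_sub by auto
  have "A \<in> sigma_sets (space M) (nat_gen M d T S (t+1) \<union> null_sets (completion M))"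
    using assms by (auto simp: sets_Ft usual_filt_def)
  then have "A \<in> sets (completion M) \<and> approximable (indicator A)"
  proof (induction rule: sigma_sets.induct)
    case (Basic a)
    show ?case
    proof (cases "a \<in> null_sets (completion M)")
      case True
      have "AE w in completion M. 0 = (indicator a w :: real)"
        using AE_not_in[OF True] by eventually_elim simp
      then show ?thesis using approximable_AE[OF approximable_psi[OF sbc_const[of d T 0]]] True by auto
    next
      case False
      then obtain s i B where "a = {w\<in>space M. S w s i \<in> B}" "B \<in> sets borel" using Basic by (auto simp: nat_gen_def)
      then show ?thesis using approximable_coord by blast
    qed
  next
    case Empty
    show ?case using approximable_psi[OF sbc_const[of d T 0]] by (simp add: indicator_def[abs_def])
  next
    case (Compl a)
    then show ?case using approximable_Compl[of a] sets.compl_sets[of a "completion M"] by auto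
  next
    case (Union a)
    then show ?case using approximable_Union[of a] by auto
  qed
  then show ?thesis by simp
qed

text \<open>The induction over integrable functions runs on the restricted measure, so that its
  basic sets are sets of \<open>Ft t\<close>.\<close>

lemma approximable_F:
  assumes X: "X \<in> borel_measurable (Ft t)" and i: "integrable (completion M) X"
  shows "approximable X"
proof -
  let ?R = "restr_to_subalg (completion M) (Ft t)"
  have sR: "sets ?R = sets (Ft t)" by (rule sets_restr_to_subalg[OF FS.subalg])
  have "integrable ?R X" by (rule integrable_in_subalg[OF FS.subalg X i])
  then show ?thesis
  proof (induction rule: integrable_induct)
    case (base A c)
    have "approximable (\<lambda>w. clip \<bar>c\<bar> (c * indicator A w))"
    proof (rule approximable_Lipschitz2[where k="\<lambda>a b. clip \<bar>c\<bar> (c * a)" and L="\<bar>c\<bar> + 1"])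
      show "approximable (indicator A)" "approximable (indicator A)" using approximable_F_set[of A t] base sR by auto
      show "continuous_on UNIV (\<lambda>(a, b::real). clip \<bar>c\<bar> (c * a))"
        unfolding case_prod_beta by (intro clip_continuous continuous_intros)
      fix a b a' b' :: real
      have "\<bar>clip \<bar>c\<bar> (c * a) - clip \<bar>c\<bar> (c * a')\<bar> \<le> \<bar>c * a - c * a'\<bar>" by (rule clip_Lipschitz)
      also have "\<dots> = \<bar>c\<bar> * \<bar>a - a'\<bar>" by (simp add: right_diff_distrib[symmetric] abs_mult)
      also have "\<dots> \<le> (\<bar>c\<bar> + 1) * (\<bar>a - a'\<bar> + \<bar>b - b'\<bar>)" by (intro mult_mono) auto
      finally show "\<bar>clip \<bar>c\<bar> (c * a) - clip \<bar>c\<bar> (c * a')\<bar> \<le> (\<bar>c\<bar> + 1) * (\<bar>a - a'\<bar> + \<bar>b - b'\<bar>)" .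
    qed simp
    moreover have "clip \<bar>c\<bar> (c * indicator A w) = indicator A w *\<^sub>R c" for w by (rule clip_eq[THEN trans]) (auto simp: indicator_def)
    ultimately show ?case by simp
  next
    case (add f g)
    show ?case by (rule approximable_Lipschitz2[OF add(3,4), of "(+)" 1]) (auto simp: case_prod_beta intro!: continuous_intros)
  next
    case (lim f s)
    have iP: "integrable (completion M) f" by (rule integrable_from_subalg[OF FS.subalg lim(4)])
    have iPs: "integrable (completion M) (s k)" for k by (rule integrable_from_subalg[OF FS.subalg lim(1)])
    show ?case
    proof (rule approximable_closed[OF iP])
      fix \<epsilon> :: real assume "0 < \<epsilon>"
      have "(\<lambda>k. \<integral>w. \<bar>f w - s k w\<bar> \<partial>completion M) \<longlonglongrightarrow> (\<integral>w. \<bar>f w - f w\<bar> \<partial>completion M)"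
      proof (rule integral_dominated_convergence[where w="\<lambda>w. 3 * \<bar>f w\<bar>"])
        show "AE w in completion M. (\<lambda>k. \<bar>f w - s k w\<bar>) \<longlonglongrightarrow> \<bar>f w - f w\<bar>"
          using lim(2) by (intro AE_I2 tendsto_intros) (simp add: space_restr_to_subalg)
        show "AE w in completion M. norm \<bar>f w - s k w\<bar> \<le> 3 * \<bar>f w\<bar>" for k
        proof (rule AE_I2)
          fix w assume "w \<in> space (completion M)"
          then have "norm (s k w) \<le> 2 * norm (f w)" using lim(3) by (simp add: space_restr_to_subalg)
          then show "norm \<bar>f w - s k w\<bar> \<le> 3 * \<bar>f w\<bar>" by simp
        qed
      qed (use iP iPs in auto)
      then have "(\<lambda>k. \<integral>w. \<bar>f w - s k w\<bar> \<partial>completion M) \<longlonglongrightarrow> 0" by simp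
      then have "\<forall>\<^sub>F k in sequentially. (\<integral>w. \<bar>f w - s k w\<bar> \<partial>completion M) < \<epsilon>"
        using \<open>0 < \<epsilon>\<close> by (rule order_tendstoD(2))
      then show "\<exists>X'. approximable X' \<and> (\<integral>w. \<bar>f w - X' w\<bar> \<partial>completion M) < \<epsilon>"
        using lim(5) by (auto simp: eventually_sequentially)
    qed
  qed
qed

end

lemma cadlag_clamp_right:
  assumes "cadlag_real T z" and "0 < T"
  shows "((\<lambda>s. z (clampT T s)) \<longlongrightarrow> z (clampT T t)) (at_right t)"
  by (rule clampT_tendsto_right) (use assms in \<open>simp_all add: cadlag_real_def\<close>)

section \<open>Extended weak convergence\<close>

definition trunc_path :: "nat \<Rightarrow> (real \<Rightarrow> nat \<Rightarrow> real) \<Rightarrow> real \<Rightarrow> nat \<Rightarrow> real" where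
  "trunc_path d x = (\<lambda>t i. if i < d then x t i else 0)"

lemma euclid_trunc: "d \<le> m \<Longrightarrow> euclid d (\<lambda>i. if i < d then v i else 0) (\<lambda>i. if i < d then w i else 0) \<le> euclid m v w"
  using euclid_mono[of d m v w] euclid_cong[of d "\<lambda>i. if i < d then v i else 0" v "\<lambda>i. if i < d then w i else 0" w] by simp

lemma tendsto_0_le_filter:
  fixes f g :: "'c \<Rightarrow> real"
  assumes "(g \<longlongrightarrow> 0) F" "\<And>n. 0 \<le> f n" "\<And>n. f n \<le> g n"
  shows "(f \<longlongrightarrow> 0) F"
  by (rule tendsto_sandwich[OF _ _ tendsto_const assms(1)]) (use assms in auto)

lemma trunc_path_Dsp:
  assumes x: "x \<in> Dsp m T" and dm: "d \<le> m"
  shows "trunc_path d x \<in> Dsp d T"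
  unfolding Dsp_def
proof (intro CollectI conjI allI ballI)
  fix t
  show "trunc_path d x t \<in> Rm d" by (simp add: trunc_path_def Rm_def)
  show "trunc_path d x t = trunc_path d x (max 0 (min T t))" by (simp only: trunc_path_def Dsp_clamp[OF x])
next
  fix t assume "t \<in> {0..<T}"
  then have "((\<lambda>s. euclid m (x s) (x t)) \<longlongrightarrow> 0) (at_right t)" using x by (simp add: Dsp_def)
  then show "((\<lambda>s. euclid d (trunc_path d x s) (trunc_path d x t)) \<longlongrightarrow> 0) (at_right t)"
    by (rule tendsto_0_le_filter) (use euclid_trunc[OF dm] in \<open>auto simp: trunc_path_def\<close>)
next
  fix t assume "t \<in> {0<..T}"
  then have "\<exists>l\<in>Rm m. ((\<lambda>s. euclid m (x s) l) \<longlongrightarrow> 0) (at_left t)" using x unfolding Dsp_def by blast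
  then obtain l where l: "((\<lambda>s. euclid m (x s) l) \<longlongrightarrow> 0) (at_left t)" by blast
  show "\<exists>l\<in>Rm d. ((\<lambda>s. euclid d (trunc_path d x s) l) \<longlongrightarrow> 0) (at_left t)"
  proof (rule bexI[of _ "\<lambda>i. if i < d then l i else 0"])
    show "((\<lambda>s. euclid d (trunc_path d x s) (\<lambda>i. if i < d then l i else 0)) \<longlongrightarrow> 0) (at_left t)"
      using l by (rule tendsto_0_le_filter) (use euclid_trunc[OF dm] in \<open>auto simp: trunc_path_def\<close>)
  qed (simp add: Rm_def)
qed

text \<open>The time changes that work for the joint path work for its first coordinates.\<close>

lemma skor_continuous_trunc:
  assumes p: "skor_continuous d T \<psi>" and T: "0 < T" and dm: "d \<le> m"
  shows "skor_continuous m T (\<lambda>x. \<psi> (trunc_path d x))"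
  unfolding skor_continuous_def
proof (intro allI impI)
  fix xs x assume xs: "\<forall>n. xs n \<in> Dsp m T" and x: "x \<in> Dsp m T" and cv: "skor_conv m T xs x"
  obtain lam e where e: "e \<longlonglongrightarrow> 0" and lam: "\<And>n. skor_close m T (e n) (lam n) (xs n) x"
    using cv unfolding skor_conv_iff[OF T spec[OF xs] x] by blast
  have "skor_close d T (e n) (lam n) (trunc_path d (xs n)) (trunc_path d x)" for n
    using lam[of n] order_trans[OF euclid_trunc[OF dm]] unfolding skor_close_def trunc_path_def by blast
  then have "skor_conv d T (\<lambda>n. trunc_path d (xs n)) (trunc_path d x)"
    unfolding skor_conv_iff[OF T trunc_path_Dsp[OF spec[OF xs] dm] trunc_path_Dsp[OF x dm]] using e by blast
  then show "(\<lambda>n. \<psi> (trunc_path d (xs n))) \<longlonglongrightarrow> \<psi> (trunc_path d x)"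
    by (rule p[unfolded skor_continuous_def, rule_format, OF trunc_path_Dsp[OF spec[OF xs] dm] trunc_path_Dsp[OF x dm]])
qed

locale ext_conv =
  fixes d :: nat and T :: real
    and M :: "nat \<Rightarrow> 'a measure" and S :: "nat \<Rightarrow> 'a \<Rightarrow> real \<Rightarrow> nat \<Rightarrow> real"
    and N :: "'b measure" and S0 :: "'b \<Rightarrow> real \<Rightarrow> nat \<Rightarrow> real"
  assumes pn: "\<And>n. cadlag_proc (M n) d T (S n)" and p0: "cadlag_proc N d T S0"
    and ext_weak: "\<forall>k \<psi> (Z :: nat \<Rightarrow> nat \<Rightarrow> real \<Rightarrow> 'a \<Rightarrow> real) (Z0 :: nat \<Rightarrow> real \<Rightarrow> 'b \<Rightarrow> real).
          (\<forall>i<k. skor_bounded_continuous d T (\<psi> i)) \<longrightarrow>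
          (\<forall>i<k. \<forall>n. (\<forall>w\<in>space (M n). cadlag_real T (\<lambda>t. Z i n t w)) \<and>
              (\<forall>t\<in>{0..T}. AE w in completion (M n).
                 Z i n t w = cond_exp_t (M n) d T (S n) t (\<lambda>w. \<psi> i (S n w)) w)) \<longrightarrow>
          (\<forall>i<k. (\<forall>w\<in>space N. cadlag_real T (\<lambda>t. Z0 i t w)) \<and>
              (\<forall>t\<in>{0..T}. AE w in completion N.
                 Z0 i t w = cond_exp_t N d T S0 t (\<lambda>w. \<psi> i (S0 w)) w)) \<longrightarrow>
          (\<forall>\<phi>. skor_bounded_continuous (d + k) T \<phi> \<longrightarrow>
             (\<lambda>n. \<integral>w. \<phi> (joint_path d T k (S n) (\<lambda>i. Z i n) w) \<partial>completion (M n))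
               \<longlonglongrightarrow> (\<integral>w. \<phi> (joint_path d T k S0 Z0 w) \<partial>completion N))"
begin

sublocale Pn: cadlag_proc "M n" d T "S n" for n by (rule pn)
sublocale P0: cadlag_proc N d T S0 by (rule p0)

lemma T_pos: "0 < T" by (rule P0.T)

abbreviation "CMn n \<equiv> completion (M n)"
abbreviation "CM0 \<equiv> completion N"
abbreviation "Fn n \<equiv> cadlag_proc.Ft (M n) d T (S n)"
abbreviation "F0 \<equiv> cadlag_proc.Ft N d T S0"

text \<open>The case of no martingales: \<open>joint_path\<close> with \<open>k = 0\<close> is the
  path itself.\<close>

lemma weak:
  assumes "skor_bounded_continuous d T \<phi>"
  shows "(\<lambda>n. \<integral>w. \<phi> (S n w) \<partial>CMn n) \<longlonglongrightarrow> (\<integral>w. \<phi> (S0 w) \<partial>CM0)"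
proof -
  have z: "joint_path d T 0 X Z w = X w" if "X w \<in> Dsp d T" for X :: "'c \<Rightarrow> real \<Rightarrow> nat \<Rightarrow> real" and Z w
    using Dsp_Rm[OF that] by (auto simp: joint_path_def Rm_def fun_eq_iff)
  have "(\<lambda>n. \<integral>w. \<phi> (joint_path d T 0 (S n) (\<lambda>i t w. 0) w) \<partial>CMn n) \<longlonglongrightarrow> (\<integral>w. \<phi> (joint_path d T 0 S0 (\<lambda>i t w. 0) w) \<partial>CM0)"
    using ext_weak[rule_format, of 0 "\<lambda>_ _. 0" "\<lambda>i n t w. 0" "\<lambda>i t w. 0" \<phi>] assms by simp
  moreover have "(\<integral>w. \<phi> (joint_path d T 0 (S n) (\<lambda>i t w. 0) w) \<partial>CMn n) = (\<integral>w. \<phi> (S n w) \<partial>CMn n)" for n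
    by (intro Bochner_Integration.integral_cong refl) (use z[of "S n"] Pn.S_Dsp in simp)
  moreover have "(\<integral>w. \<phi> (joint_path d T 0 S0 (\<lambda>i t w. 0) w) \<partial>CM0) = (\<integral>w. \<phi> (S0 w) \<partial>CM0)"
    by (intro Bochner_Integration.integral_cong refl) (use z[of S0] P0.S_Dsp in simp)
  ultimately show ?thesis by simp
qed

text \<open>\<open>cv X X0\<close> plays the role of convergence in probability under a Skorohod coupling, but needs neither a
  coupling nor tightness: both sides are compared with one continuous functional of the paths.\<close>

definition cv :: "(nat \<Rightarrow> 'a \<Rightarrow> real) \<Rightarrow> ('b \<Rightarrow> real) \<Rightarrow> bool" where
  "cv X X0 \<longleftrightarrow>
    (\<exists>B. (\<forall>n. X n \<in> borel_measurable (CMn n) \<and> (AE w in CMn n. \<bar>X n w\<bar> \<le> B)) \<and>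
         X0 \<in> borel_measurable CM0 \<and> (AE w in CM0. \<bar>X0 w\<bar> \<le> B)) \<and>
    (\<forall>\<epsilon>>0. \<exists>\<psi>. skor_bounded_continuous d T \<psi> \<and> (\<integral>w. \<bar>X0 w - \<psi> (S0 w)\<bar> \<partial>CM0) < \<epsilon> \<and>
         (\<forall>\<^sub>F n in sequentially. (\<integral>w. \<bar>X n w - \<psi> (S n w)\<bar> \<partial>CMn n) < \<epsilon>))"

lemma cv_bound:
  assumes "cv X X0"
  obtains B where "0 \<le> B" "\<And>n. AE w in CMn n. \<bar>X n w\<bar> \<le> B" "AE w in CM0. \<bar>X0 w\<bar> \<le> B"
proof -
  obtain B where B: "\<And>n. AE w in CMn n. \<bar>X n w\<bar> \<le> B" "AE w in CM0. \<bar>X0 w\<bar> \<le> B" using assms unfolding cv_def by blast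
  have "AE w in CMn n. \<bar>X n w\<bar> \<le> max B 0" for n using B(1)[of n] by eventually_elim simp
  moreover have "AE w in CM0. \<bar>X0 w\<bar> \<le> max B 0" using B(2) by eventually_elim simp
  ultimately show thesis using that[of "max B 0"] by simp
qed

lemma cv_meas: "cv X X0 \<Longrightarrow> X n \<in> borel_measurable (CMn n)" "cv X X0 \<Longrightarrow> X0 \<in> borel_measurable CM0"
  unfolding cv_def by blast+

lemma cv_int:
  assumes "cv X X0"
  shows "integrable (CMn n) (X n)" "integrable CM0 X0"
proof -
  obtain B where B: "AE w in CMn n. \<bar>X n w\<bar> \<le> B" "AE w in CM0. \<bar>X0 w\<bar> \<le> B" using cv_bound[OF assms] by metis
  show "integrable (CMn n) (X n)" by (rule Pn.FS.integrable_const_bound[of _ B]) (use B cv_meas[OF assms] in auto)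
  show "integrable CM0 X0" by (rule P0.FS.integrable_const_bound[of _ B]) (use B cv_meas[OF assms] in auto)
qed

lemma cv_psi:
  assumes "skor_bounded_continuous d T \<psi>"
  shows "cv (\<lambda>n w. \<psi> (S n w)) (\<lambda>w. \<psi> (S0 w))"
proof -
  obtain B where "\<forall>x\<in>Dsp d T. \<bar>\<psi> x\<bar> \<le> B" using sbc_bound[OF assms] by blast
  then have "AE w in CMn n. \<bar>\<psi> (S n w)\<bar> \<le> B" "AE w in CM0. \<bar>\<psi> (S0 w)\<bar> \<le> B" for n
    using Pn.S_Dsp P0.S_Dsp by (auto intro!: AE_I2)
  moreover have "\<exists>\<psi>'. skor_bounded_continuous d T \<psi>' \<and> (\<integral>w. \<bar>\<psi> (S0 w) - \<psi>' (S0 w)\<bar> \<partial>CM0) < \<epsilon> \<and>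
         (\<forall>\<^sub>F n in sequentially. (\<integral>w. \<bar>\<psi> (S n w) - \<psi>' (S n w)\<bar> \<partial>CMn n) < \<epsilon>)" if "0 < \<epsilon>" for \<epsilon>
    using assms that by (intro exI[of _ \<psi>]) simp
  ultimately show ?thesis unfolding cv_def using Pn.sbc_integrable(1)[OF assms] P0.sbc_integrable(1)[OF assms] by blast
qed

lemma cv_const: "cv (\<lambda>n w. c) (\<lambda>w. c)"
  by (rule cv_psi[OF sbc_const])

text \<open>Halving \<epsilon>: it is enough to find, for each accuracy, some \<open>cv\<close> pair
  that is close on both sides; its own functional then serves.\<close>

lemma cv_closed:
  assumes m: "\<And>n. X n \<in> borel_measurable (CMn n)" "X0 \<in> borel_measurable CM0"
    and B: "\<And>n. AE w in CMn n. \<bar>X n w\<bar> \<le> B" "AE w in CM0. \<bar>X0 w\<bar> \<le> B"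
    and c: "\<And>\<epsilon>. 0 < \<epsilon> \<Longrightarrow> \<exists>Y Y0. cv Y Y0 \<and> (\<integral>w. \<bar>X0 w - Y0 w\<bar> \<partial>CM0) < \<epsilon> \<and>
         (\<forall>\<^sub>F n in sequentially. (\<integral>w. \<bar>X n w - Y n w\<bar> \<partial>CMn n) < \<epsilon>)"
  shows "cv X X0"
proof -
  have iX: "integrable (CMn n) (X n)" "integrable CM0 X0" for n
    by (rule Pn.FS.integrable_const_bound[of _ B], use B m in auto)
      (rule P0.FS.integrable_const_bound[of _ B], use B m in auto)
  have "\<exists>\<psi>. skor_bounded_continuous d T \<psi> \<and> (\<integral>w. \<bar>X0 w - \<psi> (S0 w)\<bar> \<partial>CM0) < \<epsilon> \<and>
         (\<forall>\<^sub>F n in sequentially. (\<integral>w. \<bar>X n w - \<psi> (S n w)\<bar> \<partial>CMn n) < \<epsilon>)" if "0 < \<epsilon>" for \<epsilon>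
  proof -
    have e2: "0 < \<epsilon>/2" using that by simp
    obtain Y Y0 where Y: "cv Y Y0" "(\<integral>w. \<bar>X0 w - Y0 w\<bar> \<partial>CM0) < \<epsilon>/2"
      "\<forall>\<^sub>F n in sequentially. (\<integral>w. \<bar>X n w - Y n w\<bar> \<partial>CMn n) < \<epsilon>/2" using c[OF e2] by blast
    obtain \<psi> where p: "skor_bounded_continuous d T \<psi>" "(\<integral>w. \<bar>Y0 w - \<psi> (S0 w)\<bar> \<partial>CM0) < \<epsilon>/2"
      "\<forall>\<^sub>F n in sequentially. (\<integral>w. \<bar>Y n w - \<psi> (S n w)\<bar> \<partial>CMn n) < \<epsilon>/2" using Y(1) e2 unfolding cv_def by blast
    note iY = cv_int[OF Y(1)] and ip = Pn.sbc_integrable(2)[OF p(1)] P0.sbc_integrable(2)[OF p(1)]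
    have "(\<integral>w. \<bar>X0 w - \<psi> (S0 w)\<bar> \<partial>CM0) \<le> (\<integral>w. \<bar>X0 w - Y0 w\<bar> + \<bar>Y0 w - \<psi> (S0 w)\<bar> \<partial>CM0)"
      using iX iY ip by (intro integral_mono) auto
    also have "\<dots> < \<epsilon>" using Y(2) p(2) iX iY ip by simp
    finally have 0: "(\<integral>w. \<bar>X0 w - \<psi> (S0 w)\<bar> \<partial>CM0) < \<epsilon>" .
    have "\<forall>\<^sub>F n in sequentially. (\<integral>w. \<bar>X n w - \<psi> (S n w)\<bar> \<partial>CMn n) < \<epsilon>"
      using Y(3) p(3)
    proof eventually_elim
      case (elim n)
      have "(\<integral>w. \<bar>X n w - \<psi> (S n w)\<bar> \<partial>CMn n) \<le> (\<integral>w. \<bar>X n w - Y n w\<bar> + \<bar>Y n w - \<psi> (S n w)\<bar> \<partial>CMn n)"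
        using iX iY ip by (intro integral_mono) auto
      also have "\<dots> < \<epsilon>" using elim iX iY ip by simp
      finally show ?case .
    qed
    then show ?thesis using 0 p(1) by blast
  qed
  then show ?thesis unfolding cv_def using m B by blast
qed

lemma cv_AE:
  assumes X: "cv X X0" and m: "\<And>n. Y n \<in> borel_measurable (CMn n)" "Y0 \<in> borel_measurable CM0"
    and e: "\<And>n. AE w in CMn n. X n w = Y n w" "AE w in CM0. X0 w = Y0 w"
  shows "cv Y Y0"
proof -
  obtain B where B: "\<And>n. AE w in CMn n. \<bar>X n w\<bar> \<le> B" "AE w in CM0. \<bar>X0 w\<bar> \<le> B" using cv_bound[OF X] by metis
  show ?thesis
  proof (rule cv_closed[OF m])
    show "AE w in CMn n. \<bar>Y n w\<bar> \<le> B" for n using B(1)[of n] e(1)[of n] by eventually_elim simp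
    show "AE w in CM0. \<bar>Y0 w\<bar> \<le> B" using B(2) e(2) by eventually_elim simp
    fix \<epsilon> :: real assume "0 < \<epsilon>"
    have "(\<integral>w. \<bar>Y n w - X n w\<bar> \<partial>CMn n) = (\<integral>w. 0 \<partial>CMn n)" for n
      using e(1)[of n] m cv_meas[OF X] by (intro integral_cong_AE) (auto elim: eventually_mono)
    moreover have "(\<integral>w. \<bar>Y0 w - X0 w\<bar> \<partial>CM0) = (\<integral>w. 0 \<partial>CM0)"
      using e(2) m cv_meas[OF X] by (intro integral_cong_AE) (auto elim: eventually_mono)
    ultimately show "\<exists>X X0. cv X X0 \<and> (\<integral>w. \<bar>Y0 w - X0 w\<bar> \<partial>CM0) < \<epsilon> \<and>
         (\<forall>\<^sub>F n in sequentially. (\<integral>w. \<bar>Y n w - X n w\<bar> \<partial>CMn n) < \<epsilon>)"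
      using X \<open>0 < \<epsilon>\<close> by (intro exI[of _ X] exI[of _ X0]) simp
  qed
qed

text \<open>Both expectations are compared with those of one functional, for which weak convergence
  holds.\<close>

lemma cv_limit:
  assumes "cv X X0"
  shows "(\<lambda>n. \<integral>w. X n w \<partial>CMn n) \<longlonglongrightarrow> (\<integral>w. X0 w \<partial>CM0)"
proof (rule LIMSEQ_I)
  fix \<epsilon> :: real assume "0 < \<epsilon>"
  then have e: "0 < \<epsilon>/3" by simp
  obtain \<psi> where p: "skor_bounded_continuous d T \<psi>" "(\<integral>w. \<bar>X0 w - \<psi> (S0 w)\<bar> \<partial>CM0) < \<epsilon>/3"
      "\<forall>\<^sub>F n in sequentially. (\<integral>w. \<bar>X n w - \<psi> (S n w)\<bar> \<partial>CMn n) < \<epsilon>/3" using assms e unfolding cv_def by blast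
  note i = cv_int[OF assms] and ip = Pn.sbc_integrable(2)[OF p(1)] P0.sbc_integrable(2)[OF p(1)]
  have "\<forall>\<^sub>F n in sequentially. dist (\<integral>w. \<psi> (S n w) \<partial>CMn n) (\<integral>w. \<psi> (S0 w) \<partial>CM0) < \<epsilon>/3"
    using weak[OF p(1)] e by (rule tendstoD)
  with p(3) have "\<forall>\<^sub>F n in sequentially. norm ((\<integral>w. X n w \<partial>CMn n) - (\<integral>w. X0 w \<partial>CM0)) < \<epsilon>"
  proof eventually_elim
    case (elim n)
    have "\<bar>(\<integral>w. X n w \<partial>CMn n) - (\<integral>w. \<psi> (S n w) \<partial>CMn n)\<bar> \<le> (\<integral>w. \<bar>X n w - \<psi> (S n w)\<bar> \<partial>CMn n)"
      using i ip integral_abs_bound[of "CMn n" "\<lambda>w. X n w - \<psi> (S n w)"] by simp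
    moreover have "\<bar>(\<integral>w. X0 w \<partial>CM0) - (\<integral>w. \<psi> (S0 w) \<partial>CM0)\<bar> \<le> (\<integral>w. \<bar>X0 w - \<psi> (S0 w)\<bar> \<partial>CM0)"
      using i ip integral_abs_bound[of "CM0" "\<lambda>w. X0 w - \<psi> (S0 w)"] by simp
    ultimately show ?case using elim p(2) unfolding dist_real_def real_norm_def by linarith
  qed
  then show "\<exists>no. \<forall>n\<ge>no. norm ((\<integral>w. X n w \<partial>CMn n) - (\<integral>w. X0 w \<partial>CM0)) < \<epsilon>"
    by (simp add: eventually_sequentially)
qed

text \<open>A Lipschitz function of two variables preserves L1-closeness, so the approximating
  functionals can be combined by the same function. Minimum, maximum, sum and difference are
  instances; the product lacks a global Lipschitz constant.\<close>

lemma cv_Lipschitz2: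
  assumes X: "cv X X0" and Y: "cv Y Y0"
    and c: "continuous_on UNIV (\<lambda>(a, b). k a b)"
    and L: "\<And>a b a' b'. \<bar>k a b - k a' b'\<bar> \<le> L * (\<bar>a - a'\<bar> + \<bar>b - b'\<bar>)" "0 < L"
  shows "cv (\<lambda>n w. k (X n w) (Y n w)) (\<lambda>w. k (X0 w) (Y0 w))"
proof -
  obtain B where B: "0 \<le> B" "\<And>n. AE w in CMn n. \<bar>X n w\<bar> \<le> B" "AE w in CM0. \<bar>X0 w\<bar> \<le> B" using cv_bound[OF X] by metis
  obtain C where C: "0 \<le> C" "\<And>n. AE w in CMn n. \<bar>Y n w\<bar> \<le> C" "AE w in CM0. \<bar>Y0 w\<bar> \<le> C" using cv_bound[OF Y] by metis
  have km: "(\<lambda>w. k (f w) (g w)) \<in> borel_measurable Q" if "f \<in> borel_measurable Q" "g \<in> borel_measurable Q" for f g and Q :: "'c measure"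
  proof -
    have "(\<lambda>w. (f w, g w)) \<in> borel_measurable Q" using that by (intro borel_measurable_Pair)
    from measurable_compose[OF this borel_measurable_continuous_onI[OF c]] show ?thesis by simp
  qed
  have kb: "\<bar>k a b\<bar> \<le> \<bar>k 0 0\<bar> + L * (B + C)" if "\<bar>a\<bar> \<le> B" "\<bar>b\<bar> \<le> C" for a b
  proof -
    have "\<bar>k a b - k 0 0\<bar> \<le> L * (\<bar>a\<bar> + \<bar>b\<bar>)" using L(1)[of a b 0 0] by simp
    also have "\<dots> \<le> L * (B + C)" using that L(2) by (intro mult_left_mono add_mono) auto
    finally show ?thesis by linarith
  qed
  have m: "(\<lambda>w. k (X n w) (Y n w)) \<in> borel_measurable (CMn n)" "(\<lambda>w. k (X0 w) (Y0 w)) \<in> borel_measurable CM0" for n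
    using cv_meas[OF X] cv_meas[OF Y] by (intro km; blast)+
  have b: "AE w in CMn n. \<bar>k (X n w) (Y n w)\<bar> \<le> \<bar>k 0 0\<bar> + L * (B + C)" "AE w in CM0. \<bar>k (X0 w) (Y0 w)\<bar> \<le> \<bar>k 0 0\<bar> + L * (B + C)" for n
    using B(2)[of n] C(2)[of n] B(3) C(3) by (auto elim!: eventually_elim2 intro: kb)
  have bound: "(\<integral>w. \<bar>k (f w) (g w) - k (f' w) (g' w)\<bar> \<partial>Q) \<le> L * ((\<integral>w. \<bar>f w - f' w\<bar> \<partial>Q) + (\<integral>w. \<bar>g w - g' w\<bar> \<partial>Q))"
    if i: "integrable Q f" "integrable Q g" "integrable Q f'" "integrable Q g'" for f g f' g' and Q :: "'c measure"
  proof -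
    have iL: "integrable Q (\<lambda>w. L * (\<bar>f w - f' w\<bar> + \<bar>g w - g' w\<bar>))" using i by simp
    have "integrable Q (\<lambda>w. k (f w) (g w) - k (f' w) (g' w))"
    proof (rule Bochner_Integration.integrable_bound[OF iL])
      show "(\<lambda>w. k (f w) (g w) - k (f' w) (g' w)) \<in> borel_measurable Q" using km[of f Q g] km[of f' Q g'] i by simp
      show "AE w in Q. norm (k (f w) (g w) - k (f' w) (g' w)) \<le> norm (L * (\<bar>f w - f' w\<bar> + \<bar>g w - g' w\<bar>))"
        using L by (intro AE_I2) (simp add: abs_mult)
    qed
    then have "(\<integral>w. \<bar>k (f w) (g w) - k (f' w) (g' w)\<bar> \<partial>Q) \<le> (\<integral>w. L * (\<bar>f w - f' w\<bar> + \<bar>g w - g' w\<bar>) \<partial>Q)"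
      using iL by (intro integral_mono L(1)) auto
    also have "\<dots> = L * ((\<integral>w. \<bar>f w - f' w\<bar> \<partial>Q) + (\<integral>w. \<bar>g w - g' w\<bar> \<partial>Q))" using i by simp
    finally show ?thesis .
  qed
  show ?thesis
  proof (rule cv_closed[OF m b])
    fix \<epsilon> :: real assume "0 < \<epsilon>"
    then have e: "0 < \<epsilon> / (2 * L)" using L(2) by simp
    obtain \<psi>1 where p: "skor_bounded_continuous d T \<psi>1" "(\<integral>w. \<bar>X0 w - \<psi>1 (S0 w)\<bar> \<partial>CM0) < \<epsilon> / (2 * L)"
      "\<forall>\<^sub>F n in sequentially. (\<integral>w. \<bar>X n w - \<psi>1 (S n w)\<bar> \<partial>CMn n) < \<epsilon> / (2 * L)" using X e unfolding cv_def by blast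
    obtain \<psi>2 where q: "skor_bounded_continuous d T \<psi>2" "(\<integral>w. \<bar>Y0 w - \<psi>2 (S0 w)\<bar> \<partial>CM0) < \<epsilon> / (2 * L)"
      "\<forall>\<^sub>F n in sequentially. (\<integral>w. \<bar>Y n w - \<psi>2 (S n w)\<bar> \<partial>CMn n) < \<epsilon> / (2 * L)" using Y e unfolding cv_def by blast
    note ip = Pn.sbc_integrable(2)[OF p(1)] P0.sbc_integrable(2)[OF p(1)] and iq = Pn.sbc_integrable(2)[OF q(1)] P0.sbc_integrable(2)[OF q(1)]
    have fin: "L * (u + v) < \<epsilon>" if "u < \<epsilon> / (2 * L)" "v < \<epsilon> / (2 * L)" for u v
    proof -
      have "L * (u + v) < L * (\<epsilon> / (2 * L) + \<epsilon> / (2 * L))" using that L(2) by (intro mult_strict_left_mono add_strict_mono)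
      also have "\<dots> = \<epsilon>" using L(2) by (simp add: field_simps)
      finally show ?thesis .
    qed
    have "(\<integral>w. \<bar>k (X0 w) (Y0 w) - k (\<psi>1 (S0 w)) (\<psi>2 (S0 w))\<bar> \<partial>CM0) < \<epsilon>"
      by (rule le_less_trans[OF bound[OF cv_int(2)[OF X] cv_int(2)[OF Y] ip(2) iq(2)] fin[OF p(2) q(2)]])
    moreover have "\<forall>\<^sub>F n in sequentially. (\<integral>w. \<bar>k (X n w) (Y n w) - k (\<psi>1 (S n w)) (\<psi>2 (S n w))\<bar> \<partial>CMn n) < \<epsilon>"
      using p(3) q(3)
    proof eventually_elim
      case (elim n)
      show ?case by (rule le_less_trans[OF bound[OF cv_int(1)[OF X] cv_int(1)[OF Y] ip(1) iq(1)] fin[OF elim]])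
    qed
    ultimately show "\<exists>Z Z0. cv Z Z0 \<and> (\<integral>w. \<bar>k (X0 w) (Y0 w) - Z0 w\<bar> \<partial>CM0) < \<epsilon> \<and>
         (\<forall>\<^sub>F n in sequentially. (\<integral>w. \<bar>k (X n w) (Y n w) - Z n w\<bar> \<partial>CMn n) < \<epsilon>)"
      using cv_psi[OF sbc_Lipschitz2[OF p(1) q(1) c L(1)]] by blast
  qed
qed

lemma cv_L1_limit:
  assumes X: "cv X X0" and Y: "cv Y Y0"
  shows "(\<lambda>n. \<integral>w. \<bar>X n w - Y n w\<bar> \<partial>CMn n) \<longlonglongrightarrow> (\<integral>w. \<bar>X0 w - Y0 w\<bar> \<partial>CM0)"
  by (rule cv_limit, rule cv_Lipschitz2[OF X Y, where k="\<lambda>a b. \<bar>a - b\<bar>" and L=1])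
    (auto simp: case_prod_beta intro!: continuous_intros)

text \<open>Lets the variables before the limit be replaced by an L1-equivalent sequence, such as
  indicators obtained by rounding.\<close>

lemma cv_squeeze:
  assumes X: "cv X X0" and m: "\<And>n. Y n \<in> borel_measurable (CMn n)" and b: "\<And>n. AE w in CMn n. \<bar>Y n w\<bar> \<le> B"
    and z: "(\<lambda>n. \<integral>w. \<bar>Y n w - X n w\<bar> \<partial>CMn n) \<longlonglongrightarrow> 0"
  shows "cv Y X0"
proof -
  obtain C where C: "0 \<le> C" "\<And>n. AE w in CMn n. \<bar>X n w\<bar> \<le> C" "AE w in CM0. \<bar>X0 w\<bar> \<le> C" using cv_bound[OF X] by metis
  show ?thesis
  proof (rule cv_closed[OF m cv_meas(2)[OF X], of "max B C"])
    show "AE w in CMn n. \<bar>Y n w\<bar> \<le> max B C" for n using b[of n] by eventually_elim simp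
    show "AE w in CM0. \<bar>X0 w\<bar> \<le> max B C" using C(3) by eventually_elim simp
    fix \<epsilon> :: real assume "0 < \<epsilon>"
    then have "\<forall>\<^sub>F n in sequentially. (\<integral>w. \<bar>Y n w - X n w\<bar> \<partial>CMn n) < \<epsilon>" using order_tendstoD(2)[OF z] by blast
    then show "\<exists>Z Z0. cv Z Z0 \<and> (\<integral>w. \<bar>X0 w - Z0 w\<bar> \<partial>CM0) < \<epsilon> \<and>
         (\<forall>\<^sub>F n in sequentially. (\<integral>w. \<bar>Y n w - Z n w\<bar> \<partial>CMn n) < \<epsilon>)" using X \<open>0 < \<epsilon>\<close> by (intro exI[of _ X] exI[of _ X0]) simp
  qed
qed

text \<open>Diagonal choice: functionals \<open>\<psi> j\<close> approximating \<open>X0\<close> are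
  evaluated at \<open>S n\<close> with an index \<open>J n\<close> that grows slowly enough for
  their mutual L1-distances, known to be small under the limit process, to be small under
  \<open>S n\<close> as well.\<close>

lemma cv_exists:
  assumes a: "P0.approximable X0" and B: "AE w in CM0. \<bar>X0 w\<bar> \<le> B"
  shows "\<exists>X. cv X X0"
proof -
  have iX: "integrable CM0 X0" using a by (simp add: P0.approximable_def)
  have B0: "0 \<le> B" using P0.FS.not_empty
  proof -
    have "\<exists>w. \<bar>X0 w\<bar> \<le> B" using B by (rule eventually_happens'[rotated]) (simp add: P0.FS.ae_filter_bot)
    then show ?thesis using abs_ge_zero order_trans by blast
  qed
  have "\<exists>\<psi>. skor_bounded_continuous d T \<psi> \<and> (\<forall>x. \<bar>\<psi> x\<bar> \<le> B) \<and> (\<integral>w. \<bar>X0 w - \<psi> (S0 w)\<bar> \<partial>CM0) < inverse (real (Suc j))" for j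
  proof -
    have "0 < inverse (real (Suc j))" by simp
    then obtain \<psi> where p: "skor_bounded_continuous d T \<psi>" "(\<integral>w. \<bar>X0 w - \<psi> (S0 w)\<bar> \<partial>CM0) < inverse (real (Suc j))"
      using a unfolding P0.approximable_def by blast
    \<comment> \<open>Clipping at \<open>B\<close> does not increase the distance to
      \<open>X0\<close> and gives one bound for all \<open>j\<close>, as \<open>cv\<close>
      demands.\<close>
    have s: "skor_bounded_continuous d T (\<lambda>x. clip B (\<psi> x))"
      by (rule sbc_Lipschitz2[OF p(1) p(1), where k="\<lambda>a b. clip B a" and L=1])
        (auto simp: case_prod_beta intro!: clip_continuous continuous_intros order_trans[OF clip_Lipschitz])
    have "(\<integral>w. \<bar>X0 w - clip B (\<psi> (S0 w))\<bar> \<partial>CM0) \<le> (\<integral>w. \<bar>X0 w - \<psi> (S0 w)\<bar> \<partial>CM0)"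
    proof (rule integral_mono_AE)
      show "AE w in CM0. \<bar>X0 w - clip B (\<psi> (S0 w))\<bar> \<le> \<bar>X0 w - \<psi> (S0 w)\<bar>"
        using B
      proof eventually_elim
        case (elim w)
        then show ?case using clip_Lipschitz[of B "X0 w" "\<psi> (S0 w)"] by (simp add: clip_eq)
      qed
    qed (use iX P0.sbc_integrable(2)[OF s] P0.sbc_integrable(2)[OF p(1)] in auto)
    then show ?thesis using s p(2) clip_bound[OF B0] by (intro exI[of _ "\<lambda>x. clip B (\<psi> x)"]) auto
  qed
  then obtain \<psi> where p: "\<And>j. skor_bounded_continuous d T (\<psi> j)" "\<And>j x. \<bar>\<psi> j x\<bar> \<le> B"
    "\<And>j. (\<integral>w. \<bar>X0 w - \<psi> j (S0 w)\<bar> \<partial>CM0) < inverse (real (Suc j))" by metis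
  note ip = Pn.sbc_integrable(2)[OF p(1)] P0.sbc_integrable(2)[OF p(1)]
  \<comment> \<open>A strict bound for the limit process; \<open>cv_L1_limit\<close> turns it into
    one for all large \<open>n\<close>.\<close>
  have lim0: "(\<integral>w. \<bar>\<psi> i (S0 w) - \<psi> j (S0 w)\<bar> \<partial>CM0) < 2 * inverse (real (Suc i))" if "i \<le> j" for i j
  proof -
    have "(\<integral>w. \<bar>\<psi> i (S0 w) - \<psi> j (S0 w)\<bar> \<partial>CM0) \<le> (\<integral>w. \<bar>X0 w - \<psi> i (S0 w)\<bar> + \<bar>X0 w - \<psi> j (S0 w)\<bar> \<partial>CM0)"
      using iX ip(2) by (intro integral_mono) auto
    also have "\<dots> < inverse (real (Suc i)) + inverse (real (Suc j))" using p(3)[of i] p(3)[of j] iX ip(2) by simp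
    also have "inverse (real (Suc j)) \<le> inverse (real (Suc i))" using that by (intro le_imp_inverse_le) auto
    finally show ?thesis by simp
  qed
  have "\<exists>K. \<forall>n\<ge>K. \<forall>i\<le>j. (\<integral>w. \<bar>\<psi> i (S n w) - \<psi> j (S n w)\<bar> \<partial>CMn n) < 2 * inverse (real (Suc i))" for j
  proof -
    have "\<forall>\<^sub>F n in sequentially. \<forall>i\<in>{..j}. (\<integral>w. \<bar>\<psi> i (S n w) - \<psi> j (S n w)\<bar> \<partial>CMn n) < 2 * inverse (real (Suc i))"
      using order_tendstoD(2)[OF cv_L1_limit[OF cv_psi[OF p(1)] cv_psi[OF p(1)]] lim0] by (intro eventually_ball_finite) auto
    then show ?thesis by (simp only: eventually_sequentially Ball_def atMost_iff)
  qed
  then obtain K where K: "\<And>j n i. n \<ge> K j \<Longrightarrow> i \<le> j \<Longrightarrow> (\<integral>w. \<bar>\<psi> i (S n w) - \<psi> j (S n w)\<bar> \<partial>CMn n) < 2 * inverse (real (Suc i))" by metis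
  \<comment> \<open>The largest index \<open>j\<close> up to \<open>n\<close> whose threshold
    \<open>K j\<close> has been passed, and 0 when there is none.\<close>
  define J where "J n = Max (insert 0 {j. j \<le> n \<and> K j \<le> n})" for n
  have fin: "finite (insert 0 {j. j \<le> n \<and> K j \<le> n})" for n by (rule finite.insertI, rule finite_subset[of _ "{..n}"]) auto
  have J1: "j \<le> J n" if "j \<le> n" "K j \<le> n" for j n unfolding J_def using fin that by (intro Max_ge) auto
  have J2: "J n = 0 \<or> K (J n) \<le> n" for n using Max_in[OF fin, of n] unfolding J_def by auto
  define X where "X n w = \<psi> (J n) (S n w)" for n w
  have near: "(\<integral>w. \<bar>X n w - \<psi> i (S n w)\<bar> \<partial>CMn n) < 2 * inverse (real (Suc i))" if "i \<le> n" "K i \<le> n" for i n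
  proof -
    have "i \<le> J n" using J1[OF that] .
    have KJ: "K (J n) \<le> n"
    proof (cases "J n = 0")
      case True
      then show ?thesis using \<open>i \<le> J n\<close> that by simp
    next
      case False
      then show ?thesis using J2[of n] by simp
    qed
    show ?thesis unfolding X_def using K[OF KJ \<open>i \<le> J n\<close>] by (simp add: abs_minus_commute)
  qed
  have "cv X X0"
  proof (rule cv_closed[where B=B])
    show "X n \<in> borel_measurable (CMn n)" for n unfolding X_def by (rule Pn.sbc_integrable(1)[OF p(1)])
    show "AE w in CMn n. \<bar>X n w\<bar> \<le> B" for n unfolding X_def using p(2) by simp
    fix \<epsilon> :: real assume "0 < \<epsilon>"
    then obtain i where i: "inverse (real (Suc i)) < \<epsilon>/2" using reals_Archimedean[of "\<epsilon>/2"] by auto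
    have "(\<integral>w. \<bar>X0 w - \<psi> i (S0 w)\<bar> \<partial>CM0) < \<epsilon>" using p(3)[of i] i \<open>0 < \<epsilon>\<close> by linarith
    moreover have "\<forall>\<^sub>F n in sequentially. (\<integral>w. \<bar>X n w - \<psi> i (S n w)\<bar> \<partial>CMn n) < \<epsilon>"
      using eventually_ge_at_top[of "max i (K i)"]
    proof eventually_elim
      case (elim n)
      then have "(\<integral>w. \<bar>X n w - \<psi> i (S n w)\<bar> \<partial>CMn n) < 2 * inverse (real (Suc i))" by (intro near) auto
      then show ?case using i by linarith
    qed
    ultimately show "\<exists>Y Y0. cv Y Y0 \<and> (\<integral>w. \<bar>X0 w - Y0 w\<bar> \<partial>CM0) < \<epsilon> \<and>
         (\<forall>\<^sub>F n in sequentially. (\<integral>w. \<bar>X n w - Y n w\<bar> \<partial>CMn n) < \<epsilon>)" using cv_psi[OF p(1)] by blast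
  qed (use iX B in auto)
  then show ?thesis by blast
qed

end

text \<open>No measurability is asked for: a nonintegrable function has integral 0 by convention,
  and \<open>B\<close> is nonnegative.\<close>

lemma (in prob_space) integral_abs_le_const:
  assumes "\<And>w. \<bar>h w\<bar> \<le> (B::real)"
  shows "\<bar>\<integral>w. h w \<partial>M\<bar> \<le> B"
proof (cases "integrable M h")
  case True
  have "\<bar>\<integral>w. h w \<partial>M\<bar> \<le> (\<integral>w. \<bar>h w\<bar> \<partial>M)" by (rule integral_abs_bound)
  also have "\<dots> \<le> (\<integral>w. B \<partial>M)" using True assms by (intro integral_mono) auto
  finally show ?thesis using prob_space by simp
next
  case False
  then show ?thesis using assms[of undefined] by (simp add: not_integrable_integral_eq)
qed

section \<open>Time averages of martingales, and conditional expectations at fixed times\<close>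

lemma mono_disc_countable: "mono (a :: real \<Rightarrow> real) \<Longrightarrow> countable {t. \<not> isCont a t}"
  using mono_on_ctble_discont[of UNIV a] by (simp add: mono_on_def mono_def)

context cadlag_proc
begin

lemma cadlag_process_joint_measurable:
  assumes z: "\<And>w. w \<in> space M \<Longrightarrow> cadlag_real T (\<lambda>t. z t w)"
    and m: "\<And>t. t \<in> {0..T} \<Longrightarrow> z t \<in> borel_measurable (completion M)"
  shows "(\<lambda>(s, w). z (clampT T s) w) \<in> borel_measurable (borel \<Otimes>\<^sub>M completion M)"
  by (rule right_cont_measurable) (use cadlag_clamp_right[OF z T] m clampT_in[OF T] in auto)

lemma unif_swap:
  assumes m: "(\<lambda>(s, w). k s w) \<in> borel_measurable (borel \<Otimes>\<^sub>M completion M)"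
    and b: "\<And>s w. w \<in> space M \<Longrightarrow> \<bar>k s w\<bar> \<le> (B::real)" and pq: "p < q"
  shows "(\<integral>w. (\<integral>s. k s w \<partial>unif p q) \<partial>completion M) = (\<integral>s. (\<integral>w. k s w \<partial>completion M) \<partial>unif p q)"
    and "(\<lambda>s. \<integral>w. k s w \<partial>completion M) \<in> borel_measurable borel"
proof -
  interpret U: prob_space "unif p q" by (rule prob_space_unif[OF pq])
  interpret UP: pair_prob_space "unif p q" "completion M" ..
  have sets: "sets (unif p q \<Otimes>\<^sub>M completion M) = sets (borel \<Otimes>\<^sub>M completion M)" by (rule sets_pair_measure_cong) simp_all
  have m': "(\<lambda>(s, w). k s w) \<in> borel_measurable (unif p q \<Otimes>\<^sub>M completion M)"
    using m by (simp cong: measurable_cong_sets add: measurable_cong_sets[OF sets refl])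
  have i: "integrable (unif p q \<Otimes>\<^sub>M completion M) (\<lambda>(s, w). k s w)"
    by (rule UP.integrable_const_bound[of _ B]) (use m' b in \<open>auto simp: space_pair_measure intro!: AE_I2\<close>)
  show "(\<integral>w. (\<integral>s. k s w \<partial>unif p q) \<partial>completion M) = (\<integral>s. (\<integral>w. k s w \<partial>completion M) \<partial>unif p q)"
    using UP.Fubini_integral[OF i] by simp
  have "(\<lambda>s. \<integral>w. k s w \<partial>completion M) \<in> borel_measurable (unif p q)"
    by (rule FS.borel_measurable_lebesgue_integral[OF m'])
  then show "(\<lambda>s. \<integral>w. k s w \<partial>completion M) \<in> borel_measurable borel" by simp
qed

lemma cond_exp_t_eq: "cond_exp_t M d T S t h = real_cond_exp (completion M) (Ft t) h"
  by (simp add: cond_exp_t_def Ft_def)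

text \<open>Joint measurability of a cadlag version permits exchanging the time average with the
  expectation. Under the expectation the version at each time may be replaced by the conditional
  expectation, so the result no longer mentions the version.\<close>

lemma avg_functional:
  assumes p: "skor_bounded_continuous d T \<psi>"
    and z1: "\<And>w. w \<in> space M \<Longrightarrow> cadlag_real T (\<lambda>t. Z t w)"
    and z2: "\<And>t. t \<in> {0..T} \<Longrightarrow> AE w in completion M. Z t w = real_cond_exp (completion M) (Ft t) (\<lambda>w. \<psi> (S w)) w"
    and q: "skor_bounded_continuous d T \<psi>'"
    and K: "continuous_on UNIV (\<lambda>(a, b). K a b)" "\<And>a b. \<bar>K a b\<bar> \<le> (B::real)"
    and ab: "a < b"
  shows "(\<integral>w. (\<integral>s. K (joint_path d T 1 S (\<lambda>i. Z) w s d) (\<psi>' (trunc_path d (joint_path d T 1 S (\<lambda>i. Z) w))) \<partial>unif a b) \<partial>completion M)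
     = (\<integral>s. (\<integral>w. K (real_cond_exp (completion M) (Ft (clampT T s)) (\<lambda>w. \<psi> (S w)) w) (\<psi>' (S w)) \<partial>completion M) \<partial>unif a b)"
    and "(\<lambda>s. \<integral>w. K (real_cond_exp (completion M) (Ft (clampT T s)) (\<lambda>w. \<psi> (S w)) w) (\<psi>' (S w)) \<partial>completion M) \<in> borel_measurable borel"
proof -
  let ?P = "completion M"
  let ?R = "\<lambda>t. real_cond_exp ?P (Ft t) (\<lambda>w. \<psi> (S w))"
  have zF: "Z t \<in> borel_measurable (Ft t)" if "t \<in> {0..T}" for t
    by (rule FS.AE_eq_measurable[OF borel_measurable_cond_exp z2[OF that]])
  have zm: "Z t \<in> borel_measurable ?P" if "t \<in> {0..T}" for t
    by (rule FS.measurable_F_P[OF zF[OF that]])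
  have qm: "(\<lambda>w. \<psi>' (S w)) \<in> borel_measurable ?P" by (rule sbc_integrable(1)[OF q])
  have Km: "(\<lambda>w. K (f w) (\<psi>' (S w))) \<in> borel_measurable ?P" if "f \<in> borel_measurable ?P" for f
  proof -
    have "(\<lambda>w. (f w, \<psi>' (S w))) \<in> borel_measurable ?P" using that qm by (intro borel_measurable_Pair)
    from measurable_compose[OF this borel_measurable_continuous_onI[OF K(1)]] show ?thesis by simp
  qed
  have jm: "(\<lambda>(s, w). K (Z (clampT T s) w) (\<psi>' (S w))) \<in> borel_measurable (borel \<Otimes>\<^sub>M ?P)"
  proof -
    have "(\<lambda>x. (case x of (s, w) \<Rightarrow> Z (clampT T s) w, \<psi>' (S (snd x)))) \<in> borel_measurable (borel \<Otimes>\<^sub>M ?P)"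
      using cadlag_process_joint_measurable[OF z1 zm] measurable_compose[OF measurable_snd qm]
      by (intro borel_measurable_Pair) auto
    from measurable_compose[OF this borel_measurable_continuous_onI[OF K(1)]] show ?thesis by (simp add: case_prod_beta)
  qed
  have eq: "(\<integral>w. K (Z (clampT T s) w) (\<psi>' (S w)) \<partial>?P) = (\<integral>w. K (?R (clampT T s) w) (\<psi>' (S w)) \<partial>?P)" for s
  proof (rule integral_cong_AE)
    have c: "clampT T s \<in> {0..T}" by (rule clampT_in[OF T])
    show "(\<lambda>w. K (Z (clampT T s) w) (\<psi>' (S w))) \<in> borel_measurable ?P" by (rule Km[OF zm[OF c]])
    show "(\<lambda>w. K (?R (clampT T s) w) (\<psi>' (S w))) \<in> borel_measurable ?P"
      by (rule Km[OF borel_measurable_cond_exp2])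
    show "AE w in ?P. K (Z (clampT T s) w) (\<psi>' (S w)) = K (?R (clampT T s) w) (\<psi>' (S w))"
      using z2[OF c] by eventually_elim simp
  qed
  have "(\<integral>w. (\<integral>s. K (joint_path d T 1 S (\<lambda>i. Z) w s d) (\<psi>' (trunc_path d (joint_path d T 1 S (\<lambda>i. Z) w))) \<partial>unif a b) \<partial>?P)
     = (\<integral>w. (\<integral>s. K (Z (clampT T s) w) (\<psi>' (S w)) \<partial>unif a b) \<partial>?P)"
  proof (rule Bochner_Integration.integral_cong[OF refl])
    fix w assume "w \<in> space ?P"
    then have w: "S w \<in> Dsp d T" using S_Dsp by simp
    have "trunc_path d (joint_path d T 1 S (\<lambda>i. Z) w) = S w"
      using Dsp_Rm[OF w] by (auto simp: trunc_path_def joint_path_def Rm_def fun_eq_iff)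
    then show "(\<integral>s. K (joint_path d T 1 S (\<lambda>i. Z) w s d) (\<psi>' (trunc_path d (joint_path d T 1 S (\<lambda>i. Z) w))) \<partial>unif a b)
       = (\<integral>s. K (Z (clampT T s) w) (\<psi>' (S w)) \<partial>unif a b)"
      by (simp add: joint_path_def)
  qed
  also have "\<dots> = (\<integral>s. (\<integral>w. K (Z (clampT T s) w) (\<psi>' (S w)) \<partial>?P) \<partial>unif a b)"
    by (rule unif_swap(1)[OF jm K(2) ab])
  finally show "(\<integral>w. (\<integral>s. K (joint_path d T 1 S (\<lambda>i. Z) w s d) (\<psi>' (trunc_path d (joint_path d T 1 S (\<lambda>i. Z) w))) \<partial>unif a b) \<partial>?P)
     = (\<integral>s. (\<integral>w. K (?R (clampT T s) w) (\<psi>' (S w)) \<partial>?P) \<partial>unif a b)" unfolding eq .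
  show "(\<lambda>s. \<integral>w. K (?R (clampT T s) w) (\<psi>' (S w)) \<partial>?P) \<in> borel_measurable borel"
    using unif_swap(2)[OF jm K(2) ab] unfolding eq .
qed

end

context ext_conv
begin

text \<open>The only consequence of extended weak convergence that is used: convergence of time averages
  of functionals of a martingale and the path.\<close>

lemma martingale_avg_limit:
  assumes p: "skor_bounded_continuous d T \<psi>"
    and Zn: "\<And>n w. w \<in> space (M n) \<Longrightarrow> cadlag_real T (\<lambda>t. Zn n t w)"
      "\<And>n t. t \<in> {0..T} \<Longrightarrow> AE w in CMn n. Zn n t w = real_cond_exp (CMn n) (Fn n t) (\<lambda>w. \<psi> (S n w)) w"
    and Z0: "\<And>w. w \<in> space N \<Longrightarrow> cadlag_real T (\<lambda>t. Z0 t w)"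
      "\<And>t. t \<in> {0..T} \<Longrightarrow> AE w in CM0. Z0 t w = real_cond_exp CM0 (F0 t) (\<lambda>w. \<psi> (S0 w)) w"
    and q: "skor_bounded_continuous d T \<psi>'"
    and K: "continuous_on UNIV (\<lambda>(a, b). K a b)" "\<And>a b. \<bar>K a b\<bar> \<le> (B::real)"
    and ab: "a < b"
  shows "(\<lambda>n. \<integral>s. (\<integral>w. K (real_cond_exp (CMn n) (Fn n (clampT T s)) (\<lambda>w. \<psi> (S n w)) w) (\<psi>' (S n w)) \<partial>CMn n) \<partial>unif a b)
    \<longlonglongrightarrow> (\<integral>s. (\<integral>w. K (real_cond_exp CM0 (F0 (clampT T s)) (\<lambda>w. \<psi> (S0 w)) w) (\<psi>' (S0 w)) \<partial>CM0) \<partial>unif a b)"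
proof -
  define \<phi> where "\<phi> x = (\<integral>s. K (x s d) (\<psi>' (trunc_path d x)) \<partial>unif a b)" for x
  have sb: "skor_bounded_continuous (d + 1) T \<phi>"
    unfolding \<phi>_def by (rule skor_continuous_avg[OF T_pos ab _ K skor_continuous_trunc[OF sbc_cont[OF q] T_pos]]) auto
  have lim: "(\<lambda>n. \<integral>w. \<phi> (joint_path d T 1 (S n) (\<lambda>i. Zn n) w) \<partial>CMn n) \<longlonglongrightarrow> (\<integral>w. \<phi> (joint_path d T 1 S0 (\<lambda>i. Z0) w) \<partial>CM0)"
    using ext_weak[rule_format, of 1 "\<lambda>_. \<psi>" "\<lambda>i. Zn" "\<lambda>i. Z0" \<phi>] p Zn Z0 sb
    by (simp add: Pn.cond_exp_t_eq P0.cond_exp_t_eq)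
  have "(\<integral>w. \<phi> (joint_path d T 1 (S n) (\<lambda>i. Zn n) w) \<partial>CMn n)
    = (\<integral>s. (\<integral>w. K (real_cond_exp (CMn n) (Fn n (clampT T s)) (\<lambda>w. \<psi> (S n w)) w) (\<psi>' (S n w)) \<partial>CMn n) \<partial>unif a b)" for n
    unfolding \<phi>_def by (rule Pn.avg_functional(1)[where Z="Zn n", OF p Zn q K ab])
  moreover have "(\<integral>w. \<phi> (joint_path d T 1 S0 (\<lambda>i. Z0) w) \<partial>CM0)
    = (\<integral>s. (\<integral>w. K (real_cond_exp CM0 (F0 (clampT T s)) (\<lambda>w. \<psi> (S0 w)) w) (\<psi>' (S0 w)) \<partial>CM0) \<partial>unif a b)"
    unfolding \<phi>_def by (rule P0.avg_functional(1)[where Z=Z0, OF p Z0 q K ab])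
  ultimately show ?thesis using lim by simp
qed

text \<open>The exceptional times are the jumps of \<open>a0\<close>, the second moment of the limit
  martingale. At a continuity point \<open>t\<close>, take \<open>\<psi>'\<close> close to the limit
  variable. The average over \<open>[t, t + \<delta>]\<close> of the distance to
  \<open>\<psi>'\<close> converges, hence is small for large \<open>n\<close>. Passing from the
  average to \<open>t\<close> requires small L1-increments of the n-th martingale on this interval.
  They are bounded by the growth of its second moment, which, being nondecreasing, is bounded by
  averages over the intervals on either side; those averages converge too.\<close>

lemma cv_cond_exp_psi:
  assumes p: "skor_bounded_continuous d T \<psi>"
  shows "\<exists>C. countable C \<and> (\<forall>t. 0 < t \<and> t < T \<and> t \<notin> C \<longrightarrow>
    cv (\<lambda>n. real_cond_exp (CMn n) (Fn n t) (\<lambda>w. \<psi> (S n w))) (real_cond_exp CM0 (F0 t) (\<lambda>w. \<psi> (S0 w))))"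
proof -
  obtain B where B: "0 \<le> B" "\<forall>x\<in>Dsp d T. \<bar>\<psi> x\<bar> \<le> B" using sbc_bound[OF p] by blast
  have Bn: "\<bar>\<psi> (S n w)\<bar> \<le> B" if "w \<in> space (CMn n)" for n w using B(2) Pn.S_Dsp that by simp
  have B0: "\<bar>\<psi> (S0 w)\<bar> \<le> B" if "w \<in> space CM0" for w using B(2) P0.S_Dsp that by simp
  note pm = Pn.sbc_integrable(1)[OF p] P0.sbc_integrable(1)[OF p]
  define Rn where "Rn n t = real_cond_exp (CMn n) (Fn n t) (\<lambda>w. \<psi> (S n w))" for n t
  define R0 where "R0 t = real_cond_exp CM0 (F0 t) (\<lambda>w. \<psi> (S0 w))" for t
  have Rb: "AE w in CMn n. \<bar>Rn n t w\<bar> \<le> B" "AE w in CM0. \<bar>R0 t w\<bar> \<le> B" for n t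
    unfolding Rn_def R0_def
    by (rule Pn.FS.cond_exp_bound[OF pm(1)], use Bn in auto)
      (rule P0.FS.cond_exp_bound[OF pm(2)], use B0 in auto)
  have Rm: "Rn n t \<in> borel_measurable (CMn n)" "R0 t \<in> borel_measurable CM0" for n t by (simp_all add: Rn_def R0_def)
  have Ri: "integrable (CMn n) (Rn n t)" "integrable CM0 (R0 t)" for n t
    by (rule Pn.FS.integrable_const_bound[of _ B], use Rb Rm in auto)
      (rule P0.FS.integrable_const_bound[of _ B], use Rb Rm in auto)
  have "\<exists>Z. (\<forall>w\<in>space (CMn n). cadlag_real T (\<lambda>t. Z t w)) \<and> (\<forall>t\<in>{0..T}. AE w in CMn n. Z t w = Rn n t w)" for n
    unfolding Rn_def using Pn.FS.cadlag_version_exists[OF pm(1) Bn T_pos] by blast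
  then obtain Zn where Zn: "\<And>n w. w \<in> space (M n) \<Longrightarrow> cadlag_real T (\<lambda>t. Zn n t w)"
      "\<And>n t. t \<in> {0..T} \<Longrightarrow> AE w in CMn n. Zn n t w = Rn n t w" by (metis space_completion)
  obtain Z0 where Z0: "\<And>w. w \<in> space N \<Longrightarrow> cadlag_real T (\<lambda>t. Z0 t w)"
      "\<And>t. t \<in> {0..T} \<Longrightarrow> AE w in CM0. Z0 t w = R0 t w"
    unfolding R0_def using P0.FS.cadlag_version_exists[OF pm(2) B0 T_pos] by (metis space_completion)
  define an where "an n t = (\<integral>w. (Rn n t w)\<^sup>2 \<partial>CMn n)" for n t
  define a0 where "a0 t = (\<integral>w. (R0 t w)\<^sup>2 \<partial>CM0)" for t
  have anm: "an n s \<le> an n t" if "s \<le> t" for n s t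
    unfolding an_def Rn_def by (rule Pn.FS.cond_exp_L2_mono[OF pm(1) Bn that])
  have a0m: "a0 s \<le> a0 t" if "s \<le> t" for s t
    unfolding a0_def R0_def by (rule P0.FS.cond_exp_L2_mono[OF pm(2) B0 that])
  have in1: "(\<integral>w. \<bar>Rn n t w - Rn n s w\<bar> \<partial>CMn n) \<le> sqrt (an n t - an n s)" if "s \<le> t" for n s t
    unfolding an_def Rn_def by (rule Pn.FS.cond_exp_L1_increment[OF pm(1) Bn that])
  have in0: "(\<integral>w. \<bar>R0 t w - R0 s w\<bar> \<partial>CM0) \<le> sqrt (a0 t - a0 s)" if "s \<le> t" for s t
    unfolding a0_def R0_def by (rule P0.FS.cond_exp_L1_increment[OF pm(2) B0 that])
  have cC: "countable {t. \<not> isCont a0 t}" by (rule mono_disc_countable) (simp add: mono_def a0m)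
  have main: "cv (\<lambda>n. Rn n t) (R0 t)" if t: "0 < t" "t < T" "isCont a0 t" for t
  proof (rule cv_closed[OF Rm Rb])
    fix \<epsilon> :: real assume "0 < \<epsilon>"
    \<comment> \<open>The final bound is 5 times \<eta>: 3 for the average and 2 for the return to
      \<open>t\<close>.\<close>
    define \<eta> where "\<eta> = \<epsilon>/8"
    have \<eta>: "0 < \<eta>" using \<open>0 < \<epsilon>\<close> by (simp add: \<eta>_def)
    have "0 < \<eta>\<^sup>2" using \<eta> by simp
    then obtain \<delta>0 where d0: "\<delta>0 > 0" "\<And>s. \<bar>s - t\<bar> < \<delta>0 \<Longrightarrow> \<bar>a0 s - a0 t\<bar> < \<eta>\<^sup>2"
      using t(3) unfolding continuous_at_real_range by (metis real_norm_def)
    \<comment> \<open>Three adjacent intervals of length \<delta> are used, from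
      \<open>t - \<delta>\<close> to \<open>t + 2 * \<delta>\<close>: the middle one carries the
      distance, the outer ones bound the second moment at its ends. All must fit into
      \<open>[0, T]\<close> and into the window where \<open>a0\<close> is nearly constant.\<close>
    define \<delta> where "\<delta> = min (\<delta>0/3) (min (t/2) ((T - t)/3))"
    have dl: "\<delta> \<le> \<delta>0/3" "\<delta> \<le> min (t/2) ((T - t)/3)" unfolding \<delta>_def by (rule min.cobounded1, rule min.cobounded2)
    have d1: "\<delta> \<le> t/2" and d2: "\<delta> \<le> (T - t)/3" using dl(2) by simp_all
    have d3: "0 < \<delta>" unfolding \<delta>_def using d0(1) t by simp
    have \<delta>: "0 < \<delta>" "0 \<le> t - \<delta>" "t + 2 * \<delta> \<le> T" "2 * \<delta> < \<delta>0"
      using d1 d2 d3 dl(1) by (simp_all add: field_simps)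
    have osc: "a0 (t + 2 * \<delta>) - a0 (t - \<delta>) < 2 * \<eta>\<^sup>2" "a0 (t + \<delta>) - a0 t < \<eta>\<^sup>2"
      using d0(2)[of "t + 2 * \<delta>"] d0(2)[of "t - \<delta>"] d0(2)[of "t + \<delta>"] \<delta> by auto
    have "P0.approximable (R0 t)" by (rule P0.approximable_F[of _ t, OF _ Ri(2)]) (simp add: R0_def)
    then obtain \<psi>' where q: "skor_bounded_continuous d T \<psi>'" "(\<integral>w. \<bar>R0 t w - \<psi>' (S0 w)\<bar> \<partial>CM0) < \<eta>"
      using \<eta> unfolding P0.approximable_def by blast
    obtain B1 where B1: "0 \<le> B1" "\<forall>x\<in>Dsp d T. \<bar>\<psi>' x\<bar> \<le> B1" using sbc_bound[OF q(1)] by blast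
    define B' where "B' = max B B1"
    have B': "B \<le> B'" "B1 \<le> B'" "0 \<le> B'" using B by (auto simp: B'_def)
    note iq = Pn.sbc_integrable(2)[OF q(1)] P0.sbc_integrable(2)[OF q(1)]
    \<comment> \<open>Test functions have to be bounded; clipping at \<open>B'\<close> changes
      nothing on the range of the variables. \<open>K1\<close> yields the distance to
      \<open>\<psi>'\<close>, \<open>K2\<close> the second moment.\<close>
    define K1 where "K1 x y = \<bar>clip B' x - clip B' y\<bar>" for x y
    define K2 where "K2 x y = (clip B' x)\<^sup>2" for x y :: real
    have K1c: "continuous_on UNIV (\<lambda>(a, b). K1 a b)"
      unfolding K1_def case_prod_beta by (intro continuous_intros clip_continuous)
    have K1b: "\<bar>K1 a b\<bar> \<le> 2 * B'" for a b
      unfolding K1_def using clip_bound[OF B'(3), of a] clip_bound[OF B'(3), of b] by linarith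
    have K2c: "continuous_on UNIV (\<lambda>(a, b). K2 a b)"
      unfolding K2_def case_prod_beta by (intro continuous_intros clip_continuous)
    have K2b: "\<bar>K2 a b\<bar> \<le> B'\<^sup>2" for a b
      unfolding K2_def using clip_bound[OF B'(3), of a] B'(3) by (simp add: abs_le_square_iff[symmetric])
    note K1 = K1c K1b and K2 = K2c K2b
    define Dn where "Dn n s = (\<integral>w. \<bar>Rn n s w - \<psi>' (S n w)\<bar> \<partial>CMn n)" for n s
    define D0 where "D0 s = (\<integral>w. \<bar>R0 s w - \<psi>' (S0 w)\<bar> \<partial>CM0)" for s
    have e1: "(\<integral>w. K1 (Rn n s w) (\<psi>' (S n w)) \<partial>CMn n) = Dn n s" for n s
      unfolding Dn_def
    proof (rule integral_cong_AE)
      show "AE w in CMn n. K1 (Rn n s w) (\<psi>' (S n w)) = \<bar>Rn n s w - \<psi>' (S n w)\<bar>"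
        using Rb(1)[of n s] AE_space
      proof eventually_elim
        case (elim w)
        then have "\<bar>\<psi>' (S n w)\<bar> \<le> B'" using B1(2) Pn.S_Dsp[of w n] B'(2) by force
        then show ?case using elim B'(1) by (simp add: K1_def clip_eq)
      qed
    qed (use Rm(1)[of n s] iq(1)[of n] in \<open>auto simp: K1_def clip_def\<close>)
    have e2: "(\<integral>w. K1 (R0 s w) (\<psi>' (S0 w)) \<partial>CM0) = D0 s" for s
      unfolding D0_def
    proof (rule integral_cong_AE)
      show "AE w in CM0. K1 (R0 s w) (\<psi>' (S0 w)) = \<bar>R0 s w - \<psi>' (S0 w)\<bar>"
        using Rb(2)[of s] AE_space
      proof eventually_elim
        case (elim w)
        then have "\<bar>\<psi>' (S0 w)\<bar> \<le> B'" using B1(2) P0.S_Dsp[of w] B'(2) by force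
        then show ?case using elim B'(1) by (simp add: K1_def clip_eq)
      qed
    qed (use Rm(2)[of s] iq(2) in \<open>auto simp: K1_def clip_def\<close>)
    have e3: "(\<integral>w. K2 (Rn n s w) (\<psi>' (S n w)) \<partial>CMn n) = an n s" for n s
      unfolding an_def
    proof (rule integral_cong_AE)
      show "AE w in CMn n. K2 (Rn n s w) (\<psi>' (S n w)) = (Rn n s w)\<^sup>2"
        using Rb(1)[of n s] by eventually_elim (use B'(1) in \<open>simp add: K2_def clip_eq\<close>)
    qed (use Rm(1)[of n s] in \<open>auto simp: K2_def clip_def\<close>)
    have e4: "(\<integral>w. K2 (R0 s w) (\<psi>' (S0 w)) \<partial>CM0) = a0 s" for s
      unfolding a0_def
    proof (rule integral_cong_AE)
      show "AE w in CM0. K2 (R0 s w) (\<psi>' (S0 w)) = (R0 s w)\<^sup>2"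
        using Rb(2)[of s] by eventually_elim (use B'(1) in \<open>simp add: K2_def clip_eq\<close>)
    qed (use Rm(2)[of s] in \<open>auto simp: K2_def clip_def\<close>)
    note Znr = Zn(1) Zn(2)[unfolded Rn_def] and Z0r = Z0(1) Z0(2)[unfolded R0_def]
    have limK1: "(\<lambda>n. \<integral>s. Dn n (clampT T s) \<partial>unif a b) \<longlonglongrightarrow> (\<integral>s. D0 (clampT T s) \<partial>unif a b)" if "a < b" for a b
      using martingale_avg_limit[where Zn=Zn and ?Z0.0=Z0, OF p Znr Z0r q(1) K1 that, folded Rn_def R0_def, unfolded e1 e2] by simp
    have limK2: "(\<lambda>n. \<integral>s. an n (clampT T s) \<partial>unif a b) \<longlonglongrightarrow> (\<integral>s. a0 (clampT T s) \<partial>unif a b)" if "a < b" for a b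
      using martingale_avg_limit[where Zn=Zn and ?Z0.0=Z0, OF p Znr Z0r q(1) K2 that, folded Rn_def R0_def, unfolded e3 e4] by simp
    have mD: "(\<lambda>s. Dn n (clampT T s)) \<in> borel_measurable borel" "(\<lambda>s. D0 (clampT T s)) \<in> borel_measurable borel" for n
      using Pn.avg_functional(2)[where Z="Zn n", OF p Znr q(1) K1 zero_less_one, folded Rn_def, unfolded e1]
        P0.avg_functional(2)[where Z=Z0, OF p Z0r q(1) K1 zero_less_one, folded R0_def, unfolded e2] by simp_all
    have mA: "(\<lambda>s. an n (clampT T s)) \<in> borel_measurable borel" "(\<lambda>s. a0 (clampT T s)) \<in> borel_measurable borel" for n
      using Pn.avg_functional(2)[where Z="Zn n", OF p Znr q(1) K2 zero_less_one, folded Rn_def, unfolded e3]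
        P0.avg_functional(2)[where Z=Z0, OF p Z0r q(1) K2 zero_less_one, folded R0_def, unfolded e4] by simp_all
    have bD: "\<bar>Dn n s\<bar> \<le> 2 * B'" "\<bar>D0 s\<bar> \<le> 2 * B'" for n s
      unfolding e1[symmetric] e2[symmetric]
      by (rule Pn.FS.integral_abs_le_const, use K1 in auto) (rule P0.FS.integral_abs_le_const, use K1 in auto)
    have bA: "\<bar>an n s\<bar> \<le> B'\<^sup>2" "\<bar>a0 s\<bar> \<le> B'\<^sup>2" for n s
      unfolding e3[symmetric] e4[symmetric]
      by (rule Pn.FS.integral_abs_le_const, use K2 in auto) (rule P0.FS.integral_abs_le_const, use K2 in auto)
    have cl: "clampT T s = s" if "s \<in> {t - \<delta>..t + 2 * \<delta>}" for s using that \<delta> by auto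
    define UD where "UD n = (\<integral>s. Dn n (clampT T s) \<partial>unif t (t + \<delta>))" for n
    define UD0 where "UD0 = (\<integral>s. D0 (clampT T s) \<partial>unif t (t + \<delta>))"
    define Ur where "Ur n = (\<integral>s. an n (clampT T s) \<partial>unif (t + \<delta>) (t + 2 * \<delta>))" for n
    define Ul where "Ul n = (\<integral>s. an n (clampT T s) \<partial>unif (t - \<delta>) t)" for n
    define Ur0 where "Ur0 = (\<integral>s. a0 (clampT T s) \<partial>unif (t + \<delta>) (t + 2 * \<delta>))"
    define Ul0 where "Ul0 = (\<integral>s. a0 (clampT T s) \<partial>unif (t - \<delta>) t)"
    have l1: "UD \<longlonglongrightarrow> UD0" unfolding UD_def UD0_def by (rule limK1) (use \<delta> in simp)
    have l2: "Ur \<longlonglongrightarrow> Ur0" unfolding Ur_def Ur0_def by (rule limK2) (use \<delta> in simp)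
    have l3: "Ul \<longlonglongrightarrow> Ul0" unfolding Ul_def Ul0_def by (rule limK2) (use \<delta> in simp)
    have UD0le: "UD0 \<le> 2 * \<eta>" unfolding UD0_def
    proof (rule unif_avg_le[where h="D0" and c="clampT T", OF _ mD(2) bD(2)])
      fix s assume s: "s \<in> {t..t + \<delta>}"
      have "D0 s \<le> (\<integral>w. \<bar>R0 t w - \<psi>' (S0 w)\<bar> + \<bar>R0 s w - R0 t w\<bar> \<partial>CM0)"
        unfolding D0_def using Ri iq by (intro integral_mono) auto
      also have "\<dots> \<le> \<eta> + sqrt (a0 s - a0 t)" using q(2) in0[of t s] s Ri iq by simp
      also have "sqrt (a0 s - a0 t) \<le> sqrt (\<eta>\<^sup>2)" using a0m[of s "t + \<delta>"] osc(2) s by (intro real_sqrt_le_mono) auto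
      also have "\<dots> = \<eta>" using \<eta> by simp
      finally show "D0 (clampT T s) \<le> 2 * \<eta>" using cl[of s] s \<delta> by simp
    qed (use \<delta> in simp)
    have "Ur0 \<le> a0 (t + 2 * \<delta>)" unfolding Ur0_def
      by (rule unif_avg_le[where h="a0" and c="clampT T", OF _ mA(2) bA(2)]) (use \<delta> cl a0m in auto)
    moreover have "a0 (t - \<delta>) \<le> Ul0" unfolding Ul0_def
      by (rule unif_avg_ge[where h="a0" and c="clampT T", OF _ mA(2) bA(2)]) (use \<delta> cl a0m in auto)
    ultimately have "Ur0 - Ul0 < 3 * \<eta>\<^sup>2" using osc(1) \<open>0 < \<eta>\<^sup>2\<close> by linarith
    then have ev1: "\<forall>\<^sub>F n in sequentially. Ur n - Ul n < 3 * \<eta>\<^sup>2"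
      using order_tendstoD(2)[OF tendsto_diff[OF l2 l3]] by blast
    have ev2: "\<forall>\<^sub>F n in sequentially. UD n < 3 * \<eta>"
      using UD0le \<eta> by (intro order_tendstoD(2)[OF l1]) linarith
    have "\<forall>\<^sub>F n in sequentially. Dn n t < \<epsilon>"
      using ev1 ev2
    proof eventually_elim
      case (elim n)
      \<comment> \<open>By monotonicity the averages to the right of \<open>t + \<delta>\<close> and
        to the left of \<open>t\<close> enclose the increment of the second moment.\<close>
      have "an n (t + \<delta>) \<le> Ur n" unfolding Ur_def
        by (rule unif_avg_ge[where h="an n" and c="clampT T", OF _ mA(1) bA(1)]) (use \<delta> cl anm in auto)
      moreover have "Ul n \<le> an n t" unfolding Ul_def
        by (rule unif_avg_le[where h="an n" and c="clampT T", OF _ mA(1) bA(1)]) (use \<delta> cl anm in auto)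
      ultimately have "an n (t + \<delta>) - an n t \<le> 4 * \<eta>\<^sup>2" using elim(1) \<open>0 < \<eta>\<^sup>2\<close> by linarith
      moreover have "4 * \<eta>\<^sup>2 = (2 * \<eta>)\<^sup>2" by (simp add: power2_eq_square)
      ultimately have "an n (t + \<delta>) - an n t \<le> (2 * \<eta>)\<^sup>2" by (rule ord_le_eq_trans)
      then have sq: "sqrt (an n (t + \<delta>) - an n t) \<le> 2 * \<eta>" using \<eta> by (intro real_le_lsqrt) (use anm[of t "t+\<delta>" n] \<delta> in auto)
      have "Dn n t - 2 * \<eta> \<le> UD n" unfolding UD_def
      proof (rule unif_avg_ge[where h="Dn n" and c="clampT T", OF _ mD(1) bD(1)])
        fix s assume s: "s \<in> {t..t + \<delta>}"
        have "Dn n t \<le> (\<integral>w. \<bar>Rn n s w - \<psi>' (S n w)\<bar> + \<bar>Rn n s w - Rn n t w\<bar> \<partial>CMn n)"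
          unfolding Dn_def using Ri iq by (intro integral_mono) auto
        also have "\<dots> \<le> Dn n s + sqrt (an n s - an n t)" using in1[of t s n] s Ri iq by (simp add: Dn_def)
        also have "sqrt (an n s - an n t) \<le> sqrt (an n (t + \<delta>) - an n t)" using anm[of s "t + \<delta>" n] s by (intro real_sqrt_le_mono) auto
        finally show "Dn n t - 2 * \<eta> \<le> Dn n (clampT T s)" using sq cl[of s] s \<delta> by simp
      qed (use \<delta> in simp)
      then show ?case using elim \<eta> by (simp add: \<eta>_def)
    qed
    moreover have "(\<integral>w. \<bar>R0 t w - \<psi>' (S0 w)\<bar> \<partial>CM0) < \<epsilon>" using q(2) \<eta> by (simp add: \<eta>_def)
    ultimately show "\<exists>Y Y0. cv Y Y0 \<and> (\<integral>w. \<bar>R0 t w - Y0 w\<bar> \<partial>CM0) < \<epsilon> \<and>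
         (\<forall>\<^sub>F n in sequentially. (\<integral>w. \<bar>Rn n t w - Y n w\<bar> \<partial>CMn n) < \<epsilon>)"
      using cv_psi[OF q(1)] unfolding Dn_def by blast
  qed
  show ?thesis
  proof (intro exI[of _ "{t. \<not> isCont a0 t}"] conjI allI impI cC)
    fix t assume "0 < t \<and> t < T \<and> t \<notin> {t. \<not> isCont a0 t}"
    then have "0 < t" "t < T" "isCont a0 t" by blast+
    then have "cv (\<lambda>n. Rn n t) (R0 t)" by (rule main)
    then show "cv (\<lambda>n. real_cond_exp (CMn n) (Fn n t) (\<lambda>w. \<psi> (S n w))) (real_cond_exp CM0 (F0 t) (\<lambda>w. \<psi> (S0 w)))"
      unfolding Rn_def R0_def .
  qed
qed

text \<open>Conditional expectation contracts L1, so functionals of accuracy 1/(j+1) suffice; their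
  exceptional sets are united over \<open>j\<close>.\<close>

lemma cv_cond_exp:
  assumes X: "cv X X0"
  shows "\<exists>C. countable C \<and> (\<forall>t. 0 < t \<and> t < T \<and> t \<notin> C \<longrightarrow>
    cv (\<lambda>n. real_cond_exp (CMn n) (Fn n t) (X n)) (real_cond_exp CM0 (F0 t) X0))"
proof -
  obtain B where B: "0 \<le> B" "\<And>n. AE w in CMn n. \<bar>X n w\<bar> \<le> B" "AE w in CM0. \<bar>X0 w\<bar> \<le> B" using cv_bound[OF X] by metis
  have "\<exists>\<psi>. skor_bounded_continuous d T \<psi> \<and> (\<integral>w. \<bar>X0 w - \<psi> (S0 w)\<bar> \<partial>CM0) < inverse (real (Suc j)) \<and>
         (\<forall>\<^sub>F n in sequentially. (\<integral>w. \<bar>X n w - \<psi> (S n w)\<bar> \<partial>CMn n) < inverse (real (Suc j)))" for j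
    using X unfolding cv_def by simp
  then have "\<forall>j. \<exists>\<psi>. skor_bounded_continuous d T \<psi> \<and> (\<integral>w. \<bar>X0 w - \<psi> (S0 w)\<bar> \<partial>CM0) < inverse (real (Suc j)) \<and>
         (\<forall>\<^sub>F n in sequentially. (\<integral>w. \<bar>X n w - \<psi> (S n w)\<bar> \<partial>CMn n) < inverse (real (Suc j)))" by blast
  from choice[OF this] obtain \<psi> where ps: "\<forall>j. skor_bounded_continuous d T (\<psi> j) \<and> (\<integral>w. \<bar>X0 w - \<psi> j (S0 w)\<bar> \<partial>CM0) < inverse (real (Suc j)) \<and>
         (\<forall>\<^sub>F n in sequentially. (\<integral>w. \<bar>X n w - \<psi> j (S n w)\<bar> \<partial>CMn n) < inverse (real (Suc j)))" ..
  have p: "skor_bounded_continuous d T (\<psi> j)" "(\<integral>w. \<bar>X0 w - \<psi> j (S0 w)\<bar> \<partial>CM0) < inverse (real (Suc j))"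
     "\<forall>\<^sub>F n in sequentially. (\<integral>w. \<bar>X n w - \<psi> j (S n w)\<bar> \<partial>CMn n) < inverse (real (Suc j))" for j
    using ps[rule_format, of j] by blast+
  have "\<exists>C. countable C \<and> (\<forall>t. 0 < t \<and> t < T \<and> t \<notin> C \<longrightarrow>
    cv (\<lambda>n. real_cond_exp (CMn n) (Fn n t) (\<lambda>w. \<psi> j (S n w))) (real_cond_exp CM0 (F0 t) (\<lambda>w. \<psi> j (S0 w))))" for j
    by (rule cv_cond_exp_psi[OF p(1)])
  then have "\<forall>j. \<exists>C. countable C \<and> (\<forall>t. 0 < t \<and> t < T \<and> t \<notin> C \<longrightarrow>
    cv (\<lambda>n. real_cond_exp (CMn n) (Fn n t) (\<lambda>w. \<psi> j (S n w))) (real_cond_exp CM0 (F0 t) (\<lambda>w. \<psi> j (S0 w))))" by blast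
  from choice[OF this] obtain C where Cs: "\<forall>j. countable (C j) \<and> (\<forall>t. 0 < t \<and> t < T \<and> t \<notin> C j \<longrightarrow>
    cv (\<lambda>n. real_cond_exp (CMn n) (Fn n t) (\<lambda>w. \<psi> j (S n w))) (real_cond_exp CM0 (F0 t) (\<lambda>w. \<psi> j (S0 w))))" ..
  have C: "countable (C j)" "0 < t \<Longrightarrow> t < T \<Longrightarrow> t \<notin> C j \<Longrightarrow>
    cv (\<lambda>n. real_cond_exp (CMn n) (Fn n t) (\<lambda>w. \<psi> j (S n w))) (real_cond_exp CM0 (F0 t) (\<lambda>w. \<psi> j (S0 w)))" for j t
    using Cs[rule_format, of j] by simp_all
  have "cv (\<lambda>n. real_cond_exp (CMn n) (Fn n t) (X n)) (real_cond_exp CM0 (F0 t) X0)"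
    if t: "0 < t" "t < T" "t \<notin> (\<Union>j. C j)" for t
  proof (rule cv_closed[of _ _ B])
    show "AE w in CMn n. \<bar>real_cond_exp (CMn n) (Fn n t) (X n) w\<bar> \<le> B" for n
      by (rule Pn.FS.cond_exp_bound[OF cv_meas(1)[OF X] B(2)])
    show "AE w in CM0. \<bar>real_cond_exp CM0 (F0 t) X0 w\<bar> \<le> B"
      by (rule P0.FS.cond_exp_bound[OF cv_meas(2)[OF X] B(3)])
    fix \<epsilon> :: real assume "0 < \<epsilon>"
    then obtain j where j: "inverse (real (Suc j)) < \<epsilon>" using reals_Archimedean by blast
    let ?Y = "\<lambda>n. real_cond_exp (CMn n) (Fn n t) (\<lambda>w. \<psi> j (S n w))" and ?L = "real_cond_exp CM0 (F0 t) (\<lambda>w. \<psi> j (S0 w))"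
    have "cv ?Y ?L" using C(2)[of t j] t by blast
    moreover have "(\<integral>w. \<bar>real_cond_exp CM0 (F0 t) X0 w - ?L w\<bar> \<partial>CM0) < \<epsilon>"
      using P0.FS.cond_exp_L1[OF cv_int(2)[OF X] P0.sbc_integrable(2)[OF p(1)], of t j] p(2)[of j] j by linarith
    moreover have "\<forall>\<^sub>F n in sequentially. (\<integral>w. \<bar>real_cond_exp (CMn n) (Fn n t) (X n) w - ?Y n w\<bar> \<partial>CMn n) < \<epsilon>"
      using p(3)[of j]
    proof eventually_elim
      case (elim n)
      then show ?case using Pn.FS.cond_exp_L1[OF cv_int(1)[OF X] Pn.sbc_integrable(2)[OF p(1)], of n t j] j by linarith
    qed
    ultimately show "\<exists>Y Y0. cv Y Y0 \<and> (\<integral>w. \<bar>real_cond_exp CM0 (F0 t) X0 w - Y0 w\<bar> \<partial>CM0) < \<epsilon> \<and>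
         (\<forall>\<^sub>F n in sequentially. (\<integral>w. \<bar>real_cond_exp (CMn n) (Fn n t) (X n) w - Y n w\<bar> \<partial>CMn n) < \<epsilon>)" by blast
  qed simp_all
  then show ?thesis using C(1) by (intro exI[of _ "\<Union>j. C j"]) auto
qed

end

section \<open>Increments of the path between close stopping times\<close>

context cadlag_proc
begin

lemma euclid_measurable:
  assumes "\<And>i. (\<lambda>x. v x i) \<in> borel_measurable Q" "\<And>i. (\<lambda>x. w x i) \<in> borel_measurable Q"
  shows "(\<lambda>x. euclid d (v x) (w x)) \<in> borel_measurable Q"
  unfolding euclid_def using assms by measurable

lemma S_clamp: "w \<in> space M \<Longrightarrow> S w (min (t + u) T) = S w (t + u)"
proof -
  assume w: "w \<in> space M"
  show ?thesis
  proof (cases "t + u \<le> T")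
    case False
    then show ?thesis using Dsp_ge_T[OF S_Dsp[OF w] T, of "t + u"] by (simp add: min_def)
  qed simp
qed

lemma S_shift_measurable:
  assumes s: "\<sigma> \<in> borel_measurable (completion M)"
  shows "(\<lambda>x. S (snd x) (\<sigma> (snd x) + fst x) i) \<in> borel_measurable (borel \<Otimes>\<^sub>M completion M)"
proof -
  have [measurable]: "(\<lambda>x. \<sigma> (snd x)) \<in> borel_measurable (borel \<Otimes>\<^sub>M completion M :: (real \<times> 'a) measure)"
    by (rule measurable_compose[OF measurable_snd s])
  have "(\<lambda>x. (\<sigma> (snd x) + fst x, snd x)) \<in> measurable (borel \<Otimes>\<^sub>M completion M) (borel \<Otimes>\<^sub>M completion M)"
    by measurable
  from measurable_compose[OF this S_joint_measurable[of i]] show ?thesis by simp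
qed

text \<open>The time \<open>\<sigma> w + u\<close> is not cut off at \<open>T\<close>: paths are
  constant from there on, and without the cut-off shifts simply add.\<close>

definition jump_set :: "real \<Rightarrow> ('a \<Rightarrow> real) \<Rightarrow> real \<Rightarrow> 'a set" where
  "jump_set \<eta> \<sigma> u = {w\<in>space M. \<eta> < euclid d (S w (\<sigma> w + u)) (S w (\<sigma> w))}"

lemma jump_indicator_measurable:
  assumes s: "\<sigma> \<in> borel_measurable (completion M)"
  shows "(\<lambda>x. indicator (jump_set \<eta> \<sigma> (fst x)) (snd x) :: ennreal) \<in> borel_measurable (borel \<Otimes>\<^sub>M completion M)"
proof -
  have "(\<lambda>x. euclid d (S (snd x) (\<sigma> (snd x) + fst x)) (S (snd x) (\<sigma> (snd x)))) \<in> borel_measurable (borel \<Otimes>\<^sub>M completion M)"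
    using S_shift_measurable[OF s] measurable_compose[OF measurable_snd S_random_time_measurable[OF s]]
    by (intro euclid_measurable)
  then have "(\<lambda>x. if \<eta> < euclid d (S (snd x) (\<sigma> (snd x) + fst x)) (S (snd x) (\<sigma> (snd x))) then 1 else 0 :: ennreal)
      \<in> borel_measurable (borel \<Otimes>\<^sub>M completion M)" by measurable
  then show ?thesis
    by (subst measurable_cong[of _ _ "\<lambda>x. if \<eta> < euclid d (S (snd x) (\<sigma> (snd x) + fst x)) (S (snd x) (\<sigma> (snd x))) then 1 else 0"])
      (auto simp: jump_set_def space_pair_measure)
qed

lemma jump_set_sets:
  assumes s: "\<sigma> \<in> borel_measurable (completion M)"
  shows "jump_set \<eta> \<sigma> u \<in> sets (completion M)"
proof -
  have "(\<lambda>w. \<sigma> w + u) \<in> borel_measurable (completion M)" using s by simp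
  then have "(\<lambda>w. euclid d (S w (\<sigma> w + u)) (S w (\<sigma> w))) \<in> borel_measurable (completion M)"
    using S_random_time_measurable s by (intro euclid_measurable) blast+
  then have "{w\<in>space (completion M). \<eta> < euclid d (S w (\<sigma> w + u)) (S w (\<sigma> w))} \<in> sets (completion M)" by measurable
  then show ?thesis by (simp add: jump_set_def)
qed

text \<open>Two close stopping times are compared through the common later time \<open>\<sigma> + v\<close>, with \<open>v\<close>
  averaged over an interval; this removes the randomness of the gap \<open>\<sigma> - \<tau>\<close>.\<close>

lemma close_stopping_times:
  assumes \<delta>: "0 < \<delta>" "3 * \<delta> < \<delta>0" and p: "0 \<le> p" and \<eta>: "0 < \<eta>"
    and ald: "\<And>u \<tau>. 0 < u \<Longrightarrow> u < \<delta>0 \<Longrightarrow> FS.stopT T \<tau> \<Longrightarrow> measure (completion M) (jump_set \<eta> \<tau> u) \<le> p"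
    and s: "FS.stopT T \<sigma>" "FS.stopT T \<tau>" and c: "\<And>w. w \<in> space M \<Longrightarrow> \<bar>\<sigma> w - \<tau> w\<bar> \<le> \<delta>"
  shows "measure (completion M) {w\<in>space M. 2 * \<eta> < euclid d (S w (\<sigma> w)) (S w (\<tau> w))} \<le> 4 * p"
proof -
  let ?P = "completion M"
  note sm = FS.stopT_measurable[OF s(1)] FS.stopT_measurable[OF s(2)]
  let ?A = "{w\<in>space M. 2 * \<eta> < euclid d (S w (\<sigma> w)) (S w (\<tau> w))}"
  have "(\<lambda>w. euclid d (S w (\<sigma> w)) (S w (\<tau> w))) \<in> borel_measurable ?P"
    using S_random_time_measurable sm by (intro euclid_measurable) blast+
  then have "{w\<in>space ?P. 2 * \<eta> < euclid d (S w (\<sigma> w)) (S w (\<tau> w))} \<in> sets ?P" by measurable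
  then have Am: "?A \<in> sets ?P" by simp
  let ?I = "\<lambda>\<rho> u w. indicator (jump_set \<eta> \<rho> u) w :: ennreal"
  interpret PS: pair_sigma_finite lborel ?P
    by (intro pair_sigma_finite.intro FS.sigma_finite_measure_axioms) (rule lborel.sigma_finite_measure_axioms)
  have le1: "emeasure ?P (jump_set \<eta> \<rho> u) \<le> ennreal p" if "0 \<le> u" "u < \<delta>0" "FS.stopT T \<rho>" for \<rho> u
  proof (cases "u = 0")
    case True
    then have "jump_set \<eta> \<rho> u = {}" using \<eta> by (simp add: jump_set_def)
    then show ?thesis by simp
  next
    case False
    then show ?thesis using ald[of u \<rho>] that by (simp add: FS.emeasure_eq_measure ennreal_leI)
  qed
  have swap: "(\<integral>\<^sup>+w. (\<integral>\<^sup>+v. indicator {a..b} v * ?I \<rho> v w \<partial>lborel) \<partial>?P) \<le> ennreal (p * (b - a))"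
    if r: "FS.stopT T \<rho>" and ab: "0 \<le> a" "a \<le> b" "b < \<delta>0" for \<rho> a b
  proof -
    note rm = FS.stopT_measurable[OF r]
    have mm: "(\<lambda>x. indicator {a..b} (fst x) * ?I \<rho> (fst x) (snd x)) \<in> borel_measurable (lborel \<Otimes>\<^sub>M ?P)"
    proof -
      have sets: "sets (lborel \<Otimes>\<^sub>M ?P) = sets (borel \<Otimes>\<^sub>M ?P)" by (rule sets_pair_measure_cong) simp_all
      have "(\<lambda>x. indicator {a..b} (fst x) * ?I \<rho> (fst x) (snd x)) \<in> borel_measurable (borel \<Otimes>\<^sub>M ?P)"
        using jump_indicator_measurable[OF rm, of \<eta>] by measurable
      then show ?thesis using measurable_cong_sets[OF sets refl] by blast
    qed
    have "(\<integral>\<^sup>+w. (\<integral>\<^sup>+v. indicator {a..b} v * ?I \<rho> v w \<partial>lborel) \<partial>?P) = (\<integral>\<^sup>+v. (\<integral>\<^sup>+w. indicator {a..b} v * ?I \<rho> v w \<partial>?P) \<partial>lborel)"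
      using PS.Fubini[OF mm] by simp
    also have "\<dots> = (\<integral>\<^sup>+v. indicator {a..b} v * emeasure ?P (jump_set \<eta> \<rho> v) \<partial>lborel)"
    proof (rule nn_integral_cong)
      fix v show "(\<integral>\<^sup>+w. indicator {a..b} v * ?I \<rho> v w \<partial>?P) = indicator {a..b} v * emeasure ?P (jump_set \<eta> \<rho> v)"
        using jump_set_sets[OF rm, of \<eta> v] by (simp add: nn_integral_cmult_indicator)
    qed
    also have "\<dots> \<le> (\<integral>\<^sup>+v. ennreal p * indicator {a..b} v \<partial>lborel)"
      using le1[OF _ _ r] ab by (intro nn_integral_mono) (auto simp: indicator_def)
    also have "\<dots> = ennreal p * ennreal (b - a)" using ab by (simp add: nn_integral_cmult_indicator)
    also have "\<dots> = ennreal (p * (b - a))" using p ab by (simp add: ennreal_mult)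
    finally show ?thesis .
  qed
  \<comment> \<open>For a point of \<open>?A\<close> and any \<open>v\<close> in
    \<open>[\<delta>, 2 * \<delta>]\<close>, the path at \<open>\<sigma> + v\<close> is far from its
    value at \<sigma> or from its value at \<tau>. Seen from \<tau> the shift is
    \<open>e + v\<close> with \<open>e = \<sigma> - \<tau>\<close>; starting at \<delta> keeps it
    nonnegative, and it is at most \<open>3 * \<delta>\<close>.\<close>
  have point: "ennreal \<delta> * indicator ?A w \<le> (\<integral>\<^sup>+v. indicator {\<delta>..2*\<delta>} v * ?I \<sigma> v w \<partial>lborel) + (\<integral>\<^sup>+v. indicator {0..3*\<delta>} v * ?I \<tau> v w \<partial>lborel)"
    if w: "w \<in> space ?P" for w
  proof (cases "w \<in> ?A")
    case True
    have Im: "(\<lambda>v. ?I \<rho> v w) \<in> borel_measurable borel" if "\<rho> \<in> borel_measurable ?P" for \<rho>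
    proof -
      have "(\<lambda>v. (v, w)) \<in> measurable borel (borel \<Otimes>\<^sub>M ?P)" using w by simp
      from measurable_compose[OF this jump_indicator_measurable[OF that, of \<eta>]] show ?thesis by simp
    qed
    define e where "e = \<sigma> w - \<tau> w"
    have e: "\<bar>e\<bar> \<le> \<delta>" using c w by (simp add: e_def)
    \<comment> \<open>Written \<open>e + 1 * v\<close> to fit the affine substitution that removes
      \<open>e\<close> below.\<close>
    have one: "1 \<le> ?I \<sigma> v w + ?I \<tau> (e + 1 * v) w" for v
    proof -
      have "2 * \<eta> < euclid d (S w (\<sigma> w)) (S w (\<tau> w))" using True by simp
      also have "\<dots> \<le> euclid d (S w (\<sigma> w + v)) (S w (\<sigma> w)) + euclid d (S w (\<sigma> w + v)) (S w (\<tau> w))"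
        using euclid_triangle[of d "S w (\<sigma> w)" "S w (\<tau> w)" "S w (\<sigma> w + v)"] euclid_sym[of d "S w (\<sigma> w)" "S w (\<sigma> w + v)"] by simp
      finally have "\<eta> < euclid d (S w (\<sigma> w + v)) (S w (\<sigma> w)) \<or> \<eta> < euclid d (S w (\<sigma> w + v)) (S w (\<tau> w))" by linarith
      moreover have eq: "\<tau> w + (e + 1 * v) = \<sigma> w + v" by (simp add: e_def)
      then have "(w \<in> jump_set \<eta> \<tau> (e + 1 * v)) = (\<eta> < euclid d (S w (\<sigma> w + v)) (S w (\<tau> w)))"
        unfolding jump_set_def mem_Collect_eq eq using w by simp
      moreover have "(w \<in> jump_set \<eta> \<sigma> v) = (\<eta> < euclid d (S w (\<sigma> w + v)) (S w (\<sigma> w)))"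
        unfolding jump_set_def using w by simp
      ultimately show ?thesis by (auto simp: indicator_def)
    qed
    have "ennreal \<delta> * indicator ?A w = (\<integral>\<^sup>+v. indicator {\<delta>..2*\<delta>} v \<partial>lborel)" using True \<delta> by simp
    also have "\<dots> \<le> (\<integral>\<^sup>+v. indicator {\<delta>..2*\<delta>} v * ?I \<sigma> v w + indicator {0..3*\<delta>} (e + 1 * v) * ?I \<tau> (e + 1 * v) w \<partial>lborel)"
    proof (rule nn_integral_mono)
      fix v :: real
      show "indicator {\<delta>..2*\<delta>} v \<le> indicator {\<delta>..2*\<delta>} v * ?I \<sigma> v w + indicator {0..3*\<delta>} (e + 1 * v) * ?I \<tau> (e + 1 * v) w"
      proof (cases "v \<in> {\<delta>..2*\<delta>}")
        case True
        then have "e + 1 * v \<in> {0..3*\<delta>}" using e by auto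
        then show ?thesis using True one[of v] by simp
      qed simp
    qed
    also have "\<dots> = (\<integral>\<^sup>+v. indicator {\<delta>..2*\<delta>} v * ?I \<sigma> v w \<partial>lborel) + (\<integral>\<^sup>+v. indicator {0..3*\<delta>} (e + 1 * v) * ?I \<tau> (e + 1 * v) w \<partial>lborel)"
    proof (rule nn_integral_add)
      show "(\<lambda>v. indicator {\<delta>..2*\<delta>} v * ?I \<sigma> v w) \<in> borel_measurable lborel"
        using Im[OF sm(1)] by measurable
      have t: "(\<lambda>v. indicator {0..3*\<delta>} v * ?I \<tau> v w) \<in> borel_measurable borel" using Im[OF sm(2)] by measurable
      have "(\<lambda>v. e + 1 * v) \<in> measurable lborel borel" by simp
      from measurable_compose[OF this t] show "(\<lambda>v. indicator {0..3*\<delta>} (e + 1 * v) * ?I \<tau> (e + 1 * v) w) \<in> borel_measurable lborel" .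
    qed
    also have "(\<integral>\<^sup>+v. indicator {0..3*\<delta>} (e + 1 * v) * ?I \<tau> (e + 1 * v) w \<partial>lborel) = (\<integral>\<^sup>+v. indicator {0..3*\<delta>} v * ?I \<tau> v w \<partial>lborel)"
      using nn_integral_real_affine[of "\<lambda>v. indicator {0..3*\<delta>} v * ?I \<tau> v w" 1 e] Im[OF sm(2)] by simp
    finally show ?thesis .
  qed simp
  have "ennreal \<delta> * emeasure ?P ?A = (\<integral>\<^sup>+w. ennreal \<delta> * indicator ?A w \<partial>?P)" using Am by (simp add: nn_integral_cmult_indicator)
  also have "\<dots> \<le> (\<integral>\<^sup>+w. (\<integral>\<^sup>+v. indicator {\<delta>..2*\<delta>} v * ?I \<sigma> v w \<partial>lborel) + (\<integral>\<^sup>+v. indicator {0..3*\<delta>} v * ?I \<tau> v w \<partial>lborel) \<partial>?P)"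
    by (rule nn_integral_mono[OF point])
  also have "\<dots> = (\<integral>\<^sup>+w. (\<integral>\<^sup>+v. indicator {\<delta>..2*\<delta>} v * ?I \<sigma> v w \<partial>lborel) \<partial>?P) + (\<integral>\<^sup>+w. (\<integral>\<^sup>+v. indicator {0..3*\<delta>} v * ?I \<tau> v w \<partial>lborel) \<partial>?P)"
  proof (rule nn_integral_add)
    have m: "(\<lambda>w. (\<integral>\<^sup>+v. indicator {a..b} v * ?I \<rho> v w \<partial>lborel)) \<in> borel_measurable ?P" if "\<rho> \<in> borel_measurable ?P" for \<rho> a b
    proof -
      have sets: "sets (?P \<Otimes>\<^sub>M lborel) = sets (?P \<Otimes>\<^sub>M borel)" by (rule sets_pair_measure_cong) simp_all
      have "(\<lambda>x. (snd x, fst x)) \<in> measurable (?P \<Otimes>\<^sub>M borel) (borel \<Otimes>\<^sub>M ?P)" by measurable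
      from measurable_compose[OF this jump_indicator_measurable[OF that, of \<eta>]]
      have "(\<lambda>x. ?I \<rho> (snd x) (fst x)) \<in> borel_measurable (?P \<Otimes>\<^sub>M borel)" by simp
      then have "(\<lambda>x. indicator {a..b} (snd x) * ?I \<rho> (snd x) (fst x)) \<in> borel_measurable (?P \<Otimes>\<^sub>M borel)" by measurable
      then have "(\<lambda>(w, v). indicator {a..b} v * ?I \<rho> v w) \<in> borel_measurable (?P \<Otimes>\<^sub>M lborel)"
        using measurable_cong_sets[OF sets refl] by (simp add: case_prod_beta)
      then show ?thesis by (rule lborel.borel_measurable_nn_integral)
    qed
    show "(\<lambda>w. (\<integral>\<^sup>+v. indicator {\<delta>..2*\<delta>} v * ?I \<sigma> v w \<partial>lborel)) \<in> borel_measurable ?P" by (rule m[OF sm(1)])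
    show "(\<lambda>w. (\<integral>\<^sup>+v. indicator {0..3*\<delta>} v * ?I \<tau> v w \<partial>lborel)) \<in> borel_measurable ?P" by (rule m[OF sm(2)])
  qed
  also have "\<dots> \<le> ennreal (p * (2 * \<delta> - \<delta>)) + ennreal (p * (3 * \<delta> - 0))"
    using \<delta> by (intro add_mono swap s) auto
  \<comment> \<open>The interval lengths \<delta> and \<open>3 * \<delta>\<close> add up to the
    factor 4.\<close>
  also have "\<dots> = ennreal \<delta> * ennreal (4 * p)" using p \<delta> by (simp add: ennreal_plus[symmetric] ennreal_mult[symmetric] algebra_simps del: ennreal_plus)
  finally have "ennreal (\<delta> * measure ?P ?A) \<le> ennreal (\<delta> * (4 * p))"
    using p \<delta> by (simp add: FS.emeasure_eq_measure ennreal_mult)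
  then have "\<delta> * measure ?P ?A \<le> \<delta> * (4 * p)" using p \<delta> by (subst (asm) ennreal_le_iff) auto
  then show ?thesis using \<delta> by simp
qed

end

section \<open>The Aldous criterion\<close>

locale aldous_conv = ext_conv +
  assumes aldous: "\<forall>\<epsilon>>0. \<exists>L. (\<forall>\<delta>>0. (\<lambda>n. SUP u\<in>{0<..<\<delta>}. SUP \<tau>\<in>stop_times (M n) d T (S n).
              measure (completion (M n))
                {w\<in>space (M n). \<epsilon> < euclid d (S n w (min (\<tau> w + u) T)) (S n w (\<tau> w))})
            \<longlonglongrightarrow> L \<delta>) \<and> (L \<longlongrightarrow> 0) (at_right 0)"
begin

text \<open>The quantifier over stopping times stands inside \<open>eventually\<close>: one
  threshold for \<open>n\<close> serves all pairs.\<close>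

abbreviation rounding_bound :: "(real \<Rightarrow> (real \<Rightarrow> nat \<Rightarrow> real) \<Rightarrow> real) \<Rightarrow> real \<Rightarrow> real \<Rightarrow> bool" where
  "rounding_bound \<phi> \<delta> \<epsilon> \<equiv> \<forall>\<^sub>F n in sequentially. \<forall>\<sigma> \<tau>. Pn.FS.stopT n T \<sigma> \<and> Pn.FS.stopT n T \<tau> \<and> (\<forall>w\<in>space (M n). \<bar>\<sigma> w - \<tau> w\<bar> \<le> \<delta>) \<longrightarrow>
    (\<integral>w. \<bar>\<phi> (\<sigma> w) (S n w) - \<phi> (\<tau> w) (S n w)\<bar> \<partial>CMn n) \<le> \<epsilon>"

text \<open>The iterated limit is unwound: first a \<delta> with \<open>L \<delta> < p\<close>, then
  \<open>n\<close> large. To read single probabilities off real suprema, these must be over nonempty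
  bounded sets, whence the constant stopping time \<open>T\<close> and the bound 1.\<close>

lemma aldous_uniform:
  assumes \<eta>: "0 < \<eta>" and p: "0 < p"
  shows "\<exists>\<delta>>0. \<forall>\<^sub>F n in sequentially. \<forall>u \<tau>. 0 < u \<and> u < \<delta> \<and> Pn.FS.stopT n T \<tau> \<longrightarrow>
    measure (CMn n) (Pn.jump_set n \<eta> \<tau> u) \<le> p"
proof -
  obtain L where L: "\<And>\<delta>. 0 < \<delta> \<Longrightarrow> (\<lambda>n. SUP u\<in>{0<..<\<delta>}. SUP \<tau>\<in>stop_times (M n) d T (S n).
              measure (completion (M n))
                {w\<in>space (M n). \<eta> < euclid d (S n w (min (\<tau> w + u) T)) (S n w (\<tau> w))})
            \<longlonglongrightarrow> L \<delta>" "(L \<longlongrightarrow> 0) (at_right 0)" using aldous \<eta> by meson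
  have "eventually (\<lambda>\<delta>. L \<delta> < p) (at_right 0)" by (rule order_tendstoD(2)[OF L(2) p])
  moreover have "eventually (\<lambda>\<delta>::real. 0 < \<delta>) (at_right 0)" by (auto simp: eventually_at_filter)
  ultimately have "eventually (\<lambda>\<delta>. 0 < \<delta> \<and> L \<delta> < p) (at_right 0)" by eventually_elim simp
  then obtain \<delta> where \<delta>: "0 < \<delta>" "L \<delta> < p" using eventually_happens' trivial_limit_at_right_real by blast
  define m where "m n u \<tau> = measure (completion (M n)) {w\<in>space (M n). \<eta> < euclid d (S n w (min (\<tau> w + u) T)) (S n w (\<tau> w))}" for n u \<tau>
  have m1: "m n u \<tau> \<le> 1" for n u \<tau> unfolding m_def by (rule Pn.FS.prob_le_1)
  have ne: "(\<lambda>_. T) \<in> stop_times (M n) d T (S n)" for n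
    unfolding Pn.stop_times_iff using T_pos by (intro Pn.FS.stopT_const) auto
  have le: "m n u \<tau> \<le> (SUP u\<in>{0<..<\<delta>}. SUP \<tau>\<in>stop_times (M n) d T (S n). m n u \<tau>)"
    if "u \<in> {0<..<\<delta>}" "\<tau> \<in> stop_times (M n) d T (S n)" for n u \<tau>
  proof -
    have "m n u \<tau> \<le> (SUP \<tau>\<in>stop_times (M n) d T (S n). m n u \<tau>)"
      using that m1 by (intro cSUP_upper bdd_aboveI2[of _ _ 1]) auto
    also have "\<dots> \<le> (SUP u\<in>{0<..<\<delta>}. SUP \<tau>\<in>stop_times (M n) d T (S n). m n u \<tau>)"
    proof (intro cSUP_upper that(1) bdd_aboveI2[of _ _ 1])
      fix u show "(SUP \<tau>\<in>stop_times (M n) d T (S n). m n u \<tau>) \<le> 1" using ne[of n] m1 by (intro cSUP_least) blast+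
    qed
    finally show ?thesis .
  qed
  have "\<forall>\<^sub>F n in sequentially. (SUP u\<in>{0<..<\<delta>}. SUP \<tau>\<in>stop_times (M n) d T (S n). m n u \<tau>) < p"
    unfolding m_def by (rule order_tendstoD(2)[OF L(1)[OF \<delta>(1)] \<delta>(2)])
  then have "\<forall>\<^sub>F n in sequentially. \<forall>u \<tau>. 0 < u \<and> u < \<delta> \<and> Pn.FS.stopT n T \<tau> \<longrightarrow>
    measure (CMn n) (Pn.jump_set n \<eta> \<tau> u) \<le> p"
  proof eventually_elim
    case (elim n)
    show ?case
    proof (intro allI impI)
      fix u \<tau> assume a: "0 < u \<and> u < \<delta> \<and> Pn.FS.stopT n T \<tau>"
      have "Pn.jump_set n \<eta> \<tau> u = {w\<in>space (M n). \<eta> < euclid d (S n w (min (\<tau> w + u) T)) (S n w (\<tau> w))}"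
        unfolding Pn.jump_set_def using Pn.S_clamp by auto
      then have "measure (CMn n) (Pn.jump_set n \<eta> \<tau> u) = m n u \<tau>" by (simp add: m_def)
      also have "\<dots> \<le> p" using le[of u \<tau> n] a elim unfolding Pn.stop_times_iff by auto
      finally show "measure (CMn n) (Pn.jump_set n \<eta> \<tau> u) \<le> p" .
    qed
  qed
  then show ?thesis using \<delta>(1) by blast
qed

text \<open>Half of \<eta> and a quarter of \<open>p\<close> undo the factors 2 and 4 lost in
  \<open>close_stopping_times\<close>; \<delta> is a quarter of \<open>\<delta>0\<close> because
  shifts up to \<open>3 * \<delta>\<close> occur there.\<close>

lemma aldous_pairs:
  assumes \<eta>: "0 < \<eta>" and p: "0 < p"
  shows "\<exists>\<delta>>0. \<forall>\<^sub>F n in sequentially. \<forall>\<sigma> \<tau>. Pn.FS.stopT n T \<sigma> \<and> Pn.FS.stopT n T \<tau> \<and> (\<forall>w\<in>space (M n). \<bar>\<sigma> w - \<tau> w\<bar> \<le> \<delta>) \<longrightarrow>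
    measure (CMn n) {w\<in>space (M n). \<eta> < euclid d (S n w (\<sigma> w)) (S n w (\<tau> w))} \<le> p"
proof -
  have "0 < \<eta>/2" "0 < p/4" using assms by auto
  from aldous_uniform[OF this] obtain \<delta>0 where \<delta>0: "0 < \<delta>0" "\<forall>\<^sub>F n in sequentially. \<forall>u \<tau>. 0 < u \<and> u < \<delta>0 \<and> Pn.FS.stopT n T \<tau> \<longrightarrow>
    measure (CMn n) (Pn.jump_set n (\<eta>/2) \<tau> u) \<le> p/4" by blast
  define \<delta> where "\<delta> = \<delta>0/4"
  have \<delta>: "0 < \<delta>" "3 * \<delta> < \<delta>0" using \<delta>0(1) by (auto simp: \<delta>_def)
  have "\<forall>\<^sub>F n in sequentially. \<forall>\<sigma> \<tau>. Pn.FS.stopT n T \<sigma> \<and> Pn.FS.stopT n T \<tau> \<and> (\<forall>w\<in>space (M n). \<bar>\<sigma> w - \<tau> w\<bar> \<le> \<delta>) \<longrightarrow>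
    measure (CMn n) {w\<in>space (M n). \<eta> < euclid d (S n w (\<sigma> w)) (S n w (\<tau> w))} \<le> p"
    using \<delta>0(2)
  proof eventually_elim
    case (elim n)
    show ?case
    proof (intro allI impI)
      fix \<sigma> \<tau> assume a: "Pn.FS.stopT n T \<sigma> \<and> Pn.FS.stopT n T \<tau> \<and> (\<forall>w\<in>space (M n). \<bar>\<sigma> w - \<tau> w\<bar> \<le> \<delta>)"
      have "measure (CMn n) {w\<in>space (M n). 2 * (\<eta>/2) < euclid d (S n w (\<sigma> w)) (S n w (\<tau> w))} \<le> 4 * (p/4)"
        by (rule Pn.close_stopping_times[OF \<delta>]) (use elim a assms in auto)
      then show "measure (CMn n) {w\<in>space (M n). \<eta> < euclid d (S n w (\<sigma> w)) (S n w (\<tau> w))} \<le> p" by simp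
    qed
  qed
  then show ?thesis using \<delta>(1) by blast
qed

context
  fixes \<phi> :: "real \<Rightarrow> (real \<Rightarrow> nat \<Rightarrow> real) \<Rightarrow> real" and K :: real
  assumes \<phi>: "payoff d T \<phi>"
    and K: "\<And>t x. t \<in> {0..T} \<Longrightarrow> x \<in> Dsp d T \<Longrightarrow> 0 \<le> \<phi> t x \<and> \<phi> t x \<le> K"
begin

lemma payoff_stop_measurable:
  "Pn.FS.stopT n T \<sigma> \<Longrightarrow> (\<lambda>w. \<phi> (\<sigma> w) (S n w)) \<in> borel_measurable (CMn n)"
  "P0.FS.stopT T \<sigma>0 \<Longrightarrow> (\<lambda>w. \<phi> (\<sigma>0 w) (S0 w)) \<in> borel_measurable CM0"
  using Pn.payoff_random_time_measurable[OF \<phi> Pn.FS.stopT_measurable] Pn.FS.stopT_range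
    P0.payoff_random_time_measurable[OF \<phi> P0.FS.stopT_measurable] P0.FS.stopT_range by (metis space_completion)+

lemma payoff_stop_bound:
  "Pn.FS.stopT n T \<sigma> \<Longrightarrow> w \<in> space (M n) \<Longrightarrow> 0 \<le> \<phi> (\<sigma> w) (S n w) \<and> \<phi> (\<sigma> w) (S n w) \<le> K"
  "P0.FS.stopT T \<sigma>0 \<Longrightarrow> w0 \<in> space N \<Longrightarrow> 0 \<le> \<phi> (\<sigma>0 w0) (S0 w0) \<and> \<phi> (\<sigma>0 w0) (S0 w0) \<le> K"
  using K[OF Pn.FS.stopT_range Pn.S_Dsp] K[OF P0.FS.stopT_range P0.S_Dsp] by simp_all

lemma payoff_stop_integrable:
  assumes "Pn.FS.stopT n T \<sigma>" shows "integrable (CMn n) (\<lambda>w. \<phi> (\<sigma> w) (S n w))"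
  by (rule Pn.FS.integrable_const_bound[of _ K])
    (use payoff_stop_bound(1)[OF assms] payoff_stop_measurable(1)[OF assms] in \<open>auto intro!: AE_I2\<close>)

text \<open>Off the event that the path moves by more than 1/(k+1), the payoff change is dominated
  by \<open>osc_reg\<close>, whose expectation is small for the limit process by dominated
  convergence and then for large \<open>n\<close> by weak convergence. On that event the change is
  at most \<open>K\<close>, and the Aldous bound makes the event improbable.\<close>

lemma payoff_rounding:
  assumes \<epsilon>: "0 < \<epsilon>"
  shows "\<exists>\<delta>>0. rounding_bound \<phi> \<delta> \<epsilon>"
proof -
  let ?o = "osc_reg d T \<phi>"
  have o1: "skor_bounded_continuous d T (?o k)" for k by (rule osc_reg_continuous[OF \<phi> T_pos K])
  have o2: "(\<lambda>k. ?o k x) \<longlonglongrightarrow> 0" if "x \<in> Dsp d T" for x by (rule osc_reg_tendsto[OF \<phi> T_pos K that])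
  have o3: "0 \<le> ?o k x" if "x \<in> Dsp d T" for k x by (rule osc_reg_nonneg[OF \<phi> T_pos K that])
  have o4: "?o k x \<le> K" if "x \<in> Dsp d T" for k x by (rule osc_reg_le[OF \<phi> T_pos K that])
  have o5: "\<bar>\<phi> s x - \<phi> r x\<bar> \<le> ?o k x"
    if "x \<in> Dsp d T" "s \<in> {0..T}" "r \<in> {0..T}" "\<bar>s - r\<bar> \<le> 1 / real (Suc k)" "euclid d (x s) (x r) \<le> 1 / real (Suc k)" for k x s r
    by (rule osc_reg_dominates[OF \<phi> T_pos K that])
  obtain w0 where "w0 \<in> space N" using P0.not_empty by blast
  then have K0: "0 \<le> K" using K[of 0 "S0 w0"] P0.S_Dsp T_pos by force
  have "(\<lambda>k. \<integral>w. ?o k (S0 w) \<partial>CM0) \<longlonglongrightarrow> (\<integral>w. 0 \<partial>CM0)"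
  proof (rule integral_dominated_convergence[where w="\<lambda>_. K"])
    show "AE w in CM0. (\<lambda>k. ?o k (S0 w)) \<longlonglongrightarrow> 0" using o2 P0.S_Dsp by (intro AE_I2) simp
    show "AE w in CM0. norm (?o k (S0 w)) \<le> K" for k using o3 o4 P0.S_Dsp by (intro AE_I2) simp
  qed (use P0.sbc_integrable(1)[OF o1] in auto)
  then have "\<forall>\<^sub>F k in sequentially. (\<integral>w. ?o k (S0 w) \<partial>CM0) < \<epsilon>/2" using \<epsilon> by (intro order_tendstoD(2)) auto
  then obtain k where k: "(\<integral>w. ?o k (S0 w) \<partial>CM0) < \<epsilon>/2" by (auto simp: eventually_sequentially)
  have ev1: "\<forall>\<^sub>F n in sequentially. (\<integral>w. ?o k (S n w) \<partial>CMn n) < \<epsilon>/2"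
    by (rule order_tendstoD(2)[OF weak[OF o1] k])
  \<comment> \<open>\<open>K + 1\<close> in place of \<open>K\<close>, since \<open>K\<close> may be
    0.\<close>
  have "0 < 1 / real (Suc k)" "0 < \<epsilon> / (2 * (K + 1))" using \<epsilon> K0 by auto
  from aldous_pairs[OF this] obtain \<delta>2 where \<delta>2: "0 < \<delta>2" "\<forall>\<^sub>F n in sequentially. \<forall>\<sigma> \<tau>. Pn.FS.stopT n T \<sigma> \<and> Pn.FS.stopT n T \<tau> \<and> (\<forall>w\<in>space (M n). \<bar>\<sigma> w - \<tau> w\<bar> \<le> \<delta>2) \<longrightarrow>
    measure (CMn n) {w\<in>space (M n). 1 / real (Suc k) < euclid d (S n w (\<sigma> w)) (S n w (\<tau> w))} \<le> \<epsilon> / (2 * (K + 1))" by blast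
  define \<delta> where "\<delta> = min \<delta>2 (1 / real (Suc k))"
  have \<delta>: "0 < \<delta>" "\<delta> \<le> \<delta>2" "\<delta> \<le> 1 / real (Suc k)" using \<delta>2(1) by (auto simp: \<delta>_def)
  have "rounding_bound \<phi> \<delta> \<epsilon>"
    using ev1 \<delta>2(2)
  proof eventually_elim
    case (elim n)
    show ?case
    proof (intro allI impI)
      fix \<sigma> \<tau> assume a: "Pn.FS.stopT n T \<sigma> \<and> Pn.FS.stopT n T \<tau> \<and> (\<forall>w\<in>space (M n). \<bar>\<sigma> w - \<tau> w\<bar> \<le> \<delta>)"
      define A where "A = {w\<in>space (M n). 1 / real (Suc k) < euclid d (S n w (\<sigma> w)) (S n w (\<tau> w))}"
      have PA: "measure (CMn n) A \<le> \<epsilon> / (2 * (K + 1))"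
        unfolding A_def using elim(2)[rule_format, of \<sigma> \<tau>] a \<delta>(2) by (meson order_trans)
      have sm: "\<sigma> \<in> borel_measurable (CMn n)" "\<tau> \<in> borel_measurable (CMn n)" using a Pn.FS.stopT_measurable by blast+
      have "(\<lambda>w. euclid d (S n w (\<sigma> w)) (S n w (\<tau> w))) \<in> borel_measurable (CMn n)"
        using Pn.S_random_time_measurable sm by (intro Pn.euclid_measurable) blast+
      then have "{w\<in>space (CMn n). 1 / real (Suc k) < euclid d (S n w (\<sigma> w)) (S n w (\<tau> w))} \<in> sets (CMn n)" by measurable
      then have Am: "A \<in> sets (CMn n)" by (simp add: A_def)
      have Asp: "A \<inter> space (M n) = A" by (auto simp: A_def)
      have iA: "integrable (CMn n) (indicator A :: 'a \<Rightarrow> real)" using Am by (intro Pn.FS.integrable_const_bound[of _ 1]) auto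
      have i1: "integrable (CMn n) (\<lambda>w. \<bar>\<phi> (\<sigma> w) (S n w) - \<phi> (\<tau> w) (S n w)\<bar>)"
        using payoff_stop_integrable[of n \<sigma>] payoff_stop_integrable[of n \<tau>] a by simp
      have "(\<integral>w. \<bar>\<phi> (\<sigma> w) (S n w) - \<phi> (\<tau> w) (S n w)\<bar> \<partial>CMn n) \<le> (\<integral>w. ?o k (S n w) + K * indicator A w \<partial>CMn n)"
      proof (rule integral_mono[OF i1])
        show "integrable (CMn n) (\<lambda>w. ?o k (S n w) + K * indicator A w)" using Pn.sbc_integrable(2)[OF o1] iA by simp
        fix w assume w: "w \<in> space (CMn n)"
        then have w': "w \<in> space (M n)" by simp
        have r: "\<sigma> w \<in> {0..T}" "\<tau> w \<in> {0..T}" using a Pn.FS.stopT_range w by blast+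
        show "\<bar>\<phi> (\<sigma> w) (S n w) - \<phi> (\<tau> w) (S n w)\<bar> \<le> ?o k (S n w) + K * indicator A w"
        proof (cases "w \<in> A")
          case True
          have "\<bar>\<phi> (\<sigma> w) (S n w) - \<phi> (\<tau> w) (S n w)\<bar> \<le> K" using K[OF r(1) Pn.S_Dsp[OF w']] K[OF r(2) Pn.S_Dsp[OF w']] by auto
          then show ?thesis using True o3[OF Pn.S_Dsp[OF w'], of k] by simp
        next
          case False
          then have "euclid d (S n w (\<sigma> w)) (S n w (\<tau> w)) \<le> 1 / real (Suc k)" using w' by (auto simp: A_def)
          moreover have "\<bar>\<sigma> w - \<tau> w\<bar> \<le> 1 / real (Suc k)" using a w' \<delta>(3) by (meson order_trans)
          ultimately show ?thesis using o5[OF Pn.S_Dsp[OF w'] r] False by simp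
        qed
      qed
      also have "\<dots> = (\<integral>w. ?o k (S n w) \<partial>CMn n) + K * measure (CMn n) A" using Pn.sbc_integrable(2)[OF o1] iA Am Asp by simp
      also have "K * measure (CMn n) A \<le> (K + 1) * (\<epsilon> / (2 * (K + 1)))" using PA K0 by (intro mult_mono) auto
      also have "\<dots> = \<epsilon>/2" using K0 by (simp add: field_simps)
      finally show "(\<integral>w. \<bar>\<phi> (\<sigma> w) (S n w) - \<phi> (\<tau> w) (S n w)\<bar> \<partial>CMn n) \<le> \<epsilon>" using elim(1) by linarith
    qed
  qed
  then show ?thesis using \<delta>(1) by blast
qed

text \<open>Averages of the payoff over \<open>[t, t + 1/(j+1)]\<close> are continuous functionals.
  They approximate the payoff at \<open>t\<close> for the limit process by right-continuity, and for
  large \<open>n\<close> by \<open>payoff_rounding\<close> applied to constant stopping times. At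
  \<open>T\<close> the payoff itself is continuous, since time changes fix \<open>T\<close>.\<close>

lemma cv_payoff:
  assumes t: "t \<in> {0..T}"
  shows "cv (\<lambda>n w. \<phi> t (S n w)) (\<lambda>w. \<phi> t (S0 w))"
proof (cases "t = T")
  case True
  have "skor_bounded_continuous d T (\<phi> T)" by (rule payoff_T_continuous[OF \<phi> T_pos, of K]) (use K in force)
  then show ?thesis using cv_psi True by simp
next
  case False
  then have tT: "0 \<le> t" "t < T" using t by auto
  have Kabs: "\<bar>\<phi> s x\<bar> \<le> K" if "s \<in> {0..T}" "x \<in> Dsp d T" for s x using K[OF that] by simp
  define \<psi> where "\<psi> j x = (\<integral>s. \<phi> (clampT T s) x \<partial>unif t (t + inverse (real (Suc j))))" for j x
  have sb: "skor_bounded_continuous d T (\<psi> j)" for j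
    unfolding \<psi>_def by (rule payoff_avg_continuous[OF \<phi> T_pos _ Kabs]) auto
  have pm: "(\<lambda>w. \<phi> t (S n w)) \<in> borel_measurable (CMn n)" "(\<lambda>w. \<phi> t (S0 w)) \<in> borel_measurable CM0" for n
    using payoff_stop_measurable(1)[OF Pn.FS.stopT_const[OF t]] payoff_stop_measurable(2)[OF P0.FS.stopT_const[OF t]] by auto
  have pb: "AE w in CMn n. \<bar>\<phi> t (S n w)\<bar> \<le> K" "AE w in CM0. \<bar>\<phi> t (S0 w)\<bar> \<le> K" for n
    using Kabs[OF t] Pn.S_Dsp P0.S_Dsp by (auto intro!: AE_I2)
  have lim0: "(\<lambda>j. \<integral>w. \<bar>\<phi> t (S0 w) - \<psi> j (S0 w)\<bar> \<partial>CM0) \<longlonglongrightarrow> (\<integral>w. \<bar>\<phi> t (S0 w) - \<phi> t (S0 w)\<bar> \<partial>CM0)"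
  proof (rule integral_dominated_convergence[where w="\<lambda>_. 2 * K"])
    show "AE w in CM0. (\<lambda>j. \<bar>\<phi> t (S0 w) - \<psi> j (S0 w)\<bar>) \<longlonglongrightarrow> \<bar>\<phi> t (S0 w) - \<phi> t (S0 w)\<bar>"
    proof (intro AE_I2 tendsto_intros)
      fix w assume "w \<in> space CM0"
      then have x: "S0 w \<in> Dsp d T" using P0.S_Dsp by simp
      have "(\<lambda>j. \<psi> j (S0 w)) \<longlonglongrightarrow> \<phi> (clampT T t) (S0 w)" unfolding \<psi>_def
        by (rule unif_avg_right_limit[OF payoff_clamp_measurable[OF \<phi> x T_pos] Kabs[OF clampT_in[OF T_pos] x] payoff_clamp_right[OF \<phi> x T_pos]])
      then show "(\<lambda>j. \<psi> j (S0 w)) \<longlonglongrightarrow> \<phi> t (S0 w)" using tT by simp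
    qed
    show "AE w in CM0. norm \<bar>\<phi> t (S0 w) - \<psi> j (S0 w)\<bar> \<le> 2 * K" for j
    proof (rule AE_I2)
      fix w assume "w \<in> space CM0"
      then have x: "S0 w \<in> Dsp d T" using P0.S_Dsp by simp
      have "\<bar>\<psi> j (S0 w)\<bar> \<le> K" unfolding \<psi>_def
        by (rule unif_integral_bound(2)[OF _ payoff_clamp_measurable[OF \<phi> x T_pos] Kabs[OF clampT_in[OF T_pos] x]]) simp
      then show "norm \<bar>\<phi> t (S0 w) - \<psi> j (S0 w)\<bar> \<le> 2 * K" using Kabs[OF t x] by simp
    qed
  qed (use pm P0.sbc_integrable(1)[OF sb] in auto)
  show ?thesis
  proof (rule cv_closed[OF pm pb])
    fix \<epsilon> :: real assume "0 < \<epsilon>"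
    then have e2: "0 < \<epsilon>/2" by simp
    from payoff_rounding[OF e2] obtain \<delta> where \<delta>: "0 < \<delta>" and ev: "rounding_bound \<phi> \<delta> (\<epsilon>/2)" by blast
    have "\<forall>\<^sub>F j in sequentially. (\<integral>w. \<bar>\<phi> t (S0 w) - \<psi> j (S0 w)\<bar> \<partial>CM0) < \<epsilon>"
      using lim0 \<open>0 < \<epsilon>\<close> by (intro order_tendstoD(2)) auto
    moreover have "\<forall>\<^sub>F j in sequentially. inverse (real (Suc j)) < \<delta>" by (rule order_tendstoD(2)[OF LIMSEQ_inverse_real_of_nat \<delta>])
    ultimately have "\<forall>\<^sub>F j in sequentially. (\<integral>w. \<bar>\<phi> t (S0 w) - \<psi> j (S0 w)\<bar> \<partial>CM0) < \<epsilon> \<and> inverse (real (Suc j)) < \<delta>" by eventually_elim simp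
    then obtain j where j: "(\<integral>w. \<bar>\<phi> t (S0 w) - \<psi> j (S0 w)\<bar> \<partial>CM0) < \<epsilon>" "inverse (real (Suc j)) < \<delta>" by (auto simp: eventually_sequentially)
    have "\<forall>\<^sub>F n in sequentially. (\<integral>w. \<bar>\<phi> t (S n w) - \<psi> j (S n w)\<bar> \<partial>CMn n) < \<epsilon>"
      using ev
    proof eventually_elim
      case (elim n)
      let ?b = "t + inverse (real (Suc j))"
      have tb: "t < ?b" by simp
      have jm: "(\<lambda>(s, w). \<bar>\<phi> t (S n w) - \<phi> (clampT T s) (S n w)\<bar>) \<in> borel_measurable (borel \<Otimes>\<^sub>M CMn n)"
        using Pn.payoff_joint_measurable[OF \<phi>, of n] measurable_compose[OF measurable_snd pm(1), of n]
        unfolding case_prod_beta by (intro borel_measurable_abs borel_measurable_diff)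
      have jb: "\<bar>\<bar>\<phi> t (S n w) - \<phi> (clampT T s) (S n w)\<bar>\<bar> \<le> 2 * K" if "w \<in> space (M n)" for s w
        using Kabs[OF t Pn.S_Dsp[OF that]] Kabs[OF clampT_in[OF T_pos] Pn.S_Dsp[OF that], of s] by linarith
      have "(\<integral>w. \<bar>\<phi> t (S n w) - \<psi> j (S n w)\<bar> \<partial>CMn n) \<le> (\<integral>w. (\<integral>s. \<bar>\<phi> t (S n w) - \<phi> (clampT T s) (S n w)\<bar> \<partial>unif t ?b) \<partial>CMn n)"
      proof (rule integral_mono_AE)
        show "integrable (CMn n) (\<lambda>w. \<bar>\<phi> t (S n w) - \<psi> j (S n w)\<bar>)"
          using payoff_stop_integrable[OF Pn.FS.stopT_const[OF t], of n] Pn.sbc_integrable(2)[OF sb] by simp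
        interpret U: prob_space "unif t ?b" by (rule prob_space_unif[OF tb])
        have m2: "(\<lambda>w. \<integral>s. \<bar>\<phi> t (S n w) - \<phi> (clampT T s) (S n w)\<bar> \<partial>unif t ?b) \<in> borel_measurable (CMn n)"
        proof (rule U.borel_measurable_lebesgue_integral)
          have sets: "sets (CMn n \<Otimes>\<^sub>M unif t ?b) = sets (CMn n \<Otimes>\<^sub>M borel)" by (rule sets_pair_measure_cong) simp_all
          have "(\<lambda>x. (snd x, fst x)) \<in> measurable (CMn n \<Otimes>\<^sub>M borel) (borel \<Otimes>\<^sub>M CMn n)" by measurable
          from measurable_compose[OF this jm]
          show "(\<lambda>(w, s). \<bar>\<phi> t (S n w) - \<phi> (clampT T s) (S n w)\<bar>) \<in> borel_measurable (CMn n \<Otimes>\<^sub>M unif t ?b)"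
            using measurable_cong_sets[OF sets refl] by (simp add: case_prod_beta)
        qed
        have hm: "(\<lambda>s. \<bar>\<phi> t (S n w) - \<phi> (clampT T s) (S n w)\<bar>) \<in> borel_measurable borel" if "w \<in> space (M n)" for w
          using payoff_clamp_measurable[OF \<phi> Pn.S_Dsp[OF that] T_pos] by simp
        show "integrable (CMn n) (\<lambda>w. \<integral>s. \<bar>\<phi> t (S n w) - \<phi> (clampT T s) (S n w)\<bar> \<partial>unif t ?b)"
          by (rule Pn.FS.integrable_const_bound[of _ "2 * K", OF AE_I2 m2])
            (use unif_integral_bound(2)[OF tb hm jb] in auto)
        show "AE w in CMn n. \<bar>\<phi> t (S n w) - \<psi> j (S n w)\<bar> \<le> (\<integral>s. \<bar>\<phi> t (S n w) - \<phi> (clampT T s) (S n w)\<bar> \<partial>unif t ?b)"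
        proof (rule AE_I2)
          fix w assume "w \<in> space (CMn n)"
          then have x: "S n w \<in> Dsp d T" using Pn.S_Dsp by simp
          have ic: "integrable (unif t ?b) (\<lambda>s. \<phi> (clampT T s) (S n w))"
            by (rule unif_integral_bound(1)[OF tb payoff_clamp_measurable[OF \<phi> x T_pos] Kabs[OF clampT_in[OF T_pos] x]])
          have "(\<integral>s. \<phi> t (S n w) \<partial>unif t ?b) = \<phi> t (S n w)" using U.prob_space by simp
          then have "\<phi> t (S n w) - \<psi> j (S n w) = (\<integral>s. \<phi> t (S n w) - \<phi> (clampT T s) (S n w) \<partial>unif t ?b)"
            unfolding \<psi>_def using Bochner_Integration.integral_diff[OF U.integrable_const[of "\<phi> t (S n w)"] ic] by simp
          then show "\<bar>\<phi> t (S n w) - \<psi> j (S n w)\<bar> \<le> (\<integral>s. \<bar>\<phi> t (S n w) - \<phi> (clampT T s) (S n w)\<bar> \<partial>unif t ?b)"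
            using integral_abs_bound by metis
        qed
      qed
      also have "\<dots> = (\<integral>s. (\<integral>w. \<bar>\<phi> t (S n w) - \<phi> (clampT T s) (S n w)\<bar> \<partial>CMn n) \<partial>unif t ?b)"
        by (rule Pn.unif_swap(1)[OF jm jb tb])
      also have "\<dots> \<le> \<epsilon>/2"
      proof -
        have sm: "(\<lambda>s. \<integral>w. \<bar>\<phi> t (S n w) - \<phi> (clampT T s) (S n w)\<bar> \<partial>CMn n) \<in> borel_measurable borel"
          by (rule Pn.unif_swap(2)[OF jm jb tb])
        interpret U: prob_space "unif t ?b" by (rule prob_space_unif[OF tb])
        have small: "(\<integral>w. \<bar>\<phi> t (S n w) - \<phi> (clampT T s) (S n w)\<bar> \<partial>CMn n) \<le> \<epsilon>/2" if "s \<in> {t..?b}" for s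
        proof -
          have "\<bar>t - clampT T s\<bar> \<le> \<delta>" using that tT j(2) by auto
          then show ?thesis
            using elim[rule_format, of "\<lambda>_. t" "\<lambda>_. clampT T s"] Pn.FS.stopT_const[OF t] Pn.FS.stopT_const[OF clampT_in[OF T_pos]] by simp
        qed
        have nn: "0 \<le> (\<integral>w. \<bar>\<phi> t (S n w) - \<phi> (clampT T s) (S n w)\<bar> \<partial>CMn n)" for s by (intro integral_nonneg_AE) auto
        have "(\<integral>s. (\<integral>w. \<bar>\<phi> t (S n w) - \<phi> (clampT T s) (S n w)\<bar> \<partial>CMn n) \<partial>unif t ?b) \<le> \<bar>\<integral>s. (\<integral>w. \<bar>\<phi> t (S n w) - \<phi> (clampT T s) (S n w)\<bar> \<partial>CMn n) \<partial>unif t ?b\<bar>" by simp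
        also have "\<dots> \<le> \<epsilon>/2" by (rule unif_integral_bound(2)[OF tb sm]) (use small nn in \<open>simp add: abs_of_nonneg\<close>)
        finally show ?thesis .
      qed
      finally show ?case using \<open>0 < \<epsilon>\<close> by linarith
    qed
    then show "\<exists>Y Y0. cv Y Y0 \<and> (\<integral>w. \<bar>\<phi> t (S0 w) - Y0 w\<bar> \<partial>CM0) < \<epsilon> \<and>
         (\<forall>\<^sub>F n in sequentially. (\<integral>w. \<bar>\<phi> t (S n w) - Y n w\<bar> \<partial>CMn n) < \<epsilon>)"
      using cv_psi[OF sb[of j]] j(1) by blast
  qed
qed

end

end

section \<open>Dynkin games on a finite grid\<close>

text \<open>The alternative \<open>m \<le> j\<close> makes the index well defined, with default
  \<open>m\<close> when no earlier set is met.\<close>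

definition hit :: "nat \<Rightarrow> (nat \<Rightarrow> 'a set) \<Rightarrow> 'a \<Rightarrow> nat" where
  "hit m D w = (LEAST j. m \<le> j \<or> w \<in> D j)"

lemma hit:
  shows "hit m D w \<le> m" "hit m D w < m \<Longrightarrow> w \<in> D (hit m D w)" "j < hit m D w \<Longrightarrow> w \<notin> D j"
    "hit m D w \<le> j \<longleftrightarrow> m \<le> j \<or> (\<exists>i\<le>j. w \<in> D i)"
proof -
  let ?Q = "\<lambda>j. m \<le> j \<or> w \<in> D j"
  have q: "?Q (hit m D w)" unfolding hit_def by (rule LeastI[of ?Q m]) simp
  have l: "?Q i \<Longrightarrow> hit m D w \<le> i" for i unfolding hit_def by (rule Least_le)
  show "hit m D w \<le> m" using l by simp
  show "hit m D w < m \<Longrightarrow> w \<in> D (hit m D w)" using q by linarith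
  show "j < hit m D w \<Longrightarrow> w \<notin> D j" using l[of j] by linarith
  show "hit m D w \<le> j \<longleftrightarrow> m \<le> j \<or> (\<exists>i\<le>j. w \<in> D i)" using q l order_trans by (metis le_refl)
qed

context filtered_space
begin

lemma stopI_hit:
  assumes mono: "\<And>i j. i \<le> j \<Longrightarrow> j \<le> m \<Longrightarrow> t i \<le> t j" and D: "\<And>j. j < m \<Longrightarrow> D j \<in> sets (F (t j))"
  shows "stopI t m (hit m D)"
  unfolding stopI_def
proof (intro conjI ballI allI impI)
  fix j assume j: "j \<le> m"
  show "{w \<in> space P. hit m D w \<le> j} \<in> sets (F (t j))"
  proof (cases "j = m")
    case True
    then show ?thesis by (simp add: hit(1) space_P_in_F)
  next
    case False
    have "{w \<in> space P. hit m D w \<le> j} = space P \<inter> (\<Union>i\<in>{..j}. D i)" using j False by (auto simp: hit(4))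
    moreover have "D i \<in> sets (F (t j))" if "i \<in> {..j}" for i
      using D[of i] F_mono[OF mono[of i j]] that j False by auto
    ultimately show ?thesis using space_P_in_F by (metis finite_atMost sets.Int sets.finite_UN)
  qed
qed (rule hit(1))

text \<open>The index is cut at \<open>m\<close> because nothing is assumed of \<open>X j\<close>
  beyond \<open>m\<close>.\<close>

lemma stopI_compose_measurable:
  assumes k: "stopI t m \<kappa>" and X: "\<And>j. j \<le> m \<Longrightarrow> X j \<in> borel_measurable P"
  shows "(\<lambda>w. X (\<kappa> w) w) \<in> borel_measurable P"
proof -
  have "(\<lambda>w. X (min (\<kappa> w) m) w) \<in> borel_measurable P"
    by (rule measurable_compose_countable[OF _ stopI_measurable[OF k], where f="\<lambda>j. X (min j m)"]) (simp add: X)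
  moreover have "min (\<kappa> w) m = \<kappa> w" if "w \<in> space P" for w using k that by (simp add: stopI_def)
  ultimately show ?thesis by (subst measurable_cong[of _ _ "\<lambda>w. X (min (\<kappa> w) m) w"]) simp_all
qed

lemma stopI_min:
  assumes "stopI t m \<kappa>" "stopI t m \<kappa>'"
  shows "stopI t m (\<lambda>w. min (\<kappa> w) (\<kappa>' w))"
proof -
  have "{w\<in>space P. min (\<kappa> w) (\<kappa>' w) \<le> j} = {w\<in>space P. \<kappa> w \<le> j} \<union> {w\<in>space P. \<kappa>' w \<le> j}" for j
    by (auto simp: min_le_iff_disj)
  then show ?thesis using assms unfolding stopI_def by (auto simp: min_le_iff_disj)
qed

context
  fixes t :: "nat \<Rightarrow> real" and m :: nat and f g V :: "nat \<Rightarrow> 'a \<Rightarrow> real" and K :: real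
  assumes mono: "\<And>i j. i \<le> j \<Longrightarrow> j \<le> m \<Longrightarrow> t i \<le> t j"
    and fm: "\<And>j. j \<le> m \<Longrightarrow> f j \<in> borel_measurable (F (t j))"
    and gm: "\<And>j. j \<le> m \<Longrightarrow> g j \<in> borel_measurable (F (t j))"
    and fg: "\<And>j w. j \<le> m \<Longrightarrow> w \<in> space P \<Longrightarrow> 0 \<le> f j w \<and> f j w \<le> g j w \<and> g j w \<le> K"
    and V_last: "V m = f m"
    and V_step: "\<And>j. j < m \<Longrightarrow> V j = (\<lambda>w. min (g j w) (max (f j w) (real_cond_exp P (F (t j)) (V (Suc j)) w)))"
begin

lemma V_between: "j \<le> m \<Longrightarrow> w \<in> space P \<Longrightarrow> f j w \<le> V j w \<and> V j w \<le> g j w"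
  by (cases "j = m") (use fg[of j w] V_last V_step[of j] in auto)

lemma V_measurable: "j \<le> m \<Longrightarrow> V j \<in> borel_measurable (F (t j))"
  by (cases "j = m") (use fm[of j] gm[of j] V_last V_step[of j] in auto)

lemma stopped_integrable:
  assumes k: "stopI t m \<kappa>"
  shows "integrable P (\<lambda>w. V (\<kappa> w) w)" "integrable P (\<lambda>w. f (\<kappa> w) w)" "integrable P (\<lambda>w. g (\<kappa> w) w)"
proof -
  have km: "\<kappa> w \<le> m" if "w \<in> space P" for w using k that by (simp add: stopI_def)
  have "norm (V (\<kappa> w) w) \<le> K \<and> norm (f (\<kappa> w) w) \<le> K \<and> norm (g (\<kappa> w) w) \<le> K" if "w \<in> space P" for w
    using fg[OF km[OF that] that] V_between[OF km[OF that] that] unfolding real_norm_def by linarith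
  then have b: "AE w in P. norm (V (\<kappa> w) w) \<le> K" "AE w in P. norm (f (\<kappa> w) w) \<le> K" "AE w in P. norm (g (\<kappa> w) w) \<le> K"
    by (simp_all add: AE_I2)
  show "integrable P (\<lambda>w. V (\<kappa> w) w)" "integrable P (\<lambda>w. f (\<kappa> w) w)" "integrable P (\<lambda>w. g (\<kappa> w) w)"
    by (rule integrable_const_bound[OF b(1) stopI_compose_measurable[OF k measurable_F_P[OF V_measurable]]]
        integrable_const_bound[OF b(2) stopI_compose_measurable[OF k measurable_F_P[OF fm]]]
        integrable_const_bound[OF b(3) stopI_compose_measurable[OF k measurable_F_P[OF gm]]]; assumption)+
qed

lemma V_integrable: "j \<le> m \<Longrightarrow> integrable P (V j)"
  by (rule integrable_const_bound[of _ K]) (use fg V_between measurable_F_P[OF V_measurable] in \<open>fastforce intro!: AE_I2\<close>)+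

text \<open>Induction over the truncations \<open>min \<kappa> j\<close>. The factor
  \<open>s\<close> serves both players at once: 1 for the supermartingale inequality, -1 for the
  submartingale inequality, each required only strictly before \<kappa>.\<close>

lemma optional_stopping:
  assumes k: "stopI t m \<kappa>"
    and s: "\<And>j w. j < m \<Longrightarrow> w \<in> space P \<Longrightarrow> j < \<kappa> w \<Longrightarrow> s * real_cond_exp P (F (t j)) (V (Suc j)) w \<le> s * V j w"
  shows "s * (\<integral>w. V (\<kappa> w) w \<partial>P) \<le> s * (\<integral>w. V 0 w \<partial>P)"
proof -
  have kc: "stopI t m (\<lambda>w. min (\<kappa> w) j)" if "j \<le> m" for j
    by (rule stopI_min[OF k]) (use that space_P_in_F in \<open>auto simp: stopI_def\<close>)
  have "s * (\<integral>w. V (min (\<kappa> w) j) w \<partial>P) \<le> s * (\<integral>w. V 0 w \<partial>P)" if "j \<le> m" for j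
    using that
  proof (induction j)
    case 0
    show ?case by simp
  next
    case (Suc j)
    let ?A = "{w\<in>space P. j < \<kappa> w}"
    let ?C = "real_cond_exp P (F (t j)) (V (Suc j))"
    have eq: "?A = space P - {w\<in>space P. \<kappa> w \<le> j}" by auto
    have le: "{w\<in>space P. \<kappa> w \<le> j} \<in> sets (F (t j))" using k Suc.prems by (simp add: stopI_def)
    \<comment> \<open>Not having stopped by \<open>j\<close> is known at \<open>t j\<close>, so the
      increment of \<open>V\<close> on this event may be conditioned there.\<close>
    have A: "?A \<in> sets (F (t j))" unfolding eq by (rule sets.Diff[OF space_P_in_F le])
    then have AP: "?A \<in> sets P" using sets_F by blast
    have Am: "indicator ?A \<in> borel_measurable (F (t j))" using A by simp
    have iV: "integrable P (V (Suc j))" "integrable P (V j)" using V_integrable Suc by auto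
    have iC: "integrable P ?C" by (rule FS.real_cond_exp_int(1)[OF iV(1)])
    have ii: "integrable P (\<lambda>w. indicator ?A w * V (Suc j) w)" "integrable P (\<lambda>w. indicator ?A w * V j w)" "integrable P (\<lambda>w. indicator ?A w * ?C w)"
      using integrable_real_mult_indicator[OF AP] iV iC by (simp_all add: mult.commute)
    have "(\<integral>w. V (min (\<kappa> w) (Suc j)) w - V (min (\<kappa> w) j) w \<partial>P) = (\<integral>w. indicator ?A w * V (Suc j) w - indicator ?A w * V j w \<partial>P)"
    proof (rule Bochner_Integration.integral_cong[OF refl])
      fix w assume "w \<in> space P"
      then show "V (min (\<kappa> w) (Suc j)) w - V (min (\<kappa> w) j) w = indicator ?A w * V (Suc j) w - indicator ?A w * V j w"
        by (cases "j < \<kappa> w") (simp_all add: min_absorb2 min_absorb1 Suc_leI)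
    qed
    also have "\<dots> = (\<integral>w. indicator ?A w * ?C w \<partial>P) - (\<integral>w. indicator ?A w * V j w \<partial>P)"
      using ii cond_exp_mult_bounded[OF iV(1) Am, of 1] by (simp add: indicator_def)
    finally have "s * (\<integral>w. V (min (\<kappa> w) (Suc j)) w \<partial>P) - s * (\<integral>w. V (min (\<kappa> w) j) w \<partial>P) =
        (\<integral>w. s * (indicator ?A w * ?C w) \<partial>P) - (\<integral>w. s * (indicator ?A w * V j w) \<partial>P)"
      using stopped_integrable(1)[OF kc[of j]] stopped_integrable(1)[OF kc[OF Suc.prems]] Suc.prems
      by (simp add: right_diff_distrib[symmetric])
    moreover have "(\<integral>w. s * (indicator ?A w * ?C w) \<partial>P) \<le> (\<integral>w. s * (indicator ?A w * V j w) \<partial>P)"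
      by (rule integral_mono) (use ii s[of j] Suc.prems in \<open>auto simp: indicator_def\<close>)
    ultimately show ?case using Suc by linarith
  qed
  from this[OF le_refl] have "s * (\<integral>w. V (min (\<kappa> w) m) w \<partial>P) \<le> s * (\<integral>w. V 0 w \<partial>P)" .
  moreover have "(\<integral>w. V (min (\<kappa> w) m) w \<partial>P) = (\<integral>w. V (\<kappa> w) w \<partial>P)"
    by (rule Bochner_Integration.integral_cong[OF refl]) (use k in \<open>simp add: stopI_def min_def\<close>)
  ultimately show ?thesis by simp
qed

lemma pair_integrable:
  assumes k: "stopI t m \<kappa>" "stopI t m \<kappa>'"
  shows "integrable P (\<lambda>w. if \<kappa> w < \<kappa>' w then g (\<kappa> w) w else f (\<kappa>' w) w)"
proof (rule Bochner_Integration.integrable_bound[of _ "\<lambda>w. \<bar>g (\<kappa> w) w\<bar> + \<bar>f (\<kappa>' w) w\<bar>"])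
  have "{w\<in>space P. \<kappa> w < \<kappa>' w} = (\<Union>j. {w\<in>space P. \<kappa> w = j} \<inter> {w\<in>space P. j < \<kappa>' w})" by auto
  moreover have "{w\<in>space P. \<kappa> w = j} \<in> sets P" "{w\<in>space P. j < \<kappa>' w} \<in> sets P" for j
    using stopI_measurable[OF k(1)] stopI_measurable[OF k(2)] by measurable
  ultimately have "{w\<in>space P. \<kappa> w < \<kappa>' w} \<in> sets P" by auto
  then show "(\<lambda>w. if \<kappa> w < \<kappa>' w then g (\<kappa> w) w else f (\<kappa>' w) w) \<in> borel_measurable P"
    using stopped_integrable(3)[OF k(1)] stopped_integrable(2)[OF k(2)] by (intro measurable_If) auto
qed (use stopped_integrable(3)[OF k(1)] stopped_integrable(2)[OF k(2)] in auto)

text \<open>The minimizer stops when \<open>V\<close> first reaches the upper payoff. Before that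
  \<open>V < g\<close>, so the outer minimum of the recursion is inactive and \<open>V\<close>
  dominates the conditional expectation of its successor: up to this index it is a supermartingale.
  A minimizer who stops first pays \<open>g\<close>, at most \<open>V\<close> there; otherwise the
  payment is \<open>f\<close>, again at most \<open>V\<close>.\<close>

lemma dynkin_upper:
  "\<exists>\<kappa>. stopI t m \<kappa> \<and> (\<forall>\<kappa>'. stopI t m \<kappa>' \<longrightarrow> (\<integral>w. (if \<kappa> w < \<kappa>' w then g (\<kappa> w) w else f (\<kappa>' w) w) \<partial>P) \<le> (\<integral>w. V 0 w \<partial>P))"
proof (intro exI[of _ "hit m (\<lambda>j. {w\<in>space P. g j w \<le> V j w})"] conjI allI impI)
  let ?D = "\<lambda>j. {w\<in>space P. g j w \<le> V j w}"
  let ?\<kappa> = "hit m ?D"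
  have "?D j \<in> sets (F (t j))" if "j < m" for j
  proof -
    have "{w\<in>space (F (t j)). g j w \<le> V j w} \<in> sets (F (t j))" using gm[of j] V_measurable[of j] that by (intro borel_measurable_le) auto
    then show ?thesis by (simp add: space_F)
  qed
  then show k: "stopI t m ?\<kappa>" using mono by (intro stopI_hit) auto
  fix \<kappa>' assume k': "stopI t m \<kappa>'"
  have km: "\<kappa>' w \<le> m" if "w \<in> space P" for w using k' that by (simp add: stopI_def)
  have kk: "stopI t m (\<lambda>w. min (?\<kappa> w) (\<kappa>' w))" by (rule stopI_min[OF k k'])
  have "(\<integral>w. (if ?\<kappa> w < \<kappa>' w then g (?\<kappa> w) w else f (\<kappa>' w) w) \<partial>P) \<le> (\<integral>w. V (min (?\<kappa> w) (\<kappa>' w)) w \<partial>P)"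
  proof (rule integral_mono[OF pair_integrable[OF k k'] stopped_integrable(1)[OF kk]])
    fix w assume w: "w \<in> space P"
    show "(if ?\<kappa> w < \<kappa>' w then g (?\<kappa> w) w else f (\<kappa>' w) w) \<le> V (min (?\<kappa> w) (\<kappa>' w)) w"
    proof (cases "?\<kappa> w < \<kappa>' w")
      case True
      then have "w \<in> ?D (?\<kappa> w)" using km[OF w] by (intro hit(2)) simp
      then show ?thesis using True by simp
    next
      case False
      then show ?thesis using V_between[OF km[OF w] w] by (simp add: min_def)
    qed
  qed
  also have "\<dots> \<le> (\<integral>w. V 0 w \<partial>P)"
  proof -
    have "1 * (\<integral>w. V (min (?\<kappa> w) (\<kappa>' w)) w \<partial>P) \<le> 1 * (\<integral>w. V 0 w \<partial>P)"
    proof (rule optional_stopping[OF kk])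
      fix j w assume j: "j < m" "w \<in> space P" "j < min (?\<kappa> w) (\<kappa>' w)"
      then have "w \<notin> ?D j" by (intro hit(3)[of j m]) simp
      then have "V j w < g j w" using j by simp
      then show "1 * real_cond_exp P (F (t j)) (V (Suc j)) w \<le> 1 * V j w" using V_step[OF j(1)] by (auto simp: min_def max_def split: if_splits)
    qed
    then show ?thesis by simp
  qed
  finally show "(\<integral>w. (if ?\<kappa> w < \<kappa>' w then g (?\<kappa> w) w else f (\<kappa>' w) w) \<partial>P) \<le> (\<integral>w. V 0 w \<partial>P)" .
qed

text \<open>The maximizer stops when \<open>V\<close> first falls to the lower payoff. Before that
  \<open>V > f\<close>, so the inner maximum is attained by the conditional expectation and
  \<open>V\<close> does not exceed it. At the last index \<open>V = f\<close>, so the default of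
  \<open>hit\<close> is a proper stop as well.\<close>

lemma dynkin_lower:
  "\<exists>\<kappa>'. stopI t m \<kappa>' \<and> (\<forall>\<kappa>. stopI t m \<kappa> \<longrightarrow> (\<integral>w. V 0 w \<partial>P) \<le> (\<integral>w. (if \<kappa> w < \<kappa>' w then g (\<kappa> w) w else f (\<kappa>' w) w) \<partial>P))"
proof (intro exI[of _ "hit m (\<lambda>j. {w\<in>space P. V j w \<le> f j w})"] conjI allI impI)
  let ?D = "\<lambda>j. {w\<in>space P. V j w \<le> f j w}"
  let ?\<kappa> = "hit m ?D"
  have "?D j \<in> sets (F (t j))" if "j < m" for j
  proof -
    have "{w\<in>space (F (t j)). V j w \<le> f j w} \<in> sets (F (t j))" using fm[of j] V_measurable[of j] that by (intro borel_measurable_le) auto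
    then show ?thesis by (simp add: space_F)
  qed
  then show k: "stopI t m ?\<kappa>" using mono by (intro stopI_hit) auto
  fix \<kappa>' assume k': "stopI t m \<kappa>'"
  have km: "\<kappa>' w \<le> m" if "w \<in> space P" for w using k' that by (simp add: stopI_def)
  have kk: "stopI t m (\<lambda>w. min (\<kappa>' w) (?\<kappa> w))" by (rule stopI_min[OF k' k])
  have "- 1 * (\<integral>w. V (min (\<kappa>' w) (?\<kappa> w)) w \<partial>P) \<le> - 1 * (\<integral>w. V 0 w \<partial>P)"
  proof (rule optional_stopping[OF kk])
    fix j w assume j: "j < m" "w \<in> space P" "j < min (\<kappa>' w) (?\<kappa> w)"
    then have "w \<notin> ?D j" by (intro hit(3)[of j m]) simp
    then have "f j w < V j w" using j by simp
    then show "- 1 * real_cond_exp P (F (t j)) (V (Suc j)) w \<le> - 1 * V j w" using V_step[OF j(1)] by (auto simp: min_def max_def split: if_splits)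
  qed
  then have "(\<integral>w. V 0 w \<partial>P) \<le> (\<integral>w. V (min (\<kappa>' w) (?\<kappa> w)) w \<partial>P)" by simp
  also have "\<dots> \<le> (\<integral>w. (if \<kappa>' w < ?\<kappa> w then g (\<kappa>' w) w else f (?\<kappa> w) w) \<partial>P)"
  proof (rule integral_mono[OF stopped_integrable(1)[OF kk] pair_integrable[OF k' k]])
    fix w assume w: "w \<in> space P"
    show "V (min (\<kappa>' w) (?\<kappa> w)) w \<le> (if \<kappa>' w < ?\<kappa> w then g (\<kappa>' w) w else f (?\<kappa> w) w)"
    proof (cases "\<kappa>' w < ?\<kappa> w")
      case True
      then show ?thesis using V_between[OF km[OF w] w] by simp
    next
      case False
      have "V (?\<kappa> w) w \<le> f (?\<kappa> w) w"
      proof (cases "?\<kappa> w = m")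
        case True then show ?thesis using V_last by simp
      next
        case False
        then have "w \<in> ?D (?\<kappa> w)" using hit(1)[of m ?D w] by (intro hit(2)) simp
        then show ?thesis by simp
      qed
      then show ?thesis using False by (simp add: min_def)
    qed
  qed
  finally show "(\<integral>w. V 0 w \<partial>P) \<le> (\<integral>w. (if \<kappa>' w < ?\<kappa> w then g (\<kappa>' w) w else f (?\<kappa> w) w) \<partial>P)" .
qed

end

end

text \<open>Index of the first grid point strictly after \<open>s\<close>, or of the last grid point. Strictness makes the
  index right-continuous in \<open>s\<close>.\<close>

abbreviation next_index :: "(nat \<Rightarrow> real) \<Rightarrow> nat \<Rightarrow> real \<Rightarrow> nat" where
  "next_index t m \<equiv> hit m (\<lambda>j. {..<t j})"

lemma next_index_right:
  assumes "s < t m"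
  shows "\<forall>\<^sub>F r in at_right s. next_index t m r = next_index t m s"
proof -
  let ?h = "next_index t m s"
  have "s < t ?h" using hit(2)[of m "\<lambda>j. {..<t j}" s] hit(1)[of m "\<lambda>j. {..<t j}" s] assms by (cases "?h = m") auto
  then have "\<forall>\<^sub>F r in at_right s. r < t ?h" by (rule order_tendstoD(2)[OF tendsto_ident_at])
  moreover have "\<forall>\<^sub>F r in at_right s. s < r" by (auto simp: eventually_at_filter)
  ultimately show ?thesis
  proof eventually_elim
    case (elim r)
    have "next_index t m r \<le> ?h" using elim unfolding hit(4) by auto
    moreover have "?h \<le> next_index t m r"
    proof (cases "next_index t m r = m")
      case True then show ?thesis using hit(1) by simp
    next
      case False
      then have "r < t (next_index t m r)" using hit(2)[of m "\<lambda>j. {..<t j}" r] hit(1)[of m "\<lambda>j. {..<t j}" r] by simp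
      then show ?thesis using elim unfolding hit(4) by (intro disjI2 exI[of _ "next_index t m r"]) simp
    qed
    ultimately show ?case by simp
  qed
qed

text \<open>The grid need not contain 0; the condition on \<open>t 0\<close> covers times before its
  first point.\<close>

lemma next_index_mesh:
  assumes tm: "t m = T" and s: "s \<in> {0..T}" and t0: "t 0 \<le> \<delta>" and step: "\<And>i. i < m \<Longrightarrow> t (Suc i) - t i \<le> \<delta>"
  shows "s \<le> t (next_index t m s)" "t (next_index t m s) - s \<le> \<delta>"
proof -
  let ?h = "next_index t m s"
  show "s \<le> t ?h" using hit(2)[of m "\<lambda>j. {..<t j}" s] hit(1)[of m "\<lambda>j. {..<t j}" s] tm s by (cases "?h = m") auto
  show "t ?h - s \<le> \<delta>"
  proof (cases ?h)
    case 0
    then show ?thesis using t0 s by simp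
  next
    case (Suc i)
    then have "t i \<le> s" "i < m" using hit(3)[of i m "\<lambda>j. {..<t j}" s] hit(1)[of m "\<lambda>j. {..<t j}" s] by auto
    then show ?thesis using step[of i] Suc by simp
  qed
qed

text \<open>The index is the hitting index of the events \<open>\<tau> < t j\<close>, which are
  known at \<open>t j\<close> as countable unions of events
  \<open>\<tau> \<le> t j - 1/(n+1)\<close>.\<close>

lemma (in filtered_space) stopI_next_index:
  assumes \<tau>: "stopT T \<tau>" and mono: "\<And>i j. i \<le> j \<Longrightarrow> j \<le> m \<Longrightarrow> t i \<le> t j"
  shows "stopI t m (\<lambda>w. next_index t m (\<tau> w))"
proof -
  have "{w\<in>space P. \<tau> w < c} \<in> sets (F c)" for c
  proof -
    have "{w\<in>space P. \<tau> w < c} = (\<Union>n. {w\<in>space P. \<tau> w \<le> c - inverse (real (Suc n))})"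
    proof (intro set_eqI iffI)
      fix w assume "w \<in> {w\<in>space P. \<tau> w < c}"
      moreover then obtain n where "inverse (real (Suc n)) < c - \<tau> w" using reals_Archimedean[of "c - \<tau> w"] by auto
      ultimately show "w \<in> (\<Union>n. {w\<in>space P. \<tau> w \<le> c - inverse (real (Suc n))})" by (intro UN_I[of n]) auto
    next
      fix w assume "w \<in> (\<Union>n. {w\<in>space P. \<tau> w \<le> c - inverse (real (Suc n))})"
      then obtain n where "w \<in> space P" "\<tau> w \<le> c - inverse (real (Suc n))" by blast
      moreover have "0 < inverse (real (Suc n))" by simp
      ultimately have "\<tau> w < c" by linarith
      then show "w \<in> {w\<in>space P. \<tau> w < c}" using \<open>w \<in> space P\<close> by simp
    qed
    moreover have "{w\<in>space P. \<tau> w \<le> c - inverse (real (Suc n))} \<in> sets (F c)" for n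
      using stopT_le[OF \<tau>, of "c - inverse (real (Suc n))"] F_mono[of "c - inverse (real (Suc n))" c] by auto
    ultimately show ?thesis by auto
  qed
  then have "stopI t m (hit m (\<lambda>j. {w\<in>space P. \<tau> w < t j}))" using mono by (intro stopI_hit) auto
  moreover have "hit m (\<lambda>j. {w\<in>space P. \<tau> w < t j}) w = next_index t m (\<tau> w)" if "w \<in> space P" for w
    using that by (simp add: hit_def)
  ultimately show ?thesis by (simp add: stopI_def cong: conj_cong)
qed

lemma le_INF_add_ennreal:
  assumes "\<And>x. x \<in> A \<Longrightarrow> a \<le> f x + ennreal e"
  shows "a \<le> (INF x\<in>A. f x) + ennreal e"
proof -
  have "a - ennreal e \<le> (INF x\<in>A. f x)"
    by (rule INF_greatest) (use assms in \<open>simp add: ennreal_minus_le_iff add.commute\<close>)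
  then show ?thesis by (simp add: ennreal_minus_le_iff add.commute)
qed

context cadlag_proc
begin

lemma payoff_pair_measurable:
  assumes p: "payoff d T f" "payoff d T g" and s: "FS.stopT T \<sigma>" "FS.stopT T \<tau>"
  shows "(\<lambda>w. if \<sigma> w < \<tau> w then g (\<sigma> w) (S w) else f (\<tau> w) (S w)) \<in> borel_measurable (completion M)"
proof (rule measurable_If)
  show "{w \<in> space (completion M). \<sigma> w < \<tau> w} \<in> sets (completion M)"
    using FS.stopT_measurable[OF s(1)] FS.stopT_measurable[OF s(2)] by (rule borel_measurable_less)
qed (use payoff_random_time_measurable[OF p(2) FS.stopT_measurable[OF s(1)]] FS.stopT_range[OF s(1)]
      payoff_random_time_measurable[OF p(1) FS.stopT_measurable[OF s(2)]] FS.stopT_range[OF s(2)] in auto)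

text \<open>For any pair of strategies the game ends at the minimum of the two stopping times,
  itself a stopping time, and truncation costs at most the excess of \<open>g\<close> over
  \<open>K\<close> there; when \<open>f\<close> is paid this uses \<open>f \<le> g\<close>. The
  bound is uniform in both strategies, so it passes through supremum and infimum.\<close>

lemma game_value_truncate:
  assumes p: "payoff d T f" "payoff d T g" and K: "0 \<le> K" and \<epsilon>: "0 \<le> \<epsilon>"
    and fg: "\<And>t x. t \<in> {0..T} \<Longrightarrow> x \<in> Dsp d T \<Longrightarrow> 0 \<le> f t x \<and> f t x \<le> g t x"
    and e: "\<And>\<tau>. FS.stopT T \<tau> \<Longrightarrow> (\<integral>\<^sup>+w. ennreal (max 0 (g (\<tau> w) (S w) - K)) \<partial>completion M) \<le> ennreal \<epsilon>"
  defines "G \<equiv> game_value M d T S f g" and "GK \<equiv> game_value M d T S (\<lambda>t x. min (f t x) K) (\<lambda>t x. min (g t x) K)"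
  shows "GK \<le> G" "G \<le> GK + ennreal \<epsilon>"
proof -
  show "GK \<le> G" unfolding G_def GK_def game_value_def
    by (intro INF_mono' SUP_mono' nn_integral_mono) (auto intro!: ennreal_leI)
  show "G \<le> GK + ennreal \<epsilon>" unfolding GK_def game_value_def
  proof (rule le_INF_add_ennreal)
    fix \<sigma> assume sm: "\<sigma> \<in> stop_times M d T S"
    then have s: "FS.stopT T \<sigma>" by (simp add: stop_times_iff)
    have "G \<le> (SUP \<tau>\<in>stop_times M d T S. \<integral>\<^sup>+ w. ennreal (if \<sigma> w < \<tau> w then g (\<sigma> w) (S w) else f (\<tau> w) (S w)) \<partial>completion M)"
      unfolding G_def game_value_def by (rule INF_lower[OF sm])
    also have "\<dots> \<le> (SUP \<tau>\<in>stop_times M d T S. \<integral>\<^sup>+ w. ennreal (if \<sigma> w < \<tau> w then min (g (\<sigma> w) (S w)) K else min (f (\<tau> w) (S w)) K) \<partial>completion M) + ennreal \<epsilon>"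
    proof (rule SUP_least)
      fix \<tau> assume tm: "\<tau> \<in> stop_times M d T S"
      then have \<tau>: "FS.stopT T \<tau>" by (simp add: stop_times_iff)
      have st: "FS.stopT T (\<lambda>w. min (\<sigma> w) (\<tau> w))" by (rule FS.stopT_min[OF s \<tau>])
      let ?HK = "\<lambda>w. if \<sigma> w < \<tau> w then min (g (\<sigma> w) (S w)) K else min (f (\<tau> w) (S w)) K"
      let ?R = "\<lambda>w. max 0 (g (min (\<sigma> w) (\<tau> w)) (S w) - K)"
      have "(\<integral>\<^sup>+ w. ennreal (if \<sigma> w < \<tau> w then g (\<sigma> w) (S w) else f (\<tau> w) (S w)) \<partial>completion M) \<le> (\<integral>\<^sup>+ w. ennreal (?HK w) + ennreal (?R w) \<partial>completion M)"
      proof (rule nn_integral_mono)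
        fix w assume "w \<in> space (completion M)"
        then have r: "S w \<in> Dsp d T" "\<sigma> w \<in> {0..T}" "\<tau> w \<in> {0..T}" using S_Dsp FS.stopT_range[OF s] FS.stopT_range[OF \<tau>] by auto
        have "(if \<sigma> w < \<tau> w then g (\<sigma> w) (S w) else f (\<tau> w) (S w)) \<le> ?HK w + ?R w"
          using fg[OF r(3,1)] by (auto simp: min_def max_def)
        then have "ennreal (if \<sigma> w < \<tau> w then g (\<sigma> w) (S w) else f (\<tau> w) (S w)) \<le> ennreal (?HK w + ?R w)" by (rule ennreal_leI)
        also have "\<dots> = ennreal (?HK w) + ennreal (?R w)" by (rule ennreal_plus) (use fg[OF r(2,1)] fg[OF r(3,1)] K in auto)
        finally show "ennreal (if \<sigma> w < \<tau> w then g (\<sigma> w) (S w) else f (\<tau> w) (S w)) \<le> ennreal (?HK w) + ennreal (?R w)" .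
      qed
      also have "\<dots> = (\<integral>\<^sup>+ w. ennreal (?HK w) \<partial>completion M) + (\<integral>\<^sup>+ w. ennreal (?R w) \<partial>completion M)"
      proof (rule nn_integral_add)
        show "(\<lambda>w. ennreal (?HK w)) \<in> borel_measurable (completion M)"
          using payoff_pair_measurable[OF payoff_min[OF p(1), of K] payoff_min[OF p(2), of K] s \<tau>] by simp
        show "(\<lambda>w. ennreal (?R w)) \<in> borel_measurable (completion M)"
          using payoff_random_time_measurable[OF p(2) FS.stopT_measurable[OF st]] FS.stopT_range[OF st] by simp
      qed
      also have "\<dots> \<le> (SUP \<tau>\<in>stop_times M d T S. \<integral>\<^sup>+ w. ennreal (if \<sigma> w < \<tau> w then min (g (\<sigma> w) (S w)) K else min (f (\<tau> w) (S w)) K) \<partial>completion M) + ennreal \<epsilon>"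
        by (intro add_mono e[OF st] SUP_upper[OF tm])
      finally show "(\<integral>\<^sup>+ w. ennreal (if \<sigma> w < \<tau> w then g (\<sigma> w) (S w) else f (\<tau> w) (S w)) \<partial>completion M) \<le> \<dots>" .
    qed
    finally show "G \<le> (SUP \<tau>\<in>stop_times M d T S. \<integral>\<^sup>+ w. ennreal (if \<sigma> w < \<tau> w then min (g (\<sigma> w) (S w)) K else min (f (\<tau> w) (S w)) K) \<partial>completion M) + ennreal \<epsilon>" .
  qed
qed

text \<open>In each inequality one player uses an optimal grid strategy and the stopping time of the
  opponent is rounded up to the grid. Rounding preserves the order of stopping except for ties,
  where \<open>f \<le> g\<close> decides in the right direction; what remains is the rounding error
  of the payoff of the opponent.\<close>

lemma game_value_grid:
  fixes t :: "nat \<Rightarrow> real"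
  assumes p: "payoff d T f" "payoff d T g" and \<epsilon>: "0 \<le> \<epsilon>"
    and fg: "\<And>t x. t \<in> {0..T} \<Longrightarrow> x \<in> Dsp d T \<Longrightarrow> 0 \<le> f t x \<and> f t x \<le> g t x \<and> g t x \<le> K"
    and mono: "\<And>i j. i \<le> j \<Longrightarrow> j \<le> m \<Longrightarrow> t i \<le> t j" and tr: "\<And>i. i \<le> m \<Longrightarrow> t i \<in> {0..T}" and tm: "t m = T"
    and V_last: "V m = (\<lambda>w. f (t m) (S w))"
    and V_step: "\<And>j. j < m \<Longrightarrow> V j = (\<lambda>w. min (g (t j) (S w)) (max (f (t j) (S w)) (real_cond_exp (completion M) (Ft (t j)) (V (Suc j)) w)))"
    and ef: "\<And>\<tau>. FS.stopT T \<tau> \<Longrightarrow> (\<integral>w. \<bar>f (\<tau> w) (S w) - f (t (next_index t m (\<tau> w))) (S w)\<bar> \<partial>completion M) \<le> \<epsilon>"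
    and eg: "\<And>\<tau>. FS.stopT T \<tau> \<Longrightarrow> (\<integral>w. \<bar>g (\<tau> w) (S w) - g (t (next_index t m (\<tau> w))) (S w)\<bar> \<partial>completion M) \<le> \<epsilon>"
  shows "game_value M d T S f g \<le> ennreal ((\<integral>w. V 0 w \<partial>completion M) + \<epsilon>)"
    "ennreal (\<integral>w. V 0 w \<partial>completion M) \<le> game_value M d T S f g + ennreal \<epsilon>"
proof -
  let ?H = "\<lambda>\<sigma> \<tau> w. if \<sigma> w < \<tau> w then g (\<sigma> w) (S w) else f (\<tau> w) (S w)"
  let ?I = "\<lambda>\<kappa> \<kappa>' w. if \<kappa> w < \<kappa>' w then g (t (\<kappa> w)) (S w) else f (t (\<kappa>' w)) (S w)"
  let ?n = "\<lambda>\<tau> w. next_index t m (\<tau> w)"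
  have sp: "space (completion M) = space M" by simp
  have Hb: "0 \<le> ?H \<sigma> \<tau> w \<and> ?H \<sigma> \<tau> w \<le> K" if "FS.stopT T \<sigma>" "FS.stopT T \<tau>" "w \<in> space M" for \<sigma> \<tau> w
    using fg[OF FS.stopT_range[OF that(1)] S_Dsp[OF that(3)]] fg[OF FS.stopT_range[OF that(2)] S_Dsp[OF that(3)]] that(3) by fastforce
  have Hi: "integrable (completion M) (?H \<sigma> \<tau>)" if "FS.stopT T \<sigma>" "FS.stopT T \<tau>" for \<sigma> \<tau>
  proof (rule FS.integrable_const_bound[of _ K, OF AE_I2 payoff_pair_measurable[OF p that]])
    fix w assume "w \<in> space (completion M)"
    then have "0 \<le> ?H \<sigma> \<tau> w \<and> ?H \<sigma> \<tau> w \<le> K" unfolding sp by (rule Hb[OF that])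
    then show "norm (?H \<sigma> \<tau> w) \<le> K" by (simp only: real_norm_def abs_of_nonneg)
  qed
  have H0: "AE w in completion M. 0 \<le> ?H \<sigma> \<tau> w" if "FS.stopT T \<sigma>" "FS.stopT T \<tau>" for \<sigma> \<tau>
    by (rule AE_I2, unfold sp, rule Hb[OF that, THEN conjunct1])
  have Hn: "(\<integral>\<^sup>+w. ennreal (?H \<sigma> \<tau> w) \<partial>completion M) = ennreal (\<integral>w. ?H \<sigma> \<tau> w \<partial>completion M)" if "FS.stopT T \<sigma>" "FS.stopT T \<tau>" for \<sigma> \<tau>
    by (rule nn_integral_eq_integral[OF Hi[OF that] H0[OF that]])
  have si: "FS.stopT T (\<lambda>w. t (\<kappa> w))" if "FS.stopI t m \<kappa>" for \<kappa> by (rule FS.stopI_stopT[OF that mono tr])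
  have fm: "(\<lambda>w. f (t j) (S w)) \<in> borel_measurable (Ft (t j))" "(\<lambda>w. g (t j) (S w)) \<in> borel_measurable (Ft (t j))" if "j \<le> m" for j
    using payoff_adapted[OF p(1) tr[OF that]] payoff_adapted[OF p(2) tr[OF that]] by auto
  have fgj: "0 \<le> f (t j) (S w) \<and> f (t j) (S w) \<le> g (t j) (S w) \<and> g (t j) (S w) \<le> K" if "j \<le> m" "w \<in> space (completion M)" for j w
    using fg[OF tr[OF that(1)] S_Dsp] that by simp
  have nI: "FS.stopI t m (?n \<tau>)" if "FS.stopT T \<tau>" for \<tau> by (rule FS.stopI_next_index[OF that mono])
  have Ii: "integrable (completion M) (?I \<kappa> \<kappa>')" if "FS.stopI t m \<kappa>" "FS.stopI t m \<kappa>'" for \<kappa> \<kappa>'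
    using FS.pair_integrable[where t=t and m=m and f="\<lambda>j w. f (t j) (S w)" and g="\<lambda>j w. g (t j) (S w)" and V=V and K=K,
        OF mono fm fgj V_last V_step that] by simp
  have di: "integrable (completion M) (\<lambda>w. \<bar>\<phi> (\<tau> w) (S w) - \<phi> (t (?n \<tau> w)) (S w)\<bar>)"
    if \<tau>: "FS.stopT T \<tau>" and q: "payoff d T \<phi>" and b: "\<And>t x. t \<in> {0..T} \<Longrightarrow> x \<in> Dsp d T \<Longrightarrow> 0 \<le> \<phi> t x \<and> \<phi> t x \<le> K" for \<tau> \<phi>
  proof (intro integrable_abs Bochner_Integration.integrable_diff)
    have "integrable (completion M) (\<lambda>w. \<phi> (\<rho> w) (S w))" if r: "FS.stopT T \<rho>" for \<rho>
      by (rule FS.integrable_const_bound[of _ K])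
        (use b[OF FS.stopT_range[OF r] S_Dsp] payoff_random_time_measurable[OF q FS.stopT_measurable[OF r]] FS.stopT_range[OF r] in \<open>auto intro!: AE_I2\<close>)
    then show "integrable (completion M) (\<lambda>w. \<phi> (\<tau> w) (S w))" "integrable (completion M) (\<lambda>w. \<phi> (t (?n \<tau> w)) (S w))"
      using \<tau> si[OF nI[OF \<tau>]] by auto
  qed
  have fK: "0 \<le> f t x \<and> f t x \<le> K" "0 \<le> g t x \<and> g t x \<le> K" if "t \<in> {0..T}" "x \<in> Dsp d T" for t x using fg[OF that] by auto
  have V0: "0 \<le> (\<integral>w. V 0 w \<partial>completion M)"
    using FS.V_between[where t=t and m=m and f="\<lambda>j w. f (t j) (S w)" and g="\<lambda>j w. g (t j) (S w)" and V=V and K=K and j=0,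
        OF mono fm fgj V_last V_step] fgj[of 0] by (intro integral_nonneg_AE AE_I2) force
  have nle: "next_index t m s \<le> m" for s by (rule hit(1))
  have ts: "s \<le> t (next_index t m s)" if "s \<le> T" for s
    using hit(2)[of m "\<lambda>j. {..<t j}" s] nle[of s] tm that by (cases "next_index t m s = m") auto
  show "game_value M d T S f g \<le> ennreal ((\<integral>w. V 0 w \<partial>completion M) + \<epsilon>)"
  proof -
    obtain \<kappa> where k: "FS.stopI t m \<kappa>" and opt: "\<And>\<kappa>'. FS.stopI t m \<kappa>' \<Longrightarrow> (\<integral>w. ?I \<kappa> \<kappa>' w \<partial>completion M) \<le> (\<integral>w. V 0 w \<partial>completion M)"
      using FS.dynkin_upper[where t=t and m=m and f="\<lambda>j w. f (t j) (S w)" and g="\<lambda>j w. g (t j) (S w)" and V=V and K=K,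
        OF mono fm fgj V_last V_step] by blast
    let ?s = "\<lambda>w. t (\<kappa> w)"
    have km: "\<kappa> w \<le> m" if "w \<in> space M" for w using k that by (simp add: FS.stopI_def)
    have sm: "?s \<in> stop_times M d T S" using si[OF k] by (simp add: stop_times_iff)
    have "game_value M d T S f g \<le> (SUP \<tau>\<in>stop_times M d T S. \<integral>\<^sup>+ w. ennreal (?H ?s \<tau> w) \<partial>completion M)"
      unfolding game_value_def by (rule INF_lower[OF sm])
    also have "\<dots> \<le> ennreal ((\<integral>w. V 0 w \<partial>completion M) + \<epsilon>)"
    proof (rule SUP_least)
      fix \<tau> assume "\<tau> \<in> stop_times M d T S"
      then have \<tau>: "FS.stopT T \<tau>" by (simp add: stop_times_iff)
      have "(\<integral>w. ?H ?s \<tau> w \<partial>completion M) \<le> (\<integral>w. ?I \<kappa> (?n \<tau>) w + \<bar>f (\<tau> w) (S w) - f (t (?n \<tau> w)) (S w)\<bar> \<partial>completion M)"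
      proof (rule integral_mono[OF Hi[OF si[OF k] \<tau>] Bochner_Integration.integrable_add[OF Ii[OF k nI[OF \<tau>]] di[OF \<tau> p(1) fK(1)]]])
        fix w assume "w \<in> space (completion M)"
        then have w: "w \<in> space M" by simp
        have tT: "\<tau> w \<le> T" using FS.stopT_range[OF \<tau>] w by simp
        note b = fg[OF tr[OF km[OF w]] S_Dsp[OF w]]
        consider "t (\<kappa> w) < \<tau> w" | "\<tau> w \<le> t (\<kappa> w)" "\<kappa> w < ?n \<tau> w" | "\<tau> w \<le> t (\<kappa> w)" "?n \<tau> w \<le> \<kappa> w" by linarith
        then show "?H ?s \<tau> w \<le> ?I \<kappa> (?n \<tau>) w + \<bar>f (\<tau> w) (S w) - f (t (?n \<tau> w)) (S w)\<bar>"
        proof cases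
          case 1
          then have "\<kappa> w < ?n \<tau> w" using ts[OF tT] mono[of "?n \<tau> w" "\<kappa> w"] km[OF w] by (meson leD leI less_le_trans)
          then show ?thesis using 1 by simp
        next
          \<comment> \<open>The grid time of \<kappa> is not before \<tau>, yet its index precedes
            the rounded one, so it coincides with \<tau>: the grid game pays \<open>g\<close> where
            the original game pays \<open>f\<close>.\<close>
          case 2
          then have "t (\<kappa> w) \<le> \<tau> w" using hit(3)[of "\<kappa> w" m "\<lambda>j. {..<t j}" "\<tau> w"] by simp
          then have "\<tau> w = t (\<kappa> w)" using 2 by simp
          then show ?thesis using 2 b by (simp add: add_increasing2)
        qed simp
      qed
      also have "\<dots> \<le> (\<integral>w. V 0 w \<partial>completion M) + \<epsilon>"
        using opt[OF nI[OF \<tau>]] ef[OF \<tau>] Ii[OF k nI[OF \<tau>]] di[OF \<tau> p(1) fK(1)] by simp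
      finally show "(\<integral>\<^sup>+ w. ennreal (?H ?s \<tau> w) \<partial>completion M) \<le> ennreal ((\<integral>w. V 0 w \<partial>completion M) + \<epsilon>)"
        unfolding Hn[OF si[OF k] \<tau>] by (rule ennreal_leI)
    qed
    finally show ?thesis .
  qed
  show "ennreal (\<integral>w. V 0 w \<partial>completion M) \<le> game_value M d T S f g + ennreal \<epsilon>"
    unfolding game_value_def
  proof (rule le_INF_add_ennreal)
    obtain \<kappa>' where k: "FS.stopI t m \<kappa>'" and opt: "\<And>\<kappa>. FS.stopI t m \<kappa> \<Longrightarrow> (\<integral>w. V 0 w \<partial>completion M) \<le> (\<integral>w. ?I \<kappa> \<kappa>' w \<partial>completion M)"
      using FS.dynkin_lower[where t=t and m=m and f="\<lambda>j w. f (t j) (S w)" and g="\<lambda>j w. g (t j) (S w)" and V=V and K=K,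
        OF mono fm fgj V_last V_step] by blast
    let ?s = "\<lambda>w. t (\<kappa>' w)"
    have km: "\<kappa>' w \<le> m" if "w \<in> space M" for w using k that by (simp add: FS.stopI_def)
    have sm: "?s \<in> stop_times M d T S" using si[OF k] by (simp add: stop_times_iff)
    fix \<sigma> assume "\<sigma> \<in> stop_times M d T S"
    then have \<sigma>: "FS.stopT T \<sigma>" by (simp add: stop_times_iff)
    have "(\<integral>w. V 0 w \<partial>completion M) \<le> (\<integral>w. ?I (?n \<sigma>) \<kappa>' w \<partial>completion M)" by (rule opt[OF nI[OF \<sigma>]])
    also have "\<dots> \<le> (\<integral>w. ?H \<sigma> ?s w + \<bar>g (\<sigma> w) (S w) - g (t (?n \<sigma> w)) (S w)\<bar> \<partial>completion M)"
    proof (rule integral_mono[OF Ii[OF nI[OF \<sigma>] k] Bochner_Integration.integrable_add[OF Hi[OF \<sigma> si[OF k]] di[OF \<sigma> p(2) fK(2)]]])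
      fix w assume "w \<in> space (completion M)"
      then have w: "w \<in> space M" by simp
      note b = fg[OF tr[OF km[OF w]] S_Dsp[OF w]]
      consider "?n \<sigma> w < \<kappa>' w" | "\<kappa>' w \<le> ?n \<sigma> w" "t (\<kappa>' w) \<le> \<sigma> w" | "\<kappa>' w \<le> ?n \<sigma> w" "\<sigma> w < t (\<kappa>' w)" by linarith
      then show "?I (?n \<sigma>) \<kappa>' w \<le> ?H \<sigma> ?s w + \<bar>g (\<sigma> w) (S w) - g (t (?n \<sigma> w)) (S w)\<bar>"
      proof cases
        case 1
        then have "\<sigma> w < t (?n \<sigma> w)" using hit(2)[of m "\<lambda>j. {..<t j}" "\<sigma> w"] km[OF w] by simp
        also have "\<dots> \<le> t (\<kappa>' w)" using 1 km[OF w] by (intro mono) auto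
        finally show ?thesis using 1 by simp
      next
        case 2
        then show ?thesis by simp
      next
        \<comment> \<open>Rounding has produced a tie: the original game pays \<open>g\<close> at
          \<sigma>, the grid game \<open>f\<close> at the rounded time, and \<open>f \<le> g\<close>
          there reduces the comparison to the rounding error of \<open>g\<close>.\<close>
        case 3
        then have "?n \<sigma> w \<le> \<kappa>' w" unfolding hit(4) by auto
        then have "?n \<sigma> w = \<kappa>' w" using 3 by simp
        then show ?thesis using 3 b by (simp, linarith)
      qed
    qed
    also have "\<dots> \<le> (\<integral>w. ?H \<sigma> ?s w \<partial>completion M) + \<epsilon>"
      using eg[OF \<sigma>] Hi[OF \<sigma> si[OF k]] di[OF \<sigma> p(2) fK(2)] by simp
    finally have "ennreal (\<integral>w. V 0 w \<partial>completion M) \<le> ennreal ((\<integral>w. ?H \<sigma> ?s w \<partial>completion M) + \<epsilon>)" by (rule ennreal_leI)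
    also have "\<dots> = (\<integral>\<^sup>+ w. ennreal (?H \<sigma> ?s w) \<partial>completion M) + ennreal \<epsilon>"
      unfolding Hn[OF \<sigma> si[OF k]] by (rule ennreal_plus[OF _ \<epsilon>]) (rule integral_nonneg_AE[OF H0[OF \<sigma> si[OF k]]])
    also have "\<dots> \<le> (SUP \<tau>\<in>stop_times M d T S. \<integral>\<^sup>+ w. ennreal (?H \<sigma> \<tau> w) \<partial>completion M) + ennreal \<epsilon>"
      by (intro add_mono SUP_upper[OF sm] order_refl)
    finally show "ennreal (\<integral>w. V 0 w \<partial>completion M) \<le> (SUP \<tau>\<in>stop_times M d T S. \<integral>\<^sup>+ w. ennreal (?H \<sigma> \<tau> w) \<partial>completion M) + ennreal \<epsilon>" .
  qed
qed

end

section \<open>Transfer to the limit process\<close>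

text \<open>Selects \<open>a j\<close> without multiplying by an indicator: for
  \<open>0 \<le> a \<le> B\<close> the clipped expression is \<open>a\<close> when the indicator is
  1 and 0 when it is 0. Unlike a product it is globally Lipschitz, so \<open>cv_Lipschitz2\<close>
  applies.\<close>

lemma sum_clipped_select:
  fixes a :: "nat \<Rightarrow> real"
  assumes "j \<le> k" and a: "\<And>i. i \<le> k \<Longrightarrow> 0 \<le> a i \<and> a i \<le> B"
  shows "(\<Sum>i<Suc k. max 0 (a i + B * of_bool (j = i) - B)) = a j"
proof -
  have "(\<Sum>i<Suc k. max 0 (a i + B * of_bool (j = i) - B)) = (\<Sum>i<Suc k. if j = i then a i else 0)"
  proof (rule sum.cong[OF refl])
    fix i assume "i \<in> {..<Suc k}"
    then show "max 0 (a i + B * of_bool (j = i) - B) = (if j = i then a i else 0)" using a[of i] by auto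
  qed
  also have "\<dots> = a j" using assms(1) by (simp add: less_Suc_eq_le)
  finally show ?thesis .
qed

lemma hit_le_0: "0 < k \<Longrightarrow> of_bool (hit k D w \<le> 0) = (indicator (D 0) w :: real)"
  unfolding hit(4) by (simp add: indicator_def)

lemma hit_le_Suc:
  assumes "Suc i < k"
  shows "of_bool (hit k D w \<le> Suc i) = max (of_bool (hit k D w \<le> i)) (indicator (D (Suc i)) w :: real)"
proof -
  have "(\<exists>l\<le>Suc i. w \<in> D l) \<longleftrightarrow> (\<exists>l\<le>i. w \<in> D l) \<or> w \<in> D (Suc i)" by (metis le_Suc_eq)
  then have "hit k D w \<le> Suc i \<longleftrightarrow> hit k D w \<le> i \<or> w \<in> D (Suc i)" unfolding hit(4) using assms by simp
  then show ?thesis by (simp add: indicator_def)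
qed

context ext_conv
begin

lemma cv_diff: "cv X X0 \<Longrightarrow> cv Y Y0 \<Longrightarrow> cv (\<lambda>n w. X n w - Y n w) (\<lambda>w. X0 w - Y0 w)"
  by (rule cv_Lipschitz2[where k="\<lambda>a b. a - b" and L=1]) (auto simp: case_prod_beta intro!: continuous_intros)

lemma cv_max: "cv X X0 \<Longrightarrow> cv Y Y0 \<Longrightarrow> cv (\<lambda>n w. max (X n w) (Y n w)) (\<lambda>w. max (X0 w) (Y0 w))"
  by (erule (1) cv_Lipschitz2[where k=max and L=1], unfold case_prod_beta, intro continuous_intros)
    (auto simp: max_def)

lemma cv_min: "cv X X0 \<Longrightarrow> cv Y Y0 \<Longrightarrow> cv (\<lambda>n w. min (X n w) (Y n w)) (\<lambda>w. min (X0 w) (Y0 w))"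
  by (erule (1) cv_Lipschitz2[where k=min and L=1], unfold case_prod_beta, intro continuous_intros)
    (auto simp: min_def)

lemma cv_sum:
  fixes k :: nat
  assumes "\<And>i. i < k \<Longrightarrow> cv (X i) (X0 i)"
  shows "cv (\<lambda>n w. \<Sum>i<k. X i n w) (\<lambda>w. \<Sum>i<k. X0 i w)"
  using assms
proof (induction k)
  case 0
  show ?case using cv_const[of 0] by simp
next
  case (Suc k)
  have "cv (\<lambda>n w. (\<Sum>i<k. X i n w) + X k n w) (\<lambda>w. (\<Sum>i<k. X0 i w) + X0 k w)"
    by (rule cv_Lipschitz2[OF Suc.IH Suc.prems, where k="\<lambda>a b. a + b" and L=1])
      (use Suc.prems in \<open>auto simp: case_prod_beta intro!: continuous_intros\<close>)
  then show ?case by simp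
qed

text \<open>Indicators of \<open>hit \<le> i\<close> arise by successive maxima, and that of
  \<open>hit = i\<close> as a difference of two of them, so only Lipschitz operations occur.\<close>

lemma cv_hit:
  assumes A: "\<And>i. i < k \<Longrightarrow> cv (\<lambda>n. indicator (An n i)) (indicator (A i))"
  shows "cv (\<lambda>n w. of_bool (hit k (An n) w = i)) (\<lambda>w. of_bool (hit k A w = i))"
proof -
  have le: "cv (\<lambda>n w. of_bool (hit k (An n) w \<le> i)) (\<lambda>w. of_bool (hit k A w \<le> i))" for i
  proof (cases "k \<le> i")
    case True
    then show ?thesis using cv_const[of 1] by (simp add: order_trans[OF hit(1)])
  next
    case False
    then show ?thesis
    proof (induction i)
      case 0
      then show ?case using A[of 0] by (simp add: hit_le_0 del: le_zero_eq)
    next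
      case (Suc i)
      then show ?case using cv_max[OF Suc.IH A[of "Suc i"]] by (simp add: hit_le_Suc)
    qed
  qed
  show ?thesis
  proof (cases i)
    case 0
    then show ?thesis using le[of 0] by simp
  next
    case (Suc j)
    have "of_bool (h = Suc j) = of_bool (h \<le> Suc j) - (of_bool (h \<le> j) :: real)" for h :: nat by auto
    then show ?thesis using cv_diff[OF le[of "Suc j"] le[of j]] Suc by simp
  qed
qed

text \<open>\<open>min \<bar>z\<bar> \<bar>1 - z\<bar>\<close> is the error made by rounding a conditional probability \<open>z\<close> to \<open>0\<close> or \<open>1\<close>.\<close>

lemma cv_event_approx:
  assumes A: "A \<in> sets (F0 a)" and ab: "0 \<le> a" "a < b" "b \<le> T"
  shows "\<exists>s An. a < s \<and> s < b \<and> (\<forall>n. An n \<in> sets (Fn n s)) \<and> cv (\<lambda>n. indicator (An n)) (indicator A)"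
proof -
  have Am: "indicator A \<in> borel_measurable (F0 a)" using A by simp
  have iA: "integrable CM0 (indicator A :: 'b \<Rightarrow> real)"
    by (rule P0.FS.integrable_const_bound[of _ 1]) (use P0.FS.measurable_F_P[OF Am] in \<open>auto simp: indicator_def\<close>)
  obtain X where X: "cv X (indicator A)"
    using cv_exists[OF P0.approximable_F[OF Am iA], of 1] by (auto simp: indicator_def)
  obtain C where C: "countable C" "\<And>t. 0 < t \<Longrightarrow> t < T \<Longrightarrow> t \<notin> C \<Longrightarrow>
    cv (\<lambda>n. real_cond_exp (CMn n) (Fn n t) (X n)) (real_cond_exp CM0 (F0 t) (indicator A))" using cv_cond_exp[OF X] by blast
  \<comment> \<open>Any nonexceptional \<open>s\<close> after \<open>a\<close> will do: since
    \<open>A\<close> is already known at \<open>a\<close>, conditioning its indicator on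
    \<open>F0 s\<close> changes nothing, while conditioning the approximating variables makes them
    known at \<open>s\<close>.\<close>
  have "uncountable ({a<..<b} - C)" using C(1) ab(2) by (simp add: uncountable_minus_countable uncountable_open_interval)
  then obtain s where s: "a < s" "s < b" "s \<notin> C" by (metis DiffE countable_empty ex_in_conv greaterThanLessThan_iff)
  define Z where "Z n = real_cond_exp (CMn n) (Fn n s) (X n)" for n
  have Zm: "Z n \<in> borel_measurable (Fn n s)" for n unfolding Z_def by simp
  have cZ0: "cv Z (real_cond_exp CM0 (F0 s) (indicator A))" unfolding Z_def using C(2)[of s] s ab by simp
  have "indicator A \<in> borel_measurable (F0 s)" by (rule P0.FS.measurable_F_mono[OF _ Am]) (use s in simp)
  then have ae: "AE w in CM0. real_cond_exp CM0 (F0 s) (indicator A) w = indicator A w"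
    by (rule P0.FS.FS.real_cond_exp_F_meas[OF iA])
  have cZ: "cv Z (indicator A)"
    by (rule cv_AE[OF cZ0 cv_meas(1)[OF cZ0] borel_measurable_integrable[OF iA] AE_I2[OF refl] ae])
  define An where "An n = {w\<in>space (M n). 1/2 < Z n w}" for n
  have An: "An n \<in> sets (Fn n s)" for n
  proof -
    have "{w\<in>space (Fn n s). 1/2 < Z n w} \<in> sets (Fn n s)" using Zm[of n] by (intro borel_measurable_less) auto
    then show ?thesis by (simp add: An_def Pn.space_Ft)
  qed
  let ?r = "\<lambda>z::real. min \<bar>z\<bar> \<bar>1 - z\<bar>"
  \<comment> \<open>The error vanishes on the limit side, where an indicator takes only the values 0
    and 1, and hence tends to 0 in L1 on the other.\<close>
  have "cv (\<lambda>n w. ?r (Z n w)) (\<lambda>w. ?r (indicator A w))"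
  proof (rule cv_Lipschitz2[OF cZ cZ, where k="\<lambda>a b. ?r a" and L=1])
    show "continuous_on UNIV (\<lambda>(a::real, b::real). ?r a)" unfolding case_prod_beta by (intro continuous_intros)
    show "\<bar>?r a - ?r a'\<bar> \<le> 1 * (\<bar>a - a'\<bar> + \<bar>b - b'\<bar>)" for a b a' b' by (smt (verit))
  qed simp
  from cv_limit[OF this] have "(\<lambda>n. \<integral>w. ?r (Z n w) \<partial>CMn n) \<longlonglongrightarrow> (\<integral>w. ?r (indicator A w) \<partial>CM0)" .
  moreover have "?r (indicator A w) = 0" for w by (simp add: indicator_def)
  moreover have "(\<integral>w. ?r (Z n w) \<partial>CMn n) = (\<integral>w. \<bar>indicator (An n) w - Z n w\<bar> \<partial>CMn n)" for n
    by (rule Bochner_Integration.integral_cong[OF refl]) (auto simp: An_def indicator_def min_def)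
  ultimately have "(\<lambda>n. \<integral>w. \<bar>indicator (An n) w - Z n w\<bar> \<partial>CMn n) \<longlonglongrightarrow> 0" by simp
  moreover have "indicator (An n) \<in> borel_measurable (CMn n)" for n using An[of n] Pn.FS.sets_F[of n s] by auto
  ultimately have "cv (\<lambda>n. indicator (An n)) (indicator A)"
    by (intro cv_squeeze[OF cZ, of _ 1]) (auto simp: indicator_def)
  then show ?thesis using s An by blast
qed

text \<open>Only the events \<open>\<sigma> \<le> i * T / k\<close> are transferred, each to events
  known at a time \<open>s i\<close> inside the next grid cell. The transferred events need not
  increase with \<open>i\<close>; the first index at which one occurs gives a stopping time
  regardless. Two cells of error arise, one from discretizing \<sigma> and one from the shift to
  \<open>s i\<close>. Strictness below \<open>T\<close> prepares an approach from the right.\<close>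

lemma stopping_time_approx:
  assumes \<sigma>: "P0.FS.stopT T \<sigma>" and k: "0 < k"
  shows "\<exists>s \<kappa> \<kappa>0. (\<forall>i\<le>k. s i \<in> {0..T}) \<and> (\<forall>n. Pn.FS.stopT n T (\<lambda>w. s (\<kappa> n w))) \<and> (\<forall>n w. \<kappa> n w \<le> k) \<and>
    (\<forall>w\<in>space N. \<kappa>0 w \<le> k \<and> \<sigma> w \<le> s (\<kappa>0 w) \<and> s (\<kappa>0 w) \<le> \<sigma> w + 2 * T / real k \<and> (\<sigma> w < T \<longrightarrow> \<sigma> w < s (\<kappa>0 w))) \<and>
    (\<forall>i. cv (\<lambda>n w. of_bool (\<kappa> n w = i)) (\<lambda>w. of_bool (\<kappa>0 w = i)))"
proof -
  let ?u = "\<lambda>i. real i * T / real k"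
  define A where "A i = {w\<in>space N. \<sigma> w \<le> ?u i}" for i
  have "\<exists>s An. ?u i < s \<and> s < ?u (Suc i) \<and> (\<forall>n. An n \<in> sets (Fn n s)) \<and> cv (\<lambda>n. indicator (An n)) (indicator (A i))" if i: "i < k" for i
  proof (rule cv_event_approx)
    show "A i \<in> sets (F0 (?u i))" unfolding A_def using P0.FS.stopT_le[OF \<sigma>] by simp
    have "real (Suc i) * T \<le> real k * T" using i T_pos by (intro mult_right_mono) auto
    then show "?u (Suc i) \<le> T" using k by (simp add: divide_le_eq mult.commute)
  qed (use T_pos k in \<open>auto simp: divide_strict_right_mono\<close>)
  then obtain r An where r: "\<And>i. i < k \<Longrightarrow> ?u i < r i" "\<And>i. i < k \<Longrightarrow> r i < ?u (Suc i)"
    "\<And>i n. i < k \<Longrightarrow> An i n \<in> sets (Fn n (r i))" "\<And>i. i < k \<Longrightarrow> cv (\<lambda>n. indicator (An i n)) (indicator (A i))" by metis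
  define s where "s i = (if i < k then r i else T)" for i
  have umono: "?u i \<le> ?u j" if "i \<le> j" for i j using that T_pos by (intro divide_right_mono mult_right_mono) auto
  have uk: "?u k = T" using k by simp
  have lo: "?u i \<le> s i" if "i \<le> k" for i using r(1)[of i] that uk by (cases "i = k") (auto simp: s_def)
  have hi: "s i \<le> ?u (Suc i)" for i using r(2)[of i] umono[of k "Suc i"] uk by (auto simp: s_def)
  have sT: "s i \<le> T" if "i \<le> k" for i
    using r(2)[of i] umono[of "Suc i" k] uk that by (auto simp: s_def)
  have s0: "0 \<le> s i" if "i \<le> k" for i using lo[OF that] T_pos by (meson divide_nonneg_nonneg less_imp_le mult_nonneg_nonneg of_nat_0_le_iff order_trans)
  have mono: "s i \<le> s j" if "i \<le> j" "j \<le> k" for i j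
  proof (cases "i = j")
    case False
    then have "s i \<le> ?u j" using hi[of i] umono[of "Suc i" j] that by simp
    then show ?thesis using lo[OF that(2)] by simp
  qed simp
  define \<kappa> where "\<kappa> n = hit k (\<lambda>i. An i n)" for n
  define \<kappa>0 where "\<kappa>0 = hit k A"
  have "Pn.FS.stopI n s k (\<kappa> n)" for n unfolding \<kappa>_def
    using mono r(3) by (intro Pn.FS.stopI_hit) (auto simp: s_def)
  then have 1: "Pn.FS.stopT n T (\<lambda>w. s (\<kappa> n w))" for n
    by (rule Pn.FS.stopI_stopT) (use mono s0 sT in auto)
  have 2: "\<kappa>0 w \<le> k \<and> \<sigma> w \<le> s (\<kappa>0 w) \<and> s (\<kappa>0 w) \<le> \<sigma> w + 2 * T / real k \<and> (\<sigma> w < T \<longrightarrow> \<sigma> w < s (\<kappa>0 w))" if w: "w \<in> space N" for w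
  proof -
    have r0: "0 \<le> \<sigma> w" "\<sigma> w \<le> T" using P0.FS.stopT_range[OF \<sigma>] w by auto
    have le: "\<kappa>0 w \<le> k" unfolding \<kappa>0_def by (rule hit(1))
    have up: "\<sigma> w \<le> s (\<kappa>0 w) \<and> (\<sigma> w < T \<longrightarrow> \<sigma> w < s (\<kappa>0 w))"
    proof (cases "\<kappa>0 w < k")
      case True
      then have "w \<in> A (\<kappa>0 w)" unfolding \<kappa>0_def by (rule hit(2))
      then show ?thesis using r(1)[OF True] True by (simp add: A_def s_def)
    next
      case False
      then show ?thesis using r0 by (simp add: s_def)
    qed
    have "?u (\<kappa>0 w) \<le> \<sigma> w + T / real k"
    proof (cases "\<kappa>0 w")
      case 0
      then show ?thesis using r0 T_pos by simp
    next
      case (Suc j)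
      then have "w \<notin> A j" unfolding \<kappa>0_def by (intro hit(3)[of j k A w]) simp
      then have "?u j \<le> \<sigma> w" using w by (simp add: A_def)
      then show ?thesis using Suc by (simp add: add_divide_distrib distrib_right)
    qed
    then have "?u (Suc (\<kappa>0 w)) \<le> \<sigma> w + 2 * T / real k" by (simp add: add_divide_distrib distrib_right)
    then show ?thesis using hi[of "\<kappa>0 w"] le up by auto
  qed
  have 3: "cv (\<lambda>n w. of_bool (\<kappa> n w = i)) (\<lambda>w. of_bool (\<kappa>0 w = i))" for i
    unfolding \<kappa>_def \<kappa>0_def by (rule cv_hit) (rule r(4))
  have 4: "\<kappa> n w \<le> k" for n w unfolding \<kappa>_def by (rule hit(1))
  show ?thesis by (rule exI[of _ s], rule exI[of _ \<kappa>], rule exI[of _ \<kappa>0]) (use 1 2 3 4 s0 sT in auto)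
qed

text \<open>At a discretized stopping time the functional is a finite sum selected by the index, so
  it converges along \<open>cv\<close> and inherits the bound. The discretized times tend to
  \<sigma> from the right, strictly unless \<sigma> equals \<open>T\<close>, and right-continuity of
  \<theta> with bounded convergence gives the bound at \<sigma>. Measurability at \<sigma> comes out
  of the same limit.\<close>

lemma stopping_bound_transfer:
  fixes \<theta> :: "real \<Rightarrow> (real \<Rightarrow> nat \<Rightarrow> real) \<Rightarrow> real"
  assumes c: "\<And>s. s \<in> {0..T} \<Longrightarrow> cv (\<lambda>n w. \<theta> s (S n w)) (\<lambda>w. \<theta> s (S0 w))"
    and B: "\<And>s x. s \<in> {0..T} \<Longrightarrow> x \<in> Dsp d T \<Longrightarrow> 0 \<le> \<theta> s x \<and> \<theta> s x \<le> B"
    and r: "\<And>s x. x \<in> Dsp d T \<Longrightarrow> s \<in> {0..<T} \<Longrightarrow> ((\<lambda>u. \<theta> u x) \<longlongrightarrow> \<theta> s x) (at_right s)"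
    and e: "\<forall>\<^sub>F n in sequentially. \<forall>\<tau>. Pn.FS.stopT n T \<tau> \<longrightarrow> (\<integral>w. \<theta> (\<tau> w) (S n w) \<partial>CMn n) \<le> \<epsilon>"
    and \<sigma>: "P0.FS.stopT T \<sigma>"
  shows "(\<integral>w. \<theta> (\<sigma> w) (S0 w) \<partial>CM0) \<le> \<epsilon>" "(\<lambda>w. \<theta> (\<sigma> w) (S0 w)) \<in> borel_measurable CM0"
proof -
  have B0: "0 \<le> B"
  proof -
    obtain w0 where "w0 \<in> space N" using P0.not_empty by blast
    then show ?thesis using B[of 0 "S0 w0"] P0.S_Dsp T_pos by force
  qed
  have "\<exists>\<rho>. (\<lambda>w. \<theta> (\<rho> w) (S0 w)) \<in> borel_measurable CM0 \<and> (\<integral>w. \<theta> (\<rho> w) (S0 w) \<partial>CM0) \<le> \<epsilon> \<and>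
     (\<forall>w\<in>space N. \<rho> w \<in> {0..T} \<and> \<sigma> w \<le> \<rho> w \<and> \<rho> w \<le> \<sigma> w + 2 * T / real (Suc k) \<and> (\<sigma> w < T \<longrightarrow> \<sigma> w < \<rho> w))" for k
  proof -
    obtain s \<kappa> \<kappa>0 where s: "\<And>i. i \<le> Suc k \<Longrightarrow> s i \<in> {0..T}" and st: "\<And>n. Pn.FS.stopT n T (\<lambda>w. s (\<kappa> n w))" and kn: "\<And>n w. \<kappa> n w \<le> Suc k"
      and k0: "\<And>w. w \<in> space N \<Longrightarrow> \<kappa>0 w \<le> Suc k \<and> \<sigma> w \<le> s (\<kappa>0 w) \<and> s (\<kappa>0 w) \<le> \<sigma> w + 2 * T / real (Suc k) \<and> (\<sigma> w < T \<longrightarrow> \<sigma> w < s (\<kappa>0 w))"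
      and ck: "\<And>i. cv (\<lambda>n w. of_bool (\<kappa> n w = i)) (\<lambda>w. of_bool (\<kappa>0 w = i))"
      using stopping_time_approx[OF \<sigma>, of "Suc k"] by blast
    define Y where "Y n w = (\<Sum>i<Suc (Suc k). max 0 (\<theta> (s i) (S n w) + B * of_bool (\<kappa> n w = i) - B))" for n w
    define Y0 where "Y0 w = (\<Sum>i<Suc (Suc k). max 0 (\<theta> (s i) (S0 w) + B * of_bool (\<kappa>0 w = i) - B))" for w
    have "cv (\<lambda>n w. max 0 (\<theta> (s i) (S n w) + B * of_bool (\<kappa> n w = i) - B)) (\<lambda>w. max 0 (\<theta> (s i) (S0 w) + B * of_bool (\<kappa>0 w = i) - B))"
      if i: "i < Suc (Suc k)" for i
    proof (rule cv_Lipschitz2[OF c ck, where k="\<lambda>a b. max 0 (a + B * b - B)" and L="1 + B"])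
      fix a b a' b' :: real
      have "\<bar>max 0 (a + B * b - B) - max 0 (a' + B * b' - B)\<bar> \<le> \<bar>(a - a') + B * (b - b')\<bar>" by (simp add: algebra_simps)
      also have "\<dots> \<le> \<bar>a - a'\<bar> + B * \<bar>b - b'\<bar>" using B0 by (metis abs_mult abs_of_nonneg abs_triangle_ineq)
      also have "\<dots> \<le> (1 + B) * (\<bar>a - a'\<bar> + \<bar>b - b'\<bar>)" using B0 by (simp add: algebra_simps)
      finally show "\<bar>max 0 (a + B * b - B) - max 0 (a' + B * b' - B)\<bar> \<le> (1 + B) * (\<bar>a - a'\<bar> + \<bar>b - b'\<bar>)" .
    qed (use B0 s[of i] i in \<open>auto simp: case_prod_beta intro!: continuous_intros\<close>)
    then have cY: "cv Y Y0" unfolding Y_def Y0_def by (rule cv_sum)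
    have Yn: "Y n w = \<theta> (s (\<kappa> n w)) (S n w)" if "w \<in> space (M n)" for n w
      unfolding Y_def by (rule sum_clipped_select[OF kn]) (rule B[OF s Pn.S_Dsp[OF that]])
    have Y0: "Y0 w = \<theta> (s (\<kappa>0 w)) (S0 w)" if "w \<in> space N" for w
      unfolding Y0_def by (rule sum_clipped_select) (use k0[OF that] B[OF s P0.S_Dsp[OF that]] in auto)
    have "\<forall>\<^sub>F n in sequentially. (\<integral>w. Y n w \<partial>CMn n) \<le> \<epsilon>"
      using e
    proof eventually_elim
      case (elim n)
      have "(\<integral>w. Y n w \<partial>CMn n) = (\<integral>w. \<theta> (s (\<kappa> n w)) (S n w) \<partial>CMn n)"
        by (rule Bochner_Integration.integral_cong[OF refl]) (simp add: Yn)
      then show ?case using elim st[of n] by simp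
    qed
    then have "(\<integral>w. Y0 w \<partial>CM0) \<le> \<epsilon>" by (rule tendsto_upperbound[OF cv_limit[OF cY]]) simp
    moreover have "(\<integral>w. Y0 w \<partial>CM0) = (\<integral>w. \<theta> (s (\<kappa>0 w)) (S0 w) \<partial>CM0)"
      by (rule Bochner_Integration.integral_cong[OF refl]) (simp add: Y0)
    moreover have "(\<lambda>w. \<theta> (s (\<kappa>0 w)) (S0 w)) \<in> borel_measurable CM0"
      using cv_meas(2)[OF cY] Y0 by (subst measurable_cong[of _ _ Y0]) auto
    ultimately show ?thesis using k0 s by (intro exI[of _ "\<lambda>w. s (\<kappa>0 w)"]) auto
  qed
  then have "\<exists>\<rho>. \<forall>k. (\<lambda>w. \<theta> (\<rho> k w) (S0 w)) \<in> borel_measurable CM0 \<and> (\<integral>w. \<theta> (\<rho> k w) (S0 w) \<partial>CM0) \<le> \<epsilon> \<and>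
     (\<forall>w\<in>space N. \<rho> k w \<in> {0..T} \<and> \<sigma> w \<le> \<rho> k w \<and> \<rho> k w \<le> \<sigma> w + 2 * T / real (Suc k) \<and> (\<sigma> w < T \<longrightarrow> \<sigma> w < \<rho> k w))" by (intro choice allI)
  then obtain \<rho> where rm: "\<And>k. (\<lambda>w. \<theta> (\<rho> k w) (S0 w)) \<in> borel_measurable CM0" and re: "\<And>k. (\<integral>w. \<theta> (\<rho> k w) (S0 w) \<partial>CM0) \<le> \<epsilon>"
    and rr: "\<And>k w. w \<in> space N \<Longrightarrow> \<rho> k w \<in> {0..T} \<and> \<sigma> w \<le> \<rho> k w \<and> \<rho> k w \<le> \<sigma> w + 2 * T / real (Suc k) \<and> (\<sigma> w < T \<longrightarrow> \<sigma> w < \<rho> k w)" by blast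
  have lim: "(\<lambda>k. \<theta> (\<rho> k w) (S0 w)) \<longlonglongrightarrow> \<theta> (\<sigma> w) (S0 w)" if w: "w \<in> space N" for w
  proof (cases "\<sigma> w < T")
    case True
    have "(\<lambda>k. 2 * T / real (Suc k)) \<longlonglongrightarrow> 0" by (rule LIMSEQ_Suc) (rule lim_const_over_n)
    then have "(\<lambda>k. \<sigma> w + 2 * T / real (Suc k)) \<longlonglongrightarrow> \<sigma> w" using tendsto_add[OF tendsto_const, of _ 0] by fastforce
    then have "(\<lambda>k. \<rho> k w) \<longlonglongrightarrow> \<sigma> w"
      by (rule tendsto_sandwich[OF _ _ tendsto_const, rotated 2]) (use rr[OF w] in \<open>auto intro!: always_eventually\<close>)
    moreover have "\<forall>\<^sub>F k in sequentially. \<rho> k w \<in> {\<sigma> w<..} \<and> \<rho> k w \<noteq> \<sigma> w" 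
      using rr[OF w] True by (intro always_eventually allI) (metis greaterThan_iff less_irrefl)
    ultimately have "filterlim (\<lambda>k. \<rho> k w) (at_right (\<sigma> w)) sequentially" by (simp add: filterlim_at)
    then show ?thesis by (rule filterlim_compose[OF r[OF P0.S_Dsp[OF w]], rotated]) (use True P0.FS.stopT_range[OF \<sigma>, of w] w in simp)
  next
    case False
    then have "\<rho> k w = \<sigma> w" for k using rr[OF w, of k] P0.FS.stopT_range[OF \<sigma>, of w] w by auto
    then show ?thesis by simp
  qed
  show m: "(\<lambda>w. \<theta> (\<sigma> w) (S0 w)) \<in> borel_measurable CM0"
    by (rule borel_measurable_LIMSEQ_real[OF lim rm]) simp
  have "(\<lambda>k. \<integral>w. \<theta> (\<rho> k w) (S0 w) \<partial>CM0) \<longlonglongrightarrow> (\<integral>w. \<theta> (\<sigma> w) (S0 w) \<partial>CM0)"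
  proof (rule integral_dominated_convergence[where w="\<lambda>_. B"])
    show "AE w in CM0. norm (\<theta> (\<rho> k w) (S0 w)) \<le> B" for k
      using B[OF _ P0.S_Dsp] rr by (intro AE_I2) (simp add: abs_of_nonneg)
  qed (use m rm lim in auto)
  then show "(\<integral>w. \<theta> (\<sigma> w) (S0 w) \<partial>CM0) \<le> \<epsilon>" by (rule tendsto_upperbound) (use re in auto)
qed

end

section \<open>Grid values, uniform integrability of the limit, and convergence of the game
  values\<close>

lemma ennreal_add_le: "0 \<le> b \<Longrightarrow> ennreal (a + b) \<le> ennreal a + ennreal b"
  by (cases "0 \<le> a") (auto simp: ennreal_neg intro: ennreal_leI)

text \<open>Two additive bounds replace a metric, so that infinite values need no separate treatment
  by the caller: an infinite limit forces \<open>a n\<close> to be infinite eventually.\<close>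

lemma tendsto_ennreal_metric:
  fixes a :: "nat \<Rightarrow> ennreal"
  assumes e: "\<And>\<epsilon>. 0 < \<epsilon> \<Longrightarrow> \<forall>\<^sub>F n in sequentially. a n \<le> b + ennreal \<epsilon> \<and> b \<le> a n + ennreal \<epsilon>"
  shows "a \<longlonglongrightarrow> b"
proof (cases "b = \<top>")
  case True
  have "\<forall>\<^sub>F n in sequentially. a n = b" using e[of 1] by (rule eventually_mono) (use True in \<open>auto simp: top_unique\<close>)
  then show ?thesis by (rule tendsto_eventually)
next
  case False
  have fin: "\<forall>\<^sub>F n in sequentially. a n \<noteq> \<top>" using e[of 1] by (rule eventually_mono) (use False in \<open>auto simp: top_unique\<close>)
  have fb: "ennreal (enn2real b) = b" by (rule ennreal_enn2real) (use False less_top in blast)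
  have "(\<lambda>n. enn2real (a n)) \<longlonglongrightarrow> enn2real b"
  proof (rule tendstoI)
    fix \<epsilon> :: real assume "0 < \<epsilon>"
    then have h: "0 < \<epsilon>/2" by simp
    show "\<forall>\<^sub>F n in sequentially. dist (enn2real (a n)) (enn2real b) < \<epsilon>"
      using e[OF h] fin
    proof eventually_elim
      case (elim n)
      obtain x y where x: "0 \<le> x" "a n = ennreal x" and y: "0 \<le> y" "b = ennreal y" using elim False by (metis ennreal_cases)
      have "ennreal x \<le> ennreal (y + \<epsilon>/2)" "ennreal y \<le> ennreal (x + \<epsilon>/2)" using elim x y h by (simp_all add: ennreal_plus[symmetric] del: ennreal_plus)
      then have "x \<le> y + \<epsilon>/2" "y \<le> x + \<epsilon>/2" using x y h by (simp_all del: ennreal_plus)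
      then show ?case using x y \<open>0 < \<epsilon>\<close> by (simp add: dist_real_def)
    qed
  qed
  then have "(\<lambda>n. ennreal (enn2real (a n))) \<longlonglongrightarrow> ennreal (enn2real b)" by (rule tendsto_ennrealI)
  then have "(\<lambda>n. ennreal (enn2real (a n))) \<longlonglongrightarrow> b" unfolding fb .
  then show ?thesis
    by (rule Lim_transform_eventually) (rule eventually_mono[OF fin], simp add: less_top)
qed

context aldous_conv
begin

text \<open>Grid times and value functions are chosen together, backwards from \<open>T\<close>: the
  times to be avoided at one stage depend on the value function just obtained. Dependent choice
  yields an endless sequence, its i-th time in the window from \<open>T * r ^ Suc i\<close> to
  \<open>T * r ^ i\<close>, which is cut off once it has come within \<delta> of 0. The windows keep
  consecutive gaps small while leaving uncountably many times to choose from after the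
  first.\<close>

lemma grid_cv:
  assumes p: "payoff d T f" "payoff d T g"
    and fg: "\<And>t x. t \<in> {0..T} \<Longrightarrow> x \<in> Dsp d T \<Longrightarrow> 0 \<le> f t x \<and> f t x \<le> g t x \<and> g t x \<le> K" and \<delta>: "0 < \<delta>"
  shows "\<exists>m t V V0. (\<forall>i j. i \<le> j \<longrightarrow> j \<le> m \<longrightarrow> t i \<le> t j) \<and> (\<forall>i\<le>m. t i \<in> {0..T}) \<and> t m = T \<and> t 0 \<le> \<delta> \<and> (\<forall>i<m. t (Suc i) - t i \<le> \<delta>) \<and>
    (\<forall>n. V n m = (\<lambda>w. f (t m) (S n w))) \<and>
    (\<forall>n. \<forall>j<m. V n j = (\<lambda>w. min (g (t j) (S n w)) (max (f (t j) (S n w)) (real_cond_exp (CMn n) (Fn n (t j)) (V n (Suc j)) w)))) \<and>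
    V0 m = (\<lambda>w. f (t m) (S0 w)) \<and>
    (\<forall>j<m. V0 j = (\<lambda>w. min (g (t j) (S0 w)) (max (f (t j) (S0 w)) (real_cond_exp CM0 (F0 (t j)) (V0 (Suc j)) w)))) \<and>
    cv (\<lambda>n. V n 0) (V0 0)"
proof -
  have fK: "0 \<le> f t x \<and> f t x \<le> K" "0 \<le> g t x \<and> g t x \<le> K" if "t \<in> {0..T}" "x \<in> Dsp d T" for t x using fg[OF that] by auto
  \<comment> \<open>A gap is at most \<open>T * r ^ i * (1 - r ^ 2)\<close>, hence at most
    \<open>2 * T * (1 - r)\<close>, which is to be at most \<delta>; the entry 1/2 keeps the ratio
    positive when \<delta> is large.\<close>
  define r where "r = max (1/2) (1 - \<delta> / (2 * T))"
  have r: "0 < r" "r < 1" using \<delta> T_pos by (auto simp: r_def)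
  have "1 - r \<le> \<delta> / (2 * T)" unfolding r_def by linarith
  then have rd: "2 * T * (1 - r) \<le> \<delta>" using T_pos by (simp add: field_simps)
  let ?s1 = "\<lambda>u W n w. min (g u (S n w)) (max (f u (S n w)) (real_cond_exp (CMn n) (Fn n u) (W n) w))"
  let ?s0 = "\<lambda>u W0 w. min (g u (S0 w)) (max (f u (S0 w)) (real_cond_exp CM0 (F0 u) W0 w))"
  define Pr where "Pr i x \<longleftrightarrow> cv (fst (snd x)) (snd (snd x)) \<and> T * r ^ Suc i < fst x \<and> fst x \<le> T * r ^ i \<and>
     (i = 0 \<longrightarrow> fst x = T \<and> fst (snd x) = (\<lambda>n w. f T (S n w)) \<and> snd (snd x) = (\<lambda>w. f T (S0 w)))" for i :: nat and x :: "real \<times> (nat \<Rightarrow> 'a \<Rightarrow> real) \<times> ('b \<Rightarrow> real)"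
  define Q where "Q i x y \<longleftrightarrow> fst (snd y) = ?s1 (fst y) (fst (snd x)) \<and> snd (snd y) = ?s0 (fst y) (snd (snd x))"
    for i :: nat and x y :: "real \<times> (nat \<Rightarrow> 'a \<Rightarrow> real) \<times> ('b \<Rightarrow> real)"
  have "\<exists>h. \<forall>i. Pr i (h i) \<and> Q i (h i) (h (Suc i))"
  proof (rule dependent_nat_choice)
    have "cv (\<lambda>n w. f T (S n w)) (\<lambda>w. f T (S0 w))" using T_pos by (intro cv_payoff[OF p(1) fK(1)]) auto
    then show "\<exists>x. Pr 0 x"
      using T_pos r by (intro exI[of _ "(T, \<lambda>n w. f T (S n w), \<lambda>w. f T (S0 w))"]) (simp add: Pr_def)
  next
    fix x i assume "Pr i x"
    then have c: "cv (fst (snd x)) (snd (snd x))" by (simp add: Pr_def)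
    obtain C where C: "countable C" "\<And>t. 0 < t \<Longrightarrow> t < T \<Longrightarrow> t \<notin> C \<Longrightarrow>
      cv (\<lambda>n. real_cond_exp (CMn n) (Fn n t) (fst (snd x) n)) (real_cond_exp CM0 (F0 t) (snd (snd x)))" using cv_cond_exp[OF c] by blast
    have "T * r ^ Suc (Suc i) < T * r ^ Suc i" using r T_pos by simp
    then have "uncountable ({T * r ^ Suc (Suc i)<..<T * r ^ Suc i} - C)"
      by (rule uncountable_minus_countable[OF uncountable_open_interval[THEN iffD2] C(1)])
    then obtain u where u: "T * r ^ Suc (Suc i) < u" "u < T * r ^ Suc i" "u \<notin> C" by (metis DiffE countable_empty ex_in_conv greaterThanLessThan_iff)
    have "0 < T * r ^ Suc (Suc i)" using r T_pos by simp
    moreover have "T * r ^ Suc i \<le> T * 1" using r T_pos by (intro mult_left_mono power_le_one) auto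
    ultimately have u0: "0 < u" "u < T" using u by auto
    then have ui: "u \<in> {0..T}" by simp
    have "cv (?s1 u (fst (snd x))) (?s0 u (snd (snd x)))"
      by (rule cv_min[OF cv_payoff[OF p(2) fK(2) ui] cv_max[OF cv_payoff[OF p(1) fK(1) ui] C(2)[OF u0 u(3)]]])
    then show "\<exists>y. Pr (Suc i) y \<and> Q i x y"
      using u by (intro exI[of _ "(u, ?s1 u (fst (snd x)), ?s0 u (snd (snd x)))"]) (simp add: Pr_def Q_def)
  qed
  then obtain h where h: "\<And>i. Pr i (h i)" "\<And>i. Q i (h i) (h (Suc i))" by blast
  define u where "u i = fst (h i)" for i
  have ub: "T * r ^ Suc i < u i" "u i \<le> T * r ^ i" for i using h(1)[of i] by (auto simp: Pr_def u_def)
  have dec: "u j \<le> u i" if "i \<le> j" for i j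
    by (rule lift_Suc_antimono_le[OF _ that]) (use ub(1) ub(2)[of "Suc _"] in \<open>meson less_imp_le order_trans\<close>)
  have uT: "u 0 = T" using h(1)[of 0] by (simp add: Pr_def u_def)
  have upos: "0 \<le> u i" for i
  proof -
    have "0 \<le> T * r ^ Suc i" using T_pos r by simp
    then show ?thesis using ub(1)[of i] by linarith
  qed
  have step: "u i - u (Suc i) \<le> \<delta>" for i
  proof -
    have "u i - u (Suc i) \<le> T * r ^ i - T * r ^ Suc (Suc i)" using ub(2)[of i] ub(1)[of "Suc i"] by linarith
    also have "\<dots> = (r ^ i * (1 + r)) * (T * (1 - r))" by (simp add: algebra_simps)
    also have "r ^ i * (1 + r) \<le> 1 * 2" using r by (intro mult_mono power_le_one) auto
    then have "(r ^ i * (1 + r)) * (T * (1 - r)) \<le> (1 * 2) * (T * (1 - r))" using r T_pos by (intro mult_right_mono) auto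
    also have "\<dots> \<le> \<delta>" using rd by simp
    finally show ?thesis .
  qed
  obtain m where "r ^ m < \<delta> / T" using real_arch_pow_inv[OF divide_pos_pos[OF \<delta> T_pos] r(2)] by blast
  then have "T * r ^ m \<le> \<delta>" using T_pos by (simp add: field_simps)
  then have um: "u m \<le> \<delta>" using ub(2)[of m] by linarith
  \<comment> \<open>Reversal puts the times into increasing order, with \<open>T\<close> as the
    last.\<close>
  define t where "t j = u (m - j)" for j
  define V where "V n j = fst (snd (h (m - j))) n" for n j
  define V0 where "V0 j = snd (snd (h (m - j)))" for j
  have Q: "V n j = ?s1 (t j) (\<lambda>n. V n (Suc j)) n" "V0 j = ?s0 (t j) (V0 (Suc j))" if "j < m" for n j
  proof -
    have e: "m - j = Suc (m - Suc j)" using that by simp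
    show "V n j = ?s1 (t j) (\<lambda>n. V n (Suc j)) n" "V0 j = ?s0 (t j) (V0 (Suc j))"
      using h(2)[of "m - Suc j"] by (simp_all add: V_def V0_def t_def u_def e Q_def)
  qed
  have last: "V n m = (\<lambda>w. f (t m) (S n w))" "V0 m = (\<lambda>w. f (t m) (S0 w))" for n
    using h(1)[of 0] uT by (simp_all add: V_def V0_def t_def Pr_def)
  have cV: "cv (\<lambda>n. V n 0) (V0 0)" using h(1)[of m] by (simp add: V_def V0_def Pr_def)
  have gaps: "t (Suc i) - t i \<le> \<delta>" if "i < m" for i
    using step[of "m - Suc i"] that by (simp add: t_def Suc_diff_Suc)
  have mono: "t i \<le> t j" if "i \<le> j" "j \<le> m" for i j using dec[of "m - j" "m - i"] that by (simp add: t_def)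
  have rng: "t i \<in> {0..T}" if "i \<le> m" for i using upos[of "m - i"] dec[of 0 "m - i"] uT by (simp add: t_def)
  have ends: "t m = T" "t 0 \<le> \<delta>" using uT um by (simp_all add: t_def)
  show ?thesis
    by (rule exI[of _ m], rule exI[of _ t], rule exI[of _ V], rule exI[of _ V0], intro conjI allI impI)
      (rule mono rng ends gaps last Q cV; assumption)+
qed

text \<open>For the limit process the estimate is not derived from an Aldous condition but carried
  over by \<open>stopping_bound_transfer\<close>. The functional is the rounding error as a function
  of time, right-continuous because \<open>next_index\<close> is.\<close>

lemma grid_rounding:
  assumes \<phi>: "payoff d T \<phi>" and K: "\<And>t x. t \<in> {0..T} \<Longrightarrow> x \<in> Dsp d T \<Longrightarrow> 0 \<le> \<phi> t x \<and> \<phi> t x \<le> K"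
    and ev: "rounding_bound \<phi> \<delta> \<epsilon>"
    and mono: "\<And>i j. i \<le> j \<Longrightarrow> j \<le> m \<Longrightarrow> t i \<le> t j" and tr: "\<And>i. i \<le> m \<Longrightarrow> t i \<in> {0..T}" and tm: "t m = T"
    and t0: "t 0 \<le> \<delta>" and step: "\<And>i. i < m \<Longrightarrow> t (Suc i) - t i \<le> \<delta>"
  shows "\<forall>\<^sub>F n in sequentially. \<forall>\<tau>. Pn.FS.stopT n T \<tau> \<longrightarrow>
      (\<integral>w. \<bar>\<phi> (\<tau> w) (S n w) - \<phi> (t (next_index t m (\<tau> w))) (S n w)\<bar> \<partial>CMn n) \<le> \<epsilon>"
    "P0.FS.stopT T \<sigma> \<Longrightarrow> (\<integral>w. \<bar>\<phi> (\<sigma> w) (S0 w) - \<phi> (t (next_index t m (\<sigma> w))) (S0 w)\<bar> \<partial>CM0) \<le> \<epsilon>"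
proof -
  let ?D = "\<lambda>s. t (next_index t m s)"
  have Dr: "?D s \<in> {0..T}" for s using tr[OF hit(1)] .
  show 1: "\<forall>\<^sub>F n in sequentially. \<forall>\<tau>. Pn.FS.stopT n T \<tau> \<longrightarrow>
      (\<integral>w. \<bar>\<phi> (\<tau> w) (S n w) - \<phi> (?D (\<tau> w)) (S n w)\<bar> \<partial>CMn n) \<le> \<epsilon>"
    using ev
  proof eventually_elim
    case (elim n)
    show ?case
    proof (intro allI impI)
      fix \<tau> assume \<tau>: "Pn.FS.stopT n T \<tau>"
      have "Pn.FS.stopT n T (\<lambda>w. ?D (\<tau> w))" by (rule Pn.FS.stopI_stopT[OF Pn.FS.stopI_next_index[OF \<tau> mono] mono tr])
      moreover have "\<bar>\<tau> w - ?D (\<tau> w)\<bar> \<le> \<delta>" if "w \<in> space (M n)" for w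
        using next_index_mesh[where \<delta>=\<delta> and t=t and m=m, OF tm Pn.FS.stopT_range[OF \<tau>] t0 step, of w] that by simp
      ultimately show "(\<integral>w. \<bar>\<phi> (\<tau> w) (S n w) - \<phi> (?D (\<tau> w)) (S n w)\<bar> \<partial>CMn n) \<le> \<epsilon>"
        using elim[rule_format, of \<tau> "\<lambda>w. ?D (\<tau> w)"] \<tau> by simp
    qed
  qed
  assume \<sigma>: "P0.FS.stopT T \<sigma>"
  show "(\<integral>w. \<bar>\<phi> (\<sigma> w) (S0 w) - \<phi> (?D (\<sigma> w)) (S0 w)\<bar> \<partial>CM0) \<le> \<epsilon>"
  proof (rule stopping_bound_transfer(1)[where \<theta>="\<lambda>s x. \<bar>\<phi> s x - \<phi> (?D s) x\<bar>" and B=K, OF _ _ _ 1 \<sigma>])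
    fix s :: real assume s: "s \<in> {0..T}"
    show "cv (\<lambda>n w. \<bar>\<phi> s (S n w) - \<phi> (?D s) (S n w)\<bar>) (\<lambda>w. \<bar>\<phi> s (S0 w) - \<phi> (?D s) (S0 w)\<bar>)"
      by (rule cv_Lipschitz2[OF cv_payoff[OF \<phi> K s] cv_payoff[OF \<phi> K Dr], where k="\<lambda>a b. \<bar>a - b\<bar>" and L=1])
        (auto simp: case_prod_beta intro!: continuous_intros)
    fix x assume x: "x \<in> Dsp d T"
    show "0 \<le> \<bar>\<phi> s x - \<phi> (?D s) x\<bar> \<and> \<bar>\<phi> s x - \<phi> (?D s) x\<bar> \<le> K" using K[OF s x] K[OF Dr[of s] x] by auto
  next
    fix s x assume x: "x \<in> Dsp d T" and s: "s \<in> {0..<T}"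
    have "\<forall>\<^sub>F u in at_right s. next_index t m u = next_index t m s" by (rule next_index_right) (use s tm in simp)
    then have "\<forall>\<^sub>F u in at_right s. \<phi> (?D s) x = \<phi> (?D u) x" by eventually_elim simp
    then have "((\<lambda>u. \<phi> (?D u) x) \<longlongrightarrow> \<phi> (?D s) x) (at_right s)" by (rule Lim_transform_eventually[OF tendsto_const])
    then show "((\<lambda>u. \<bar>\<phi> u x - \<phi> (?D u) x\<bar>) \<longlongrightarrow> \<bar>\<phi> s x - \<phi> (?D s) x\<bar>) (at_right s)"
      by (intro tendsto_intros payoff_right[OF \<phi> x s])
  qed
qed

text \<open>Three errors of size \<epsilon>/3: rounding for \<open>S n\<close>, convergence of the
  grid values, rounding for the limit process.\<close>

lemma bounded_game_value_close:
  assumes p: "payoff d T f" "payoff d T g"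
    and fg: "\<And>t x. t \<in> {0..T} \<Longrightarrow> x \<in> Dsp d T \<Longrightarrow> 0 \<le> f t x \<and> f t x \<le> g t x \<and> g t x \<le> K" and \<epsilon>: "0 < \<epsilon>"
  shows "\<forall>\<^sub>F n in sequentially. game_value (M n) d T (S n) f g \<le> game_value N d T S0 f g + ennreal \<epsilon> \<and>
    game_value N d T S0 f g \<le> game_value (M n) d T (S n) f g + ennreal \<epsilon>"
proof -
  have fK: "0 \<le> f t x \<and> f t x \<le> K" "0 \<le> g t x \<and> g t x \<le> K" if "t \<in> {0..T}" "x \<in> Dsp d T" for t x using fg[OF that] by auto
  define e where "e = \<epsilon>/3"
  have e: "0 < e" "0 \<le> e" using \<epsilon> by (auto simp: e_def)
  obtain \<delta>1 where d1: "0 < \<delta>1" "rounding_bound f \<delta>1 e" using payoff_rounding[OF p(1) fK(1) e(1)] by blast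
  obtain \<delta>2 where d2: "0 < \<delta>2" "rounding_bound g \<delta>2 e" using payoff_rounding[OF p(2) fK(2) e(1)] by blast
  define \<delta> where "\<delta> = min \<delta>1 \<delta>2"
  have \<delta>: "0 < \<delta>" "\<delta> \<le> \<delta>1" "\<delta> \<le> \<delta>2" using d1 d2 by (auto simp: \<delta>_def)
  have Rf: "rounding_bound f \<delta> e" using d1(2) by eventually_elim (meson \<delta>(2) order_trans)
  have Rg: "rounding_bound g \<delta> e" using d2(2) by eventually_elim (meson \<delta>(3) order_trans)
  obtain m t V V0 where mono: "\<And>i j. i \<le> j \<Longrightarrow> j \<le> m \<Longrightarrow> t i \<le> t j" and tr: "\<And>i. i \<le> m \<Longrightarrow> t i \<in> {0..T}" and tm: "t m = T"
    and t0: "t 0 \<le> \<delta>" and step: "\<And>i. i < m \<Longrightarrow> t (Suc i) - t i \<le> \<delta>"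
    and Vl: "\<And>n. V n m = (\<lambda>w. f (t m) (S n w))"
    and Vs: "\<And>n j. j < m \<Longrightarrow> V n j = (\<lambda>w. min (g (t j) (S n w)) (max (f (t j) (S n w)) (real_cond_exp (CMn n) (Fn n (t j)) (V n (Suc j)) w)))"
    and V0l: "V0 m = (\<lambda>w. f (t m) (S0 w))"
    and V0s: "\<And>j. j < m \<Longrightarrow> V0 j = (\<lambda>w. min (g (t j) (S0 w)) (max (f (t j) (S0 w)) (real_cond_exp CM0 (F0 (t j)) (V0 (Suc j)) w)))"
    and cV: "cv (\<lambda>n. V n 0) (V0 0)"
    using grid_cv[OF p fg \<delta>(1)] by blast
  let ?D = "\<lambda>s. t (next_index t m s)"
  have rf: "\<forall>\<^sub>F n in sequentially. \<forall>\<tau>. Pn.FS.stopT n T \<tau> \<longrightarrow> (\<integral>w. \<bar>f (\<tau> w) (S n w) - f (?D (\<tau> w)) (S n w)\<bar> \<partial>CMn n) \<le> e"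
    "P0.FS.stopT T \<sigma> \<Longrightarrow> (\<integral>w. \<bar>f (\<sigma> w) (S0 w) - f (?D (\<sigma> w)) (S0 w)\<bar> \<partial>CM0) \<le> e" for \<sigma>
    by (rule grid_rounding[OF p(1) fK(1) Rf mono tr tm t0 step]; assumption)+
  have rg: "\<forall>\<^sub>F n in sequentially. \<forall>\<tau>. Pn.FS.stopT n T \<tau> \<longrightarrow> (\<integral>w. \<bar>g (\<tau> w) (S n w) - g (?D (\<tau> w)) (S n w)\<bar> \<partial>CMn n) \<le> e"
    "P0.FS.stopT T \<sigma> \<Longrightarrow> (\<integral>w. \<bar>g (\<sigma> w) (S0 w) - g (?D (\<sigma> w)) (S0 w)\<bar> \<partial>CM0) \<le> e" for \<sigma>
    by (rule grid_rounding[OF p(2) fK(2) Rg mono tr tm t0 step]; assumption)+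
  let ?E = "\<lambda>n. \<integral>w. V n 0 w \<partial>CMn n" and ?Z = "\<integral>w. V0 0 w \<partial>CM0"
  have g0: "game_value N d T S0 f g \<le> ennreal (?Z + e)" "ennreal ?Z \<le> game_value N d T S0 f g + ennreal e"
    by (rule P0.game_value_grid[where t=t and m=m and V=V0 and K=K and \<epsilon>=e, OF p e(2) fg mono tr tm V0l V0s rf(2) rg(2)]; assumption)+
  have "\<forall>\<^sub>F n in sequentially. dist (?E n) ?Z < e" by (rule tendstoD[OF cv_limit[OF cV] e(1)])
  with rf(1) rg(1) show ?thesis
  proof eventually_elim
    case (elim n)
    have gn: "game_value (M n) d T (S n) f g \<le> ennreal (?E n + e)" "ennreal (?E n) \<le> game_value (M n) d T (S n) f g + ennreal e"
      by (rule Pn.game_value_grid[where t=t and m=m and V="V n" and K=K and \<epsilon>=e, OF p e(2) fg mono tr tm Vl Vs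
        elim(1)[rule_format] elim(2)[rule_format]]; assumption)+
    have d: "?E n \<le> ?Z + e" "?Z \<le> ?E n + e" using elim(3) by (auto simp: dist_real_def)
    have e2: "ennreal (e + e) = ennreal e + ennreal e" by (rule ennreal_plus[OF e(2) e(2)])
    have ee: "ennreal e + ennreal e + ennreal e = ennreal \<epsilon>" using e by (simp add: ennreal_plus[symmetric] e_def del: ennreal_plus)
    have "game_value (M n) d T (S n) f g \<le> ennreal (?Z + (e + e))" by (rule order_trans[OF gn(1) ennreal_leI]) (use d in simp)
    also have "\<dots> \<le> ennreal ?Z + ennreal (e + e)" by (rule ennreal_add_le) (use e in simp)
    also have "\<dots> \<le> (game_value N d T S0 f g + ennreal e) + ennreal (e + e)" by (rule add_right_mono[OF g0(2)])
    also have "\<dots> = game_value N d T S0 f g + ennreal \<epsilon>" unfolding e2 ee[symmetric] by (simp only: add.assoc)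
    finally have 1: "game_value (M n) d T (S n) f g \<le> game_value N d T S0 f g + ennreal \<epsilon>" .
    have "game_value N d T S0 f g \<le> ennreal (?E n + (e + e))" by (rule order_trans[OF g0(1) ennreal_leI]) (use d in simp)
    also have "\<dots> \<le> ennreal (?E n) + ennreal (e + e)" by (rule ennreal_add_le) (use e in simp)
    also have "\<dots> \<le> (game_value (M n) d T (S n) f g + ennreal e) + ennreal (e + e)" by (rule add_right_mono[OF gn(2)])
    also have "\<dots> = game_value (M n) d T (S n) f g + ennreal \<epsilon>" unfolding e2 ee[symmetric] by (simp only: add.assoc)
    finally show ?case using 1 by blast
  qed
qed

text \<open>The excess over \<open>K\<close> may be unbounded, so it is capped at \<open>L\<close>,
  transferred for each cap, and recovered by monotone convergence in \<open>L\<close>.\<close>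

lemma uniform_integrability_transfer:
  assumes p: "payoff d T g" and g0: "\<And>t x. t \<in> {0..T} \<Longrightarrow> x \<in> Dsp d T \<Longrightarrow> 0 \<le> g t x" and K: "0 \<le> K" and \<epsilon>: "0 \<le> \<epsilon>"
    and ui: "\<And>n \<tau>. Pn.FS.stopT n T \<tau> \<Longrightarrow> (\<integral>\<^sup>+w. ennreal (max 0 (g (\<tau> w) (S n w) - K)) \<partial>CMn n) \<le> ennreal \<epsilon>"
    and \<tau>: "P0.FS.stopT T \<tau>"
  shows "(\<integral>\<^sup>+w. ennreal (max 0 (g (\<tau> w) (S0 w) - K)) \<partial>CM0) \<le> ennreal \<epsilon>"
proof -
  define \<theta> where "\<theta> L s x = max 0 (min (g s x) (K + real L) - K)" for L :: nat and s x
  have pL: "payoff d T (\<lambda>t x. min (g t x) (K + real L))" for L by (rule payoff_min[OF p])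
  have b: "0 \<le> \<theta> L s x \<and> \<theta> L s x \<le> real L" for L s x by (simp add: \<theta>_def)
  have c: "cv (\<lambda>n w. \<theta> L s (S n w)) (\<lambda>w. \<theta> L s (S0 w))" if s: "s \<in> {0..T}" for L s
    unfolding \<theta>_def by (intro cv_max cv_const cv_diff cv_payoff[OF pL _ s, where K="K + real L"]) (use g0 K in auto)
  have r: "((\<lambda>u. \<theta> L u x) \<longlongrightarrow> \<theta> L s x) (at_right s)" if "x \<in> Dsp d T" "s \<in> {0..<T}" for L s x
    unfolding \<theta>_def by (intro tendsto_intros payoff_right[OF p that])
  have e: "(\<integral>w. \<theta> L (\<rho> w) (S n w) \<partial>CMn n) \<le> \<epsilon>" if \<rho>: "Pn.FS.stopT n T \<rho>" for L n \<rho>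
  proof (rule integral_real_bounded[OF \<epsilon>])
    have "(\<integral>\<^sup>+w. ennreal (\<theta> L (\<rho> w) (S n w)) \<partial>CMn n) \<le> (\<integral>\<^sup>+w. ennreal (max 0 (g (\<rho> w) (S n w) - K)) \<partial>CMn n)"
      by (intro nn_integral_mono ennreal_leI) (simp add: \<theta>_def)
    then show "(\<integral>\<^sup>+w. ennreal (\<theta> L (\<rho> w) (S n w)) \<partial>CMn n) \<le> ennreal \<epsilon>" using ui[OF \<rho>] by (rule order_trans)
  qed
  have 1: "(\<integral>w. \<theta> L (\<tau> w) (S0 w) \<partial>CM0) \<le> \<epsilon>" and m: "(\<lambda>w. \<theta> L (\<tau> w) (S0 w)) \<in> borel_measurable CM0" for L
    by (rule stopping_bound_transfer[where \<theta>="\<theta> L" and B="real L", OF c b r _ \<tau>]; use e in \<open>auto intro!: always_eventually\<close>)+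
  have "(\<integral>\<^sup>+w. ennreal (max 0 (g (\<tau> w) (S0 w) - K)) \<partial>CM0) \<le> (\<integral>\<^sup>+w. (SUP L. ennreal (\<theta> L (\<tau> w) (S0 w))) \<partial>CM0)"
  proof (rule nn_integral_mono)
    fix w
    obtain L where "g (\<tau> w) (S0 w) - K \<le> real L" using real_arch_simple by blast
    then have "max 0 (g (\<tau> w) (S0 w) - K) \<le> \<theta> L (\<tau> w) (S0 w)" by (simp add: \<theta>_def)
    then show "ennreal (max 0 (g (\<tau> w) (S0 w) - K)) \<le> (SUP L. ennreal (\<theta> L (\<tau> w) (S0 w)))"
      by (intro SUP_upper2[of L] ennreal_leI) auto
  qed
  also have "\<dots> = (SUP L. \<integral>\<^sup>+w. ennreal (\<theta> L (\<tau> w) (S0 w)) \<partial>CM0)"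
  proof (rule nn_integral_monotone_convergence_SUP)
    show "incseq (\<lambda>L w. ennreal (\<theta> L (\<tau> w) (S0 w)))"
      by (intro incseq_SucI le_funI ennreal_leI) (auto simp: \<theta>_def)
  qed (use m in simp)
  also have "\<dots> \<le> ennreal \<epsilon>"
  proof (rule SUP_least)
    fix L
    have i: "integrable CM0 (\<lambda>w. \<theta> L (\<tau> w) (S0 w))"
      by (rule P0.FS.integrable_const_bound[OF _ m, of _ "real L"]) (use b in \<open>auto intro!: AE_I2 simp: abs_of_nonneg\<close>)
    show "(\<integral>\<^sup>+w. ennreal (\<theta> L (\<tau> w) (S0 w)) \<partial>CM0) \<le> ennreal \<epsilon>"
      by (subst nn_integral_eq_integral[OF i]) (use b 1 in \<open>auto intro: ennreal_leI\<close>)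
  qed
  finally show ?thesis .
qed

text \<open>Truncation only lowers game values, so each of the two inequalities meets one truncation
  error and one error between truncated games; two halves of \<epsilon> suffice.\<close>

lemma game_value_converges:
  assumes p: "payoff d T f" "payoff d T g"
    and fg: "\<And>t x. t \<in> {0..T} \<Longrightarrow> x \<in> Dsp d T \<Longrightarrow> 0 \<le> f t x \<and> f t x \<le> g t x"
    and ui: "\<And>\<epsilon>. 0 < \<epsilon> \<Longrightarrow> \<exists>K\<ge>0. \<forall>n \<tau>. Pn.FS.stopT n T \<tau> \<longrightarrow> (\<integral>\<^sup>+w. ennreal (max 0 (g (\<tau> w) (S n w) - K)) \<partial>CMn n) \<le> ennreal \<epsilon>"
  shows "(\<lambda>n. game_value (M n) d T (S n) f g) \<longlonglongrightarrow> game_value N d T S0 f g"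
proof (rule tendsto_ennreal_metric)
  fix \<epsilon> :: real assume \<epsilon>: "0 < \<epsilon>"
  then have e: "0 < \<epsilon>/2" "0 \<le> \<epsilon>/2" by auto
  obtain K where K: "0 \<le> K" and u: "\<And>n \<tau>. Pn.FS.stopT n T \<tau> \<Longrightarrow> (\<integral>\<^sup>+w. ennreal (max 0 (g (\<tau> w) (S n w) - K)) \<partial>CMn n) \<le> ennreal (\<epsilon>/2)"
    using ui[OF e(1)] by blast
  have u0: "(\<integral>\<^sup>+w. ennreal (max 0 (g (\<tau> w) (S0 w) - K)) \<partial>CM0) \<le> ennreal (\<epsilon>/2)" if "P0.FS.stopT T \<tau>" for \<tau>
    by (rule uniform_integrability_transfer[OF p(2) _ K e(2) u that]) (use fg in force)
  note tn = Pn.game_value_truncate[OF p K e(2) fg u] and t0 = P0.game_value_truncate[OF p K e(2) fg u0]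
  have ee: "x + ennreal (\<epsilon>/2) + ennreal (\<epsilon>/2) = x + ennreal \<epsilon>" for x
    using e by (simp add: add.assoc ennreal_plus[symmetric] del: ennreal_plus)
  have "\<forall>\<^sub>F n in sequentially. game_value (M n) d T (S n) (\<lambda>t x. min (f t x) K) (\<lambda>t x. min (g t x) K) \<le> game_value N d T S0 (\<lambda>t x. min (f t x) K) (\<lambda>t x. min (g t x) K) + ennreal (\<epsilon>/2) \<and>
    game_value N d T S0 (\<lambda>t x. min (f t x) K) (\<lambda>t x. min (g t x) K) \<le> game_value (M n) d T (S n) (\<lambda>t x. min (f t x) K) (\<lambda>t x. min (g t x) K) + ennreal (\<epsilon>/2)"
  proof (rule bounded_game_value_close[OF payoff_min[OF p(1)] payoff_min[OF p(2)] _ e(1)])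
    fix t x assume "t \<in> {0..T}" "x \<in> Dsp d T"
    from fg[OF this] show "0 \<le> min (f t x) K \<and> min (f t x) K \<le> min (g t x) K \<and> min (g t x) K \<le> K" using K by auto
  qed
  then show "\<forall>\<^sub>F n in sequentially. game_value (M n) d T (S n) f g \<le> game_value N d T S0 f g + ennreal \<epsilon> \<and>
    game_value N d T S0 f g \<le> game_value (M n) d T (S n) f g + ennreal \<epsilon>"
  proof eventually_elim
    case (elim n)
    have "game_value (M n) d T (S n) f g \<le> game_value N d T S0 f g + ennreal (\<epsilon>/2) + ennreal (\<epsilon>/2)"
      by (rule order_trans[OF tn(2) add_right_mono[OF order_trans[OF conjunct1[OF elim] add_right_mono[OF t0(1)]]]])
    moreover have "game_value N d T S0 f g \<le> game_value (M n) d T (S n) f g + ennreal (\<epsilon>/2) + ennreal (\<epsilon>/2)"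
      by (rule order_trans[OF t0(2) add_right_mono[OF order_trans[OF conjunct2[OF elim] add_right_mono[OF tn(1)]]]])
    ultimately show ?case unfolding ee by blast
  qed
qed

end

theorem theorem2p1:
  fixes d :: nat and T :: real
    and f g :: "real \<Rightarrow> (real \<Rightarrow> nat \<Rightarrow> real) \<Rightarrow> real"
    and M :: "nat \<Rightarrow> 'a measure" and S :: "nat \<Rightarrow> 'a \<Rightarrow> real \<Rightarrow> nat \<Rightarrow> real"
    and N :: "'b measure" and S0 :: "'b \<Rightarrow> real \<Rightarrow> nat \<Rightarrow> real"
  assumes d_pos: "0 < d" and T_pos: "0 < T"
    and f_meas: "(\<lambda>(t, x). f t x) \<in> borel_measurable (restrict_space borel {0..T} \<Otimes>\<^sub>M skor_borel d T)"
    and g_meas: "(\<lambda>(t, x). g t x) \<in> borel_measurable (restrict_space borel {0..T} \<Otimes>\<^sub>M skor_borel d T)"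
    and f_nonneg: "\<forall>t\<in>{0..T}. \<forall>x\<in>Dsp d T. 0 \<le> f t x"
    and f_le_g: "\<forall>t\<in>{0..T}. \<forall>x\<in>Dsp d T. f t x \<le> g t x"
    and nonanticip: "\<forall>t\<in>{0..T}. \<forall>x\<in>Dsp d T. \<forall>y\<in>Dsp d T.
          (\<forall>s\<in>{0..t}. x s = y s) \<longrightarrow> f t x = f t y \<and> g t x = g t y"
    and cadlag_fg: "\<forall>x\<in>Dsp d T. cadlag_real T (\<lambda>t. f t x) \<and> cadlag_real T (\<lambda>t. g t x)"
    and cont_fg: "\<forall>xs x ts t. (\<forall>n. xs n \<in> Dsp d T) \<longrightarrow> x \<in> Dsp d T \<longrightarrow> skor_conv d T xs x \<longrightarrow>
          (\<forall>n. ts n \<in> {0..T}) \<longrightarrow> t \<in> {0..T} \<longrightarrow> ts \<longlonglongrightarrow> t \<longrightarrow>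
          (\<lambda>n. euclid d (xs n (ts n)) (x t)) \<longlonglongrightarrow> 0 \<longrightarrow>
          (\<lambda>n. f (ts n) (xs n)) \<longlonglongrightarrow> f t x \<and> (\<lambda>n. g (ts n) (xs n)) \<longlonglongrightarrow> g t x"
    and prob_n: "\<forall>n. prob_space (M n)" and prob: "prob_space N"
    and proc_n: "\<forall>n. cadlag_process (M n) d T (S n)"
    and proc: "cadlag_process N d T S0"
    and unif_int: "((\<lambda>K::real. SUP n. SUP \<tau>\<in>stop_times (M n) d T (S n).
          \<integral>\<^sup>+ \<omega>. ennreal (g (\<tau> \<omega>) (S n \<omega>)) * indicator {\<omega>. K < g (\<tau> \<omega>) (S n \<omega>)} \<omega> \<partial>completion (M n))
          \<longlongrightarrow> 0) at_top"
    and aldous: "\<forall>\<epsilon>>0. \<exists>L. (\<forall>\<delta>>0. (\<lambda>n. SUP u\<in>{0<..<\<delta>}. SUP \<tau>\<in>stop_times (M n) d T (S n).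
              measure (completion (M n))
                {\<omega>\<in>space (M n). \<epsilon> < euclid d (S n \<omega> (min (\<tau> \<omega> + u) T)) (S n \<omega> (\<tau> \<omega>))})
            \<longlonglongrightarrow> L \<delta>) \<and> (L \<longlongrightarrow> 0) (at_right 0)"
    and ext_weak: "\<forall>k \<psi> (Z :: nat \<Rightarrow> nat \<Rightarrow> real \<Rightarrow> 'a \<Rightarrow> real) (Z0 :: nat \<Rightarrow> real \<Rightarrow> 'b \<Rightarrow> real).
          (\<forall>i<k. skor_bounded_continuous d T (\<psi> i)) \<longrightarrow>
          (\<forall>i<k. \<forall>n. (\<forall>\<omega>\<in>space (M n). cadlag_real T (\<lambda>t. Z i n t \<omega>)) \<and>
              (\<forall>t\<in>{0..T}. AE \<omega> in completion (M n).
                 Z i n t \<omega> = cond_exp_t (M n) d T (S n) t (\<lambda>\<omega>. \<psi> i (S n \<omega>)) \<omega>)) \<longrightarrow>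
          (\<forall>i<k. (\<forall>\<omega>\<in>space N. cadlag_real T (\<lambda>t. Z0 i t \<omega>)) \<and>
              (\<forall>t\<in>{0..T}. AE \<omega> in completion N.
                 Z0 i t \<omega> = cond_exp_t N d T S0 t (\<lambda>\<omega>. \<psi> i (S0 \<omega>)) \<omega>)) \<longrightarrow>
          (\<forall>\<phi>. skor_bounded_continuous (d + k) T \<phi> \<longrightarrow>
             (\<lambda>n. \<integral>\<omega>. \<phi> (joint_path d T k (S n) (\<lambda>i. Z i n) \<omega>) \<partial>completion (M n))
               \<longlonglongrightarrow> (\<integral>\<omega>. \<phi> (joint_path d T k S0 Z0 \<omega>) \<partial>completion N))"
  shows "(\<lambda>n. game_value (M n) d T (S n) f g) \<longlonglongrightarrow> game_value N d T S0 f g"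
proof -
  have pn: "cadlag_proc (M n) d T (S n)" for n
    using prob_n proc_n T_pos by (simp add: cadlag_proc_def cadlag_proc_axioms_def)
  have p0: "cadlag_proc N d T S0"
    using prob proc T_pos by (simp add: cadlag_proc_def cadlag_proc_axioms_def)
  have "ext_conv d T M S N S0" by (rule ext_conv.intro[OF pn p0 ext_weak])
  then interpret aldous_conv d T M S N S0 by (rule aldous_conv.intro) (rule aldous_conv_axioms.intro[OF aldous])
  have pf: "payoff d T f" and pg: "payoff d T g"
    using nonanticip cadlag_fg cont_fg unfolding payoff_def cadlag_real_def by meson+
  show ?thesis
  proof (rule game_value_converges[OF pf pg])
    show "0 \<le> f t x \<and> f t x \<le> g t x" if "t \<in> {0..T}" "x \<in> Dsp d T" for t x using f_nonneg f_le_g that by blast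
    fix \<epsilon> :: real assume "0 < \<epsilon>"
    then have "0 < ennreal \<epsilon>" by simp
    let ?u = "\<lambda>K n \<tau>. \<integral>\<^sup>+ w. ennreal (g (\<tau> w) (S n w)) * indicator {w. K < g (\<tau> w) (S n w)} w \<partial>completion (M n)"
    have "\<forall>\<^sub>F K in at_top. (SUP n. SUP \<tau>\<in>stop_times (M n) d T (S n). ?u K n \<tau>) < ennreal \<epsilon>"
      by (rule order_tendstoD(2)[OF unif_int \<open>0 < ennreal \<epsilon>\<close>])
    then have "\<forall>\<^sub>F K in at_top. 0 \<le> K \<and> (SUP n. SUP \<tau>\<in>stop_times (M n) d T (S n). ?u K n \<tau>) < ennreal \<epsilon>"
      using eventually_ge_at_top[of "0::real"] by eventually_elim simp
    then have "\<exists>K. 0 \<le> K \<and> (SUP n. SUP \<tau>\<in>stop_times (M n) d T (S n). ?u K n \<tau>) < ennreal \<epsilon>"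
      by (rule eventually_happens'[OF trivial_limit_at_top_linorder])
    then obtain K where K: "0 \<le> K" and sup: "(SUP n. SUP \<tau>\<in>stop_times (M n) d T (S n). ?u K n \<tau>) < ennreal \<epsilon>" by blast
    \<comment> \<open>The excess of \<open>g\<close> over \<open>K\<close> is dominated by
      \<open>g\<close> on the event \<open>g > K\<close>, the quantity that uniform integrability
      controls, and vanishes off that event.\<close>
    show "\<exists>K\<ge>0. \<forall>n \<tau>. Pn.FS.stopT n T \<tau> \<longrightarrow> (\<integral>\<^sup>+w. ennreal (max 0 (g (\<tau> w) (S n w) - K)) \<partial>CMn n) \<le> ennreal \<epsilon>"
    proof (intro exI[of _ K] conjI K allI impI)
      fix n \<tau> assume "Pn.FS.stopT n T \<tau>"
      then have \<tau>: "\<tau> \<in> stop_times (M n) d T (S n)" by (simp add: Pn.stop_times_iff)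
      have "(\<integral>\<^sup>+w. ennreal (max 0 (g (\<tau> w) (S n w) - K)) \<partial>CMn n) \<le> ?u K n \<tau>"
      proof (rule nn_integral_mono)
        fix w
        show "ennreal (max 0 (g (\<tau> w) (S n w) - K)) \<le> ennreal (g (\<tau> w) (S n w)) * indicator {w. K < g (\<tau> w) (S n w)} w"
          using K by (cases "K < g (\<tau> w) (S n w)") (simp_all add: ennreal_leI)
      qed
      also have "\<dots> \<le> (SUP n. SUP \<tau>\<in>stop_times (M n) d T (S n). ?u K n \<tau>)"
        by (rule SUP_upper2[OF UNIV_I], rule SUP_upper[OF \<tau>])
      also have "\<dots> \<le> ennreal \<epsilon>" using sup by simp
      finally show "(\<integral>\<^sup>+w. ennreal (max 0 (g (\<tau> w) (S n w) - K)) \<partial>CMn n) \<le> ennreal \<epsilon>" .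
    qed
  qed
qed

end
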